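(* Let $\alpha\in(1,2)$ and let $(Y_i)_{i\ge 1}$ be a sequence of independent, identically distributed, centered real random variables. Assume that there exist $A>0$, $\gamma>0$ and a function $\varepsilon:\mathbb{R}\to\mathbb{R}$ such that $$\mathbb{P}[Y_1>t]=\frac{A}{2}\,\frac{1}{t^{\alpha}}\,\mathbf{1}_{[1,+\infty[}(t)+(1-A)\frac{\varepsilon(t)}{t^{\alpha}}\quad\text{for } t>0,$$ $$\mathbb{P}[Y_1\le t]=\frac{A}{2}\,\frac{1}{|\min(t,-1)|^{\alpha}}+(1-A)\frac{\varepsilon(t)}{|t|^{\alpha}}\quad\text{for } t<0,$$ where $\varepsilon$ is bounded on $[-1,1]$ and $\sup_{t}|t|^{\gamma}|\varepsilon(t)|<+\infty$. For $n\ge 1$ and $t\in[0,1]$ let $$X_n(t)=\frac{1}{2^{n/\alpha}}\sum_{i=1}^{\lfloor 2^n t\rfloor}Y_i,$$ and let $S=(S_t)_{t\in[0,1]}$ be the symmetric $\alpha$-stable Lévy process with Lévy measure $\frac{A\alpha}{2}\,\frac{du}{|u|^{1+\alpha}}$. Then for every $(\eta,p)\in(0,1/\alpha)\times[1,\alpha)$ there exist $\upsilon>0$ and $c>0$, both depending on $(\eta,p,\alpha,\gamma)$, such that for all $n\ge 1$ $$\rho^1_{W_{\eta,p}}(X_n,S)\le c\,2^{-n\upsilon},$$ where $$\upsilon=\left(\frac1\alpha-\eta\right)p\;\frac{\min\left(\frac{2}{\alpha}-1,\frac{\gamma}{\alpha}\right)}{1+\left(\frac1\alpha-\eta\right)p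}>0.$$
   Context: For $p\ge1$ and $\eta\in[0,1]$, $W_{\eta,p}$ is the fractional Sobolev space of $f\in L^p([0,1])$ (real-valued) with $\int_0^1\int_0^1\frac{|f(s)-f(t)|^p}{|s-t|^{1+\eta p}}\,ds\,dt<\infty$, equipped with the norm $$\|f\|_{W_{\eta,p}}^p=\int_0^1|f(t)|^p\,dt+\int_0^1\int_0^1\frac{|f(s)-f(t)|^p}{|s-t|^{1+\eta p}}\,ds\,dt.$$ $\mathrm{Lip}_1(W_{\eta,p})$ is the set of $F:W_{\eta,p}\to\mathbb{R}$ with $|F(x)-F(y)|\le\|x-y\|_{W_{\eta,p}}$ for all $x,y$. The Wasserstein-1 distance between the laws of $X_n$ and $S$ on $W_{\eta,p}$ is $$\rho^1_{W_{\eta,p}}(X_n,S)=\sup_{F\in\mathrm{Lip}_1(W_{\eta,p})}\bigl(\mathbb{E}[F(X_n)]-\mathbb{E}[F(S)]\bigr).$$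
   Formalization: The constant c may depend on the law of Y_1 (on A and ε) as well as on (η,p,α,γ); a c depending only on (η,p,α,γ) is impossible, as symmetric Y_1 with |Y_1| ≥ K and K → ∞ shows. *)

theory Defs
  imports "HOL-Probability.Probability"
begin

section \<open>Fractional Sobolev spaces on the unit interval\<close>

abbreviation unit_leb :: "real measure" where
  "unit_leb \<equiv> restrict_space lborel {0..1}"

definition gagliardo :: "real \<Rightarrow> real \<Rightarrow> (real \<Rightarrow> real) \<Rightarrow> ennreal" where
  "gagliardo \<eta> p f =
     (\<integral>\<^sup>+ s. \<integral>\<^sup>+ t. ennreal (\<bar>f s - f t\<bar> powr p / \<bar>s - t\<bar> powr (1 + \<eta> * p)) \<partial>unit_leb \<partial>unit_leb)"

text \<open>Elements are Borel functions rather than classes modulo almost everywhere equality, so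
  \<open>sob_norm\<close> below is only a seminorm. This does not affect Lipschitz functionals: they
  take equal values at functions that agree almost everywhere on the unit interval, so they are
  exactly the Lipschitz functionals on the quotient.\<close>

definition sob_space :: "real \<Rightarrow> real \<Rightarrow> (real \<Rightarrow> real) set" where
  "sob_space \<eta> p = {f \<in> borel_measurable unit_leb.
     (\<integral>\<^sup>+ t. ennreal (\<bar>f t\<bar> powr p) \<partial>unit_leb) < \<infinity> \<and> gagliardo \<eta> p f < \<infinity>}"

definition sob_norm :: "real \<Rightarrow> real \<Rightarrow> (real \<Rightarrow> real) \<Rightarrow> real" where
  "sob_norm \<eta> p f =
     enn2real ((\<integral>\<^sup>+ t. ennreal (\<bar>f t\<bar> powr p) \<partial>unit_leb) + gagliardo \<eta> p f) powr (1 / p)"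

section \<open>Wasserstein distance\<close>

text \<open>Functionals live on \<open>sob_space \<eta> p\<close> only; \<open>\<rightarrow>\<^sub>E\<close> fixes one constant
  value outside it. Hence, for a process whose paths lie in the space almost surely, the
  exceptional null set affects neither the measurability nor the value of an expectation.\<close>

definition Lip1 :: "real \<Rightarrow> real \<Rightarrow> ((real \<Rightarrow> real) \<Rightarrow> real) set" where
  "Lip1 \<eta> p = {F \<in> sob_space \<eta> p \<rightarrow>\<^sub>E UNIV.
     \<forall>x\<in>sob_space \<eta> p. \<forall>y\<in>sob_space \<eta> p. \<bar>F x - F y\<bar> \<le> sob_norm \<eta> p (\<lambda>t. x t - y t)}"

text \<open>The supremum is taken in the extended reals, so that an upper bound on it is a genuine bound
  even if it is not known in advance to be finite. The two processes may live on different
  probability spaces.\<close>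

definition wasserstein1 ::
  "real \<Rightarrow> real \<Rightarrow> 'a measure \<Rightarrow> (real \<Rightarrow> 'a \<Rightarrow> real) \<Rightarrow> 'b measure \<Rightarrow> (real \<Rightarrow> 'b \<Rightarrow> real) \<Rightarrow> ereal" where
  "wasserstein1 \<eta> p M X N Z =
     (SUP F\<in>Lip1 \<eta> p. ereal ((\<integral>\<omega>. F (\<lambda>t. X t \<omega>) \<partial>M) - (\<integral>\<omega>. F (\<lambda>t. Z t \<omega>) \<partial>N)))"

section \<open>Levy processes on the unit interval\<close>

definition cadlag_unit :: "(real \<Rightarrow> real) \<Rightarrow> bool" where
  "cadlag_unit f \<longleftrightarrow>
     (\<forall>t\<in>{0..<1}. (f \<longlongrightarrow> f t) (at_right t)) \<and> (\<forall>t\<in>{0<..1}. \<exists>l. (f \<longlongrightarrow> l) (at_left t))"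

definition levy_process :: "'b measure \<Rightarrow> (real \<Rightarrow> 'b \<Rightarrow> real) \<Rightarrow> bool" where
  "levy_process N S \<longleftrightarrow>
     prob_space N \<and>
     (\<forall>t\<in>{0..1}. S t \<in> borel_measurable N) \<and>
     (AE \<omega> in N. S 0 \<omega> = 0) \<and>
     (\<forall>(n::nat) \<tau>. mono_on {..n} \<tau> \<and> \<tau> ` {..n} \<subseteq> {0..1} \<longrightarrow>
        prob_space.indep_vars N (\<lambda>_. borel) (\<lambda>i \<omega>. S (\<tau> (Suc i)) \<omega> - S (\<tau> i) \<omega>) {..<n}) \<and>
     (\<forall>s t. 0 \<le> s \<and> s \<le> t \<and> t \<le> 1 \<longrightarrow>
        distr N borel (\<lambda>\<omega>. S t \<omega> - S s \<omega>) = distr N borel (S (t - s))) \<and>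
     (\<forall>\<omega>\<in>space N. cadlag_unit (\<lambda>t. S t \<omega>))"

text \<open>The characteristic exponent for drift \<open>b\<close>, Gaussian variance \<open>v\<close> and Levy measure
  \<open>\<nu>\<close>, with truncation at \<open>1\<close>.\<close>

definition levy_exponent :: "real \<Rightarrow> real \<Rightarrow> real measure \<Rightarrow> real \<Rightarrow> complex" where
  "levy_exponent b v \<nu> \<xi> =
     \<i> * of_real (b * \<xi>) - of_real (v * \<xi>\<^sup>2 / 2) +
     (\<integral>u. (iexp (\<xi> * u) - 1 - \<i> * of_real (\<xi> * u * indicator {-1<..<1} u)) \<partial>\<nu>)"

definition has_levy_triplet ::
  "'b measure \<Rightarrow> (real \<Rightarrow> 'b \<Rightarrow> real) \<Rightarrow> real \<Rightarrow> real \<Rightarrow> real measure \<Rightarrow> bool" where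
  "has_levy_triplet N S b v \<nu> \<longleftrightarrow>
     (\<forall>t\<in>{0..1}. \<forall>\<xi>. char (distr N borel (S t)) \<xi> = exp (of_real t * levy_exponent b v \<nu> \<xi>))"

definition stable_levy_measure :: "real \<Rightarrow> real \<Rightarrow> real measure" where
  "stable_levy_measure A \<alpha> = density lborel (\<lambda>u. ennreal (A * \<alpha> / 2 / \<bar>u\<bar> powr (1 + \<alpha>)))"

text \<open>Symmetric: no drift; stable with index below 2: no Gaussian part.\<close>

definition sym_stable_levy_process ::
  "'b measure \<Rightarrow> (real \<Rightarrow> 'b \<Rightarrow> real) \<Rightarrow> real \<Rightarrow> real \<Rightarrow> bool" where
  "sym_stable_levy_process N S A \<alpha> \<longleftrightarrow>
     levy_process N S \<and> has_levy_triplet N S 0 0 (stable_levy_measure A \<alpha>)"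

section \<open>The rescaled random walk\<close>

definition walk :: "real \<Rightarrow> (nat \<Rightarrow> 'a \<Rightarrow> real) \<Rightarrow> nat \<Rightarrow> real \<Rightarrow> 'a \<Rightarrow> real" where
  "walk \<alpha> Y n t \<omega> = 1 / 2 powr (real n / \<alpha>) * (\<Sum>i=1..nat \<lfloor>2 ^ n * t\<rfloor>. Y i \<omega>)"

end

theory Submission
  imports Defs
begin

text \<open>
  The bound is a coupling argument, with no Fourier inversion and no Stein operator. Put \<open>\<theta> = 1 / \<alpha>\<close> and
  let \<open>r\<close> be given by \<open>1 / r = \<theta> - \<upsilon>\<close>, which satisfies \<open>\<alpha> < r < 2\<close> and \<open>\<eta> * r < 1\<close>. If two centered laws have
  a coupling whose difference has a finite \<open>r\<close>-th moment, then by the von Bahr--Esseen inequality the \<open>r\<close>-th moments of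
  the increments of the coupled walks over \<open>k\<close> steps grow like \<open>k\<close>; integrating these bounds against the Gagliardo
  kernel, the walks scaled by \<open>2 powr (-n * \<theta>)\<close> are within \<open>2 powr (-n * \<upsilon>)\<close> in the Sobolev norm.

  This is applied twice. The quantile coupling replaces the law of \<open>Y 1\<close> by the symmetric Pareto law \<open>V\<close> with the same
  leading tail; the remainder of the tail makes the difference \<open>r\<close>-integrable since \<open>\<upsilon> < \<gamma> / \<alpha>\<close>. Then let \<open>T\<close> send a law to
  the law of the sum of two independent copies divided by \<open>2 powr \<theta>\<close>. The laws \<open>V\<close> and \<open>T V\<close> have a coupling with a square
  integrable difference, and \<open>T\<close> multiplies the second moment of the difference by \<open>2 powr (1 - 2 * \<theta>) < 1\<close>; hence the
  iterates of \<open>T\<close> are coupled at geometrically decreasing cost, and they converge weakly to the law of \<open>S 1\<close>. This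
  replaces the Pareto walk by the values of \<open>S\<close> at the dyadic points of level \<open>n\<close>. Finally, self-similarity of \<open>S\<close> bounds the
  Sobolev distance of \<open>S\<close> to its dyadic discretization by \<open>2 powr (-n * (\<theta> - \<eta>'))\<close> for every \<open>\<eta>' > \<eta>\<close>.
\<close>

section \<open>Moments of sums of independent variables\<close>

text \<open>Since \<open>r > \<alpha>\<close>, neither step law has a finite \<open>r\<close>-th
  moment: only the difference of coupled steps can have one, so a coupling is useful only if it
  cancels the leading tails. The gain shows in the scales: \<open>2^n\<close> independent
  differences add up to size \<open>2 powr (n / r)\<close>, against the normalisation
  \<open>2 powr (n * \<theta>)\<close>. The bound \<open>r < 2\<close> makes square integrable
  couplings usable, and \<open>\<eta> * r < 1\<close> makes the Gagliardo integral with numerator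
  \<open>|s - t| powr (p / r)\<close> converge at the diagonal.

  The expectation of a functional of a walk depends only on the law of one step, so every comparison
  may use a coupling on a space of its own. Two qualitative points shape the rest. A Bochner
  integral is \<open>0\<close> on functions that are not integrable, so Lipschitz functionals of
  random paths must be shown measurable; separability of the Sobolev space gives this. And weak
  convergence of the iterates of \<open>T\<close> does not suffice for unbounded functionals;
  moments of an order strictly between \<open>1\<close> and \<alpha>, bounded along the iterates,
  close the gap. There \<open>n\<close> is fixed, so Lipschitz constants that grow with
  \<open>n\<close> are harmless.\<close>

lemma powr_le_tangent:
  fixes t s :: real
  assumes "t \<ge> 0" "0 < s" "s \<le> 1"
  shows "t powr s \<le> 1 + s * (t - 1)"
proof (cases "t = 0")
  case False
  then have "t > 0" using assms by simp
  \<comment> \<open>Weighted arithmetic-geometric mean of \<open>1\<close> and \<open>t\<close>, as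
    convexity of \<open>exp\<close> between \<open>0\<close> and \<open>ln t\<close>.\<close>
  have "exp ((1 - s) *\<^sub>R 0 + s *\<^sub>R ln t) \<le> (1 - s) * exp 0 + s * exp (ln t)"
    using assms exp_convex by (intro convex_onD) auto
  then show ?thesis using \<open>t > 0\<close> by (simp add: powr_def algebra_simps)
qed (use assms in auto)

text \<open>Bernoulli's inequality, from the concave case with exponent \<open>1 / r\<close> at the
  point \<open>t powr r\<close>.\<close>

lemma powr_ge_tangent:
  fixes t r :: real
  assumes "t \<ge> 0" "1 \<le> r"
  shows "1 + r * (t - 1) \<le> t powr r"
proof -
  have "(t powr r) powr (1 / r) \<le> 1 + 1 / r * (t powr r - 1)"
    using assms by (intro powr_le_tangent) auto
  then have "t \<le> 1 + 1 / r * (t powr r - 1)"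
    using assms by (simp add: powr_powr)
  then show ?thesis using assms by (simp add: field_simps)
qed

text \<open>After division by \<open>x + y\<close> both fractions lie in the unit interval, where
  lowering the exponent from \<open>1\<close> to \<open>q\<close> enlarges a power, and the
  fractions sum to \<open>1\<close>.\<close>

lemma powr_add_le_subadditive:
  fixes x y q :: real
  assumes "x \<ge> 0" "y \<ge> 0" "0 < q" "q \<le> 1"
  shows "(x + y) powr q \<le> x powr q + y powr q"
proof (cases "x + y = 0")
  case False
  then have pos: "x + y > 0" using assms by simp
  have *: "z / (x + y) \<le> (z / (x + y)) powr q" if "z \<ge> 0" "z \<le> x + y" for z
  proof (cases "z = 0")
    case False
    then have "(z / (x + y)) powr 1 \<le> (z / (x + y)) powr q"
      using that pos assms by (intro powr_mono') auto
    then show ?thesis using that pos by simp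
  qed simp
  have "1 = x / (x + y) + y / (x + y)" using pos by (simp flip: add_divide_distrib)
  also have "\<dots> \<le> (x / (x + y)) powr q + (y / (x + y)) powr q"
    using *[of x] *[of y] assms by simp
  finally have "(x + y) powr q * 1 \<le> (x + y) powr q * ((x / (x + y)) powr q + (y / (x + y)) powr q)"
    by (intro mult_left_mono) auto
  also have "\<dots> = x powr q + y powr q"
    using pos assms by (simp add: powr_divide distrib_left)
  finally show ?thesis by simp
qed (use assms in auto)

text \<open>Jensen for the concave power: both points are compared with the tangent at their mean,
  where the linear terms cancel.\<close>

lemma powr_mean_le:
  fixes u v s :: real
  assumes "u \<ge> 0" "v \<ge> 0" "0 < s" "s \<le> 1"
  shows "u powr s + v powr s \<le> 2 * ((u + v) / 2) powr s"
proof (cases "u + v = 0")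
  case False
  define m where "m = (u + v) / 2"
  have m: "m > 0" using False assms by (simp add: m_def)
  have *: "z powr s \<le> m powr s * (1 + s * (z / m - 1))" if "z \<ge> 0" for z
  proof -
    have "z powr s = m powr s * (z / m) powr s"
      using m that by (simp add: powr_divide)
    also have "\<dots> \<le> m powr s * (1 + s * (z / m - 1))"
      using m that assms by (intro mult_left_mono powr_le_tangent) auto
    finally show ?thesis .
  qed
  have "u powr s + v powr s \<le> m powr s * (1 + s * (u / m - 1)) + m powr s * (1 + s * (v / m - 1))"
    using *[of u] *[of v] assms by simp
  also have "\<dots> = m powr s * (2 + s * ((u + v) / m - 2))"
    by (simp add: field_simps add_divide_distrib)
  also have "(u + v) / m = 2" using m by (simp add: m_def field_simps)
  finally show ?thesis by (simp add: m_def)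
next
  case True
  then have "u = 0" "v = 0" using assms by auto
  then show ?thesis by simp
qed

text \<open>Squares obey the parallelogram law exactly; as \<open>r / 2 \<le> 1\<close>, concavity
  brings both powers under one mean and subadditivity splits the result.\<close>

lemma abs_powr_parallelogram:
  fixes x y r :: real
  assumes "1 \<le> r" "r \<le> 2"
  shows "\<bar>x + y\<bar> powr r + \<bar>x - y\<bar> powr r \<le> 2 * \<bar>x\<bar> powr r + 2 * \<bar>y\<bar> powr r"
proof -
  have sq: "\<bar>z\<bar> powr r = (z\<^sup>2) powr (r / 2)" for z :: real
  proof (cases "z = 0")
    case False
    then have "z\<^sup>2 = \<bar>z\<bar> powr 2" by (simp add: powr_numeral)
    then show ?thesis by (simp only: powr_powr) simp
  qed simp
  have "\<bar>x + y\<bar> powr r + \<bar>x - y\<bar> powr r \<le> 2 * (((x + y)\<^sup>2 + (x - y)\<^sup>2) / 2) powr (r / 2)"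
    unfolding sq using assms by (intro powr_mean_le) auto
  also have "((x + y)\<^sup>2 + (x - y)\<^sup>2) / 2 = x\<^sup>2 + y\<^sup>2"
    by (simp add: power2_eq_square algebra_simps)
  also have "2 * (x\<^sup>2 + y\<^sup>2) powr (r / 2) \<le> 2 * ((x\<^sup>2) powr (r / 2) + (y\<^sup>2) powr (r / 2))"
    using assms by (intro mult_left_mono powr_add_le_subadditive) auto
  finally show ?thesis by (simp add: sq)
qed

text \<open>Convexity of the \<open>r\<close>-th power of the modulus: the tangent at
  \<open>x\<close>, read at \<open>x - y\<close>, lies below the graph. Division by
  \<open>|x| powr r\<close> reduces this to Bernoulli's inequality.\<close>

lemma abs_powr_tangent:
  fixes x y r :: real
  assumes "1 \<le> r"
  shows "\<bar>x\<bar> powr r - r * (sgn x * \<bar>x\<bar> powr (r - 1)) * y \<le> \<bar>x - y\<bar> powr r"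
proof (cases "x = 0")
  case False
  define t where "t = \<bar>x - y\<bar> / \<bar>x\<bar>"
  have "1 - y / x \<le> \<bar>1 - y / x\<bar>" by simp
  also have "\<dots> = t" using False by (simp add: t_def field_simps flip: abs_divide)
  finally have "1 - r * (y / x) \<le> 1 + r * (t - 1)" using assms
    using mult_left_mono[of "1 - y / x" t r] by (simp add: algebra_simps)
  also have "\<dots> \<le> t powr r" using assms by (intro powr_ge_tangent) (auto simp: t_def)
  finally have "\<bar>x\<bar> powr r * (1 - r * (y / x)) \<le> \<bar>x\<bar> powr r * t powr r"
    by (intro mult_left_mono) auto
  also have "\<bar>x\<bar> powr r * t powr r = \<bar>x - y\<bar> powr r"
    using False by (simp add: t_def powr_divide)
  also have "\<bar>x\<bar> powr r * (1 - r * (y / x)) = \<bar>x\<bar> powr r - r * (sgn x * \<bar>x\<bar> powr (r - 1)) * y"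
    using False by (simp add: powr_diff sgn_real_def field_simps)
  finally show ?thesis .
qed simp

text \<open>The sum of the parallelogram and of the tangent inequality: the linear term integrates to zero against a
  centered independent increment.\<close>

lemma abs_powr_add_le:
  fixes x y r :: real
  assumes "1 \<le> r" "r \<le> 2"
  shows "\<bar>x + y\<bar> powr r \<le> \<bar>x\<bar> powr r + r * (sgn x * \<bar>x\<bar> powr (r - 1)) * y + 2 * \<bar>y\<bar> powr r"
  using abs_powr_parallelogram[OF assms, of x y] abs_powr_tangent[of r x y] assms by simp

text \<open>A pointwise substitute for Jensen's inequality. The threshold \<open>K\<close> is free;
  the \<open>r\<close>-th root of an \<open>r\<close>-th moment is the choice that yields a
  \<open>p\<close>-th moment bound of the right order.\<close>

lemma powr_interpolate:
  fixes a K p r :: real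
  assumes "a \<ge> 0" "K > 0" "0 < p" "p \<le> r"
  shows "a powr p \<le> K powr (p - r) * a powr r + K powr p"
proof (cases "a \<le> K")
  case True
  then have "a powr p \<le> K powr p" using assms by (intro powr_mono2) auto
  then show ?thesis by (simp add: add_increasing)
next
  case False
  then have "a powr p = a powr (p - r) * a powr r"
    by (simp flip: powr_add)
  also have "\<dots> \<le> K powr (p - r) * a powr r"
    using False assms by (intro mult_right_mono powr_mono2') auto
  finally show ?thesis by (simp add: add_increasing2)
qed

lemma powr_add_le:
  fixes x y p :: real
  assumes "x \<ge> 0" "y \<ge> 0" "p \<ge> 0"
  shows "(x + y) powr p \<le> 2 powr p * (x powr p + y powr p)"
proof -
  have "(x + y) powr p \<le> (2 * max x y) powr p"
    using assms by (intro powr_mono2) auto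
  also have "\<dots> = 2 powr p * (max x y) powr p"
    using assms by (simp add: powr_mult)
  also have "(max x y) powr p \<le> x powr p + y powr p"
    by (simp add: max_def)
  finally show ?thesis by simp
qed

text \<open>Unlike in \<open>powr_add_le\<close>, the factor of the main term is close to
  \<open>1\<close>. Along an infinite iteration with summable \<open>e\<close> these factors have a
  bounded product, while the large factor falls on the small term.\<close>

lemma powr_add_le_weighted:
  fixes x y q e :: real
  assumes "x \<ge> 0" "y \<ge> 0" "1 \<le> q" "q \<le> 2" "0 < e" "e \<le> 1"
  shows "(x + y) powr q \<le> (1 + 3 * e) * x powr q + (2 / e) powr q * y powr q"
proof (cases "y \<le> e * x")
  case True
  have "(x + y) powr q \<le> ((1 + e) * x) powr q"
    using assms True by (intro powr_mono2) (auto simp: algebra_simps)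
  also have "\<dots> = (1 + e) powr q * x powr q" using assms by (simp add: powr_mult)
  also have "(1 + e) powr q \<le> (1 + e) powr 2"
    using assms by (intro powr_mono) auto
  also have "(1 + e) powr 2 = (1 + e)\<^sup>2"
    using assms by (simp add: powr_numeral)
  also have "\<dots> \<le> 1 + 3 * e"
    using assms mult_left_mono[of e 1 e] by (simp add: power2_eq_square algebra_simps)
  finally have "(x + y) powr q \<le> (1 + 3 * e) * x powr q"
    by (simp add: mult_right_mono)
  then show ?thesis by (simp add: add_increasing2)
next
  case False
  have "x + y \<le> y / e + y / e"
    using False assms by (intro add_mono) (auto simp: field_simps intro: mult_left_le_one_le)
  then have "(x + y) powr q \<le> (2 / e * y) powr q"
    using assms by (intro powr_mono2) (auto simp: field_simps)
  also have "\<dots> = (2 / e) powr q * y powr q"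
    using assms by (intro powr_mult)
  finally show ?thesis using assms by (simp add: add_increasing)
qed

lemma le_one_plus_powr:
  fixes a r :: real
  assumes "a \<ge> 0" "1 \<le> r"
  shows "a \<le> 1 + a powr r"
  using powr_interpolate[of a 1 1 r] assms by simp

lemma integrable_abs_powr_imp_integrable:
  fixes f :: "'a \<Rightarrow> real"
  assumes "finite_measure M" "f \<in> borel_measurable M" "integrable M (\<lambda>x. \<bar>f x\<bar> powr r)" "1 \<le> r"
  shows "integrable M f"
proof -
  interpret finite_measure M by fact
  show ?thesis
    by (rule Bochner_Integration.integrable_bound[of M "\<lambda>x. 1 + \<bar>f x\<bar> powr r"])
       (use assms le_one_plus_powr in \<open>auto simp: abs_of_nonneg add_nonneg_nonneg\<close>)
qed

text \<open>Induction on the index set. When a summand is added, the linear term of the pointwise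
  bound is a function of the partial sum times an independent centered variable, so it integrates to
  zero, and the summand costs twice its moment.\<close>

lemma (in prob_space) von_Bahr_Esseen:
  fixes X :: "'i \<Rightarrow> 'a \<Rightarrow> real"
  assumes "finite I" "indep_vars (\<lambda>_. borel) X I" and r: "1 \<le> r" "r \<le> 2"
    and int: "\<And>i. i \<in> I \<Longrightarrow> integrable M (\<lambda>x. \<bar>X i x\<bar> powr r)"
    and bnd: "\<And>i. i \<in> I \<Longrightarrow> expectation (\<lambda>x. \<bar>X i x\<bar> powr r) \<le> c"
    and cent: "\<And>i. i \<in> I \<Longrightarrow> expectation (X i) = 0"
  shows "integrable M (\<lambda>x. \<bar>\<Sum>i\<in>I. X i x\<bar> powr r) \<and>
    expectation (\<lambda>x. \<bar>\<Sum>i\<in>I. X i x\<bar> powr r) \<le> 2 * real (card I) * c"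
  using assms(1,2) int bnd cent
proof (induction I rule: finite_induct)
  case (insert i I)
  have rv: "\<And>j. j \<in> insert i I \<Longrightarrow> X j \<in> borel_measurable M"
    using insert.prems(1) by (auto simp: indep_vars_def)
  have indI: "indep_vars (\<lambda>_. borel) X I" using insert.prems(1) by (rule indep_vars_subset) auto
  define S where "S = (\<lambda>x. \<Sum>j\<in>I. X j x)"
  \<comment> \<open>Up to the factor \<open>r\<close>, the derivative of the \<open>r\<close>-th
    power of the modulus.\<close>
  define g where "g = (\<lambda>z::real. sgn z * \<bar>z\<bar> powr (r - 1))"
  have [measurable]: "S \<in> borel_measurable M" "X i \<in> borel_measurable M"
    unfolding S_def by (use rv in \<open>auto intro!: borel_measurable_sum\<close>)
  have [measurable]: "g \<in> borel_measurable borel" unfolding g_def by measurable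
  have IH: "integrable M (\<lambda>x. \<bar>S x\<bar> powr r)" "expectation (\<lambda>x. \<bar>S x\<bar> powr r) \<le> 2 * real (card I) * c"
    using insert.IH[OF indI] insert.prems unfolding S_def by auto
  have intX: "integrable M (X i)"
    using insert.prems(2)[of i] r by (intro integrable_abs_powr_imp_integrable[of M "X i" r])
      (auto intro: finite_measure_axioms)
  have gS: "integrable M (\<lambda>x. g (S x))"
  proof (rule Bochner_Integration.integrable_bound[of M "\<lambda>x. 1 + \<bar>S x\<bar> powr r"])
    show "AE x in M. norm (g (S x)) \<le> norm (1 + \<bar>S x\<bar> powr r)"
    proof (intro always_eventually allI)
      fix x
      have "norm (g (S x)) \<le> \<bar>S x\<bar> powr (r - 1)"
        by (simp add: g_def abs_mult sgn_real_def)
      also have "\<dots> \<le> 1 + \<bar>S x\<bar> powr r"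
      \<comment> \<open>For \<open>r = 1\<close> the exponent is \<open>0\<close>, which the
        interpolation does not admit; a \<open>powr\<close> with exponent \<open>0\<close> is at
        most \<open>1\<close> by definition.\<close>
      proof (cases "r = 1")
        case False
        then show ?thesis using powr_interpolate[of "\<bar>S x\<bar>" 1 "r - 1" r] r by simp
      qed (simp add: powr_def)
      finally show "norm (g (S x)) \<le> norm (1 + \<bar>S x\<bar> powr r)" by simp
    qed
  qed (use IH in auto)
  have ind: "indep_var borel (\<lambda>x. X i x) borel (\<lambda>x. g (S x))"
  proof -
    have "indep_var borel (X i) borel S"
      unfolding S_def using insert by (intro indep_vars_sum) auto
    then have "indep_var borel ((\<lambda>z. z) \<circ> X i) borel (g \<circ> S)"
      by (rule indep_var_compose) auto
    then show ?thesis by (simp add: comp_def)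
  qed
  have prod: "integrable M (\<lambda>x. X i x * g (S x))" "expectation (\<lambda>x. X i x * g (S x)) = 0"
    using indep_var_integrable[OF ind intX gS] indep_var_lebesgue_integral[OF ind intX gS]
      insert.prems(4)[of i] by auto
  have pt: "\<bar>\<Sum>j\<in>insert i I. X j x\<bar> powr r \<le> \<bar>S x\<bar> powr r + r * (X i x * g (S x)) + 2 * \<bar>X i x\<bar> powr r" for x
    using abs_powr_add_le[OF r, of "S x" "X i x"] insert.hyps by (simp add: S_def g_def ac_simps)
  have intR: "integrable M (\<lambda>x. \<bar>S x\<bar> powr r + r * (X i x * g (S x)) + 2 * \<bar>X i x\<bar> powr r)"
    using IH prod insert.prems(2)[of i] by auto
  have intL: "integrable M (\<lambda>x. \<bar>\<Sum>j\<in>insert i I. X j x\<bar> powr r)"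
  proof (rule Bochner_Integration.integrable_bound[OF intR])
    show "(\<lambda>x. \<bar>\<Sum>j\<in>insert i I. X j x\<bar> powr r) \<in> borel_measurable M"
      using rv by measurable
    show "AE x in M. norm (\<bar>\<Sum>j\<in>insert i I. X j x\<bar> powr r) \<le>
        norm (\<bar>S x\<bar> powr r + r * (X i x * g (S x)) + 2 * \<bar>X i x\<bar> powr r)"
      using pt by (intro always_eventually allI) (smt (verit) powr_ge_zero real_norm_def)
  qed
  have "expectation (\<lambda>x. \<bar>\<Sum>j\<in>insert i I. X j x\<bar> powr r) \<le>
      expectation (\<lambda>x. \<bar>S x\<bar> powr r + r * (X i x * g (S x)) + 2 * \<bar>X i x\<bar> powr r)"
    by (intro integral_mono intL intR pt)
  also have "\<dots> = expectation (\<lambda>x. \<bar>S x\<bar> powr r) + r * 0 + 2 * expectation (\<lambda>x. \<bar>X i x\<bar> powr r)"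
    using IH prod insert.prems(2)[of i] by simp
  also have "\<dots> \<le> 2 * real (card I) * c + 2 * c"
    using IH insert.prems(3)[of i] by simp
  finally show ?case using intL insert.hyps by (simp add: algebra_simps)
qed simp

section \<open>Integrals of the Gagliardo kernel\<close>

lemma nn_integral_powr_Ioc:
  fixes a c :: real
  assumes "a > -1" "c \<ge> 0"
  shows "(\<integral>\<^sup>+x. ennreal (x powr a) * indicator {0<..c} x \<partial>lborel) = ennreal (c powr (a + 1) / (a + 1))"
proof -
  let ?f = "\<lambda>x::real. x powr a * indicator {0<..c} x"
  have "((\<lambda>x. if x \<in> {0..c} then x powr a else 0) has_integral (c powr (a + 1) / (a + 1))) UNIV"
    unfolding has_integral_restrict_UNIV using has_integral_powr_from_0[OF assms] .
  also have "(\<lambda>x. if x \<in> {0..c} then x powr a else 0) = ?f"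
    by (auto simp: fun_eq_iff indicator_def)
  finally have "integral\<^sup>N lborel (\<lambda>x. ennreal (?f x)) = ennreal (c powr (a + 1) / (a + 1))"
    by (intro nn_integral_has_integral_lborel) (auto simp: indicator_def)
  then show ?thesis by (simp add: ennreal_mult'' ennreal_indicator)
qed

section \<open>Lebesgue measure on the unit interval as a probability space\<close>

lemma prob_space_unit_leb: "prob_space unit_leb"
  by (auto intro!: prob_spaceI simp: emeasure_restrict_space space_restrict_space)

interpretation unit_leb: prob_space unit_leb
  by (rule prob_space_unit_leb)

interpretation unit_leb2: pair_prob_space unit_leb unit_leb ..

lemma nn_integral_unit_leb:
  "(\<integral>\<^sup>+x. f x \<partial>unit_leb) = (\<integral>\<^sup>+x. f x * indicator {0..1} x \<partial>lborel)"
  by (subst nn_integral_restrict_space) auto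

lemma space_unit_leb [simp]: "space unit_leb = {0..1}"
  by (simp add: space_restrict_space)

lemma emeasure_unit_leb [simp]: "emeasure unit_leb {0..1} = 1"
  using unit_leb.emeasure_space_1 by simp

lemma measurable_unit_leb_borel [measurable (raw)]:
  "f \<in> measurable borel N \<Longrightarrow> f \<in> measurable unit_leb N"
  by (rule measurable_restrict_space1) simp

lemma measurable_fst_unit_leb [measurable]: "fst \<in> borel_measurable (unit_leb \<Otimes>\<^sub>M N)"
  using measurable_compose[OF measurable_fst measurable_unit_leb_borel[OF measurable_ident]]
  by (simp add: id_def)

lemma measurable_snd_unit_leb [measurable]: "snd \<in> borel_measurable (N \<Otimes>\<^sub>M unit_leb)"
  using measurable_compose[OF measurable_snd measurable_unit_leb_borel[OF measurable_ident]]
  by (simp add: id_def)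

lemma nn_integral_iterated_linear:
  fixes u v :: "'a \<Rightarrow> 'b \<Rightarrow> ennreal"
  assumes "sigma_finite_measure N"
    and uv: "(\<lambda>x. u (fst x) (snd x)) \<in> borel_measurable (M \<Otimes>\<^sub>M N)"
    "(\<lambda>x. v (fst x) (snd x)) \<in> borel_measurable (M \<Otimes>\<^sub>M N)"
  shows "(\<integral>\<^sup>+s. \<integral>\<^sup>+t. c * u s t + v s t \<partial>N \<partial>M) =
    c * (\<integral>\<^sup>+s. \<integral>\<^sup>+t. u s t \<partial>N \<partial>M) + (\<integral>\<^sup>+s. \<integral>\<^sup>+t. v s t \<partial>N \<partial>M)"
proof -
  interpret sigma_finite_measure N by fact
  have "(\<integral>\<^sup>+s. \<integral>\<^sup>+t. c * u s t + v s t \<partial>N \<partial>M) =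
      (\<integral>\<^sup>+x. c * u (fst x) (snd x) + v (fst x) (snd x) \<partial>(M \<Otimes>\<^sub>M N))"
    by (subst nn_integral_fst[symmetric]) (auto intro!: uv borel_measurable_add borel_measurable_times_ennreal)
  also have "\<dots> = c * (\<integral>\<^sup>+x. u (fst x) (snd x) \<partial>(M \<Otimes>\<^sub>M N)) + (\<integral>\<^sup>+x. v (fst x) (snd x) \<partial>(M \<Otimes>\<^sub>M N))"
    by (subst nn_integral_add) (auto simp: nn_integral_cmult uv intro!: uv borel_measurable_times_ennreal)
  also have "(\<integral>\<^sup>+x. u (fst x) (snd x) \<partial>(M \<Otimes>\<^sub>M N)) = (\<integral>\<^sup>+s. \<integral>\<^sup>+t. u s t \<partial>N \<partial>M)"
    by (subst nn_integral_fst[symmetric]) (auto intro!: uv borel_measurable_add borel_measurable_times_ennreal)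
  also have "(\<integral>\<^sup>+x. v (fst x) (snd x) \<partial>(M \<Otimes>\<^sub>M N)) = (\<integral>\<^sup>+s. \<integral>\<^sup>+t. v s t \<partial>N \<partial>M)"
    by (subst nn_integral_fst[symmetric]) (auto intro!: uv borel_measurable_add borel_measurable_times_ennreal)
  finally show ?thesis .
qed

text \<open>For fixed \<open>s\<close>, the times on either side of \<open>s\<close> each contribute
  at most the integral of \<open>x powr a\<close> over the unit interval; on the diagonal itself
  \<open>0 powr a\<close> is \<open>0\<close>.\<close>

lemma nn_integral_kernel_near_diagonal:
  fixes a :: real
  assumes "a > -1"
  shows "(\<integral>\<^sup>+s. \<integral>\<^sup>+t. ennreal (\<bar>s - t\<bar> powr a) \<partial>unit_leb \<partial>unit_leb) \<le> ennreal (2 / (a + 1))"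
proof -
  have "(\<integral>\<^sup>+t. ennreal (\<bar>s - t\<bar> powr a) \<partial>unit_leb) \<le> ennreal (2 / (a + 1))" if s: "s \<in> {0..1}" for s
  proof -
    let ?h = "\<lambda>x::real. ennreal (x powr a) * indicator {0<..1} x"
    have [measurable]: "?h \<in> borel_measurable borel" by measurable
    have "(\<integral>\<^sup>+t. ennreal (\<bar>s - t\<bar> powr a) \<partial>unit_leb)
        \<le> (\<integral>\<^sup>+t. ?h (- s + 1 * t) + ?h (s + (-1) * t) \<partial>lborel)"
      unfolding nn_integral_unit_leb using s
      by (intro nn_integral_mono) (auto simp: indicator_def abs_if)
    also have "\<dots> = (\<integral>\<^sup>+t. ?h (- s + 1 * t) \<partial>lborel) + (\<integral>\<^sup>+t. ?h (s + (-1) * t) \<partial>lborel)"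
      by (intro nn_integral_add) measurable
    also have "(\<integral>\<^sup>+t. ?h (- s + 1 * t) \<partial>lborel) = (\<integral>\<^sup>+t. ?h t \<partial>lborel)"
      by (subst nn_integral_real_affine[of ?h 1 "-s"]) auto
    also have "(\<integral>\<^sup>+t. ?h (s + (-1) * t) \<partial>lborel) = (\<integral>\<^sup>+t. ?h t \<partial>lborel)"
      using nn_integral_real_affine[of ?h "-1" s] by simp
    also have "(\<integral>\<^sup>+t. ?h t \<partial>lborel) = ennreal (1 / (a + 1))"
      using nn_integral_powr_Ioc[OF assms, of 1] by simp
    also have "ennreal (1 / (a + 1)) + ennreal (1 / (a + 1)) = ennreal (2 / (a + 1))"
      using assms by (simp flip: ennreal_plus)
    finally show ?thesis .
  qed
  then have "(\<integral>\<^sup>+s. \<integral>\<^sup>+t. ennreal (\<bar>s - t\<bar> powr a) \<partial>unit_leb \<partial>unit_leb) \<le> (\<integral>\<^sup>+s. ennreal (2 / (a + 1)) \<partial>unit_leb)"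
    by (intro nn_integral_mono) auto
  also have "\<dots> = ennreal (2 / (a + 1))" by simp
  finally show ?thesis .
qed

text \<open>Substitute \<open>x = t - s\<close> and integrate over \<open>s\<close> first: the
  starting points from which a step of length \<open>x\<close> crosses \<open>g\<close> form an
  interval of length \<open>x\<close>, so the singularity \<open>x powr (-1 - \<kappa>)\<close>
  improves to \<open>x powr (-\<kappa>)\<close>. This is why a jump has finite Gagliardo energy when
  \<open>\<eta> * p < 1\<close>.\<close>

lemma nn_integral_kernel_across_point:
  fixes \<kappa> g h :: real
  assumes "\<kappa> < 1" "h \<ge> 0"
  shows "(\<integral>\<^sup>+s. \<integral>\<^sup>+t. ennreal ((t - s) powr (-1 - \<kappa>)) * indicator {(s, t). s < g \<and> g \<le> t \<and> t \<le> s + h} (s, t) \<partial>lborel \<partial>lborel)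
    = ennreal (h powr (1 - \<kappa>) / (1 - \<kappa>))"
proof -
  let ?A = "{(s, t). s < g \<and> g \<le> t \<and> t \<le> s + h} :: (real \<times> real) set"
  have A[measurable]: "?A \<in> sets borel"
  proof -
    have "?A = {x. fst x < g} \<inter> {x. g \<le> snd x} \<inter> {x. snd x \<le> fst x + h}" by auto
    also have "\<dots> \<in> sets borel"
      by (intro sets.Int borel_open open_Collect_less borel_closed closed_Collect_le continuous_intros)
    finally show ?thesis .
  qed
  have sub: "(\<integral>\<^sup>+t. ennreal ((t - s) powr (-1 - \<kappa>)) * indicator ?A (s, t) \<partial>lborel) =
      (\<integral>\<^sup>+x. ennreal (x powr (-1 - \<kappa>)) * indicator {0<..h} x * indicator {g - x..<g} s \<partial>lborel)" for s
  proof -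
    have "(\<integral>\<^sup>+t. ennreal ((t - s) powr (-1 - \<kappa>)) * indicator ?A (s, t) \<partial>lborel) =
      (\<integral>\<^sup>+x. ennreal ((s + 1 * x - s) powr (-1 - \<kappa>)) * indicator ?A (s, s + 1 * x) \<partial>lborel)"
    proof (subst nn_integral_real_affine[where c = 1 and t = s])
      have "(\<lambda>t. (s, t)) \<in> borel_measurable borel"
        by (intro borel_measurable_continuous_onI continuous_intros)
      then have ind: "(\<lambda>t. indicator ?A (s, t) :: ennreal) \<in> borel_measurable borel"
        by (rule measurable_compose[OF _ borel_measurable_indicator[OF A]])
      show "(\<lambda>t. ennreal ((t - s) powr (-1 - \<kappa>)) * indicator ?A (s, t)) \<in> borel_measurable borel"
        by (intro borel_measurable_times_ennreal ind) simp_all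
    qed auto
    also have "\<dots> = (\<integral>\<^sup>+x. ennreal (x powr (-1 - \<kappa>)) * indicator {0<..h} x * indicator {g - x..<g} s \<partial>lborel)"
      by (intro nn_integral_cong) (auto simp: indicator_def)
    finally show ?thesis .
  qed
  have B: "{y::real \<times> real. g - fst y \<le> snd y \<and> snd y < g} \<in> sets (lborel \<Otimes>\<^sub>M lborel)"
  proof -
    have "{y::real \<times> real. g - fst y \<le> snd y \<and> snd y < g} = {y. g - fst y \<le> snd y} \<inter> {y. snd y < g}" by auto
    also have "\<dots> \<in> sets borel"
      by (intro sets.Int borel_open open_Collect_less borel_closed closed_Collect_le continuous_intros)
    finally show ?thesis unfolding lborel_prod sets_lborel .
  qed
  have meas: "(\<lambda>y::real \<times> real. ennreal (fst y powr (-1 - \<kappa>)) * indicator {0<..h} (fst y) * indicator {g - fst y..<g} (snd y))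
      \<in> borel_measurable (lborel \<Otimes>\<^sub>M lborel)"
  proof -
    have "(\<lambda>y::real \<times> real. indicator {g - fst y..<g} (snd y) :: ennreal) =
       indicator {y::real \<times> real. g - fst y \<le> snd y \<and> snd y < g}"
      by (auto simp: indicator_def fun_eq_iff)
    moreover have "(indicator {y::real \<times> real. g - fst y \<le> snd y \<and> snd y < g} :: _ \<Rightarrow> ennreal) \<in> borel_measurable (lborel \<Otimes>\<^sub>M lborel)"
      using B by (rule borel_measurable_indicator)
    ultimately show ?thesis by (intro borel_measurable_times_ennreal) simp_all
  qed
  have "(\<integral>\<^sup>+s. \<integral>\<^sup>+t. ennreal ((t - s) powr (-1 - \<kappa>)) * indicator ?A (s, t) \<partial>lborel \<partial>lborel) =
    (\<integral>\<^sup>+s. \<integral>\<^sup>+x. ennreal (x powr (-1 - \<kappa>)) * indicator {0<..h} x * indicator {g - x..<g} s \<partial>lborel \<partial>lborel)"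
    by (simp only: sub)
  also have "\<dots> = (\<integral>\<^sup>+x. \<integral>\<^sup>+s. ennreal (x powr (-1 - \<kappa>)) * indicator {0<..h} x * indicator {g - x..<g} s \<partial>lborel \<partial>lborel)"
    using lborel_pair.Fubini'[of "\<lambda>x s. ennreal (x powr (-1 - \<kappa>)) * indicator {0<..h} x * indicator {g - x..<g} s"] meas
    by (simp add: case_prod_beta')
  also have "\<dots> = (\<integral>\<^sup>+x. ennreal (x powr (- \<kappa>)) * indicator {0<..h} x \<partial>lborel)"
  proof (intro nn_integral_cong)
    fix x :: real
    have "(\<integral>\<^sup>+s. ennreal (x powr (-1 - \<kappa>)) * indicator {0<..h} x * indicator {g - x..<g} s \<partial>lborel) =
       ennreal (x powr (-1 - \<kappa>)) * indicator {0<..h} x * emeasure lborel {g - x..<g}"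
      by (subst nn_integral_cmult) auto
    also have "\<dots> = ennreal (x powr (- \<kappa>)) * indicator {0<..h} x"
    proof (cases "x \<in> {0<..h}")
      case True
      then have "x powr (-1 - \<kappa>) * x = x powr (-\<kappa>)"
        using powr_mult_base[of x "-1 - \<kappa>"] by (simp add: mult.commute)
      then show ?thesis using True by (simp flip: ennreal_mult'')
    qed simp
    finally show "(\<integral>\<^sup>+s. ennreal (x powr (-1 - \<kappa>)) * indicator {0<..h} x * indicator {g - x..<g} s \<partial>lborel) =
      ennreal (x powr (- \<kappa>)) * indicator {0<..h} x" .
  qed
  also have "\<dots> = ennreal (h powr (1 - \<kappa>) / (1 - \<kappa>))"
    using nn_integral_powr_Ioc[of "-\<kappa>" h] assms by simp
  finally show ?thesis .
qed

text \<open>A step path of level \<open>n\<close> can differ at two times only if this holds;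
  otherwise its increment is exactly zero, which removes the singularity of the kernel inside a
  cell.\<close>

definition dyadic_apart :: "nat \<Rightarrow> real \<Rightarrow> real \<Rightarrow> bool" where
  "dyadic_apart n s t \<longleftrightarrow> \<lfloor>2 ^ n * s\<rfloor> \<noteq> \<lfloor>2 ^ n * t\<rfloor>"

lemma measurable_dyadic_apart [measurable]:
  "(\<lambda>x. dyadic_apart n (fst x) (snd x)) \<in> measurable (borel \<Otimes>\<^sub>M borel) (count_space UNIV)"
  unfolding dyadic_apart_def by measurable

text \<open>The witness is the left end of the cell that contains \<open>t\<close>.\<close>

lemma dyadic_apart_point:
  assumes "dyadic_apart n s t" "s \<le> t" "0 \<le> s" "t \<le> 1"
  shows "\<exists>i\<in>{1..(2::nat)^n}. s < i / 2 ^ n \<and> i / 2 ^ n \<le> t"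
proof -
  have "\<lfloor>2 ^ n * s\<rfloor> \<le> \<lfloor>2 ^ n * t\<rfloor>"
    using assms by (intro floor_mono) simp
  then have lt: "\<lfloor>2 ^ n * s\<rfloor> < \<lfloor>2 ^ n * t\<rfloor>"
    using assms(1) by (simp add: dyadic_apart_def)
  have s0: "0 \<le> \<lfloor>2 ^ n * s\<rfloor>" using assms by simp
  define i where "i = nat \<lfloor>2 ^ n * t\<rfloor>"
  have "0 \<le> \<lfloor>2 ^ n * t\<rfloor>" using lt s0 by linarith
  then have i: "real i = of_int \<lfloor>2 ^ n * t\<rfloor>" by (simp only: i_def of_nat_nat)
  have "1 \<le> \<lfloor>2 ^ n * t\<rfloor>" using lt s0 by linarith
  then have i1: "1 \<le> i" using i by linarith
  have "2 ^ n * s < of_int \<lfloor>2 ^ n * t\<rfloor>"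
    using lt by (simp add: floor_less_iff)
  moreover have "of_int \<lfloor>2 ^ n * t\<rfloor> \<le> 2 ^ n * t" by simp
  moreover have "2 ^ n * t \<le> 2 ^ n * 1"
    using assms(4) by (intro mult_left_mono) auto
  then have "real i \<le> 2 ^ n"
    using calculation(2) i by linarith
  then have "i \<le> 2 ^ n" by (metis of_nat_le_iff of_nat_numeral of_nat_power)
  ultimately have "i \<in> {1..2 ^ n}" "s < i / 2 ^ n" "i / 2 ^ n \<le> t"
    using i i1 by (simp_all add: pos_less_divide_eq pos_divide_le_eq mult.commute)
  then show ?thesis by blast
qed

text \<open>Union bound over the \<open>2 ^ n\<close> grid points, in both orders of
  \<open>s\<close> and \<open>t\<close>. Each contributes the energy of one jump within distance
  \<open>h = 1 / 2 ^ n\<close>, and \<open>2 ^ n * h powr (1 - \<kappa>)\<close> is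
  \<open>2 powr (n * \<kappa>)\<close>.\<close>

lemma nn_integral_kernel_dyadic_apart:
  fixes \<kappa> :: real
  assumes "\<kappa> < 1"
  shows "(\<integral>\<^sup>+s. \<integral>\<^sup>+t. ennreal (of_bool (dyadic_apart n s t \<and> \<bar>s - t\<bar> \<le> 1 / 2 ^ n) * \<bar>s - t\<bar> powr (-1 - \<kappa>)) \<partial>unit_leb \<partial>unit_leb)
    \<le> ennreal (2 / (1 - \<kappa>) * 2 powr (n * \<kappa>))"
proof -
  define h :: real where "h = 1 / 2 ^ n"
  define a where "a = (\<lambda>i s t. ennreal ((t - s) powr (-1 - \<kappa>)) *
    indicator {(s, t). s < real i / 2 ^ n \<and> real i / 2 ^ n \<le> t \<and> t \<le> s + h} (s, t))"
  have am: "(\<lambda>x. a i (fst x) (snd x)) \<in> borel_measurable (lborel \<Otimes>\<^sub>M lborel)" for i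
  proof -
    have "{(s, t). s < real i / 2 ^ n \<and> real i / 2 ^ n \<le> t \<and> t \<le> s + h} =
      {x. fst x < real i / 2 ^ n} \<inter> {x. real i / 2 ^ n \<le> snd x} \<inter> {x. snd x \<le> fst x + h}" by auto
    also have "\<dots> \<in> sets borel"
      by (intro sets.Int borel_open open_Collect_less borel_closed closed_Collect_le continuous_intros)
    finally have "{(s, t). s < real i / 2 ^ n \<and> real i / 2 ^ n \<le> t \<and> t \<le> s + h} \<in> sets (lborel \<Otimes>\<^sub>M lborel)"
      unfolding lborel_prod sets_lborel .
    from borel_measurable_indicator[OF this] show ?thesis unfolding a_def prod.collapse
      by (simp add: borel_measurable_times_ennreal)
  qed
  have am1 [measurable]: "(\<lambda>x. a i (f x) (g x)) \<in> borel_measurable M"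
    if "f \<in> borel_measurable M" "g \<in> borel_measurable M" for i f g and M :: "'z measure"
  proof -
    have "(\<lambda>x. (f x, g x)) \<in> measurable M (lborel \<Otimes>\<^sub>M lborel)" using that by simp
    from measurable_compose[OF this am[of i]] show ?thesis by simp
  qed
  have pt: "ennreal (of_bool (dyadic_apart n s t \<and> \<bar>s - t\<bar> \<le> 1 / 2 ^ n) * \<bar>s - t\<bar> powr (-1 - \<kappa>))
     \<le> (\<Sum>i\<in>{1..(2::nat)^n}. a i s t + a i t s)" (is "?l \<le> _") if "s \<in> {0..1}" "t \<in> {0..1}" for s t
  proof (cases "dyadic_apart n s t \<and> \<bar>s - t\<bar> \<le> 1 / 2 ^ n")
    case True
    have st: "0 \<le> s" "s \<le> 1" "0 \<le> t" "t \<le> 1" using that by auto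
    have "\<exists>i\<in>{1..(2::nat)^n}. ?l \<le> a i s t + a i t s"
    proof (cases "s \<le> t")
      case le: True
      obtain i where i: "i \<in> {1..(2::nat)^n}" "s < i / 2 ^ n" "i / 2 ^ n \<le> t"
        using dyadic_apart_point[of n s t] True le st by blast
      have "?l \<le> a i s t" using True le i by (simp add: a_def h_def)
      then show ?thesis using i(1) by (intro bexI[of _ i]) (auto intro: add_increasing2)
    next
      case le: False
      have "dyadic_apart n t s" using True by (auto simp: dyadic_apart_def)
      then obtain i where i: "i \<in> {1..(2::nat)^n}" "t < i / 2 ^ n" "i / 2 ^ n \<le> s"
        using dyadic_apart_point[of n t s] le st by (metis nle_le)
      have "?l \<le> a i t s" using True le i by (simp add: a_def h_def)
      then show ?thesis using i(1) by (intro bexI[of _ i]) (auto intro: add_increasing)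
    qed
    then obtain i where i: "i \<in> {1..(2::nat)^n}" and "?l \<le> a i s t + a i t s" by auto
    note this(2)
    also have "a i s t + a i t s \<le> (\<Sum>i\<in>{1..(2::nat)^n}. a i s t + a i t s)"
      using i by (intro member_le_sum) auto
    finally show ?thesis .
  qed auto
  have "(\<integral>\<^sup>+s. \<integral>\<^sup>+t. ennreal (of_bool (dyadic_apart n s t \<and> \<bar>s - t\<bar> \<le> 1 / 2 ^ n) * \<bar>s - t\<bar> powr (-1 - \<kappa>)) \<partial>unit_leb \<partial>unit_leb)
    \<le> (\<integral>\<^sup>+s. \<integral>\<^sup>+t. (\<Sum>i\<in>{1..(2::nat)^n}. a i s t + a i t s) \<partial>unit_leb \<partial>unit_leb)"
    by (intro nn_integral_mono pt) auto
  also have "\<dots> \<le> (\<integral>\<^sup>+s. \<integral>\<^sup>+t. (\<Sum>i\<in>{1..(2::nat)^n}. a i s t + a i t s) \<partial>lborel \<partial>lborel)"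
    unfolding nn_integral_unit_leb
    by (intro nn_integral_mono) (auto simp: indicator_def intro!: nn_integral_mono)
  also have "\<dots> = (\<Sum>i\<in>{1..(2::nat)^n}. (\<integral>\<^sup>+s. \<integral>\<^sup>+t. a i s t \<partial>lborel \<partial>lborel) + (\<integral>\<^sup>+s. \<integral>\<^sup>+t. a i t s \<partial>lborel \<partial>lborel))"
    by (simp add: nn_integral_sum nn_integral_add am1 lborel.borel_measurable_nn_integral case_prod_beta')
  also have "\<dots> = (\<Sum>i\<in>{1..(2::nat)^n}. 2 * ennreal (h powr (1 - \<kappa>) / (1 - \<kappa>)))"
  proof (intro sum.cong refl)
    fix i :: nat
    have 1: "(\<integral>\<^sup>+s. \<integral>\<^sup>+t. a i s t \<partial>lborel \<partial>lborel) = ennreal (h powr (1 - \<kappa>) / (1 - \<kappa>))"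
      unfolding a_def using assms by (intro nn_integral_kernel_across_point) (auto simp: h_def)
    have "(\<integral>\<^sup>+s. \<integral>\<^sup>+t. a i t s \<partial>lborel \<partial>lborel) = (\<integral>\<^sup>+s. \<integral>\<^sup>+t. a i s t \<partial>lborel \<partial>lborel)"
      using lborel_pair.Fubini'[of "a i"] am[of i] by (simp add: case_prod_beta')
    then show "(\<integral>\<^sup>+s. \<integral>\<^sup>+t. a i s t \<partial>lborel \<partial>lborel) + (\<integral>\<^sup>+s. \<integral>\<^sup>+t. a i t s \<partial>lborel \<partial>lborel) =
      2 * ennreal (h powr (1 - \<kappa>) / (1 - \<kappa>))" by (simp add: 1 mult_2)
  qed
  also have "\<dots> = ennreal (2 ^ n * (2 * (h powr (1 - \<kappa>) / (1 - \<kappa>))))"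
    using assms by (simp add: ennreal_mult' mult.assoc flip: ennreal_power ennreal_numeral times_divide_eq_right)
  also have "2 ^ n * (2 * (h powr (1 - \<kappa>) / (1 - \<kappa>))) = 2 / (1 - \<kappa>) * 2 powr (n * \<kappa>)"
  proof -
    have h: "h = 2 powr (- real n)" by (simp add: h_def powr_minus powr_realpow field_simps)
    have "(2::real) ^ n * h powr (1 - \<kappa>) = 2 powr (real n * \<kappa>)"
      unfolding h powr_powr by (simp add: algebra_simps flip: powr_realpow powr_add)
    then show ?thesis by (simp add: field_simps)
  qed
  finally show ?thesis .
qed

text \<open>The first summand comes from the power of the distance near the diagonal, the second
  from close pairs of times on both sides of a grid point.\<close>

definition kernel_const :: "real \<Rightarrow> real \<Rightarrow> real" where
  "kernel_const q \<kappa> = 4 / (q - \<kappa>) + 2 / (1 - \<kappa>)"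

lemma kernel_const_pos: "\<kappa> < q \<Longrightarrow> \<kappa> < 1 \<Longrightarrow> kernel_const q \<kappa> > 0"
  by (simp add: kernel_const_def add_pos_pos)

text \<open>The numerator is the shape of the moments of walk increments: between two times there
  are at most \<open>2 ^ n * |s - t| + 1\<close> steps, and none when both lie in one cell.\<close>

lemma nn_integral_kernel:
  fixes \<kappa> q :: real
  assumes "\<kappa> < 1" "\<kappa> < q" "q > 0"
  shows "(\<integral>\<^sup>+s. \<integral>\<^sup>+t. ennreal (((2 ^ n * \<bar>s - t\<bar>) powr q + of_bool (dyadic_apart n s t)) / \<bar>s - t\<bar> powr (1 + \<kappa>)) \<partial>unit_leb \<partial>unit_leb)
    \<le> ennreal (kernel_const q \<kappa> * 2 powr (n * q))"
proof -
  let ?u = "\<lambda>s t. ennreal (\<bar>s - t\<bar> powr (q - \<kappa> - 1))"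
  let ?v = "\<lambda>s t. ennreal (of_bool (dyadic_apart n s t \<and> \<bar>s - t\<bar> \<le> 1 / 2 ^ n) * \<bar>s - t\<bar> powr (-1 - \<kappa>))"
  let ?k = "2 powr (n * q) :: real"
  have pt: "ennreal (((2 ^ n * \<bar>s - t\<bar>) powr q + of_bool (dyadic_apart n s t)) / \<bar>s - t\<bar> powr (1 + \<kappa>)) \<le>
    ennreal (2 * ?k) * ?u s t + ?v s t" for s t :: real
  proof -
    have eq: "(2 ^ n * \<bar>s - t\<bar>) powr q = ?k * \<bar>s - t\<bar> powr q"
      by (simp add: powr_mult powr_powr flip: powr_realpow)
    \<comment> \<open>Beyond distance \<open>1 / 2 ^ n\<close> the indicator is absorbed by the
      power, which costs a factor \<open>2\<close>; only close pairs keep it.\<close>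
    have "of_bool (dyadic_apart n s t) \<le> (2 ^ n * \<bar>s - t\<bar>) powr q + of_bool (dyadic_apart n s t \<and> \<bar>s - t\<bar> \<le> 1 / 2 ^ n)"
    proof (cases "\<bar>s - t\<bar> \<le> 1 / 2 ^ n")
      case False
      then have "1 \<le> (2 ^ n * \<bar>s - t\<bar>)" by (simp add: field_simps)
      then have "1 \<le> (2 ^ n * \<bar>s - t\<bar>) powr q"
        using assms by (intro ge_one_powr_ge_zero) auto
      then show ?thesis by simp
    qed simp
    then have "(2 ^ n * \<bar>s - t\<bar>) powr q + of_bool (dyadic_apart n s t) \<le>
      2 * (?k * \<bar>s - t\<bar> powr q) + of_bool (dyadic_apart n s t \<and> \<bar>s - t\<bar> \<le> 1 / 2 ^ n)"
      unfolding eq by linarith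
    then have "((2 ^ n * \<bar>s - t\<bar>) powr q + of_bool (dyadic_apart n s t)) / \<bar>s - t\<bar> powr (1 + \<kappa>) \<le>
      (2 * (?k * \<bar>s - t\<bar> powr q) + of_bool (dyadic_apart n s t \<and> \<bar>s - t\<bar> \<le> 1 / 2 ^ n)) / \<bar>s - t\<bar> powr (1 + \<kappa>)"
      by (intro divide_right_mono) auto
    also have "\<dots> = 2 * ?k * \<bar>s - t\<bar> powr (q - \<kappa> - 1) + of_bool (dyadic_apart n s t \<and> \<bar>s - t\<bar> \<le> 1 / 2 ^ n) * \<bar>s - t\<bar> powr (-1 - \<kappa>)"
    proof -
      have "\<bar>s - t\<bar> powr (q - \<kappa> - 1) = \<bar>s - t\<bar> powr q / \<bar>s - t\<bar> powr (1 + \<kappa>)"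
        by (simp flip: powr_diff) (simp add: algebra_simps)
      moreover have "\<bar>s - t\<bar> powr (-1 - \<kappa>) = 1 / \<bar>s - t\<bar> powr (1 + \<kappa>)"
        using powr_minus_divide[of "\<bar>s - t\<bar>" "1 + \<kappa>"] by (simp add: algebra_simps)
      ultimately show ?thesis by (simp add: add_divide_distrib)
    qed
    finally have "ennreal (((2 ^ n * \<bar>s - t\<bar>) powr q + of_bool (dyadic_apart n s t)) / \<bar>s - t\<bar> powr (1 + \<kappa>)) \<le>
      ennreal (2 * ?k * \<bar>s - t\<bar> powr (q - \<kappa> - 1) + of_bool (dyadic_apart n s t \<and> \<bar>s - t\<bar> \<le> 1 / 2 ^ n) * \<bar>s - t\<bar> powr (-1 - \<kappa>))"
      by (rule ennreal_leI)
    also have "\<dots> = ennreal (2 * ?k) * ?u s t + ?v s t"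
      by (subst ennreal_plus) (simp_all add: ennreal_mult')
    finally show ?thesis .
  qed
  have "(\<integral>\<^sup>+s. \<integral>\<^sup>+t. ennreal (((2 ^ n * \<bar>s - t\<bar>) powr q + of_bool (dyadic_apart n s t)) / \<bar>s - t\<bar> powr (1 + \<kappa>)) \<partial>unit_leb \<partial>unit_leb)
    \<le> (\<integral>\<^sup>+s. \<integral>\<^sup>+t. ennreal (2 * ?k) * ?u s t + ?v s t \<partial>unit_leb \<partial>unit_leb)"
    by (intro nn_integral_mono pt)
  also have "\<dots> = ennreal (2 * ?k) * (\<integral>\<^sup>+s. \<integral>\<^sup>+t. ?u s t \<partial>unit_leb \<partial>unit_leb) + (\<integral>\<^sup>+s. \<integral>\<^sup>+t. ?v s t \<partial>unit_leb \<partial>unit_leb)"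
    by (rule nn_integral_iterated_linear)
      (measurable, auto simp: dyadic_apart_def intro: unit_leb.sigma_finite_measure_axioms)
  also have "\<dots> \<le> ennreal (2 * ?k) * ennreal (2 / (q - \<kappa> - 1 + 1)) + ennreal (2 / (1 - \<kappa>) * 2 powr (n * \<kappa>))"
    using assms by (intro add_mono mult_left_mono nn_integral_kernel_near_diagonal nn_integral_kernel_dyadic_apart) auto
  also have "\<dots> = ennreal (2 * ?k * (2 / (q - \<kappa>)) + 2 / (1 - \<kappa>) * 2 powr (n * \<kappa>))"
    using assms by (simp flip: ennreal_mult'' ennreal_plus)
  \<comment> \<open>Here \<open>\<kappa> < q\<close> lets the jump part, of size
    \<open>2 powr (n * \<kappa>)\<close>, be swallowed by \<open>2 powr (n * q)\<close>.\<close>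
  also have "\<dots> \<le> ennreal (2 * ?k * (2 / (q - \<kappa>)) + 2 / (1 - \<kappa>) * ?k)"
    using assms by (intro ennreal_leI add_left_mono mult_left_mono powr_mono) (auto intro: mult_left_mono)
  also have "2 * ?k * (2 / (q - \<kappa>)) + 2 / (1 - \<kappa>) * ?k = kernel_const q \<kappa> * ?k"
    by (simp add: kernel_const_def algebra_simps)
  finally show ?thesis .
qed

section \<open>Sobolev norms of random step functions\<close>

text \<open>Kept in \<open>ennreal\<close>, where finiteness decides membership in the space and
  Tonelli's theorem applies; \<open>enn2real\<close> would send an infinite energy to
  \<open>0\<close>.\<close>

definition sob_energy :: "real \<Rightarrow> real \<Rightarrow> (real \<Rightarrow> real) \<Rightarrow> ennreal" where
  "sob_energy \<eta> p f = (\<integral>\<^sup>+t. ennreal (\<bar>f t\<bar> powr p) \<partial>unit_leb) + gagliardo \<eta> p f"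

lemma sob_space_iff: "f \<in> sob_space \<eta> p \<longleftrightarrow> f \<in> borel_measurable unit_leb \<and> sob_energy \<eta> p f < \<infinity>"
  by (auto simp: sob_space_def sob_energy_def)

lemma sob_norm_eq: "sob_norm \<eta> p f = enn2real (sob_energy \<eta> p f) powr (1 / p)"
  by (simp add: sob_norm_def sob_energy_def)

lemma sob_norm_nonneg: "sob_norm \<eta> p f \<ge> 0"
  by (simp add: sob_norm_eq)

lemma sob_energy_cong:
  assumes "\<And>t. t \<in> {0..1} \<Longrightarrow> f t = g t"
  shows "sob_energy \<eta> p f = sob_energy \<eta> p g"
  unfolding sob_energy_def gagliardo_def
  by (intro arg_cong2[where f = "(+)"] nn_integral_cong) (use assms in auto)

text \<open>A deterministic and crude bound, from the kernel estimate with \<open>q = 1\<close>. It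
  serves membership in the space and Lipschitz dependence on the steps, not the rate.\<close>

lemma sob_energy_dyadic_step_le:
  assumes "\<And>t. t \<in> {0..1} \<Longrightarrow> \<bar>f t\<bar> \<le> b" "b \<ge> 0" "p > 0"
    and "\<And>s t. s \<in> {0..1} \<Longrightarrow> t \<in> {0..1} \<Longrightarrow> \<bar>f s - f t\<bar> \<le> b * of_bool (dyadic_apart n s t)"
    and "\<eta> * p < 1" "0 < \<eta>"
  shows "sob_energy \<eta> p f \<le> ennreal (b powr p * (1 + kernel_const 1 (\<eta> * p) * 2 ^ n))"
proof -
  have k: "0 \<le> kernel_const 1 (\<eta> * p)" using assms kernel_const_pos[of "\<eta> * p" 1] by simp
  have 1: "(\<integral>\<^sup>+t. ennreal (\<bar>f t\<bar> powr p) \<partial>unit_leb) \<le> ennreal (b powr p)"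
  proof -
    have "(\<integral>\<^sup>+t. ennreal (\<bar>f t\<bar> powr p) \<partial>unit_leb) \<le> (\<integral>\<^sup>+t. ennreal (b powr p) \<partial>unit_leb)"
      using assms by (intro nn_integral_mono ennreal_leI powr_mono2) auto
    then show ?thesis by simp
  qed
  have "gagliardo \<eta> p f \<le> (\<integral>\<^sup>+s. \<integral>\<^sup>+t. ennreal (b powr p) * ennreal (((2 ^ n * \<bar>s - t\<bar>) powr 1 + of_bool (dyadic_apart n s t)) / \<bar>s - t\<bar> powr (1 + \<eta> * p)) + 0 \<partial>unit_leb \<partial>unit_leb)"
    unfolding gagliardo_def
  proof (intro nn_integral_mono)
    fix s t :: real assume st: "s \<in> space unit_leb" "t \<in> space unit_leb"
    have "\<bar>f s - f t\<bar> powr p \<le> (b * of_bool (dyadic_apart n s t)) powr p"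
      using assms st by (intro powr_mono2) auto
    also have "\<dots> = b powr p * of_bool (dyadic_apart n s t)"
      by simp
    \<comment> \<open>The nonnegative power is added only to reach the form of the kernel
      estimate.\<close>
    also have "\<dots> \<le> b powr p * ((2 ^ n * \<bar>s - t\<bar>) powr 1 + of_bool (dyadic_apart n s t))"
      by (intro mult_left_mono) auto
    finally have "\<bar>f s - f t\<bar> powr p / \<bar>s - t\<bar> powr (1 + \<eta> * p) \<le>
      b powr p * (((2 ^ n * \<bar>s - t\<bar>) powr 1 + of_bool (dyadic_apart n s t)) / \<bar>s - t\<bar> powr (1 + \<eta> * p))"
      unfolding times_divide_eq_right by (intro divide_right_mono) auto
    from ennreal_leI[OF this]
    show "ennreal (\<bar>f s - f t\<bar> powr p / \<bar>s - t\<bar> powr (1 + \<eta> * p)) \<le> ennreal (b powr p) * ennreal (((2 ^ n * \<bar>s - t\<bar>) powr 1 + of_bool (dyadic_apart n s t)) / \<bar>s - t\<bar> powr (1 + \<eta> * p)) + 0"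
      by (subst ennreal_mult'[symmetric]) auto
  qed
  also have "\<dots> = ennreal (b powr p) * (\<integral>\<^sup>+s. \<integral>\<^sup>+t. ennreal (((2 ^ n * \<bar>s - t\<bar>) powr 1 + of_bool (dyadic_apart n s t)) / \<bar>s - t\<bar> powr (1 + \<eta> * p)) \<partial>unit_leb \<partial>unit_leb) + (\<integral>\<^sup>+s. \<integral>\<^sup>+t. 0 \<partial>unit_leb \<partial>unit_leb)"
    by (rule nn_integral_iterated_linear)
      (measurable, auto simp: dyadic_apart_def intro: unit_leb.sigma_finite_measure_axioms)
  also have "\<dots> \<le> ennreal (b powr p) * ennreal (kernel_const 1 (\<eta> * p) * 2 powr (n * 1)) + 0"
    using nn_integral_kernel[of "\<eta> * p" 1 n] assms(5) by (intro add_mono mult_left_mono) auto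
  also have "\<dots> = ennreal (b powr p * (kernel_const 1 (\<eta> * p) * 2 ^ n))"
    using k by (simp add: ennreal_mult' powr_realpow)
  finally have 2: "gagliardo \<eta> p f \<le> ennreal (b powr p * (kernel_const 1 (\<eta> * p) * 2 ^ n))" .
  have "sob_energy \<eta> p f \<le> ennreal (b powr p) + ennreal (b powr p * (kernel_const 1 (\<eta> * p) * 2 ^ n))"
    unfolding sob_energy_def using 1 2 by (rule add_mono)
  also have "\<dots> = ennreal (b powr p * (1 + kernel_const 1 (\<eta> * p) * 2 ^ n))"
    using k by (subst ennreal_plus[symmetric]) (auto simp: algebra_simps)
  finally show ?thesis .
qed

text \<open>\<open>K\<close> is the \<open>L\<^sup>p\<close> norm; the bound replaces Jensen's inequality at the price of a factor two.\<close>

lemma sob_norm_le_energy: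
  assumes "sob_energy \<eta> p f < \<infinity>" "K > 0" "p \<ge> 1"
  shows "ennreal (sob_norm \<eta> p f) \<le> ennreal (K powr (1 - p)) * sob_energy \<eta> p f + ennreal K"
proof -
  define e where "e = enn2real (sob_energy \<eta> p f)"
  have e: "sob_energy \<eta> p f = ennreal e" "e \<ge> 0" using assms(1) by (auto simp: e_def)
  have "(e powr (1 / p)) powr 1 \<le> K powr (1 - p) * (e powr (1 / p)) powr p + K powr 1"
    using assms by (intro powr_interpolate) auto
  then have "sob_norm \<eta> p f \<le> K powr (1 - p) * e + K"
    using assms e by (simp add: sob_norm_eq powr_powr flip: e_def)
  then have "ennreal (sob_norm \<eta> p f) \<le> ennreal (K powr (1 - p) * e + K)"
    by (rule ennreal_leI)
  also have "\<dots> = ennreal (K powr (1 - p)) * sob_energy \<eta> p f + ennreal K"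
    using e assms(2) by (subst ennreal_plus) (auto simp: ennreal_mult')
  finally show ?thesis .
qed

locale sob_params =
  fixes \<eta> p :: real
  assumes \<eta>: "0 < \<eta>" and p: "1 \<le> p" "\<eta> * p < 1"
begin

lemma \<eta>p_pos: "0 < \<eta> * p" using \<eta> p by simp

section \<open>Expected Sobolev energy of a jointly measurable process\<close>

context
  fixes Q :: "'a measure" and g :: "real \<Rightarrow> 'a \<Rightarrow> real"
  assumes Q: "prob_space Q"
    and meas: "(\<lambda>x. g (fst x) (snd x)) \<in> borel_measurable (unit_leb \<Otimes>\<^sub>M Q)"
begin

interpretation Q: prob_space Q by (rule Q)

lemma measurable_process_path: "\<omega> \<in> space Q \<Longrightarrow> (\<lambda>t. g t \<omega>) \<in> borel_measurable unit_leb"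
  using measurable_compose[OF measurable_Pair2' meas] by simp

lemma measurable_process_at: "t \<in> {0..1} \<Longrightarrow> (\<lambda>\<omega>. g t \<omega>) \<in> borel_measurable Q"
  using measurable_compose[OF measurable_Pair1' meas] by simp

lemma measurable_process_quotient:
  "(\<lambda>x. ennreal (\<bar>g (fst (fst x)) (snd x) - g (snd (fst x)) (snd x)\<bar> powr p / \<bar>fst (fst x) - snd (fst x)\<bar> powr (1 + \<eta> * p)))
    \<in> borel_measurable ((unit_leb \<Otimes>\<^sub>M unit_leb) \<Otimes>\<^sub>M Q)"
proof -
  have 1: "(\<lambda>x. g (fst (fst x)) (snd x)) \<in> borel_measurable ((unit_leb \<Otimes>\<^sub>M unit_leb) \<Otimes>\<^sub>M Q)"
    using measurable_compose[of "\<lambda>x. (fst (fst x), snd x)" "(unit_leb \<Otimes>\<^sub>M unit_leb) \<Otimes>\<^sub>M Q", OF _ meas] by simp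
  have 2: "(\<lambda>x. g (snd (fst x)) (snd x)) \<in> borel_measurable ((unit_leb \<Otimes>\<^sub>M unit_leb) \<Otimes>\<^sub>M Q)"
    using measurable_compose[of "\<lambda>x. (snd (fst x), snd x)" "(unit_leb \<Otimes>\<^sub>M unit_leb) \<Otimes>\<^sub>M Q", OF _ meas] by simp
  have 3: "(\<lambda>x. fst (fst x)) \<in> borel_measurable ((unit_leb \<Otimes>\<^sub>M unit_leb) \<Otimes>\<^sub>M Q)"
    by (rule measurable_compose[OF measurable_fst measurable_fst_unit_leb])
  have 4: "(\<lambda>x. snd (fst x)) \<in> borel_measurable ((unit_leb \<Otimes>\<^sub>M unit_leb) \<Otimes>\<^sub>M Q)"
    by (rule measurable_compose[OF measurable_fst measurable_snd_unit_leb])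
  show ?thesis using 1 2 3 4 by measurable
qed

lemma gagliardo_pair:
  assumes "\<omega> \<in> space Q"
  shows "gagliardo \<eta> p (\<lambda>t. g t \<omega>) = (\<integral>\<^sup>+x. ennreal (\<bar>g (fst x) \<omega> - g (snd x) \<omega>\<bar> powr p / \<bar>fst x - snd x\<bar> powr (1 + \<eta> * p)) \<partial>(unit_leb \<Otimes>\<^sub>M unit_leb))"
proof -
  have "(\<lambda>x. (x, \<omega>)) \<in> measurable (unit_leb \<Otimes>\<^sub>M unit_leb) ((unit_leb \<Otimes>\<^sub>M unit_leb) \<Otimes>\<^sub>M Q)"
    using assms by simp
  from measurable_compose[OF this measurable_process_quotient]
  show ?thesis unfolding gagliardo_def
    by (subst unit_leb.nn_integral_fst[symmetric]) auto
qed

lemma measurable_sob_energy: "(\<lambda>\<omega>. sob_energy \<eta> p (\<lambda>t. g t \<omega>)) \<in> borel_measurable Q"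
proof -
  have 1: "(\<lambda>\<omega>. \<integral>\<^sup>+t. ennreal (\<bar>g t \<omega>\<bar> powr p) \<partial>unit_leb) \<in> borel_measurable Q"
  proof (rule unit_leb.borel_measurable_nn_integral)
    have "(\<lambda>x. g (snd x) (fst x)) \<in> borel_measurable (Q \<Otimes>\<^sub>M unit_leb)"
      using measurable_compose[of "\<lambda>x. (snd x, fst x)" "Q \<Otimes>\<^sub>M unit_leb", OF _ meas] by simp
    then show "(\<lambda>(\<omega>, t). ennreal (\<bar>g t \<omega>\<bar> powr p)) \<in> borel_measurable (Q \<Otimes>\<^sub>M unit_leb)"
      by (simp add: case_prod_beta')
  qed
  have "(\<lambda>\<omega>. \<integral>\<^sup>+x. ennreal (\<bar>g (fst x) \<omega> - g (snd x) \<omega>\<bar> powr p / \<bar>fst x - snd x\<bar> powr (1 + \<eta> * p)) \<partial>(unit_leb \<Otimes>\<^sub>M unit_leb)) \<in> borel_measurable Q"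
  proof (rule unit_leb2.P.borel_measurable_nn_integral)
    have "(\<lambda>y. (snd y, fst y)) \<in> measurable (Q \<Otimes>\<^sub>M (unit_leb \<Otimes>\<^sub>M unit_leb)) ((unit_leb \<Otimes>\<^sub>M unit_leb) \<Otimes>\<^sub>M Q)"
      by simp
    from measurable_compose[OF this measurable_process_quotient]
    show "(\<lambda>(\<omega>, x). ennreal (\<bar>g (fst x) \<omega> - g (snd x) \<omega>\<bar> powr p / \<bar>fst x - snd x\<bar> powr (1 + \<eta> * p)))
      \<in> borel_measurable (Q \<Otimes>\<^sub>M (unit_leb \<Otimes>\<^sub>M unit_leb))" by (simp add: case_prod_beta')
  qed
  then have 2: "(\<lambda>\<omega>. gagliardo \<eta> p (\<lambda>t. g t \<omega>)) \<in> borel_measurable Q"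
    by (rule measurable_cong[THEN iffD1, rotated]) (simp add: gagliardo_pair)
  show ?thesis unfolding sob_energy_def using 1 2 by simp
qed

text \<open>Tonelli's theorem in the times and in \<omega>: the expected energy involves only
  \<open>p\<close>-th moments of values and of increments, never the regularity of a path.\<close>

lemma nn_integral_sob_energy:
  "(\<integral>\<^sup>+\<omega>. sob_energy \<eta> p (\<lambda>t. g t \<omega>) \<partial>Q) =
     (\<integral>\<^sup>+t. \<integral>\<^sup>+\<omega>. ennreal (\<bar>g t \<omega>\<bar> powr p) \<partial>Q \<partial>unit_leb) +
     (\<integral>\<^sup>+s. \<integral>\<^sup>+t. (\<integral>\<^sup>+\<omega>. ennreal (\<bar>g s \<omega> - g t \<omega>\<bar> powr p) \<partial>Q) * ennreal (1 / \<bar>s - t\<bar> powr (1 + \<eta> * p)) \<partial>unit_leb \<partial>unit_leb)"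
proof -
  interpret A: pair_sigma_finite unit_leb Q ..
  interpret B: pair_sigma_finite "unit_leb \<Otimes>\<^sub>M unit_leb" Q ..
  have "(\<integral>\<^sup>+\<omega>. sob_energy \<eta> p (\<lambda>t. g t \<omega>) \<partial>Q) = (\<integral>\<^sup>+\<omega>. (\<integral>\<^sup>+t. ennreal (\<bar>g t \<omega>\<bar> powr p) \<partial>unit_leb) \<partial>Q) + (\<integral>\<^sup>+\<omega>. gagliardo \<eta> p (\<lambda>t. g t \<omega>) \<partial>Q)"
  proof -
    have m: "(\<lambda>x. ennreal (\<bar>g (snd x) (fst x)\<bar> powr p)) \<in> borel_measurable (Q \<Otimes>\<^sub>M unit_leb)"
      using measurable_compose[of "\<lambda>x. (snd x, fst x)" "Q \<Otimes>\<^sub>M unit_leb", OF _ meas] by simp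
    have "(\<lambda>\<omega>. \<integral>\<^sup>+x. ennreal (\<bar>g (fst x) \<omega> - g (snd x) \<omega>\<bar> powr p / \<bar>fst x - snd x\<bar> powr (1 + \<eta> * p)) \<partial>(unit_leb \<Otimes>\<^sub>M unit_leb)) \<in> borel_measurable Q"
    proof (rule unit_leb2.P.borel_measurable_nn_integral)
      have "(\<lambda>y. (snd y, fst y)) \<in> measurable (Q \<Otimes>\<^sub>M (unit_leb \<Otimes>\<^sub>M unit_leb)) ((unit_leb \<Otimes>\<^sub>M unit_leb) \<Otimes>\<^sub>M Q)"
        by simp
      from measurable_compose[OF this measurable_process_quotient]
      show "(\<lambda>(\<omega>, x). ennreal (\<bar>g (fst x) \<omega> - g (snd x) \<omega>\<bar> powr p / \<bar>fst x - snd x\<bar> powr (1 + \<eta> * p)))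
        \<in> borel_measurable (Q \<Otimes>\<^sub>M (unit_leb \<Otimes>\<^sub>M unit_leb))" by (simp add: case_prod_beta')
    qed
    then have 2: "(\<lambda>\<omega>. gagliardo \<eta> p (\<lambda>t. g t \<omega>)) \<in> borel_measurable Q"
      by (rule measurable_cong[THEN iffD1, rotated]) (simp add: gagliardo_pair)
    show ?thesis unfolding sob_energy_def
    proof (rule nn_integral_add[OF _ 2])
      show "(\<lambda>\<omega>. \<integral>\<^sup>+t. ennreal (\<bar>g t \<omega>\<bar> powr p) \<partial>unit_leb) \<in> borel_measurable Q"
        by (rule unit_leb.borel_measurable_nn_integral) (use m in \<open>simp add: case_prod_beta'\<close>)
    qed
  qed
  also have "(\<integral>\<^sup>+\<omega>. (\<integral>\<^sup>+t. ennreal (\<bar>g t \<omega>\<bar> powr p) \<partial>unit_leb) \<partial>Q) = (\<integral>\<^sup>+t. \<integral>\<^sup>+\<omega>. ennreal (\<bar>g t \<omega>\<bar> powr p) \<partial>Q \<partial>unit_leb)"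
    using meas by (intro A.Fubini') (simp add: case_prod_beta')
  also have "(\<integral>\<^sup>+\<omega>. gagliardo \<eta> p (\<lambda>t. g t \<omega>) \<partial>Q) =
    (\<integral>\<^sup>+\<omega>. \<integral>\<^sup>+x. ennreal (\<bar>g (fst x) \<omega> - g (snd x) \<omega>\<bar> powr p / \<bar>fst x - snd x\<bar> powr (1 + \<eta> * p)) \<partial>(unit_leb \<Otimes>\<^sub>M unit_leb) \<partial>Q)"
    by (intro nn_integral_cong gagliardo_pair)
  also have "\<dots> = (\<integral>\<^sup>+x. \<integral>\<^sup>+\<omega>. ennreal (\<bar>g (fst x) \<omega> - g (snd x) \<omega>\<bar> powr p / \<bar>fst x - snd x\<bar> powr (1 + \<eta> * p)) \<partial>Q \<partial>(unit_leb \<Otimes>\<^sub>M unit_leb))"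
    using measurable_process_quotient by (intro B.Fubini') (simp add: case_prod_beta')
  also have "\<dots> = (\<integral>\<^sup>+s. \<integral>\<^sup>+t. \<integral>\<^sup>+\<omega>. ennreal (\<bar>g s \<omega> - g t \<omega>\<bar> powr p / \<bar>s - t\<bar> powr (1 + \<eta> * p)) \<partial>Q \<partial>unit_leb \<partial>unit_leb)"
    by (subst unit_leb.nn_integral_fst[symmetric])
      (use Q.borel_measurable_nn_integral_fst[OF measurable_process_quotient] in auto)
  also have "\<dots> = (\<integral>\<^sup>+s. \<integral>\<^sup>+t. (\<integral>\<^sup>+\<omega>. ennreal (\<bar>g s \<omega> - g t \<omega>\<bar> powr p) \<partial>Q) * ennreal (1 / \<bar>s - t\<bar> powr (1 + \<eta> * p)) \<partial>unit_leb \<partial>unit_leb)"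
  proof (intro nn_integral_cong)
    fix s t assume st: "s \<in> space unit_leb" "t \<in> space unit_leb"
    have [measurable]: "g s \<in> borel_measurable Q" "g t \<in> borel_measurable Q"
      using st measurable_process_at by auto
    have "(\<integral>\<^sup>+\<omega>. ennreal (\<bar>g s \<omega> - g t \<omega>\<bar> powr p / \<bar>s - t\<bar> powr (1 + \<eta> * p)) \<partial>Q) =
      (\<integral>\<^sup>+\<omega>. ennreal (\<bar>g s \<omega> - g t \<omega>\<bar> powr p) * ennreal (1 / \<bar>s - t\<bar> powr (1 + \<eta> * p)) \<partial>Q)"
      by (intro nn_integral_cong) (simp flip: ennreal_mult')
    also have "\<dots> = (\<integral>\<^sup>+\<omega>. ennreal (\<bar>g s \<omega> - g t \<omega>\<bar> powr p) \<partial>Q) * ennreal (1 / \<bar>s - t\<bar> powr (1 + \<eta> * p))"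
      by (rule nn_integral_multc) measurable
    finally show "(\<integral>\<^sup>+\<omega>. ennreal (\<bar>g s \<omega> - g t \<omega>\<bar> powr p / \<bar>s - t\<bar> powr (1 + \<eta> * p)) \<partial>Q) = \<dots>" .
  qed
  finally show ?thesis .
qed

text \<open>The hypotheses have the shape that \<open>nn_integral_kernel\<close> integrates;
  \<open>\<eta> * p < q\<close> is convergence at the diagonal.\<close>

lemma nn_integral_sob_energy_le:
  assumes B: "B \<ge> 0" and q: "\<eta> * p < q"
    and at: "\<And>t. t \<in> {0..1} \<Longrightarrow> (\<integral>\<^sup>+\<omega>. ennreal (\<bar>g t \<omega>\<bar> powr p) \<partial>Q) \<le> ennreal (B * 2 powr (n * q))"
    and incr: "\<And>s t. s \<in> {0..1} \<Longrightarrow> t \<in> {0..1} \<Longrightarrow> (\<integral>\<^sup>+\<omega>. ennreal (\<bar>g s \<omega> - g t \<omega>\<bar> powr p) \<partial>Q)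
      \<le> ennreal (B * ((2 ^ n * \<bar>s - t\<bar>) powr q + of_bool (dyadic_apart n s t)))"
  shows "(\<integral>\<^sup>+\<omega>. sob_energy \<eta> p (\<lambda>t. g t \<omega>) \<partial>Q) \<le> ennreal ((1 + kernel_const q (\<eta> * p)) * B * 2 powr (n * q))"
proof -
  let ?k = "\<lambda>s t. ((2 ^ n * \<bar>s - t\<bar>) powr q + of_bool (dyadic_apart n s t))"
  have q0: "q > 0" using q \<eta>p_pos by simp
  have k: "kernel_const q (\<eta> * p) > 0" using q p by (intro kernel_const_pos) auto
  have "(\<integral>\<^sup>+t. \<integral>\<^sup>+\<omega>. ennreal (\<bar>g t \<omega>\<bar> powr p) \<partial>Q \<partial>unit_leb) \<le> (\<integral>\<^sup>+t. ennreal (B * 2 powr (n * q)) \<partial>unit_leb)"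
    by (intro nn_integral_mono at) auto
  then have 1: "(\<integral>\<^sup>+t. \<integral>\<^sup>+\<omega>. ennreal (\<bar>g t \<omega>\<bar> powr p) \<partial>Q \<partial>unit_leb) \<le> ennreal (B * 2 powr (n * q))" by simp
  have "(\<integral>\<^sup>+s. \<integral>\<^sup>+t. (\<integral>\<^sup>+\<omega>. ennreal (\<bar>g s \<omega> - g t \<omega>\<bar> powr p) \<partial>Q) * ennreal (1 / \<bar>s - t\<bar> powr (1 + \<eta> * p)) \<partial>unit_leb \<partial>unit_leb)
     \<le> (\<integral>\<^sup>+s. \<integral>\<^sup>+t. ennreal B * ennreal (?k s t / \<bar>s - t\<bar> powr (1 + \<eta> * p)) + 0 \<partial>unit_leb \<partial>unit_leb)"
  proof (intro nn_integral_mono)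
    fix s t assume st: "s \<in> space unit_leb" "t \<in> space unit_leb"
    have "(\<integral>\<^sup>+\<omega>. ennreal (\<bar>g s \<omega> - g t \<omega>\<bar> powr p) \<partial>Q) * ennreal (1 / \<bar>s - t\<bar> powr (1 + \<eta> * p))
      \<le> ennreal (B * ?k s t) * ennreal (1 / \<bar>s - t\<bar> powr (1 + \<eta> * p))"
      using st by (intro mult_right_mono incr) auto
    also have "\<dots> = ennreal (B * (?k s t / \<bar>s - t\<bar> powr (1 + \<eta> * p)))"
      using B by (subst ennreal_mult'[symmetric]) auto
    also have "\<dots> = ennreal B * ennreal (?k s t / \<bar>s - t\<bar> powr (1 + \<eta> * p)) + 0"
      using B by (subst ennreal_mult') auto
    finally show "(\<integral>\<^sup>+\<omega>. ennreal (\<bar>g s \<omega> - g t \<omega>\<bar> powr p) \<partial>Q) * ennreal (1 / \<bar>s - t\<bar> powr (1 + \<eta> * p)) \<le> \<dots>" .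
  qed
  also have "\<dots> = ennreal B * (\<integral>\<^sup>+s. \<integral>\<^sup>+t. ennreal (?k s t / \<bar>s - t\<bar> powr (1 + \<eta> * p)) \<partial>unit_leb \<partial>unit_leb) + (\<integral>\<^sup>+s. \<integral>\<^sup>+t. 0 \<partial>unit_leb \<partial>unit_leb)"
    by (rule nn_integral_iterated_linear)
      (measurable, auto simp: dyadic_apart_def intro: unit_leb.sigma_finite_measure_axioms)
  also have "\<dots> \<le> ennreal B * ennreal (kernel_const q (\<eta> * p) * 2 powr (n * q)) + 0"
    using q q0 p by (intro add_mono mult_left_mono nn_integral_kernel) auto
  finally have 2: "(\<integral>\<^sup>+s. \<integral>\<^sup>+t. (\<integral>\<^sup>+\<omega>. ennreal (\<bar>g s \<omega> - g t \<omega>\<bar> powr p) \<partial>Q) * ennreal (1 / \<bar>s - t\<bar> powr (1 + \<eta> * p)) \<partial>unit_leb \<partial>unit_leb)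
     \<le> ennreal (B * (kernel_const q (\<eta> * p) * 2 powr (n * q)))"
    using B k by (simp add: ennreal_mult')
  have "(\<integral>\<^sup>+\<omega>. sob_energy \<eta> p (\<lambda>t. g t \<omega>) \<partial>Q) \<le> ennreal (B * 2 powr (n * q)) + ennreal (B * (kernel_const q (\<eta> * p) * 2 powr (n * q)))"
    unfolding nn_integral_sob_energy by (intro add_mono 1 2)
  also have "\<dots> = ennreal ((1 + kernel_const q (\<eta> * p)) * B * 2 powr (n * q))"
    using B k by (subst ennreal_plus[symmetric]) (auto simp: algebra_simps)
  finally show ?thesis .
qed

text \<open>The choice \<open>K = E powr (1 / p)\<close> balances the two terms of
  \<open>sob_norm_le_energy\<close>: each contributes at most \<open>K\<close>, whence the factor
  \<open>2\<close>.\<close>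

lemma sob_norm_expectation:
  assumes E: "(\<integral>\<^sup>+\<omega>. sob_energy \<eta> p (\<lambda>t. g t \<omega>) \<partial>Q) \<le> ennreal E" and "E > 0"
  shows "AE \<omega> in Q. (\<lambda>t. g t \<omega>) \<in> sob_space \<eta> p"
    and "integrable Q (\<lambda>\<omega>. sob_norm \<eta> p (\<lambda>t. g t \<omega>))"
    and "(\<integral>\<omega>. sob_norm \<eta> p (\<lambda>t. g t \<omega>) \<partial>Q) \<le> 2 * E powr (1 / p)"
proof -
  note measurable_sob_energy [measurable]
  have "AE \<omega> in Q. sob_energy \<eta> p (\<lambda>t. g t \<omega>) \<noteq> \<infinity>"
    using E by (intro nn_integral_PInf_AE) (auto simp: top_unique)
  then have fin: "AE \<omega> in Q. sob_energy \<eta> p (\<lambda>t. g t \<omega>) < \<infinity>"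
    by eventually_elim (simp add: less_top)
  then show "AE \<omega> in Q. (\<lambda>t. g t \<omega>) \<in> sob_space \<eta> p"
    using AE_space by eventually_elim (simp add: sob_space_iff measurable_process_path)
  define K where "K = E powr (1 / p)"
  have K: "K > 0" using assms by (simp add: K_def)
  have [measurable]: "(\<lambda>\<omega>. sob_norm \<eta> p (\<lambda>t. g t \<omega>)) \<in> borel_measurable Q"
    unfolding sob_norm_eq by measurable
  have "(\<integral>\<^sup>+\<omega>. ennreal (sob_norm \<eta> p (\<lambda>t. g t \<omega>)) \<partial>Q) \<le> (\<integral>\<^sup>+\<omega>. ennreal (K powr (1 - p)) * sob_energy \<eta> p (\<lambda>t. g t \<omega>) + ennreal K \<partial>Q)"
  proof (rule nn_integral_mono_AE)
    show "AE \<omega> in Q. ennreal (sob_norm \<eta> p (\<lambda>t. g t \<omega>)) \<le> ennreal (K powr (1 - p)) * sob_energy \<eta> p (\<lambda>t. g t \<omega>) + ennreal K"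
      using fin by eventually_elim (rule sob_norm_le_energy[OF _ K p(1)])
  qed
  also have "\<dots> = ennreal (K powr (1 - p)) * (\<integral>\<^sup>+\<omega>. sob_energy \<eta> p (\<lambda>t. g t \<omega>) \<partial>Q) + ennreal K"
    by (simp add: nn_integral_add nn_integral_cmult Q.emeasure_space_1)
  also have "\<dots> \<le> ennreal (K powr (1 - p)) * ennreal E + ennreal K"
    by (intro add_mono mult_left_mono E) auto
  also have "\<dots> = ennreal (K powr (1 - p) * E + K)"
    using K assms by (simp add: ennreal_mult')
  also have "K powr (1 - p) * E = K"
  proof -
    have "E = K powr p" using assms p by (simp add: K_def powr_powr)
    then show ?thesis using K by (simp flip: powr_add)
  qed
  finally have *: "(\<integral>\<^sup>+\<omega>. ennreal (sob_norm \<eta> p (\<lambda>t. g t \<omega>)) \<partial>Q) \<le> ennreal (2 * K)" by simp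
  show int: "integrable Q (\<lambda>\<omega>. sob_norm \<eta> p (\<lambda>t. g t \<omega>))"
    using * by (intro integrableI_bounded) (auto simp: sob_norm_nonneg less_top[symmetric] top_unique)
  have "ennreal (\<integral>\<omega>. sob_norm \<eta> p (\<lambda>t. g t \<omega>) \<partial>Q) \<le> ennreal (2 * K)"
    using * int by (subst nn_integral_eq_integral[symmetric]) (auto simp: sob_norm_nonneg)
  then show "(\<integral>\<omega>. sob_norm \<eta> p (\<lambda>t. g t \<omega>) \<partial>Q) \<le> 2 * E powr (1 / p)"
    using K by (subst (asm) ennreal_le_iff) (auto simp: K_def)
qed

end

end

section \<open>Lipschitz functionals of coupled walks\<close>

text \<open>A function of the step sequence rather than of a random walk, so that a functional of
  the path becomes a function on a finite product space.\<close>

definition step_path :: "nat \<Rightarrow> real \<Rightarrow> (nat \<Rightarrow> real) \<Rightarrow> real \<Rightarrow> real" where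
  "step_path n h x t = h * (\<Sum>i=1..nat \<lfloor>2 ^ n * t\<rfloor>. x i)"

lemma walk_eq_step_path: "(\<lambda>t. walk \<alpha> Y n t \<omega>) = step_path n (1 / 2 powr (n / \<alpha>)) (\<lambda>i. Y i \<omega>)"
  by (simp add: walk_def step_path_def fun_eq_iff)

lemma step_path_diff: "step_path n h x t - step_path n h y t = step_path n h (\<lambda>i. x i - y i) t"
  by (simp add: step_path_def sum_subtractf right_diff_distrib)

lemma nat_floor_dyadic_le: "(t::real) \<le> 1 \<Longrightarrow> nat \<lfloor>2 ^ n * t\<rfloor> \<le> 2 ^ n"
proof -
  assume "t \<le> 1"
  then have "2 ^ n * t \<le> real (2 ^ n)" by simp
  then have "\<lfloor>2 ^ n * t\<rfloor> \<le> int (2 ^ n)" by linarith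
  then show ?thesis by linarith
qed

lemma dyadic_block_subset:
  assumes "(t::real) \<le> 1"
  shows "{k<..nat \<lfloor>2 ^ n * t\<rfloor>} \<subseteq> {1..2 ^ n}" "{1..nat \<lfloor>2 ^ n * t\<rfloor>} \<subseteq> {1..2 ^ n}"
proof -
  note le = nat_floor_dyadic_le[OF assms, of n]
  show "{k<..nat \<lfloor>2 ^ n * t\<rfloor>} \<subseteq> {1..2 ^ n}" using le_trans[OF _ le] by (auto simp del: nat_le_iff)
  show "{1..nat \<lfloor>2 ^ n * t\<rfloor>} \<subseteq> {1..2 ^ n}" using le by auto
qed

lemma step_path_bounds:
  assumes "t \<in> {0..1}"
  shows "\<bar>step_path n h x t\<bar> \<le> \<bar>h\<bar> * (\<Sum>i=1..2^n. \<bar>x i\<bar>)"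
proof -
  have "\<bar>\<Sum>i=1..nat \<lfloor>2 ^ n * t\<rfloor>. x i\<bar> \<le> (\<Sum>i=1..nat \<lfloor>2 ^ n * t\<rfloor>. \<bar>x i\<bar>)" by (rule sum_abs)
  also have "\<dots> \<le> (\<Sum>i=1..2^n. \<bar>x i\<bar>)"
    using dyadic_block_subset[of t] assms by (intro sum_mono2) auto
  finally show ?thesis by (simp add: step_path_def abs_mult mult_left_mono)
qed

lemma step_path_not_apart: "\<not> dyadic_apart n s t \<Longrightarrow> step_path n h x s = step_path n h x t"
  by (simp add: step_path_def dyadic_apart_def)

lemma step_path_increment:
  assumes "s \<le> t"
  shows "step_path n h x t - step_path n h x s = h * (\<Sum>i\<in>{nat \<lfloor>2 ^ n * s\<rfloor><..nat \<lfloor>2 ^ n * t\<rfloor>}. x i)"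
proof -
  have "nat \<lfloor>2 ^ n * s\<rfloor> \<le> nat \<lfloor>2 ^ n * t\<rfloor>"
    using assms by (intro nat_mono floor_mono) simp
  then have "{1..nat \<lfloor>2 ^ n * t\<rfloor>} = {1..nat \<lfloor>2 ^ n * s\<rfloor>} \<union> {nat \<lfloor>2 ^ n * s\<rfloor><..nat \<lfloor>2 ^ n * t\<rfloor>}"
    by auto
  then have "(\<Sum>i=1..nat \<lfloor>2 ^ n * t\<rfloor>. x i) = (\<Sum>i=1..nat \<lfloor>2 ^ n * s\<rfloor>. x i) + (\<Sum>i\<in>{nat \<lfloor>2 ^ n * s\<rfloor><..nat \<lfloor>2 ^ n * t\<rfloor>}. x i)"
    by (simp only:) (rule sum.union_disjoint, auto)
  then show ?thesis by (simp add: step_path_def algebra_simps)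
qed

text \<open>The number of summands depends on the time; summing over all \<open>2 ^ n\<close>
  indices with indicator weights makes every term a product of measurable functions.\<close>

lemma measurable_step_path_process:
  assumes "\<And>i. i \<in> {1..2^n} \<Longrightarrow> X i \<in> borel_measurable Q"
  shows "(\<lambda>z. step_path n h (\<lambda>i. X i (snd z)) (fst z)) \<in> borel_measurable (unit_leb \<Otimes>\<^sub>M Q)"
proof -
  have "(\<lambda>z. h * (\<Sum>i=1..2^n. of_bool (i \<le> nat \<lfloor>2 ^ n * fst z\<rfloor>) * X i (snd z))) \<in> borel_measurable (unit_leb \<Otimes>\<^sub>M Q)"
  proof (intro borel_measurable_times borel_measurable_const borel_measurable_sum)
    fix i :: nat assume i: "i \<in> {1..2^n}"
    show "(\<lambda>z. X i (snd z)) \<in> borel_measurable (unit_leb \<Otimes>\<^sub>M Q)"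
      using assms[OF i] by (rule measurable_compose[OF measurable_snd])
    show "(\<lambda>z. of_bool (i \<le> nat \<lfloor>2 ^ n * fst z\<rfloor>) :: real) \<in> borel_measurable (unit_leb \<Otimes>\<^sub>M Q)"
      by measurable
  qed
  moreover have "step_path n h (\<lambda>i. X i (snd z)) (fst z) = h * (\<Sum>i=1..2^n. of_bool (i \<le> nat \<lfloor>2 ^ n * fst z\<rfloor>) * X i (snd z))"
    if "z \<in> space (unit_leb \<Otimes>\<^sub>M Q)" for z
  proof -
    have "fst z \<le> 1" using that by (auto simp: space_pair_measure)
    from dyadic_block_subset(2)[OF this, of n] show ?thesis unfolding step_path_def
      by (intro arg_cong2[where f = "(*)"] refl sum.mono_neutral_cong_left) (auto simp del: nat_le_iff)
  qed
  ultimately show ?thesis by (subst measurable_cong) auto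
qed

lemma step_path_measurable: "step_path n h x \<in> borel_measurable unit_leb"
  unfolding step_path_def[abs_def] by (intro measurable_unit_leb_borel) measurable

text \<open>The bound makes \<open>G\<close> continuous for the product topology on all sequences,
  whose Borel sets form the product sigma-algebra because the index type is countable. Extension by
  \<open>0\<close> outside \<open>I\<close> passes to the finite product, and by the same bound it
  leaves \<open>G\<close> unchanged.\<close>

lemma borel_measurable_PiM_lipschitz:
  fixes G :: "('i::countable \<Rightarrow> real) \<Rightarrow> real"
  assumes "finite I" and G: "\<And>x y. \<bar>G x - G y\<bar> \<le> L * (\<Sum>i\<in>I. \<bar>x i - y i\<bar>)"
  shows "G \<in> borel_measurable (PiM I (\<lambda>_. borel))"
proof -
  have "isCont G x" for x
  proof -
    have "((\<lambda>y. L * (\<Sum>i\<in>I. \<bar>y i - x i\<bar>)) \<longlongrightarrow> L * (\<Sum>i\<in>I. \<bar>x i - x i\<bar>)) (at x)"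
    proof (intro tendsto_intros)
      fix i
      have "continuous_on UNIV (\<lambda>y::'i \<Rightarrow> real. y i)" by (rule continuous_on_product_coordinates)
      then show "((\<lambda>y. y i) \<longlongrightarrow> x i) (at x)"
        by (auto simp: continuous_on_def)
    qed
    then have "((\<lambda>y. L * (\<Sum>i\<in>I. \<bar>y i - x i\<bar>)) \<longlongrightarrow> 0) (at x)" by simp
    then have "((\<lambda>y. G y - G x) \<longlongrightarrow> 0) (at x)"
      by (rule Lim_null_comparison[rotated]) (use G in simp)
    then show ?thesis unfolding isCont_def by (rule LIM_zero_cancel)
  qed
  then have "G \<in> borel_measurable borel"
    by (intro borel_measurable_continuous_onI) (simp add: continuous_at_imp_continuous_on)
  then have G': "G \<in> borel_measurable (PiM UNIV (\<lambda>_. borel))"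
    using measurable_cong_sets[OF sets_PiM_equal_borel refl] by blast
  have "(\<lambda>x i. if i \<in> I then x i else 0) \<in> measurable (PiM I (\<lambda>_. borel)) (PiM UNIV (\<lambda>_. borel :: real measure))"
  proof (rule measurable_PiM_single')
    fix i
    show "(\<lambda>x. if i \<in> I then x i else 0) \<in> measurable (PiM I (\<lambda>_. borel)) (borel :: real measure)"
      by (cases "i \<in> I") auto
  qed auto
  from measurable_compose[OF this G']
  have "(\<lambda>x. G (\<lambda>i. if i \<in> I then x i else 0)) \<in> borel_measurable (PiM I (\<lambda>_. borel))" .
  moreover have "G (\<lambda>i. if i \<in> I then x i else 0) = G x" for x
    using G[of "\<lambda>i. if i \<in> I then x i else 0" x] by simp
  ultimately show ?thesis by simp
qed

text \<open>The canonical independent copies: a coupling of one step on \<open>Q\<close> lifts to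
  the product as a coupling of whole walks.\<close>

lemma indep_vars_PiM_coordinates:
  fixes f :: "'b \<Rightarrow> real"
  assumes I: "finite I" "I \<noteq> {}" and Q: "prob_space Q" and f: "f \<in> borel_measurable Q"
  shows "prob_space.indep_vars (PiM I (\<lambda>_. Q)) (\<lambda>_. borel) (\<lambda>i x. f (x i)) I"
    and "\<And>i. i \<in> I \<Longrightarrow> distr (PiM I (\<lambda>_. Q)) borel (\<lambda>x. f (x i)) = distr Q borel f"
proof -
  interpret P: product_prob_space "\<lambda>_. Q" I using Q by (simp add: product_prob_space_def product_prob_space_axioms_def product_sigma_finite_def prob_space_imp_sigma_finite)
  note f [measurable]
  show *: "distr (PiM I (\<lambda>_. Q)) borel (\<lambda>x. f (x i)) = distr Q borel f" if "i \<in> I" for i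
  proof -
    have "distr Q borel f = distr (distr (PiM I (\<lambda>_. Q)) Q (\<lambda>x. x i)) borel f"
      using distr_PiM_component[of I "\<lambda>_. Q" i] Q that by simp
    also have "\<dots> = distr (PiM I (\<lambda>_. Q)) borel (\<lambda>x. f (x i))"
      using that by (subst distr_distr) (auto simp: comp_def)
    finally show ?thesis by simp
  qed
  show "prob_space.indep_vars (PiM I (\<lambda>_. Q)) (\<lambda>_. borel) (\<lambda>i x. f (x i)) I"
  proof (subst P.P.indep_vars_iff_distr_eq_PiM')
    have bp: "prob_space (distr Q borel f)" using Q by (intro prob_space.prob_space_distr) auto
    have "distr (PiM I (\<lambda>_. Q)) (PiM I (\<lambda>_. borel)) (\<lambda>x. \<lambda>i\<in>I. f (x i)) =
      distr (PiM I (\<lambda>_. Q)) (PiM I (\<lambda>_. distr Q borel f)) (compose I f)"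
      by (intro distr_cong sets_PiM_cong) (auto simp: compose_def)
    also have "\<dots> = PiM I (\<lambda>_. distr Q (distr Q borel f) f)"
      using I Q bp by (intro distr_PiM_finite_prob_space') auto
    also have "\<dots> = PiM I (\<lambda>i. distr (PiM I (\<lambda>_. Q)) borel (\<lambda>x. f (x i)))"
      by (intro PiM_cong) (auto simp: * intro: distr_cong)
    finally show "distr (PiM I (\<lambda>_. Q)) (PiM I (\<lambda>_. borel)) (\<lambda>x. \<lambda>i\<in>I. f (x i)) = \<dots>" .
  qed (use I in auto)
qed

text \<open>Interpolation at \<open>K = (k * c) powr (1 / r)\<close>, the natural size of the sum:
  the von Bahr--Esseen bound contributes \<open>2\<close> to the constant, the threshold
  \<open>1\<close>.\<close>

lemma (in prob_space) sum_moment_le: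
  fixes X :: "'i \<Rightarrow> 'a \<Rightarrow> real"
  assumes "finite J" "J \<noteq> {}" "indep_vars (\<lambda>_. borel) X J" and pr: "1 \<le> p" "p \<le> r" "r \<le> 2"
    and int: "\<And>i. i \<in> J \<Longrightarrow> integrable M (\<lambda>x. \<bar>X i x\<bar> powr r)"
    and bnd: "\<And>i. i \<in> J \<Longrightarrow> expectation (\<lambda>x. \<bar>X i x\<bar> powr r) \<le> c" and c: "c > 0"
    and cent: "\<And>i. i \<in> J \<Longrightarrow> expectation (X i) = 0"
  shows "(\<integral>\<^sup>+x. ennreal (\<bar>\<Sum>i\<in>J. X i x\<bar> powr p) \<partial>M) \<le> ennreal (3 * (real (card J) * c) powr (p / r))"
proof -
  define k where "k = real (card J)"
  have k: "k > 0" using assms by (simp add: k_def card_gt_0_iff)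
  define K where "K = (k * c) powr (1 / r)"
  have K: "K > 0" using k c by (simp add: K_def)
  have VBE: "integrable M (\<lambda>x. \<bar>\<Sum>i\<in>J. X i x\<bar> powr r)" "expectation (\<lambda>x. \<bar>\<Sum>i\<in>J. X i x\<bar> powr r) \<le> 2 * k * c"
    using von_Bahr_Esseen[of J X r c] assms unfolding k_def by auto
  have "(\<integral>\<^sup>+x. ennreal (\<bar>\<Sum>i\<in>J. X i x\<bar> powr p) \<partial>M) \<le>
      (\<integral>\<^sup>+x. ennreal (K powr (p - r) * \<bar>\<Sum>i\<in>J. X i x\<bar> powr r + K powr p) \<partial>M)"
    using K pr by (intro nn_integral_mono ennreal_leI powr_interpolate) auto
  also have "\<dots> = ennreal (K powr (p - r) * expectation (\<lambda>x. \<bar>\<Sum>i\<in>J. X i x\<bar> powr r) + K powr p)"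
    using VBE by (subst nn_integral_eq_integral) (auto simp: prob_space)
  also have "\<dots> \<le> ennreal (K powr (p - r) * (2 * k * c) + K powr p)"
    using VBE by (intro ennreal_leI add_right_mono mult_left_mono) auto
  also have "K powr (p - r) * (2 * k * c) + K powr p = 3 * (k * c) powr (p / r)"
  proof -
    have "k * c = K powr r" using k c pr by (simp add: K_def powr_powr)
    then have "K powr (p - r) * (2 * k * c) = 2 * K powr p"
      using K by (simp add: mult.assoc flip: powr_add)
    moreover have "K powr p = (k * c) powr (p / r)" by (simp add: K_def powr_powr)
    ultimately show ?thesis by simp
  qed
  finally show ?thesis by (simp add: k_def)
qed

text \<open>Independent steps enter only through their common law; hence two laws can be compared
  through any convenient coupling.\<close>

definition walk_functional :: "((real \<Rightarrow> real) \<Rightarrow> real) \<Rightarrow> nat \<Rightarrow> real \<Rightarrow> real measure \<Rightarrow> real" where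
  "walk_functional F n h \<mu> = (\<integral>x. F (step_path n h x) \<partial>PiM {1..2^n} (\<lambda>_. \<mu>))"

context sob_params
begin

text \<open>Lipschitz constant of the step path with respect to the sum of the moduli of the steps.
  It grows with \<open>n\<close> and serves only measurability, integrability and limits at fixed
  \<open>n\<close>.\<close>

definition step_const :: "nat \<Rightarrow> real \<Rightarrow> real" where
  "step_const n h = \<bar>h\<bar> * (1 + kernel_const 1 (\<eta> * p) * 2 ^ n) powr (1 / p)"

lemma step_path_energy:
  "sob_energy \<eta> p (step_path n h x) \<le> ennreal ((\<bar>h\<bar> * (\<Sum>i=1..2^n. \<bar>x i\<bar>)) powr p * (1 + kernel_const 1 (\<eta> * p) * 2 ^ n))"
proof (rule sob_energy_dyadic_step_le)
  fix s t :: real assume st: "s \<in> {0..1}" "t \<in> {0..1}"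
  have *: "\<bar>step_path n h x t - step_path n h x s\<bar> \<le> \<bar>h\<bar> * (\<Sum>i=1..2^n. \<bar>x i\<bar>)" if st: "s \<in> {0..1}" "t \<in> {0..1}" "s \<le> t" for s t
  proof -
    have "\<bar>\<Sum>i\<in>{nat \<lfloor>2 ^ n * s\<rfloor><..nat \<lfloor>2 ^ n * t\<rfloor>}. x i\<bar> \<le> (\<Sum>i\<in>{nat \<lfloor>2 ^ n * s\<rfloor><..nat \<lfloor>2 ^ n * t\<rfloor>}. \<bar>x i\<bar>)"
      by (rule sum_abs)
    also have "\<dots> \<le> (\<Sum>i=1..2^n. \<bar>x i\<bar>)"
      using dyadic_block_subset[of t] st by (intro sum_mono2) auto
    finally show ?thesis using st by (simp add: step_path_increment abs_mult mult_left_mono)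
  qed
  show "\<bar>step_path n h x s - step_path n h x t\<bar> \<le> \<bar>h\<bar> * (\<Sum>i=1..2^n. \<bar>x i\<bar>) * of_bool (dyadic_apart n s t)"
  proof (cases "dyadic_apart n s t")
    case True
    then show ?thesis using *[of s t] *[of t s] st by (cases "s \<le> t") (auto simp: abs_minus_commute)
  next
    case False
    then show ?thesis using step_path_not_apart[OF False, of h x] by simp
  qed
qed (use step_path_bounds p \<eta> in \<open>auto intro!: mult_nonneg_nonneg sum_nonneg\<close>)

lemma step_path_in_sob_space: "step_path n h x \<in> sob_space \<eta> p"
  unfolding sob_space_iff using step_path_energy[of n h x]
  by (auto simp: step_path_measurable intro: le_less_trans)

lemma sob_norm_step_path: "sob_norm \<eta> p (step_path n h x) \<le> step_const n h * (\<Sum>i=1..2^n. \<bar>x i\<bar>)"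
proof -
  let ?S = "\<Sum>i=1..2^n. \<bar>x i\<bar>" let ?k = "1 + kernel_const 1 (\<eta> * p) * 2 ^ n"
  have S: "?S \<ge> 0" by (intro sum_nonneg) auto
  have k: "?k > 0" using kernel_const_pos[of "\<eta> * p" 1] p by (simp add: add_pos_pos)
  have "enn2real (sob_energy \<eta> p (step_path n h x)) \<le> (\<bar>h\<bar> * ?S) powr p * ?k"
    using step_path_energy[of n h x] k by (intro enn2real_leI) auto
  then have "sob_norm \<eta> p (step_path n h x) \<le> ((\<bar>h\<bar> * ?S) powr p * ?k) powr (1 / p)"
    unfolding sob_norm_eq using p by (intro powr_mono2) auto
  also have "\<dots> = (\<bar>h\<bar> * ?S) * ?k powr (1 / p)"
    using S k p by (subst powr_mult) (auto simp: powr_powr)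
  finally show ?thesis by (simp add: step_const_def mult_ac)
qed

lemma Lip1_step_path:
  assumes F: "F \<in> Lip1 \<eta> p"
  shows "\<bar>F (step_path n h x) - F (step_path n h y)\<bar> \<le> sob_norm \<eta> p (step_path n h (\<lambda>i. x i - y i))"
proof -
  have "\<bar>F (step_path n h x) - F (step_path n h y)\<bar> \<le> sob_norm \<eta> p (\<lambda>t. step_path n h x t - step_path n h y t)"
    using F step_path_in_sob_space unfolding Lip1_def by blast
  then show ?thesis by (simp add: step_path_diff)
qed

lemma Lip1_step_path_crude:
  assumes F: "F \<in> Lip1 \<eta> p"
  shows "\<bar>F (step_path n h x) - F (step_path n h y)\<bar> \<le> step_const n h * (\<Sum>i\<in>{1..2^n}. \<bar>x i - y i\<bar>)"
  using Lip1_step_path[OF F, of n h x y] sob_norm_step_path[of n h "\<lambda>i. x i - y i"] by linarith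

lemma measurable_Lip1_step_path:
  assumes F: "F \<in> Lip1 \<eta> p"
  shows "(\<lambda>x. F (step_path n h x)) \<in> borel_measurable (PiM {1..2^n} (\<lambda>_. borel))"
  using Lip1_step_path_crude[OF F, of n h] by (intro borel_measurable_PiM_lipschitz) auto

text \<open>By independence the joint law of the steps is a product measure, which is what makes the
  expectation a function of the common law.\<close>

lemma
  assumes F: "F \<in> Lip1 \<eta> p" and Q: "prob_space Q"
    and ind: "prob_space.indep_vars Q (\<lambda>_. borel) X {1..2^n}"
    and dist: "\<And>i. i \<in> {1..2^n} \<Longrightarrow> distr Q borel (X i) = \<mu>"
    and int: "\<And>i. i \<in> {1..2^n} \<Longrightarrow> integrable Q (X i)"
  shows walk_functional_eq: "(\<integral>\<omega>. F (step_path n h (\<lambda>i. X i \<omega>)) \<partial>Q) = walk_functional F n h \<mu>"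
    and integrable_Lip1_step_path: "integrable Q (\<lambda>\<omega>. F (step_path n h (\<lambda>i. X i \<omega>)))"
proof -
  interpret Q: prob_space Q by fact
  note mF = measurable_Lip1_step_path[OF F, of n h]
  have rv: "\<And>i. i \<in> {1..2^n} \<Longrightarrow> X i \<in> borel_measurable Q"
    using ind by (auto simp: Q.indep_vars_def)
  \<comment> \<open>Elements of the product space are \<open>undefined\<close> outside the index
    set. The two paths may then differ beyond time \<open>1\<close>, which the seminorm, and so
    \<open>F\<close>, does not see.\<close>
  have eq: "F (step_path n h (\<lambda>i\<in>{1..2^n}. x i)) = F (step_path n h x)" for x
    using Lip1_step_path_crude[OF F, of n h "\<lambda>i\<in>{1..2^n}. x i" x] by simp
  have joint: "(\<lambda>\<omega>. \<lambda>i\<in>{1..2^n}. X i \<omega>) \<in> measurable Q (PiM {1..2^n} (\<lambda>_. borel))"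
    using rv by (intro measurable_restrict) auto
  have "distr Q (PiM {1..2^n} (\<lambda>_. borel)) (\<lambda>\<omega>. \<lambda>i\<in>{1..2^n}. X i \<omega>) = PiM {1..2^n} (\<lambda>i. distr Q borel (X i))"
    using ind rv by (subst (asm) Q.indep_vars_iff_distr_eq_PiM') auto
  also have "\<dots> = PiM {1..2^n} (\<lambda>_. \<mu>)" using dist by (intro PiM_cong) auto
  finally have D: "PiM {1..2^n} (\<lambda>_. \<mu>) = distr Q (PiM {1..2^n} (\<lambda>_. borel)) (\<lambda>\<omega>. \<lambda>i\<in>{1..2^n}. X i \<omega>)" ..
  show "(\<integral>\<omega>. F (step_path n h (\<lambda>i. X i \<omega>)) \<partial>Q) = walk_functional F n h \<mu>"
    unfolding walk_functional_def D integral_distr[OF joint mF] eq ..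
  have meas: "(\<lambda>\<omega>. F (step_path n h (\<lambda>i. X i \<omega>))) \<in> borel_measurable Q"
    using measurable_compose[OF joint mF] unfolding eq .
  show "integrable Q (\<lambda>\<omega>. F (step_path n h (\<lambda>i. X i \<omega>)))"
  proof (rule Bochner_Integration.integrable_bound[OF _ meas])
    show "integrable Q (\<lambda>\<omega>. \<bar>F (step_path n h (\<lambda>_. 0))\<bar> + step_const n h * (\<Sum>i\<in>{1..2^n}. \<bar>X i \<omega>\<bar>))"
      using int by (intro Bochner_Integration.integrable_add integrable_const Bochner_Integration.integrable_mult_right Bochner_Integration.integrable_sum integrable_abs) auto
    show "AE \<omega> in Q. norm (F (step_path n h (\<lambda>i. X i \<omega>))) \<le> norm (\<bar>F (step_path n h (\<lambda>_. 0))\<bar> + step_const n h * (\<Sum>i\<in>{1..2^n}. \<bar>X i \<omega>\<bar>))"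
    proof (intro always_eventually allI)
      fix \<omega>
      show "norm (F (step_path n h (\<lambda>i. X i \<omega>))) \<le> norm (\<bar>F (step_path n h (\<lambda>_. 0))\<bar> + step_const n h * (\<Sum>i\<in>{1..2^n}. \<bar>X i \<omega>\<bar>))"
        using Lip1_step_path_crude[OF F, of n h "\<lambda>i. X i \<omega>" "\<lambda>_. 0"] unfolding real_norm_def by simp
    qed
  qed
qed

text \<open>Independent copies of the coupled pair make each marginal sequence i.i.d., so both
  expectations live on one product space and can be subtracted under the integral.\<close>

lemma walk_functional_coupling:
  fixes a b :: "'b \<Rightarrow> real"
  assumes F: "F \<in> Lip1 \<eta> p" and Q: "prob_space Q"
    and a: "integrable Q a" "distr Q borel a = \<mu>" and b: "integrable Q b" "distr Q borel b = \<nu>"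
  obtains "walk_functional F n h \<mu> - walk_functional F n h \<nu> =
      (\<integral>x. F (step_path n h (\<lambda>i. a (x i))) - F (step_path n h (\<lambda>i. b (x i))) \<partial>PiM {1..2^n} (\<lambda>_. Q))"
    "integrable (PiM {1..2^n} (\<lambda>_. Q)) (\<lambda>x. F (step_path n h (\<lambda>i. a (x i))) - F (step_path n h (\<lambda>i. b (x i))))"
proof -
  let ?P = "PiM {1..(2::nat)^n} (\<lambda>_. Q)"
  interpret P: prob_space ?P using Q by (intro prob_space_PiM)
  have am: "a \<in> borel_measurable Q" "b \<in> borel_measurable Q" using a b by auto
  have ne: "{1..(2::nat)^n} \<noteq> {}" "finite {1..(2::nat)^n}" by auto
  note A = indep_vars_PiM_coordinates[OF ne(2,1) Q am(1)]
  note B = indep_vars_PiM_coordinates[OF ne(2,1) Q am(2)]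
  have int: "integrable ?P (\<lambda>x. f (x i))" if i: "i \<in> {1..2^n}" and f: "integrable Q f" for f :: "'b \<Rightarrow> real" and i
  proof -
    have fm: "f \<in> borel_measurable Q" using f by auto
    have "integrable (distr Q borel f) (\<lambda>z. z)" using f by (subst integrable_distr_eq) auto
    then have "integrable (distr ?P borel (\<lambda>x. f (x i))) (\<lambda>z. z)"
      using indep_vars_PiM_coordinates(2)[OF ne(2,1) Q fm i] by simp
    then show ?thesis using fm i by (subst (asm) integrable_distr_eq) (auto intro: measurable_compose[OF measurable_component_singleton])
  qed
  note Wa = walk_functional_eq[OF F P.prob_space_axioms A(1), of \<mu> h] integrable_Lip1_step_path[OF F P.prob_space_axioms A(1), of \<mu> h]
  note Wb = walk_functional_eq[OF F P.prob_space_axioms B(1), of \<nu> h] integrable_Lip1_step_path[OF F P.prob_space_axioms B(1), of \<nu> h]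
  have wa: "(\<integral>x. F (step_path n h (\<lambda>i. a (x i))) \<partial>?P) = walk_functional F n h \<mu>"
    "integrable ?P (\<lambda>x. F (step_path n h (\<lambda>i. a (x i))))"
    using Wa A(2) a int[OF _ a(1)] by auto
  have wb: "(\<integral>x. F (step_path n h (\<lambda>i. b (x i))) \<partial>?P) = walk_functional F n h \<nu>"
    "integrable ?P (\<lambda>x. F (step_path n h (\<lambda>i. b (x i))))"
    using Wb B(2) b int[OF _ b(1)] by auto
  show thesis using wa wb by (intro that) auto
qed

text \<open>The factors \<open>2\<close> and \<open>3\<close> are those of
  \<open>sob_norm_expectation\<close> and \<open>sum_moment_le\<close>.\<close>

definition coupling_const :: "real \<Rightarrow> real" where
  "coupling_const r = 2 * ((1 + kernel_const (p / r) (\<eta> * p)) * 3) powr (1 / p)"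

text \<open>The quantitative core. The difference of the coupled walks is a walk with centered steps
  of finite \<open>r\<close>-th moment; its increments over \<open>k\<close> steps have
  \<open>p\<close>-th moments of order \<open>k powr (p / r)\<close>, which the Gagliardo kernel
  integrates because \<open>\<eta> * r < 1\<close>. Of \<open>a\<close> and \<open>b\<close>
  themselves only integrability is asked.\<close>

lemma walk_functional_diff_le:
  fixes a b :: "'b \<Rightarrow> real"
  assumes F: "F \<in> Lip1 \<eta> p" and Q: "prob_space Q"
    and a: "integrable Q a" "distr Q borel a = \<mu>" and b: "integrable Q b" "distr Q borel b = \<nu>"
    and cent: "(\<integral>x. a x - b x \<partial>Q) = 0"
    and r: "p \<le> r" "r \<le> 2" "\<eta> * r < 1"
    and int: "integrable Q (\<lambda>x. \<bar>a x - b x\<bar> powr r)"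
    and c: "(\<integral>x. \<bar>a x - b x\<bar> powr r \<partial>Q) \<le> c" "c > 0"
  and h: "h > 0"
  shows "\<bar>walk_functional F n h \<mu> - walk_functional F n h \<nu>\<bar> \<le> coupling_const r * h * (2 ^ n * c) powr (1 / r)"
proof -
  let ?I = "{1..(2::nat)^n}"
  let ?P = "PiM {1..(2::nat)^n} (\<lambda>_. Q)"
  interpret P: prob_space ?P using Q by (intro prob_space_PiM)
  define d where "d = (\<lambda>x. a x - b x)"
  define g where "g = (\<lambda>t x. step_path n h (\<lambda>i. d (x i)) t)"
  have [measurable]: "d \<in> borel_measurable Q" using a b by (auto simp: d_def)
  have ne: "?I \<noteq> {}" "finite ?I" by auto
  have D: "prob_space.indep_vars ?P (\<lambda>_. borel) (\<lambda>i x. d (x i)) ?I"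
    "\<And>i. i \<in> ?I \<Longrightarrow> distr ?P borel (\<lambda>x. d (x i)) = distr Q borel d"
    using indep_vars_PiM_coordinates[OF ne(2,1) Q, of d] by auto
  have dm: "\<And>i. i \<in> ?I \<Longrightarrow> (\<lambda>x. d (x i)) \<in> borel_measurable ?P" by measurable
  have dint: "integrable ?P (\<lambda>x. f (d (x i)))" "(\<integral>x. f (d (x i)) \<partial>?P) = (\<integral>x. f (d x) \<partial>Q)"
    if i: "i \<in> ?I" and f: "f \<in> borel_measurable borel" "integrable Q (\<lambda>x. f (d x))" for f :: "real \<Rightarrow> real" and i
  proof -
    have "integrable (distr Q borel d) f" using f by (subst integrable_distr_eq) auto
    then have "integrable (distr ?P borel (\<lambda>x. d (x i))) f"
      using D(2)[OF i] by simp
    then show "integrable ?P (\<lambda>x. f (d (x i)))" using f dm[OF i] by (subst (asm) integrable_distr_eq) auto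
    have "(\<integral>x. f (d (x i)) \<partial>?P) = (\<integral>z. f z \<partial>distr ?P borel (\<lambda>x. d (x i)))"
      using f dm[OF i] by (subst integral_distr) auto
    also have "\<dots> = (\<integral>x. f (d x) \<partial>Q)" using f D(2)[OF i] by (simp add: integral_distr)
    finally show "(\<integral>x. f (d (x i)) \<partial>?P) = (\<integral>x. f (d x) \<partial>Q)" .
  qed
  have dint': "integrable Q d" "(\<integral>x. d x \<partial>Q) = 0" "integrable Q (\<lambda>x. \<bar>d x\<bar> powr r)" "(\<integral>x. \<bar>d x\<bar> powr r \<partial>Q) \<le> c"
    using a b cent int c by (auto simp: d_def)
  \<comment> \<open>The third fact is \<open>\<eta> * r < 1\<close> in the form that the kernel
    estimate needs; the second makes the \<open>q\<close>-th power subadditive.\<close>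
  have q: "p / r > 0" "p / r \<le> 1" "\<eta> * p < p / r" using p r by (auto simp: field_simps)
  define q where "q = p / r"
  have moment: "(\<integral>\<^sup>+x. ennreal (\<bar>\<Sum>i\<in>J. d (x i)\<bar> powr p) \<partial>?P) \<le> ennreal (3 * (real (card J) * c) powr q)"
    if J: "J \<subseteq> ?I" for J
  proof (cases "J = {}")
    case False
    show ?thesis unfolding q_def
    proof (rule P.sum_moment_le)
      show "P.indep_vars (\<lambda>_. borel) (\<lambda>i x. d (x i)) J" using D(1) J by (rule P.indep_vars_subset)
      show "finite J" using J finite_subset by auto
      fix i assume "i \<in> J"
      then have i: "i \<in> ?I" using J by auto
      show "integrable ?P (\<lambda>x. \<bar>d (x i)\<bar> powr r)" "P.expectation (\<lambda>x. \<bar>d (x i)\<bar> powr r) \<le> c" "P.expectation (\<lambda>x. d (x i)) = 0"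
        using dint[OF i, of "\<lambda>z. \<bar>z\<bar> powr r"] dint[OF i, of "\<lambda>z. z"] dint' by auto
    qed (use False p r c in auto)
  qed (use p in simp)
  have hmoment: "(\<integral>\<^sup>+x. ennreal (\<bar>h * (\<Sum>i\<in>J. d (x i))\<bar> powr p) \<partial>?P) \<le> ennreal (3 * c powr q * h powr p * real (card J) powr q)"
    if J: "J \<subseteq> ?I" for J
  proof -
    have [measurable]: "(\<lambda>x. \<Sum>i\<in>J. d (x i)) \<in> borel_measurable ?P"
      using J dm by (intro borel_measurable_sum) auto
    have "(\<integral>\<^sup>+x. ennreal (\<bar>h * (\<Sum>i\<in>J. d (x i))\<bar> powr p) \<partial>?P) = (\<integral>\<^sup>+x. ennreal (h powr p) * ennreal (\<bar>\<Sum>i\<in>J. d (x i)\<bar> powr p) \<partial>?P)"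
      using h by (intro nn_integral_cong) (simp add: abs_mult powr_mult ennreal_mult')
    also have "\<dots> = ennreal (h powr p) * (\<integral>\<^sup>+x. ennreal (\<bar>\<Sum>i\<in>J. d (x i)\<bar> powr p) \<partial>?P)"
      by (rule nn_integral_cmult) measurable
    also have "\<dots> \<le> ennreal (h powr p) * ennreal (3 * (real (card J) * c) powr q)"
      by (intro mult_left_mono moment J) auto
    also have "\<dots> = ennreal (3 * c powr q * h powr p * real (card J) powr q)"
      using c by (subst ennreal_mult'[symmetric]) (auto simp: powr_mult mult_ac)
    finally show ?thesis .
  qed
  define B where "B = 3 * c powr q * h powr p"
  have B: "B > 0" using c h by (simp add: B_def)
  have gm: "(\<lambda>z. g (fst z) (snd z)) \<in> borel_measurable (unit_leb \<Otimes>\<^sub>M ?P)"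
    unfolding g_def by (rule measurable_step_path_process[OF dm])
  have k: "kernel_const q (\<eta> * p) > 0" using q p by (intro kernel_const_pos) (auto simp: q_def)
  define E where "E = (1 + kernel_const q (\<eta> * p)) * B * 2 powr (n * q)"
  have E: "E > 0" using k B by (simp add: E_def)
  have energy: "(\<integral>\<^sup>+x. sob_energy \<eta> p (\<lambda>t. g t x) \<partial>?P) \<le> ennreal E"
    unfolding E_def
  proof (rule nn_integral_sob_energy_le[OF P.prob_space_axioms gm])
    fix t :: real assume t: "t \<in> {0..1}"
    have "(\<integral>\<^sup>+x. ennreal (\<bar>g t x\<bar> powr p) \<partial>?P) \<le> ennreal (B * real (card {1..nat \<lfloor>2 ^ n * t\<rfloor>}) powr q)"
      unfolding g_def step_path_def B_def using dyadic_block_subset[of t] t by (intro hmoment) auto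
    also have "\<dots> \<le> ennreal (B * (2 ^ n) powr q)"
    proof (intro ennreal_leI mult_left_mono powr_mono2)
      have "nat \<lfloor>2 ^ n * t\<rfloor> \<le> 2 ^ n" using t by (intro nat_floor_dyadic_le) auto
      then have "real (nat \<lfloor>2 ^ n * t\<rfloor>) \<le> real (2 ^ n)" by (rule of_nat_mono)
      then show "real (card {1..nat \<lfloor>2 ^ n * t\<rfloor>}) \<le> 2 ^ n" by simp
    qed (use q B in \<open>auto simp: q_def\<close>)
    also have "(2 ^ n) powr q = (2 powr (n * q) :: real)" by (simp add: powr_powr flip: powr_realpow)
    finally show "(\<integral>\<^sup>+x. ennreal (\<bar>g t x\<bar> powr p) \<partial>?P) \<le> ennreal (B * 2 powr (n * q))" .
  next
    have *: "(\<integral>\<^sup>+x. ennreal (\<bar>g t x - g s x\<bar> powr p) \<partial>?P) \<le> ennreal (B * ((2 ^ n * (t - s)) powr q + of_bool (dyadic_apart n s t)))"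
      if st: "s \<in> {0..1}" "t \<in> {0..1}" "s \<le> t" for s t
    proof (cases "dyadic_apart n s t")
      case False
      then show ?thesis using step_path_not_apart[OF False, of h] B p by (simp add: g_def)
    next
      case True
      let ?J = "{nat \<lfloor>2 ^ n * s\<rfloor><..nat \<lfloor>2 ^ n * t\<rfloor>}"
      have "(\<integral>\<^sup>+x. ennreal (\<bar>g t x - g s x\<bar> powr p) \<partial>?P) \<le> ennreal (B * real (card ?J) powr q)"
        unfolding g_def step_path_increment[OF st(3)] B_def
        using dyadic_block_subset[of t] st by (intro hmoment) auto
      also have "\<dots> \<le> ennreal (B * (2 ^ n * (t - s) + 1) powr q)"
      proof (intro ennreal_leI mult_left_mono powr_mono2)
        have fl: "0 \<le> 2 ^ n * s" "2 ^ n * s \<le> 2 ^ n * t" "0 \<le> 2 ^ n * t" using st by (auto intro: mult_left_mono)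
        have fl': "0 \<le> \<lfloor>2 ^ n * s\<rfloor>" "\<lfloor>2 ^ n * s\<rfloor> \<le> \<lfloor>2 ^ n * t\<rfloor>" "0 \<le> \<lfloor>2 ^ n * t\<rfloor>"
          using fl floor_mono[OF fl(2)] by auto
        have "real (card ?J) = real (nat \<lfloor>2 ^ n * t\<rfloor>) - real (nat \<lfloor>2 ^ n * s\<rfloor>)"
          using fl' by (simp add: of_nat_diff nat_mono del: zero_le_floor)
        also have "\<dots> = of_int (\<lfloor>2 ^ n * t\<rfloor> - \<lfloor>2 ^ n * s\<rfloor>)"
          unfolding of_nat_nat[OF fl'(1)] of_nat_nat[OF fl'(3)] by simp
        \<comment> \<open>A difference of floors exceeds the true difference by less than
          \<open>1\<close>; subadditivity of the \<open>q\<close>-th power turns this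
          \<open>1\<close> into the indicator of the kernel estimate.\<close>
        also have "\<dots> \<le> 2 ^ n * t - 2 ^ n * s + 1"
          unfolding of_int_diff by linarith
        finally show "real (card ?J) \<le> 2 ^ n * (t - s) + 1" by (simp add: algebra_simps)
      qed (use q B in \<open>auto simp: q_def\<close>)
      also have "\<dots> \<le> ennreal (B * ((2 ^ n * (t - s)) powr q + 1 powr q))"
        using st q B by (intro ennreal_leI mult_left_mono powr_add_le_subadditive) (auto simp: q_def)
      finally show ?thesis using True by simp
    qed
    fix s t :: real assume st: "s \<in> {0..1}" "t \<in> {0..1}"
    show "(\<integral>\<^sup>+x. ennreal (\<bar>g s x - g t x\<bar> powr p) \<partial>?P) \<le> ennreal (B * ((2 ^ n * \<bar>s - t\<bar>) powr q + of_bool (dyadic_apart n s t)))"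
    proof (cases "s \<le> t")
      case True
      then show ?thesis using *[of s t] st by (simp add: abs_minus_commute)
    next
      case False
      have "dyadic_apart n t s = dyadic_apart n s t" by (auto simp: dyadic_apart_def)
      then show ?thesis using *[of t s] st False by simp
    qed
  qed (use B q in \<open>auto simp: q_def\<close>)
  note bound = sob_norm_expectation[OF P.prob_space_axioms gm energy E]
  obtain eq: "walk_functional F n h \<mu> - walk_functional F n h \<nu> =
      (\<integral>x. F (step_path n h (\<lambda>i. a (x i))) - F (step_path n h (\<lambda>i. b (x i))) \<partial>?P)"
    and int': "integrable ?P (\<lambda>x. F (step_path n h (\<lambda>i. a (x i))) - F (step_path n h (\<lambda>i. b (x i))))"
    using walk_functional_coupling[OF F Q a b] by blast
  have "\<bar>walk_functional F n h \<mu> - walk_functional F n h \<nu>\<bar> \<le>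
      (\<integral>x. \<bar>F (step_path n h (\<lambda>i. a (x i))) - F (step_path n h (\<lambda>i. b (x i)))\<bar> \<partial>?P)"
    unfolding eq by (rule integral_abs_bound)
  also have "\<dots> \<le> (\<integral>x. sob_norm \<eta> p (\<lambda>t. g t x) \<partial>?P)"
  proof (rule integral_mono)
    show "integrable ?P (\<lambda>x. \<bar>F (step_path n h (\<lambda>i. a (x i))) - F (step_path n h (\<lambda>i. b (x i)))\<bar>)"
      using int' by (rule integrable_abs)
    show "\<bar>F (step_path n h (\<lambda>i. a (x i))) - F (step_path n h (\<lambda>i. b (x i)))\<bar> \<le> sob_norm \<eta> p (\<lambda>t. g t x)" for x
      using Lip1_step_path[OF F, of n h "\<lambda>i. a (x i)" "\<lambda>i. b (x i)"] by (simp add: g_def d_def)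
  qed (rule bound(2))
  also have "\<dots> \<le> 2 * E powr (1 / p)" by (rule bound(3))
  also have "E powr (1 / p) = ((1 + kernel_const q (\<eta> * p)) * 3) powr (1 / p) * (h * (2 ^ n * c) powr (1 / r))"
  proof -
    have "E = ((1 + kernel_const q (\<eta> * p)) * 3) * (h powr p * (2 ^ n * c) powr q)"
      using c by (simp add: E_def B_def powr_mult powr_powr mult_ac flip: powr_realpow)
    also have "\<dots> powr (1 / p) = ((1 + kernel_const q (\<eta> * p)) * 3) powr (1 / p) * (h powr p * (2 ^ n * c) powr q) powr (1 / p)"
      by (rule powr_mult)
    also have "(h powr p * (2 ^ n * c) powr q) powr (1 / p) = h * (2 ^ n * c) powr (1 / r)"
      using h p c by (subst powr_mult) (auto simp: powr_powr q_def)
    finally show ?thesis .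
  qed
  finally show ?thesis by (simp add: coupling_const_def q_def mult_ac)
qed

end

section \<open>Separability of the Sobolev space and measurability\<close>

lemma powr_add_ge_superadditive:
  fixes x y p :: real
  assumes "x \<ge> 0" "y \<ge> 0" "1 \<le> p"
  shows "x powr p + y powr p \<le> (x + y) powr p"
proof -
  have "(x powr p + y powr p) powr (1 / p) \<le> (x powr p) powr (1 / p) + (y powr p) powr (1 / p)"
    using assms by (intro powr_add_le_subadditive) auto
  also have "\<dots> = x + y" using assms by (simp add: powr_powr)
  finally have "((x powr p + y powr p) powr (1 / p)) powr p \<le> (x + y) powr p"
    using assms by (intro powr_mono2) auto
  then show ?thesis using assms by (simp add: powr_powr)
qed

text \<open>The signed power carries \<open>L^p\<close> into \<open>L^1\<close>, and this bound
  makes its inverse continuous, so that approximation in \<open>L^1\<close> yields approximation in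
  \<open>L^p\<close>. Equal signs use superadditivity; the factor \<open>2 powr p\<close> is due to
  opposite signs.\<close>

lemma abs_diff_powr_le_signed_powr:
  fixes a b p :: real
  assumes "1 \<le> p"
  shows "\<bar>a - b\<bar> powr p \<le> 2 powr p * \<bar>sgn a * \<bar>a\<bar> powr p - sgn b * \<bar>b\<bar> powr p\<bar>"
proof -
  have ge1: "1 \<le> (2::real) powr p" using assms by (intro ge_one_powr_ge_zero) auto
  have same: "\<bar>a - b\<bar> powr p \<le> 2 powr p * \<bar>a powr p - b powr p\<bar>" if "a \<ge> 0" "b \<ge> 0" for a b :: real
  proof -
    have "\<bar>a - b\<bar> powr p \<le> \<bar>a powr p - b powr p\<bar>"
    proof (cases "a \<le> b")
      case True
      then show ?thesis using powr_add_ge_superadditive[of "b - a" a p] that assms by simp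
    next
      case False
      then show ?thesis using powr_add_ge_superadditive[of "a - b" b p] that assms by simp
    qed
    also have "\<dots> \<le> 2 powr p * \<bar>a powr p - b powr p\<bar>"
      using mult_right_mono[OF ge1, of "\<bar>a powr p - b powr p\<bar>"] by simp
    finally show ?thesis .
  qed
  have opp: "\<bar>a - b\<bar> powr p \<le> 2 powr p * (\<bar>a\<bar> powr p + \<bar>b\<bar> powr p)" for a b :: real
  proof -
    have "\<bar>a - b\<bar> powr p \<le> (\<bar>a\<bar> + \<bar>b\<bar>) powr p" using assms by (intro powr_mono2) auto
    also have "\<dots> \<le> 2 powr p * (\<bar>a\<bar> powr p + \<bar>b\<bar> powr p)" using assms by (intro powr_add_le) auto
    finally show ?thesis .
  qed
  have sg: "sgn z * \<bar>z\<bar> powr p = (if z \<ge> 0 then z powr p else - ((-z) powr p))" for z :: real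
    by (simp add: sgn_real_def)
  consider "a \<ge> 0" "b \<ge> 0" | "a < 0" "b < 0" | "a \<ge> 0" "b < 0" | "a < 0" "b \<ge> 0" by linarith
  then show ?thesis
  proof cases
    case 1
    then show ?thesis using same[of a b] by (cases "a = 0"; cases "b = 0") (auto simp: sgn_real_def)
  next
    case 2
    then have "\<bar>(-a) - (-b)\<bar> powr p \<le> 2 powr p * \<bar>(-a) powr p - (-b) powr p\<bar>" by (intro same) auto
    also have "\<bar>(-a) - (-b)\<bar> = \<bar>a - b\<bar>" by simp
    also have "\<bar>(-a) powr p - (-b) powr p\<bar> = \<bar>- ((-a) powr p) - (- ((-b) powr p))\<bar>" by simp
    finally show ?thesis using 2 by (simp add: sg)
  next
    case 3
    then show ?thesis using opp[of a b] by (cases "a = 0") (auto simp: sgn_real_def)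
  next
    case 4
    have "\<bar>- ((-a) powr p) - b powr p\<bar> = (-a) powr p + b powr p"
      using powr_ge_zero[of "-a" p] powr_ge_zero[of b p] by linarith
    then show ?thesis using opp[of a b] 4 by (cases "b = 0") (auto simp: sgn_real_def)
  qed
qed

text \<open>The countable family consists of rational combinations of finite unions of basis sets.
  Outer regularity approximates a measurable set by an open one, continuity of the measure
  approximates that by finite unions, and induction over integrable functions does the rest.\<close>

lemma L1_separable:
  fixes \<mu> :: "'b::{second_countable_topology, complete_space} measure"
  assumes "finite_measure \<mu>" and sets: "sets \<mu> = sets borel"
  shows "\<exists>D. countable D \<and> (\<forall>d\<in>D. integrable \<mu> d) \<and>
    (\<forall>f e. integrable \<mu> f \<longrightarrow> 0 < e \<longrightarrow> (\<exists>d\<in>D. (\<integral>x. \<bar>f x - d x\<bar> \<partial>\<mu>) < (e::real)))"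
proof -
  interpret finite_measure \<mu> by fact
  obtain B :: "'b set set" where B: "countable B" "topological_basis B"
    using ex_countable_basis by blast
  define \<U> where "\<U> = Union ` {\<C>. \<C> \<subseteq> B \<and> finite \<C>}"
  have cU: "countable \<U>" unfolding \<U>_def
    using countable_Collect_finite_subset[OF B(1)] by (simp add: conj_commute)
  have Uopen: "open U" if "U \<in> \<U>" for U
    using that B(2) by (auto simp: \<U>_def intro!: open_Union topological_basis_open)
  have Umeas [measurable]: "U \<in> sets \<mu>" if "U \<in> \<U>" for U
    using Uopen[OF that] by (simp add: sets)
  \<comment> \<open>Combinations are encoded as lists: countability is that of lists over a
    countable set, and appending lists adds functions.\<close>
  define \<Phi> where "\<Phi> = (\<lambda>(l::(real \<times> 'b set) list) x. \<Sum>(c, U)\<leftarrow>l. c * indicator U x :: real)"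
  define D where "D = \<Phi> ` lists (\<rat> \<times> \<U>)"
  have cD: "countable D"
    unfolding D_def by (intro countable_image countable_lists countable_SIGMA countable_rat cU)
  have Dint: "integrable \<mu> d" if "d \<in> D" for d
  proof -
    have "integrable \<mu> (\<Phi> l)" if "l \<in> lists (\<rat> \<times> \<U>)" for l
      using that
    proof (induction l)
      case (Cons a l)
      have "integrable \<mu> (\<lambda>x. fst a * indicator (snd a) x + \<Phi> l x)"
        using Cons Umeas[of "snd a"] by (intro Bochner_Integration.integrable_add Bochner_Integration.integrable_mult_right) (auto simp: emeasure_eq_measure)
      then show ?case by (simp add: \<Phi>_def case_prod_beta')
    qed (simp add: \<Phi>_def)
    then show ?thesis using that by (auto simp: D_def)
  qed
  have Dadd: "(\<lambda>x. d x + d' x) \<in> D" if dd: "d \<in> D" "d' \<in> D" for d d'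
  proof -
    obtain l l' where "l \<in> lists (\<rat> \<times> \<U>)" "l' \<in> lists (\<rat> \<times> \<U>)" "d = \<Phi> l" "d' = \<Phi> l'"
      using dd by (auto simp: D_def)
    then show ?thesis unfolding D_def
      by (intro image_eqI[of _ _ "l @ l'"]) (auto simp: \<Phi>_def)
  qed
  have approx_set: "\<exists>U\<in>\<U>. (\<integral>x. \<bar>indicator A x - indicator U x\<bar> \<partial>\<mu>) < e" if A: "A \<in> sets \<mu>" and "e > 0" for A and e :: real
  proof -
    have "emeasure \<mu> A = (INF U\<in>{U. A \<subseteq> U \<and> open U}. emeasure \<mu> U)"
      using A sets by (intro outer_regular) (auto simp: emeasure_eq_measure)
    moreover have "emeasure \<mu> A < emeasure \<mu> A + ennreal (e / 2)"
      using \<open>e > 0\<close> by (simp add: emeasure_eq_measure ennreal_less_iff flip: ennreal_plus)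
    ultimately have "\<exists>U\<in>{U. A \<subseteq> U \<and> open U}. emeasure \<mu> U < emeasure \<mu> A + ennreal (e / 2)"
      by (simp add: Inf_less_iff)
    then obtain V where V: "A \<subseteq> V" "open V" "emeasure \<mu> V < emeasure \<mu> A + ennreal (e / 2)" by auto
    have Vm: "V \<in> sets \<mu>" using V by (simp add: sets)
    have mV: "measure \<mu> V < measure \<mu> A + e / 2"
      using V(3) \<open>e > 0\<close> by (simp add: emeasure_eq_measure ennreal_less_iff flip: ennreal_plus)
    define \<C> where "\<C> = {b \<in> B. b \<subseteq> V}"
    have "V = \<Union>\<C>"
    proof (intro equalityI subsetI)
      fix x assume "x \<in> V"
      then obtain b where "b \<in> B" "x \<in> b" "b \<subseteq> V" using topological_basisE[OF B(2) V(2)] by metis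
      then show "x \<in> \<Union>\<C>" by (auto simp: \<C>_def)
    qed (auto simp: \<C>_def)
    \<comment> \<open>Exhausts \<open>V\<close> by finite unions along an enumeration of the basis
      sets inside it; inserting the empty set keeps the enumerated family nonempty.\<close>
    define W where "W = (\<lambda>m. \<Union>(from_nat_into (insert {} \<C>) ` {..<m}))"
    have cC: "countable (insert {} \<C>)" using B(1) by (auto simp: \<C>_def intro: countable_subset)
    have "(\<Union>m. W m) = V"
    proof -
      have "(\<Union>m. W m) = \<Union>(range (from_nat_into (insert {} \<C>)))" by (auto simp: W_def)
      also have "\<dots> = V" using \<open>V = \<Union>\<C>\<close> by (subst range_from_nat_into[OF _ cC]) auto
      finally show ?thesis .
    qed
    have Wm: "W m \<in> \<U>" for m
    proof -
      \<comment> \<open>The empty set need not be a basis element, so it is dropped again.\<close>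
      have "W m = \<Union>(from_nat_into (insert {} \<C>) ` {..<m} - {{}})" by (auto simp: W_def)
      moreover have "from_nat_into (insert {} \<C>) ` {..<m} - {{}} \<subseteq> B"
        using from_nat_into[of "insert {} \<C>"] by (auto simp: \<C>_def)
      ultimately show ?thesis unfolding \<U>_def by (intro image_eqI[of _ _ "from_nat_into (insert {} \<C>) ` {..<m} - {{}}"]) auto
    qed
    have "(\<lambda>m. measure \<mu> (W m)) \<longlonglongrightarrow> measure \<mu> (\<Union>m. W m)"
    proof (intro finite_Lim_measure_incseq)
      show "incseq W" unfolding W_def by (intro monoI Union_mono image_mono) auto
    qed (use Wm Umeas in auto)
    then have "eventually (\<lambda>m. measure \<mu> (W m) > measure \<mu> V - e / 2) sequentially"
      using \<open>(\<Union>m. W m) = V\<close> \<open>e > 0\<close> by (intro order_tendstoD(1)[where y = "measure \<mu> V"]) auto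
    then obtain m where m: "measure \<mu> (W m) > measure \<mu> V - e / 2" by (auto simp: eventually_sequentially)
    have sub: "W m \<subseteq> V" using \<open>(\<Union>m. W m) = V\<close> by auto
    have "(\<integral>x. \<bar>indicator A x - indicator (W m) x\<bar> \<partial>\<mu>) \<le> (\<integral>x. (indicator V x - indicator A x) + (indicator V x - indicator (W m) x) \<partial>\<mu> :: real)"
    proof (intro integral_mono)
      show "\<bar>indicator A x - indicator (W m) x\<bar> \<le> (indicator V x - indicator A x) + (indicator V x - indicator (W m) x :: real)" for x
        using sub V(1) by (auto simp: indicator_def)
    qed (use A Vm Umeas[OF Wm] in \<open>auto simp: emeasure_eq_measure\<close>)
    also have "\<dots> = (measure \<mu> V - measure \<mu> A) + (measure \<mu> V - measure \<mu> (W m))"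
      using A Vm Umeas[OF Wm] by (simp add: emeasure_eq_measure)
    also have "\<dots> < e" using m mV by simp
    finally show ?thesis using Wm by blast
  qed
  have dense: "\<forall>e>0. \<exists>d\<in>D. (\<integral>x. \<bar>f x - d x\<bar> \<partial>\<mu>) < e" if "integrable \<mu> f" for f :: "'b \<Rightarrow> real"
    using that
  proof (induction f rule: integrable_induct)
    case (base A c)
    show ?case
    proof (intro allI impI)
      fix e :: real assume e: "e > 0"
      define m where "m = measure \<mu> (space \<mu>) + 1"
      have m: "m > 0" by (simp add: m_def add_nonneg_pos)
      \<comment> \<open>A rational just above \<open>c\<close>, so that \<open>c' - c\<close> is its
        own modulus.\<close>
      obtain c' where c': "c' \<in> \<rat>" "c < c'" "c' < c + e / (2 * m)"
        using Rats_dense_in_real[of c "c + e / (2 * m)"] e m by auto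
      define k where "k = \<bar>c'\<bar> + 1"
      obtain U where U: "U \<in> \<U>" "(\<integral>x. \<bar>indicator A x - indicator U x\<bar> \<partial>\<mu>) < e / (2 * k)"
        using approx_set[OF base(1), of "e / (2 * k)"] e by (auto simp: k_def)
      have [measurable]: "A \<in> sets \<mu>" "U \<in> sets \<mu>" using base Umeas[OF U(1)] by auto
      have i1: "integrable \<mu> (\<lambda>x. \<bar>indicator A x - indicator U x\<bar> :: real)"
        by (intro integrable_abs Bochner_Integration.integrable_diff) (auto simp: emeasure_eq_measure)
      have "(\<integral>x. \<bar>indicator A x *\<^sub>R c - c' * indicator U x\<bar> \<partial>\<mu>) \<le> (\<integral>x. (c' - c) + \<bar>c'\<bar> * \<bar>indicator A x - indicator U x\<bar> \<partial>\<mu>)"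
      proof (intro integral_mono)
        show "\<bar>indicator A x *\<^sub>R c - c' * indicator U x\<bar> \<le> (c' - c) + \<bar>c'\<bar> * \<bar>indicator A x - indicator U x\<bar>" for x
          using c' by (auto simp: indicator_def)
      qed (use i1 in \<open>auto simp: emeasure_eq_measure\<close>)
      also have "\<dots> = (c' - c) * measure \<mu> (space \<mu>) + \<bar>c'\<bar> * (\<integral>x. \<bar>indicator A x - indicator U x\<bar> \<partial>\<mu>)"
        using i1 by (simp add: mult.commute)
      also have "\<dots> \<le> (c' - c) * m + k * (\<integral>x. \<bar>indicator A x - indicator U x\<bar> \<partial>\<mu>)"
        using c' by (intro add_mono mult_left_mono mult_right_mono) (auto simp: m_def k_def)
      also have "\<dots> < e / 2 + e / 2"
      proof (rule add_strict_mono)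
        have "c' - c < e / (2 * m)" using c' by simp
        then show "(c' - c) * m < e / 2" using m by (simp add: field_simps)
        have "k > 0" by (simp add: k_def)
        then show "k * (\<integral>x. \<bar>indicator A x - indicator U x\<bar> \<partial>\<mu>) < e / 2" using U(2) by (simp add: field_simps)
      qed
      also have "e / 2 + e / 2 = e" by simp
      finally have "(\<integral>x. \<bar>indicator A x *\<^sub>R c - c' * indicator U x\<bar> \<partial>\<mu>) < e" .
      moreover have "(\<lambda>x. c' * indicator U x) \<in> D"
        unfolding D_def by (intro image_eqI[of _ _ "[(c', U)]"]) (use c' U in \<open>auto simp: \<Phi>_def\<close>)
      ultimately show "\<exists>d\<in>D. (\<integral>x. \<bar>indicator A x *\<^sub>R c - d x\<bar> \<partial>\<mu>) < e"
        by (intro bexI[of _ "\<lambda>x. c' * indicator U x"])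
    qed
  next
    case (add f g)
    show ?case
    proof (intro allI impI)
      fix e :: real assume "e > 0"
      then obtain d d' where d: "d \<in> D" "(\<integral>x. \<bar>f x - d x\<bar> \<partial>\<mu>) < e / 2" "d' \<in> D" "(\<integral>x. \<bar>g x - d' x\<bar> \<partial>\<mu>) < e / 2"
        using add.IH by (meson half_gt_zero)
      have i: "integrable \<mu> (\<lambda>x. \<bar>f x - d x\<bar>)" "integrable \<mu> (\<lambda>x. \<bar>g x - d' x\<bar>)"
        using add d Dint by auto
      have "(\<integral>x. \<bar>f x + g x - (d x + d' x)\<bar> \<partial>\<mu>) \<le> (\<integral>x. \<bar>f x - d x\<bar> + \<bar>g x - d' x\<bar> \<partial>\<mu>)"
        using add d Dint i by (intro integral_mono) auto
      also have "\<dots> < e" using d i by simp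
      finally show "\<exists>d\<in>D. (\<integral>x. \<bar>f x + g x - d x\<bar> \<partial>\<mu>) < e" using Dadd[OF d(1,3)]
        by (intro bexI[of _ "\<lambda>x. d x + d' x"])
    qed
  next
    case (lim f s)
    show ?case
    proof (intro allI impI)
      fix e :: real assume e: "e > 0"
      have "(\<lambda>i. \<integral>x. \<bar>f x - s i x\<bar> \<partial>\<mu>) \<longlonglongrightarrow> (\<integral>x. 0 \<partial>\<mu>)"
      proof (rule integral_dominated_convergence[where w = "\<lambda>x. 3 * \<bar>f x\<bar>"])
        show "AE x in \<mu>. (\<lambda>i. \<bar>f x - s i x\<bar>) \<longlonglongrightarrow> 0"
        proof (rule AE_I2)
          fix x assume "x \<in> space \<mu>"
          then have "(\<lambda>i. \<bar>f x - s i x\<bar>) \<longlonglongrightarrow> \<bar>f x - f x\<bar>"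
            using lim by (intro tendsto_intros) auto
          then show "(\<lambda>i. \<bar>f x - s i x\<bar>) \<longlonglongrightarrow> 0" by simp
        qed
        show "AE x in \<mu>. norm \<bar>f x - s i x\<bar> \<le> 3 * \<bar>f x\<bar>" for i
        proof (rule AE_I2)
          fix x assume "x \<in> space \<mu>"
          from lim.hyps(3)[OF this, of i] show "norm \<bar>f x - s i x\<bar> \<le> 3 * \<bar>f x\<bar>" by simp
        qed
      qed (use lim in auto)
      then have "eventually (\<lambda>i. (\<integral>x. \<bar>f x - s i x\<bar> \<partial>\<mu>) < e / 2) sequentially"
        using e by (intro order_tendstoD(2)) auto
      then obtain i where i: "(\<integral>x. \<bar>f x - s i x\<bar> \<partial>\<mu>) < e / 2" by (auto simp: eventually_sequentially)
      obtain d where d: "d \<in> D" "(\<integral>x. \<bar>s i x - d x\<bar> \<partial>\<mu>) < e / 2"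
        using lim.IH[of i] e by (meson half_gt_zero)
      have int: "integrable \<mu> (\<lambda>x. \<bar>f x - s i x\<bar>)" "integrable \<mu> (\<lambda>x. \<bar>s i x - d x\<bar>)"
        using lim d Dint by auto
      have "(\<integral>x. \<bar>f x - d x\<bar> \<partial>\<mu>) \<le> (\<integral>x. \<bar>f x - s i x\<bar> + \<bar>s i x - d x\<bar> \<partial>\<mu>)"
        using lim d Dint int by (intro integral_mono) auto
      also have "\<dots> < e" using d i int by simp
      finally show "\<exists>d\<in>D. (\<integral>x. \<bar>f x - d x\<bar> \<partial>\<mu>) < e" using d by blast
    qed
  qed
  show ?thesis using cD Dint dense by (intro exI[of _ D]) auto
qed

context sob_params
begin

text \<open>A function is sent to the signed powers of its values and of its difference quotients, a
  pair in \<open>L^1\<close> of the unit square. By \<open>abs_diff_powr_le_signed_powr\<close> the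
  two \<open>L^1\<close> distances bound the energy of a difference, so separability is inherited
  from \<open>L^1\<close>.\<close>

lemma sob_separable:
  "\<exists>D :: nat \<Rightarrow> real \<Rightarrow> real. (\<forall>k. D k \<in> sob_space \<eta> p) \<and>
    (\<forall>f e. f \<in> sob_space \<eta> p \<longrightarrow> 0 < e \<longrightarrow> (\<exists>k. sob_energy \<eta> p (\<lambda>t. f t - D k t) < e))"
proof -
  define \<mu> :: "(real \<times> real) measure" where "\<mu> = distr (unit_leb \<Otimes>\<^sub>M unit_leb) borel (\<lambda>x. x)"
  have idm: "(\<lambda>x. x) \<in> measurable (unit_leb \<Otimes>\<^sub>M unit_leb) (borel :: (real \<times> real) measure)"
  proof -
    have "(\<lambda>x. (fst x, snd x)) \<in> measurable (unit_leb \<Otimes>\<^sub>M unit_leb) (borel \<Otimes>\<^sub>M borel :: (real \<times> real) measure)"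
      by measurable
    then show ?thesis by (simp add: borel_prod)
  qed
  have fin: "finite_measure \<mu>"
    unfolding \<mu>_def by (rule unit_leb2.P.finite_measure_distr[OF idm])
  have sets: "sets \<mu> = sets borel" by (simp add: \<mu>_def)
  obtain E where "countable E \<and> (\<forall>d\<in>E. integrable \<mu> d) \<and>
    (\<forall>f e. integrable \<mu> f \<longrightarrow> 0 < e \<longrightarrow> (\<exists>d\<in>E. (\<integral>x. \<bar>f x - d x\<bar> \<partial>\<mu>) < (e::real)))"
    using L1_separable[OF fin sets] ..
  note E = this[THEN conjunct1, rule_format] this[THEN conjunct2, THEN conjunct1, rule_format]
    this[THEN conjunct2, THEN conjunct2, rule_format]
  \<comment> \<open>Extension by zero gives Borel functions on the whole line, as the measure on the
    plane requires.\<close>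
  define ext where "ext = (\<lambda>f (t::real). if t \<in> {0..1} then f t else (0::real))"
  define sp where "sp = (\<lambda>z::real. sgn z * \<bar>z\<bar> powr p)"
  define H1 where "H1 = (\<lambda>f (x :: real \<times> real). sp (ext f (fst x)))"
  \<comment> \<open>With the exponent \<open>1 / p + \<eta>\<close>, the \<open>p\<close>-th power
    of the modulus of the quotient is exactly the Gagliardo integrand.\<close>
  define H2 where "H2 = (\<lambda>f (x :: real \<times> real). sp ((ext f (fst x) - ext f (snd x)) / \<bar>fst x - snd x\<bar> powr (1 / p + \<eta>)))"
  have abs_sp: "\<bar>sp z\<bar> = \<bar>z\<bar> powr p" for z by (simp add: sp_def abs_mult sgn_real_def)
  have [measurable]: "sp \<in> borel_measurable borel" unfolding sp_def by measurable
  have ext_meas: "ext f \<in> borel_measurable borel" if "f \<in> borel_measurable unit_leb" for f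
  proof -
    have "f \<in> borel_measurable (restrict_space borel {0..1})"
      using that measurable_cong_sets[of unit_leb "restrict_space borel {0..1}" borel borel] by (simp add: sets_restrict_space)
    then have "(\<lambda>t. indicator {0..1} t *\<^sub>R f t) \<in> borel_measurable borel"
      by (subst (asm) borel_measurable_restrict_space_iff) auto
    also have "(\<lambda>t. indicator {0..1} t *\<^sub>R f t) = ext f" by (auto simp: ext_def fun_eq_iff)
    finally show ?thesis .
  qed
  have Hm: "H1 f \<in> borel_measurable borel" "H2 f \<in> borel_measurable borel" if "f \<in> borel_measurable unit_leb" for f
  proof -
    note [measurable] = ext_meas[OF that]
    show "H1 f \<in> borel_measurable borel" "H2 f \<in> borel_measurable borel"
      unfolding H1_def H2_def borel_prod[symmetric] by measurable
  qed
  have quot: "\<bar>z / \<bar>s - t\<bar> powr (1 / p + \<eta>)\<bar> powr p = \<bar>z\<bar> powr p / \<bar>s - t\<bar> powr (1 + \<eta> * p)" for z s t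
  proof -
    have "(1 / p + \<eta>) * p = 1 + \<eta> * p" using p by (simp add: distrib_right)
    then show ?thesis by (simp add: abs_divide powr_divide powr_powr)
  qed
  have nn: "(\<integral>\<^sup>+x. u x \<partial>\<mu>) = (\<integral>\<^sup>+s. \<integral>\<^sup>+t. u (s, t) \<partial>unit_leb \<partial>unit_leb)" if "u \<in> borel_measurable borel" for u
  proof -
    have "(\<integral>\<^sup>+x. u x \<partial>\<mu>) = (\<integral>\<^sup>+x. u x \<partial>(unit_leb \<Otimes>\<^sub>M unit_leb))"
      unfolding \<mu>_def using that idm by (subst nn_integral_distr) auto
    also have "\<dots> = (\<integral>\<^sup>+s. \<integral>\<^sup>+t. u (s, t) \<partial>unit_leb \<partial>unit_leb)"
      using measurable_compose[OF idm that] by (rule unit_leb.nn_integral_fst[symmetric])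
    finally show ?thesis .
  qed
  have Hint: "integrable \<mu> (H1 f)" "integrable \<mu> (H2 f)" if f: "f \<in> sob_space \<eta> p" for f
  proof -
    have fm: "f \<in> borel_measurable unit_leb" and fe: "sob_energy \<eta> p f < \<infinity>" using f by (auto simp: sob_space_iff)
    note m [measurable] = Hm[OF fm]
    have "(\<integral>\<^sup>+x. ennreal (norm (H1 f x)) \<partial>\<mu>) = (\<integral>\<^sup>+s. \<integral>\<^sup>+t. ennreal (norm (H1 f (s, t))) \<partial>unit_leb \<partial>unit_leb)"
      by (rule nn) measurable
    also have "\<dots> = (\<integral>\<^sup>+s. \<integral>\<^sup>+t. ennreal (\<bar>f s\<bar> powr p) \<partial>unit_leb \<partial>unit_leb)"
      by (intro nn_integral_cong) (simp add: H1_def abs_sp ext_def)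
    also have "\<dots> \<le> sob_energy \<eta> p f" by (simp add: sob_energy_def)
    finally show "integrable \<mu> (H1 f)" using fe m(1) by (intro integrableI_bounded) (simp_all add: \<mu>_def)
    have "(\<integral>\<^sup>+x. ennreal (norm (H2 f x)) \<partial>\<mu>) = (\<integral>\<^sup>+s. \<integral>\<^sup>+t. ennreal (norm (H2 f (s, t))) \<partial>unit_leb \<partial>unit_leb)"
      by (rule nn) measurable
    also have "\<dots> = gagliardo \<eta> p f" unfolding gagliardo_def
      by (intro nn_integral_cong) (simp add: H2_def abs_sp ext_def quot del: abs_divide)
    also have "\<dots> \<le> sob_energy \<eta> p f" by (simp add: sob_energy_def)
    finally show "integrable \<mu> (H2 f)" using fe m(2) by (intro integrableI_bounded) (simp_all add: \<mu>_def)
  qed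
  have dist: "sob_energy \<eta> p (\<lambda>t. f t - f' t) \<le> ennreal (2 powr p) * (ennreal (\<integral>x. \<bar>H1 f x - H1 f' x\<bar> \<partial>\<mu>) + ennreal (\<integral>x. \<bar>H2 f x - H2 f' x\<bar> \<partial>\<mu>))"
    if f: "f \<in> sob_space \<eta> p" "f' \<in> sob_space \<eta> p" for f f'
  proof -
    have fm: "f \<in> borel_measurable unit_leb" "f' \<in> borel_measurable unit_leb" using f by (auto simp: sob_space_iff)
    note m [measurable] = Hm[OF fm(1)] Hm[OF fm(2)]
    have 1: "(\<integral>\<^sup>+t. ennreal (\<bar>f t - f' t\<bar> powr p) \<partial>unit_leb) \<le> ennreal (2 powr p) * ennreal (\<integral>x. \<bar>H1 f x - H1 f' x\<bar> \<partial>\<mu>)"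
    proof -
      have "(\<integral>\<^sup>+t. ennreal (\<bar>f t - f' t\<bar> powr p) \<partial>unit_leb) = (\<integral>\<^sup>+s. \<integral>\<^sup>+t. ennreal (\<bar>f s - f' s\<bar> powr p) \<partial>unit_leb \<partial>unit_leb)"
        by simp
      also have "\<dots> \<le> (\<integral>\<^sup>+s. \<integral>\<^sup>+t. ennreal (2 powr p * \<bar>H1 f (s, t) - H1 f' (s, t)\<bar>) \<partial>unit_leb \<partial>unit_leb)"
        using p abs_diff_powr_le_signed_powr[OF p(1)] by (intro nn_integral_mono ennreal_leI) (auto simp: H1_def sp_def ext_def)
      also have "\<dots> = (\<integral>\<^sup>+x. ennreal (2 powr p * \<bar>H1 f x - H1 f' x\<bar>) \<partial>\<mu>)"
        by (rule nn[symmetric]) measurable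
      also have "\<dots> = ennreal (2 powr p * (\<integral>x. \<bar>H1 f x - H1 f' x\<bar> \<partial>\<mu>))"
        using Hint[OF f(1)] Hint[OF f(2)] by (subst nn_integral_eq_integral) auto
      finally show ?thesis by (simp add: ennreal_mult')
    qed
    have 2: "gagliardo \<eta> p (\<lambda>t. f t - f' t) \<le> ennreal (2 powr p) * ennreal (\<integral>x. \<bar>H2 f x - H2 f' x\<bar> \<partial>\<mu>)"
    proof -
      have "gagliardo \<eta> p (\<lambda>t. f t - f' t) \<le> (\<integral>\<^sup>+s. \<integral>\<^sup>+t. ennreal (2 powr p * \<bar>H2 f (s, t) - H2 f' (s, t)\<bar>) \<partial>unit_leb \<partial>unit_leb)"
        unfolding gagliardo_def
      proof (intro nn_integral_mono ennreal_leI)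
        fix s t assume st: "s \<in> space unit_leb" "t \<in> space unit_leb"
        let ?w = "\<bar>s - t\<bar> powr (1 / p + \<eta>)"
        have "\<bar>f s - f' s - (f t - f' t)\<bar> powr p / \<bar>s - t\<bar> powr (1 + \<eta> * p) =
          \<bar>(f s - f t) / ?w - (f' s - f' t) / ?w\<bar> powr p"
          unfolding quot[symmetric] by (simp add: algebra_simps flip: diff_divide_distrib)
        also have "\<dots> \<le> 2 powr p * \<bar>H2 f (s, t) - H2 f' (s, t)\<bar>"
          using abs_diff_powr_le_signed_powr[OF p(1), of "(f s - f t) / ?w" "(f' s - f' t) / ?w"] st
          by (simp add: H2_def sp_def ext_def)
        finally show "\<bar>f s - f' s - (f t - f' t)\<bar> powr p / \<bar>s - t\<bar> powr (1 + \<eta> * p) \<le> 2 powr p * \<bar>H2 f (s, t) - H2 f' (s, t)\<bar>" .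
      qed
      also have "\<dots> = (\<integral>\<^sup>+x. ennreal (2 powr p * \<bar>H2 f x - H2 f' x\<bar>) \<partial>\<mu>)"
        by (rule nn[symmetric]) measurable
      also have "\<dots> = ennreal (2 powr p * (\<integral>x. \<bar>H2 f x - H2 f' x\<bar> \<partial>\<mu>))"
        using Hint[OF f(1)] Hint[OF f(2)] by (subst nn_integral_eq_integral) auto
      finally show ?thesis by (simp add: ennreal_mult')
    qed
    show ?thesis unfolding sob_energy_def distrib_left using 1 2 by (rule add_mono)
  qed
  \<comment> \<open>The dense set of \<open>L^1\<close> need not meet the image of the Sobolev
    space. Hence one Sobolev function, if there is one, is chosen near each pair from
    \<open>E\<close> at each precision, at the price of a triangle inequality.\<close>
  define good where "good = (\<lambda>(d1, d2, k) f. f \<in> sob_space \<eta> p \<and> (\<integral>x. \<bar>H1 f x - d1 x\<bar> \<partial>\<mu>) < 1 / Suc k \<and> (\<integral>x. \<bar>H2 f x - d2 x\<bar> \<partial>\<mu>) < 1 / Suc k)"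
  define C where "C = (\<lambda>z. SOME f. good z f) ` {z \<in> E \<times> E \<times> UNIV. \<exists>f. good z f}"
  have cE: "countable (E \<times> E \<times> (UNIV :: nat set))"
    by (intro countable_SIGMA E(1)) simp
  have "{z \<in> E \<times> E \<times> UNIV. \<exists>f. good z f} \<subseteq> E \<times> E \<times> UNIV" by (rule Collect_restrict)
  from countable_image[OF countable_subset[OF this cE]] have cC: "countable C" unfolding C_def .
  have Csub: "f \<in> sob_space \<eta> p" if fC: "f \<in> C" for f
  proof -
    obtain z where z: "\<exists>f. good z f" "f = (SOME f. good z f)" using fC unfolding C_def by blast
    then have "good z f" by (simp add: someI_ex)
    then show ?thesis by (auto simp: good_def split: prod.splits)
  qed
  have dense: "\<exists>f'\<in>C. sob_energy \<eta> p (\<lambda>t. f t - f' t) < e" if f: "f \<in> sob_space \<eta> p" and e: "e > 0" for f e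
  proof -
    have "(\<lambda>k. ennreal (2 powr p * (4 * (1 / Suc k)))) \<longlonglongrightarrow> ennreal (2 powr p * (4 * 0))"
      by (intro tendsto_ennrealI tendsto_intros LIMSEQ_Suc lim_1_over_n)
    then have "eventually (\<lambda>k. ennreal (2 powr p * (4 * (1 / Suc k))) < e) sequentially"
      using e by (intro order_tendstoD(2)) auto
    then obtain k where k: "ennreal (2 powr p * (4 * (1 / Suc k))) < e" by (auto simp: eventually_sequentially)
    obtain d1 where d1: "d1 \<in> E" "(\<integral>x. \<bar>H1 f x - d1 x\<bar> \<partial>\<mu>) < 1 / Suc k" using E(3)[OF Hint(1)[OF f], of "1 / Suc k"] by auto
    obtain d2 where d2: "d2 \<in> E" "(\<integral>x. \<bar>H2 f x - d2 x\<bar> \<partial>\<mu>) < 1 / Suc k" using E(3)[OF Hint(2)[OF f], of "1 / Suc k"] by auto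
    have gf: "good (d1, d2, k) f" using f d1 d2 by (simp add: good_def)
    define f' where "f' = (SOME f. good (d1, d2, k) f)"
    have g': "good (d1, d2, k) f'" unfolding f'_def by (rule someI[of "good (d1, d2, k)", OF gf])
    have f'C: "f' \<in> C" unfolding C_def f'_def using gf d1 d2 by (intro image_eqI[of _ _ "(d1, d2, k)"]) auto
    have f': "f' \<in> sob_space \<eta> p" using Csub[OF f'C] .
    have tri: "(\<integral>x. \<bar>H f x - H f' x\<bar> \<partial>\<mu>) \<le> 2 * (1 / Suc k)"
      if i: "integrable \<mu> (H f)" "integrable \<mu> (H f')" "integrable \<mu> d"
        and l: "(\<integral>x. \<bar>H f x - d x\<bar> \<partial>\<mu>) < 1 / Suc k" "(\<integral>x. \<bar>H f' x - d x\<bar> \<partial>\<mu>) < 1 / Suc k"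
      for d and H :: "(real \<Rightarrow> real) \<Rightarrow> (real \<times> real) \<Rightarrow> real"
    proof -
      have "(\<integral>x. \<bar>H f x - H f' x\<bar> \<partial>\<mu>) \<le> (\<integral>x. \<bar>H f x - d x\<bar> + \<bar>H f' x - d x\<bar> \<partial>\<mu>)"
        using i by (intro integral_mono) auto
      also have "\<dots> = (\<integral>x. \<bar>H f x - d x\<bar> \<partial>\<mu>) + (\<integral>x. \<bar>H f' x - d x\<bar> \<partial>\<mu>)"
        using i by (intro Bochner_Integration.integral_add) auto
      finally show ?thesis using l by simp
    qed
    have "sob_energy \<eta> p (\<lambda>t. f t - f' t) \<le> ennreal (2 powr p) * (ennreal (\<integral>x. \<bar>H1 f x - H1 f' x\<bar> \<partial>\<mu>) + ennreal (\<integral>x. \<bar>H2 f x - H2 f' x\<bar> \<partial>\<mu>))"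
      by (rule dist[OF f f'])
    also have "\<dots> \<le> ennreal (2 powr p) * (ennreal (2 * (1 / Suc k)) + ennreal (2 * (1 / Suc k)))"
      using tri[of H1 d1] tri[of H2 d2] Hint[OF f] Hint[OF f'] E(2) d1 d2 g'
      by (intro mult_left_mono add_mono ennreal_leI) (auto simp: good_def)
    also have "\<dots> = ennreal (2 powr p * (4 * (1 / Suc k)))"
      by (subst ennreal_plus[symmetric]) (auto simp: ennreal_mult'[symmetric])
    also have "\<dots> < e" by (rule k)
    finally show ?thesis using f'C by blast
  qed
  \<comment> \<open>The enumeration \<open>from_nat_into\<close> needs a nonempty set; approximating
    the zero path supplies a member.\<close>
  have "step_path 0 0 (\<lambda>_. 0) \<in> sob_space \<eta> p" by (rule step_path_in_sob_space)
  then have ne: "C \<noteq> {}" using dense[of _ 1] by fastforce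
  show ?thesis
  proof (intro exI[of _ "from_nat_into C"] conjI allI impI)
    show "from_nat_into C k \<in> sob_space \<eta> p" for k using from_nat_into[OF ne] Csub by blast
    show "\<exists>k. sob_energy \<eta> p (\<lambda>t. f t - from_nat_into C k t) < e" if "f \<in> sob_space \<eta> p" "e > 0" for f e
      using dense[OF that] from_nat_into_surj[OF cC] by metis
  qed
qed

text \<open>The path space carries no sigma-algebra, so \<open>F\<close> is approximated along the
  process: at precision \<open>e m\<close> the path is replaced by the first member of a dense
  sequence within that energy. This index is measurable because energies are, and the Lipschitz
  bound gives pointwise convergence.\<close>

lemma measurable_Lip1_process:
  assumes F: "F \<in> Lip1 \<eta> p" and Q: "prob_space Q"
    and meas: "(\<lambda>x. g (fst x) (snd x)) \<in> borel_measurable (unit_leb \<Otimes>\<^sub>M Q)"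
  shows "(\<lambda>\<omega>. F (\<lambda>t. g t \<omega>)) \<in> borel_measurable Q"
proof -
  obtain D :: "nat \<Rightarrow> real \<Rightarrow> real" where "(\<forall>k. D k \<in> sob_space \<eta> p) \<and>
    (\<forall>f e. f \<in> sob_space \<eta> p \<longrightarrow> 0 < e \<longrightarrow> (\<exists>k. sob_energy \<eta> p (\<lambda>t. f t - D k t) < e))"
    using sob_separable ..
  note D = this[THEN conjunct1, rule_format] this[THEN conjunct2, rule_format]
  note [measurable] = measurable_sob_energy[OF Q meas]
  have [measurable]: "(\<lambda>\<omega>. sob_energy \<eta> p (\<lambda>t. g t \<omega> - D k t)) \<in> borel_measurable Q" for k
  proof (rule measurable_sob_energy[OF Q])
    have "D k \<in> borel_measurable unit_leb" using D(1) by (auto simp: sob_space_iff)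
    then have "(\<lambda>x. D k (fst x)) \<in> borel_measurable (unit_leb \<Otimes>\<^sub>M Q)"
      by (rule measurable_compose[OF measurable_fst])
    with meas show "(\<lambda>x. g (fst x) (snd x) - D k (fst x)) \<in> borel_measurable (unit_leb \<Otimes>\<^sub>M Q)"
      by (rule borel_measurable_diff)
  qed
  define e where "e = (\<lambda>m::nat. 1 / real (Suc m))"
  define N where "N = (\<lambda>m \<omega>. LEAST k. sob_energy \<eta> p (\<lambda>t. g t \<omega> - D k t) < ennreal (e m))"
  \<comment> \<open>Paths of infinite energy are outside the space, where \<open>F\<close> has the
    constant value \<open>undefined\<close> by the extensionality built into
    \<open>Lip1\<close>.\<close>
  define \<phi> where "\<phi> = (\<lambda>m \<omega>. if sob_energy \<eta> p (\<lambda>t. g t \<omega>) < \<infinity> then F (D (N m \<omega>)) else undefined)"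
  have Nm [measurable]: "N m \<in> measurable Q (count_space UNIV)" for m
    unfolding N_def by measurable
  have \<phi>m: "\<phi> m \<in> borel_measurable Q" for m
  proof -
    have 1: "(\<lambda>\<omega>. F (D (N m \<omega>))) \<in> borel_measurable Q"
      by (rule measurable_compose[OF Nm]) simp
    have 2: "{\<omega> \<in> space Q. sob_energy \<eta> p (\<lambda>t. g t \<omega>) < \<infinity>} \<in> sets Q"
      by measurable
    show ?thesis unfolding \<phi>_def by (rule measurable_If[OF 1 _ 2]) simp
  qed
  show ?thesis
  proof (rule borel_measurable_LIMSEQ_metric[OF \<phi>m])
    fix \<omega> assume \<omega>: "\<omega> \<in> space Q"
    show "(\<lambda>m. \<phi> m \<omega>) \<longlonglongrightarrow> F (\<lambda>t. g t \<omega>)"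
    proof (cases "sob_energy \<eta> p (\<lambda>t. g t \<omega>) < \<infinity>")
      case False
      then have "F (\<lambda>t. g t \<omega>) = undefined"
        using F PiE_arb[of F "sob_space \<eta> p" "\<lambda>_. UNIV"] by (simp add: Lip1_def sob_space_iff)
      then show ?thesis using False by (simp add: \<phi>_def)
    next
      case True
      then have g: "(\<lambda>t. g t \<omega>) \<in> sob_space \<eta> p"
        by (simp add: sob_space_iff measurable_process_path[OF Q meas \<omega>])
      have bound: "norm (\<phi> m \<omega> - F (\<lambda>t. g t \<omega>)) \<le> e m powr (1 / p)" for m
      proof -
        have em: "e m > 0" by (simp add: e_def)
        have "\<exists>k. sob_energy \<eta> p (\<lambda>t. g t \<omega> - D k t) < ennreal (e m)"
          using D(2)[OF g, of "ennreal (e m)"] em by simp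
        then have N: "sob_energy \<eta> p (\<lambda>t. g t \<omega> - D (N m \<omega>) t) < ennreal (e m)"
          unfolding N_def by (rule LeastI_ex)
        have "\<bar>F (\<lambda>t. g t \<omega>) - F (D (N m \<omega>))\<bar> \<le> sob_norm \<eta> p (\<lambda>t. g t \<omega> - D (N m \<omega>) t)"
          using F g D(1) unfolding Lip1_def by blast
        also have "\<dots> \<le> e m powr (1 / p)"
          unfolding sob_norm_eq using N em p by (intro powr_mono2 enn2real_leI) auto
        finally show ?thesis using True by (simp add: \<phi>_def abs_minus_commute)
      qed
      have "e \<longlonglongrightarrow> 0" unfolding e_def by (rule LIMSEQ_Suc[OF lim_1_over_n])
      then have "(\<lambda>m. e m powr (1 / p)) \<longlonglongrightarrow> 0 powr (1 / p)"
        using p by (intro tendsto_powr') (auto simp: e_def)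
      then have "(\<lambda>m. e m powr (1 / p)) \<longlonglongrightarrow> 0" by simp
      then have "(\<lambda>m. \<phi> m \<omega> - F (\<lambda>t. g t \<omega>)) \<longlonglongrightarrow> 0"
        by (rule Lim_null_comparison[rotated]) (use bound in simp)
      then show ?thesis by (rule LIM_zero_cancel)
    qed
  qed
qed

end

section \<open>Dyadic discretization of a self-similar Levy process\<close>

lemma (in prob_space) indep_vars_reindex:
  assumes inj: "inj_on f I" and ind: "indep_vars M' X (f ` I)"
  shows "indep_vars (\<lambda>i. M' (f i)) (\<lambda>i. X (f i)) I"
proof -
  let ?G = "\<lambda>k. {X k -` A \<inter> space M |A. A \<in> sets (M' k)}"
  have rv: "\<forall>k\<in>f ` I. random_variable (M' k) (X k)" and sub: "\<forall>k\<in>f ` I. ?G k \<subseteq> events"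
    and prd: "\<And>J A. J \<subseteq> f ` I \<Longrightarrow> J \<noteq> {} \<Longrightarrow> finite J \<Longrightarrow> A \<in> Pi J ?G \<Longrightarrow> prob (\<Inter>j\<in>J. A j) = (\<Prod>j\<in>J. prob (A j))"
    using ind unfolding indep_vars_def2 indep_sets_def by blast+
  show ?thesis unfolding indep_vars_def2 indep_sets_def
  proof (intro conjI ballI allI impI)
    fix J A assume J: "J \<subseteq> I" "J \<noteq> {}" "finite J" and A: "A \<in> Pi J (\<lambda>i. ?G (f i))"
    define g where "g = inv_into I f"
    have g: "g (f j) = j" if "j \<in> J" for j using that J inj by (auto simp: g_def)
    have "prob (\<Inter>k\<in>f ` J. A (g k)) = (\<Prod>k\<in>f ` J. prob (A (g k)))"
      using J A by (intro prd) (auto simp: g Pi_iff)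
    also have "\<dots> = (\<Prod>j\<in>J. prob (A (g (f j))))"
      using inj_on_subset[OF inj J(1)] by (simp add: prod.reindex)
    finally show "prob (\<Inter>j\<in>J. A j) = (\<Prod>j\<in>J. prob (A j))" by (simp add: g)
  qed (use rv sub in auto)
qed

text \<open>The sampled time has countably many values, and clamping keeps it in the unit interval.
  The offset \<open>c = 1\<close> samples at right ends of cells, \<open>c = 0\<close> at left
  ends.\<close>

lemma measurable_process_dyadic_sample:
  fixes S :: "real \<Rightarrow> 'b \<Rightarrow> real"
  assumes "\<And>t. t \<in> {0..1} \<Longrightarrow> S t \<in> borel_measurable N"
  shows "(\<lambda>x. S (max 0 (min 1 ((of_int \<lfloor>2 ^ k * fst x\<rfloor> + c) / 2 ^ k))) (snd x)) \<in> borel_measurable (unit_leb \<Otimes>\<^sub>M N)"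
proof (rule measurable_compose_countable[where g = "\<lambda>x. \<lfloor>2 ^ k * fst x\<rfloor>"])
  fix i :: int
  have "S (max 0 (min 1 ((of_int i + c) / 2 ^ k))) \<in> borel_measurable N" by (rule assms) auto
  then show "(\<lambda>x. S (max 0 (min 1 ((of_int i + c) / 2 ^ k))) (snd x)) \<in> borel_measurable (unit_leb \<Otimes>\<^sub>M N)"
    by (rule measurable_compose[OF measurable_snd])
qed measurable

text \<open>The right end of the cell of \<open>t\<close> lies strictly above \<open>t\<close>, so
  right continuity can be applied along these times.\<close>

lemma right_dyadic_approximation:
  fixes t :: real
  assumes "t < 1" "0 \<le> t"
  shows "filterlim (\<lambda>k. max 0 (min 1 ((of_int \<lfloor>2 ^ k * t\<rfloor> + 1) / 2 ^ k))) (at_right t) sequentially"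
proof -
  have lo: "t < (of_int \<lfloor>2 ^ k * t\<rfloor> + 1) / 2 ^ k" for k :: nat
  proof -
    have "2 ^ k * t < of_int \<lfloor>2 ^ k * t\<rfloor> + 1" by linarith
    then show ?thesis by (simp add: field_simps)
  qed
  have hi: "(of_int \<lfloor>2 ^ k * t\<rfloor> + 1) / 2 ^ k \<le> t + 1 / 2 ^ k" for k :: nat
  proof -
    have "of_int \<lfloor>2 ^ k * t\<rfloor> + 1 \<le> 2 ^ k * t + 1" by linarith
    then show ?thesis by (simp add: field_simps)
  qed
  have "(\<lambda>k. t + (1 / 2) ^ k) \<longlonglongrightarrow> t + 0" by (intro tendsto_intros LIMSEQ_realpow_zero) auto
  then have lim: "(\<lambda>k. t + 1 / 2 ^ k) \<longlonglongrightarrow> t" by (simp add: power_one_over)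
  have "(\<lambda>k. max 0 (min 1 ((of_int \<lfloor>2 ^ k * t\<rfloor> + 1) / 2 ^ k))) \<longlonglongrightarrow> t"
  proof (rule tendsto_sandwich[OF _ _ tendsto_const lim])
    show "\<forall>\<^sub>F k in sequentially. t \<le> max 0 (min 1 ((of_int \<lfloor>2 ^ k * t\<rfloor> + 1) / 2 ^ k))"
      using lo assms by (intro always_eventually allI) (simp add: less_imp_le le_max_iff_disj)
    show "\<forall>\<^sub>F k in sequentially. max 0 (min 1 ((of_int \<lfloor>2 ^ k * t\<rfloor> + 1) / 2 ^ k)) \<le> t + 1 / 2 ^ k"
      using hi assms by (intro always_eventually allI) (simp add: min_le_iff_disj)
  qed
  moreover have "max 0 (min 1 ((of_int \<lfloor>2 ^ k * t\<rfloor> + 1) / 2 ^ k)) \<in> {t<..}" for k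
    using lo[of k] assms by (simp add: less_max_iff_disj)
  ultimately show ?thesis by (intro tendsto_imp_filterlim_at_right) auto
qed

text \<open>Right continuity makes the process the pointwise limit of its samples at right ends of
  dyadic cells.\<close>

lemma levy_process_jointly_measurable:
  assumes "levy_process N S"
  shows "(\<lambda>x. S (fst x) (snd x)) \<in> borel_measurable (unit_leb \<Otimes>\<^sub>M N)"
proof (rule borel_measurable_LIMSEQ_metric)
  show "(\<lambda>x. S (max 0 (min 1 ((of_int \<lfloor>2 ^ k * fst x\<rfloor> + 1) / 2 ^ k))) (snd x)) \<in> borel_measurable (unit_leb \<Otimes>\<^sub>M N)" for k
    using assms by (intro measurable_process_dyadic_sample) (auto simp: levy_process_def)
  fix x assume x: "x \<in> space (unit_leb \<Otimes>\<^sub>M N)"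
  define t \<omega> where "t = fst x" and "\<omega> = snd x"
  have t: "0 \<le> t" "t \<le> 1" and \<omega>: "\<omega> \<in> space N" using x by (auto simp: space_pair_measure t_def \<omega>_def)
  have "(\<lambda>k. S (max 0 (min 1 ((of_int \<lfloor>2 ^ k * t\<rfloor> + 1) / 2 ^ k))) \<omega>) \<longlonglongrightarrow> S t \<omega>"
  \<comment> \<open>At the end point there is no right limit to use; the clamped samples are all
    taken at \<open>1\<close>.\<close>
  proof (cases "t = 1")
    case True
    have "\<lfloor>2 ^ k :: real\<rfloor> = 2 ^ k" for k :: nat
      using floor_of_int[of "2 ^ k"] by (metis of_int_numeral of_int_power)
    then have "min 1 ((of_int \<lfloor>2 ^ k * t\<rfloor> + 1) / 2 ^ k) = (1 :: real)" for k :: nat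
      using True by (simp add: min_def field_simps)
    then show ?thesis using True by simp
  next
    case False
    have "cadlag_unit (\<lambda>t. S t \<omega>)" using assms \<omega> by (auto simp: levy_process_def)
    then have "((\<lambda>t. S t \<omega>) \<longlongrightarrow> S t \<omega>) (at_right t)" using t False by (auto simp: cadlag_unit_def)
    then show ?thesis by (rule filterlim_compose) (rule right_dyadic_approximation, use t False in auto)
  qed
  then show "(\<lambda>k. S (max 0 (min 1 ((of_int \<lfloor>2 ^ k * fst x\<rfloor> + 1) / 2 ^ k))) (snd x)) \<longlonglongrightarrow> S (fst x) (snd x)"
    by (simp add: t_def \<omega>_def)
qed

lemma nn_integral_distr_eq_cong:
  fixes X Y :: "'b \<Rightarrow> real"
  assumes "distr N borel X = distr N' borel Y" "X \<in> borel_measurable N" "Y \<in> borel_measurable N'" "f \<in> borel_measurable borel"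
  shows "(\<integral>\<^sup>+x. f (X x) \<partial>N) = (\<integral>\<^sup>+x. f (Y x) \<partial>N')"
proof -
  have "(\<integral>\<^sup>+x. f (X x) \<partial>N) = (\<integral>\<^sup>+z. f z \<partial>distr N borel X)"
    using assms(2,4) by (intro nn_integral_distr[symmetric]) auto
  also have "\<dots> = (\<integral>\<^sup>+x. f (Y x) \<partial>N')"
    unfolding assms(1) using assms(3,4) by (intro nn_integral_distr) auto
  finally show ?thesis .
qed

context sob_params
begin

text \<open>In \<open>2 * 2 powr p\<close>, the power comes from splitting the \<open>p\<close>-th
  power of a difference of two errors, the \<open>2\<close> from bounding both errors alike.\<close>

definition levy_const :: "real \<Rightarrow> real \<Rightarrow> real" where
  "levy_const \<beta> m = 2 * ((1 + kernel_const (p * \<beta>) (\<eta> * p)) * (2 * 2 powr p * m)) powr (1 / p)"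

text \<open>The rescaled grid increments of \<open>S\<close> are i.i.d. with the law of
  \<open>S 1\<close>, so the walk with these steps is \<open>S\<close> frozen at left ends of cells.
  The error \<open>g\<close> has \<open>p\<close>-th moments of order
  \<open>2 powr (- (n * p * a))\<close>; within a cell its increments are those of \<open>S\<close>,
  across cells they are bounded by two errors. The kernel estimate with
  \<open>q = p * \<beta>\<close> costs \<open>2 powr (n * q)\<close>, and the \<open>p\<close>-th
  root leaves \<open>2 powr (- (n * (a - \<beta>)))\<close>.\<close>

lemma levy_process_discretization:
  fixes N :: "'b measure" and S :: "real \<Rightarrow> 'b \<Rightarrow> real"
  assumes F: "F \<in> Lip1 \<eta> p" and levy: "levy_process N S"
    and scaling: "\<And>t. t \<in> {0..1} \<Longrightarrow> distr N borel (S t) = distr N borel (\<lambda>\<omega>. t powr a * S 1 \<omega>)"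
    and \<beta>: "\<eta> < \<beta>" "\<beta> \<le> a"
    and m: "(\<integral>\<^sup>+\<omega>. ennreal (\<bar>S 1 \<omega>\<bar> powr p) \<partial>N) \<le> ennreal m" "m > 0"
  shows "\<bar>walk_functional F n (2 powr (- (n * a))) (distr N borel (S 1)) - (\<integral>\<omega>. F (\<lambda>t. S t \<omega>) \<partial>N)\<bar>
    \<le> levy_const \<beta> m * 2 powr (- (n * (a - \<beta>)))"
proof -
  interpret N: prob_space N using levy by (simp add: levy_process_def)
  have Sm: "\<And>t. t \<in> {0..1} \<Longrightarrow> S t \<in> borel_measurable N" using levy by (simp add: levy_process_def)
  have S1m [measurable]: "S 1 \<in> borel_measurable N" by (rule Sm) simp
  have stat: "\<And>s t. 0 \<le> s \<Longrightarrow> s \<le> t \<Longrightarrow> t \<le> 1 \<Longrightarrow> distr N borel (\<lambda>\<omega>. S t \<omega> - S s \<omega>) = distr N borel (S (t - s))"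
    using levy by (simp add: levy_process_def)
  have S0: "AE \<omega> in N. S 0 \<omega> = 0" using levy by (simp add: levy_process_def)
  note joint = levy_process_jointly_measurable[OF levy]
  define q where "q = p * \<beta>"
  have q: "q > 0" "\<eta> * p < q" "q \<le> p * a" using \<beta> p \<eta> by (auto simp: q_def mult.commute)
  have k: "kernel_const q (\<eta> * p) > 0" using q p by (intro kernel_const_pos) auto
  have law: "distr N borel (\<lambda>\<omega>. S t \<omega> - S s \<omega>) = distr N borel (\<lambda>\<omega>. (t - s) powr a * S 1 \<omega>)"
    if "0 \<le> s" "s \<le> t" "t \<le> 1" for s t
    using stat[OF that] scaling[of "t - s"] that by simp
  have incr: "(\<integral>\<^sup>+\<omega>. ennreal (\<bar>S t \<omega> - S s \<omega>\<bar> powr p) \<partial>N) \<le> ennreal (m * (t - s) powr (p * a))"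
    if st: "0 \<le> s" "s \<le> t" "t \<le> 1" for s t
  proof -
    have "(\<integral>\<^sup>+\<omega>. ennreal (\<bar>S t \<omega> - S s \<omega>\<bar> powr p) \<partial>N) = (\<integral>\<^sup>+\<omega>. ennreal (\<bar>(t - s) powr a * S 1 \<omega>\<bar> powr p) \<partial>N)"
      using Sm[of s] Sm[of t] st by (intro nn_integral_distr_eq_cong[OF law[OF st], of "\<lambda>z. ennreal (\<bar>z\<bar> powr p)"]) auto
    also have "\<dots> = (\<integral>\<^sup>+\<omega>. ennreal ((t - s) powr (p * a)) * ennreal (\<bar>S 1 \<omega>\<bar> powr p) \<partial>N)"
      by (intro nn_integral_cong) (simp add: abs_mult powr_mult powr_powr ennreal_mult' mult.commute)
    also have "\<dots> = ennreal ((t - s) powr (p * a)) * (\<integral>\<^sup>+\<omega>. ennreal (\<bar>S 1 \<omega>\<bar> powr p) \<partial>N)"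
      by (rule nn_integral_cmult) measurable
    also have "\<dots> \<le> ennreal ((t - s) powr (p * a)) * ennreal m"
      by (intro mult_left_mono m) simp
    also have "\<dots> = ennreal (m * (t - s) powr (p * a))" using m by (simp add: ennreal_mult' mult.commute)
    finally show ?thesis .
  qed
  \<comment> \<open>The kernel estimate at level \<open>0\<close> already shows that almost every
    path of \<open>S\<close> belongs to the space.\<close>
  have SinW: "AE \<omega> in N. (\<lambda>t. S t \<omega>) \<in> sob_space \<eta> p" and Sint: "integrable N (\<lambda>\<omega>. sob_norm \<eta> p (\<lambda>t. S t \<omega>))"
  proof -
    have at: "(\<integral>\<^sup>+\<omega>. ennreal (\<bar>S t \<omega>\<bar> powr p) \<partial>N) \<le> ennreal (m * 2 powr (real 0 * q))" if t: "t \<in> {0..1}" for t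
    proof -
      have "(\<integral>\<^sup>+\<omega>. ennreal (\<bar>S t \<omega>\<bar> powr p) \<partial>N) = (\<integral>\<^sup>+\<omega>. ennreal (\<bar>S t \<omega> - S 0 \<omega>\<bar> powr p) \<partial>N)"
        using S0 by (intro nn_integral_cong_AE) auto
      also have "\<dots> \<le> ennreal (m * (t - 0) powr (p * a))" using t by (intro incr) auto
      also have "\<dots> \<le> ennreal (m * 1)" using t q m by (intro ennreal_leI mult_left_mono powr_le1) auto
      finally show ?thesis by simp
    qed
    have inc: "(\<integral>\<^sup>+\<omega>. ennreal (\<bar>S s \<omega> - S t \<omega>\<bar> powr p) \<partial>N) \<le> ennreal (m * ((2 ^ 0 * \<bar>s - t\<bar>) powr q + of_bool (dyadic_apart 0 s t)))"
      if st: "s \<in> {0..1}" "t \<in> {0..1}" for s t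
    proof -
      have "(\<integral>\<^sup>+\<omega>. ennreal (\<bar>S s \<omega> - S t \<omega>\<bar> powr p) \<partial>N) \<le> ennreal (m * \<bar>s - t\<bar> powr (p * a))"
        using incr[of s t] incr[of t s] st by (cases "s \<le> t") (auto simp: abs_minus_commute)
      also have "\<dots> \<le> ennreal (m * ((2 ^ 0 * \<bar>s - t\<bar>) powr q + of_bool (dyadic_apart 0 s t)))"
      proof (intro ennreal_leI mult_left_mono)
        have "\<bar>s - t\<bar> powr (p * a) \<le> \<bar>s - t\<bar> powr q" using st q by (intro powr_mono') auto
        then show "\<bar>s - t\<bar> powr (p * a) \<le> (2 ^ 0 * \<bar>s - t\<bar>) powr q + of_bool (dyadic_apart 0 s t)" by (auto simp: of_bool_def)
      qed (use m in auto)
      finally show ?thesis .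
    qed
    have "(\<integral>\<^sup>+\<omega>. sob_energy \<eta> p (\<lambda>t. S t \<omega>) \<partial>N) \<le> ennreal ((1 + kernel_const q (\<eta> * p)) * m * 2 powr (real 0 * q))"
      using m q at inc by (intro nn_integral_sob_energy_le[OF N.prob_space_axioms joint]) auto
    moreover have "(1 + kernel_const q (\<eta> * p)) * m * 2 powr (real 0 * q) > 0" using k m by simp
    ultimately show "AE \<omega> in N. (\<lambda>t. S t \<omega>) \<in> sob_space \<eta> p" "integrable N (\<lambda>\<omega>. sob_norm \<eta> p (\<lambda>t. S t \<omega>))"
      using sob_norm_expectation[OF N.prob_space_axioms joint] by blast+
  qed
  define fl where "fl = (\<lambda>t::real. of_int \<lfloor>2 ^ n * t\<rfloor> / 2 ^ n :: real)"
  have fl: "0 \<le> fl t" "fl t \<le> t" "t - fl t \<le> 1 / 2 ^ n" "fl t \<le> 1" if "t \<in> {0..1}" for t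
  proof -
    have "of_int \<lfloor>2 ^ n * t\<rfloor> \<le> 2 ^ n * t" "2 ^ n * t \<le> of_int \<lfloor>2 ^ n * t\<rfloor> + 1" by linarith+
    then have "of_int \<lfloor>2 ^ n * t\<rfloor> / 2 ^ n \<le> 2 ^ n * t / 2 ^ n" "2 ^ n * t / 2 ^ n \<le> (of_int \<lfloor>2 ^ n * t\<rfloor> + 1) / 2 ^ n"
      by (intro divide_right_mono; simp)+
    then show "fl t \<le> t" "t - fl t \<le> 1 / 2 ^ n" by (simp_all add: fl_def add_divide_distrib)
    then show "fl t \<le> 1" using that by simp
    show "0 \<le> fl t" using that by (simp add: fl_def)
  qed
  define g where "g = (\<lambda>t \<omega>. S t \<omega> - S (fl t) \<omega>)"
  have gm: "(\<lambda>x. g (fst x) (snd x)) \<in> borel_measurable (unit_leb \<Otimes>\<^sub>M N)"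
  proof -
    have "(\<lambda>x. S (max 0 (min 1 ((of_int \<lfloor>2 ^ n * fst x\<rfloor> + 0) / 2 ^ n))) (snd x)) \<in> borel_measurable (unit_leb \<Otimes>\<^sub>M N)"
      using Sm by (rule measurable_process_dyadic_sample)
    moreover have "max 0 (min 1 ((of_int \<lfloor>2 ^ n * fst x\<rfloor> + 0) / 2 ^ n)) = fl (fst x)" if "x \<in> space (unit_leb \<Otimes>\<^sub>M N)" for x
      using fl[of "fst x"] that by (auto simp: space_pair_measure fl_def)
    ultimately have "(\<lambda>x. S (fl (fst x)) (snd x)) \<in> borel_measurable (unit_leb \<Otimes>\<^sub>M N)"
      by (subst measurable_cong[symmetric]) (auto simp del: add_0_right)
    with joint show ?thesis unfolding g_def by (rule borel_measurable_diff)
  qed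
  \<comment> \<open>Bound for the \<open>p\<close>-th moment of an increment of \<open>S\<close>
    over one cell of length \<open>1 / 2 ^ n\<close>.\<close>
  define m' where "m' = m * 2 powr (- (n * (p * a)))"
  have m': "m' > 0" using m by (simp add: m'_def)
  define B where "B = 2 * 2 powr p * m'"
  have B: "B > 0" "m' \<le> B" using m' p ge_one_powr_ge_zero[of 2 p] by (auto simp: B_def)
  have gat: "(\<integral>\<^sup>+\<omega>. ennreal (\<bar>g t \<omega>\<bar> powr p) \<partial>N) \<le> ennreal m'" if t: "t \<in> {0..1}" for t
  proof -
    have "(\<integral>\<^sup>+\<omega>. ennreal (\<bar>g t \<omega>\<bar> powr p) \<partial>N) \<le> ennreal (m * (t - fl t) powr (p * a))"
      unfolding g_def using fl[OF t] t by (intro incr) auto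
    also have "\<dots> \<le> ennreal (m * (1 / 2 ^ n) powr (p * a))"
      using fl[OF t] m q by (intro ennreal_leI mult_left_mono powr_mono2) auto
    also have "1 / 2 ^ n = (2 powr (- real n) :: real)" by (simp add: powr_minus powr_realpow field_simps)
    finally show ?thesis by (simp add: m'_def powr_powr)
  qed
  have ginc: "(\<integral>\<^sup>+\<omega>. ennreal (\<bar>g s \<omega> - g t \<omega>\<bar> powr p) \<partial>N) \<le> ennreal (B * ((2 ^ n * \<bar>s - t\<bar>) powr q + of_bool (dyadic_apart n s t)))"
    if st: "s \<in> {0..1}" "t \<in> {0..1}" for s t
  proof (cases "dyadic_apart n s t")
    case True
    have [measurable]: "g s \<in> borel_measurable N" "g t \<in> borel_measurable N"
      using measurable_process_at[OF N.prob_space_axioms gm] st by auto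
    have "(\<integral>\<^sup>+\<omega>. ennreal (\<bar>g s \<omega> - g t \<omega>\<bar> powr p) \<partial>N) \<le>
      (\<integral>\<^sup>+\<omega>. ennreal (2 powr p) * (ennreal (\<bar>g s \<omega>\<bar> powr p) + ennreal (\<bar>g t \<omega>\<bar> powr p)) \<partial>N)"
    proof (intro nn_integral_mono)
      fix \<omega>
      have "\<bar>g s \<omega> - g t \<omega>\<bar> powr p \<le> (\<bar>g s \<omega>\<bar> + \<bar>g t \<omega>\<bar>) powr p" using p by (intro powr_mono2) auto
      also have "\<dots> \<le> 2 powr p * (\<bar>g s \<omega>\<bar> powr p + \<bar>g t \<omega>\<bar> powr p)" using p by (intro powr_add_le) auto
      finally show "ennreal (\<bar>g s \<omega> - g t \<omega>\<bar> powr p) \<le> ennreal (2 powr p) * (ennreal (\<bar>g s \<omega>\<bar> powr p) + ennreal (\<bar>g t \<omega>\<bar> powr p))"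
        by (subst ennreal_plus[symmetric], simp, simp, subst ennreal_mult'[symmetric]) (auto intro: ennreal_leI)
    qed
    also have "\<dots> = ennreal (2 powr p) * ((\<integral>\<^sup>+\<omega>. ennreal (\<bar>g s \<omega>\<bar> powr p) \<partial>N) + (\<integral>\<^sup>+\<omega>. ennreal (\<bar>g t \<omega>\<bar> powr p) \<partial>N))"
      by (subst nn_integral_cmult, measurable, subst nn_integral_add, measurable)
    also have "\<dots> \<le> ennreal (2 powr p) * (ennreal m' + ennreal m')"
      by (intro mult_left_mono add_mono gat st) auto
    also have "\<dots> = ennreal B" using m'
      by (subst ennreal_plus[symmetric], simp, simp, subst ennreal_mult'[symmetric]) (auto simp: B_def)
    also have "\<dots> \<le> ennreal (B * ((2 ^ n * \<bar>s - t\<bar>) powr q + of_bool (dyadic_apart n s t)))"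
      using True B by (intro ennreal_leI) (simp add: distrib_left)
    finally show ?thesis .
  next
    case False
    then have eq: "fl s = fl t" by (simp add: fl_def dyadic_apart_def)
    have close: "2 ^ n * \<bar>s - t\<bar> \<le> 1"
    proof -
      have "\<bar>s - t\<bar> \<le> 1 / 2 ^ n" using fl[OF st(1)] fl[OF st(2)] eq by linarith
      then show ?thesis by (simp add: field_simps)
    qed
    have "(\<integral>\<^sup>+\<omega>. ennreal (\<bar>g s \<omega> - g t \<omega>\<bar> powr p) \<partial>N) \<le> ennreal (m * \<bar>s - t\<bar> powr (p * a))"
      using incr[of s t] incr[of t s] st by (cases "s \<le> t") (auto simp: abs_minus_commute g_def eq)
    also have "m * \<bar>s - t\<bar> powr (p * a) = m' * (2 ^ n * \<bar>s - t\<bar>) powr (p * a)"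
      by (simp add: m'_def powr_mult powr_powr flip: powr_realpow powr_add)
    \<comment> \<open>Times in one cell are at rescaled distance at most \<open>1\<close>, so the
      exponent may be lowered from \<open>p * a\<close> to \<open>q\<close>.\<close>
    also have "ennreal \<dots> \<le> ennreal (B * ((2 ^ n * \<bar>s - t\<bar>) powr q))"
      using B m' close q by (intro ennreal_leI mult_mono powr_mono') auto
    finally show ?thesis using False by simp
  qed
  define E where "E = (1 + kernel_const q (\<eta> * p)) * B * 2 powr (n * q)"
  have E: "E > 0" using k B by (simp add: E_def)
  have energy: "(\<integral>\<^sup>+\<omega>. sob_energy \<eta> p (\<lambda>t. g t \<omega>) \<partial>N) \<le> ennreal E"
    unfolding E_def
  proof (rule nn_integral_sob_energy_le[OF N.prob_space_axioms gm])
    fix t :: real assume "t \<in> {0..1}"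
    then have "(\<integral>\<^sup>+\<omega>. ennreal (\<bar>g t \<omega>\<bar> powr p) \<partial>N) \<le> ennreal m'" by (rule gat)
    also have "\<dots> \<le> ennreal (B * 2 powr (n * q))"
      using B q m' mult_mono[of m' B 1 "2 powr (n * q)"] ge_one_powr_ge_zero[of 2 "n * q"] by (intro ennreal_leI) auto
    finally show "(\<integral>\<^sup>+\<omega>. ennreal (\<bar>g t \<omega>\<bar> powr p) \<partial>N) \<le> ennreal (B * 2 powr (n * q))" .
  qed (use B q ginc in auto)
  note bound = sob_norm_expectation[OF N.prob_space_axioms gm energy E]
  define h where "h = 2 powr (- (n * a))"
  have h: "h > 0" by (simp add: h_def)
  \<comment> \<open>Division by \<open>h\<close> restores the law of \<open>S 1\<close> by
    self-similarity; the index starts at \<open>1\<close> as in \<open>step_path\<close>.\<close>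
  define X where "X = (\<lambda>i::nat. \<lambda>\<omega>. (S (real i / 2 ^ n) \<omega> - S ((real i - 1) / 2 ^ n) \<omega>) / h)"
  have grid: "0 \<le> (real i - 1) / 2 ^ n" "(real i - 1) / 2 ^ n \<le> real i / 2 ^ n" "real i / 2 ^ n \<le> 1" if "i \<in> {1..2^n}" for i
  proof -
    have "i \<le> 2 ^ n" using that by simp
    then have "real i \<le> real (2 ^ n)" by (rule of_nat_mono)
    then show "real i / 2 ^ n \<le> 1" by simp
  qed (use that in \<open>auto intro: divide_right_mono\<close>)
  have Dm: "(\<lambda>\<omega>. S (real i / 2 ^ n) \<omega> - S ((real i - 1) / 2 ^ n) \<omega>) \<in> borel_measurable N" if "i \<in> {1..2^n}" for i
  proof -
    have "real i / 2 ^ n \<in> {0..1}" "(real i - 1) / 2 ^ n \<in> {0..1}"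
      using order_trans[OF grid(1,2)[OF that]] order_trans[OF grid(2,3)[OF that]] grid[OF that]
      unfolding atLeastAtMost_iff by blast+
    from Sm[OF this(1)] Sm[OF this(2)] show ?thesis by (rule borel_measurable_diff)
  qed
  have Xm: "X i \<in> borel_measurable N" if "i \<in> {1..2^n}" for i
    unfolding X_def using Dm[OF that] by (rule borel_measurable_divide) simp
  have Xlaw: "distr N borel (X i) = distr N borel (S 1)" if i: "i \<in> {1..2^n}" for i
  proof -
    let ?Y = "\<lambda>\<omega>. S (real i / 2 ^ n) \<omega> - S ((real i - 1) / 2 ^ n) \<omega>"
    have Ym: "?Y \<in> borel_measurable N" by (rule Dm[OF i])
    have hh: "(real i / 2 ^ n - (real i - 1) / 2 ^ n) powr a = h"
    proof -
      have "real i / 2 ^ n - (real i - 1) / 2 ^ n = 2 powr (- real n)"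
        by (simp add: powr_minus powr_realpow field_simps)
      then show ?thesis by (simp add: h_def powr_powr)
    qed
    have "distr N borel (X i) = distr (distr N borel ?Y) borel (\<lambda>z. z / h)"
      using Ym by (subst distr_distr) (auto simp: comp_def X_def)
    also have "distr N borel ?Y = distr N borel (\<lambda>\<omega>. h * S 1 \<omega>)"
      using law[OF grid[OF i]] by (simp only: hh)
    also have "distr \<dots> borel (\<lambda>z. z / h) = distr N borel (S 1)"
      using h by (subst distr_distr) (auto simp: comp_def)
    finally show ?thesis .
  qed
  have S1int: "integrable N (S 1)"
  proof (rule integrable_abs_powr_imp_integrable[OF N.finite_measure_axioms S1m _ p(1)])
    show "integrable N (\<lambda>\<omega>. \<bar>S 1 \<omega>\<bar> powr p)"
      using m by (intro integrableI_bounded) (auto simp: top_unique less_top[symmetric])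
  qed
  have Xint: "integrable N (X i)" if i: "i \<in> {1..2^n}" for i
  proof -
    have "integrable (distr N borel (S 1)) (\<lambda>z. z)" using S1int by (subst integrable_distr_eq) auto
    then have "integrable (distr N borel (X i)) (\<lambda>z. z)" using Xlaw[OF i] by simp
    then show ?thesis using Xm[OF i] by (subst (asm) integrable_distr_eq) auto
  qed
  have Xind: "N.indep_vars (\<lambda>_. borel) X {1..2^n}"
  proof -
    define \<tau> where "\<tau> = (\<lambda>i::nat. real i / 2 ^ n)"
    have "mono_on {..2^n} \<tau> \<and> \<tau> ` {..2^n} \<subseteq> {0..1}"
    proof -
      have "real i \<le> 2 ^ n" if "i \<le> 2 ^ n" for i
        using of_nat_mono[OF that, where 'a = real] by simp
      then show ?thesis by (auto simp: \<tau>_def mono_on_def divide_right_mono)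
    qed
    then have "N.indep_vars (\<lambda>_. borel) (\<lambda>i \<omega>. S (\<tau> (Suc i)) \<omega> - S (\<tau> i) \<omega>) {..<2^n}"
      using levy by (simp add: levy_process_def)
    then have "N.indep_vars (\<lambda>_. borel) (\<lambda>i \<omega>. (S (\<tau> (Suc i)) \<omega> - S (\<tau> i) \<omega>) / h) {..<2^n}"
      by (rule N.indep_vars_compose2[where Y = "\<lambda>_ z. z / h"]) measurable
    \<comment> \<open>The increments in \<open>levy_process\<close> are indexed from
      \<open>0\<close>; the shift moves them to the indices of the walk.\<close>
    moreover have "inj_on (\<lambda>i::nat. i - 1) {1..2^n}" "(\<lambda>i. i - 1) ` {1..(2::nat)^n} \<subseteq> {..<2^n}"
      by (auto simp: inj_on_def)
    ultimately have "N.indep_vars (\<lambda>_. borel) (\<lambda>i \<omega>. (S (\<tau> (Suc (i - 1))) \<omega> - S (\<tau> (i - 1)) \<omega>) / h) {1..2^n}"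
      using N.indep_vars_reindex[of "\<lambda>i. i - 1" "{1..2^n}" "\<lambda>_. borel"] N.indep_vars_subset by blast
    then show ?thesis
      by (rule N.indep_vars_cong[THEN iffD1, rotated 3]) (auto simp: X_def \<tau>_def of_nat_diff)
  qed
  \<comment> \<open>The sum telescopes to the value at the left end of the cell. The term
    \<open>S 0\<close> stays because it vanishes only almost surely.\<close>
  have path: "step_path n h (\<lambda>i. X i \<omega>) t = S (fl t) \<omega> - S 0 \<omega>" if t: "t \<in> {0..1}" for t \<omega>
  proof -
    define j where "j = nat \<lfloor>2 ^ n * t\<rfloor>"
    have "step_path n h (\<lambda>i. X i \<omega>) t = (\<Sum>i=1..j. S (real i / 2 ^ n) \<omega> - S ((real i - 1) / 2 ^ n) \<omega>)"
      using h by (simp add: step_path_def X_def j_def sum_distrib_left)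
    also have "\<dots> = S (real j / 2 ^ n) \<omega> - S 0 \<omega>"
      by (induction j) auto
    also have "real j = of_int \<lfloor>2 ^ n * t\<rfloor>" using t by (simp add: j_def)
    finally show ?thesis by (simp add: fl_def)
  qed
  have W: "(\<integral>\<omega>. F (step_path n h (\<lambda>i. X i \<omega>)) \<partial>N) = walk_functional F n h (distr N borel (S 1))"
    and Wint: "integrable N (\<lambda>\<omega>. F (step_path n h (\<lambda>i. X i \<omega>)))"
    using walk_functional_eq[OF F N.prob_space_axioms Xind, of "distr N borel (S 1)" h]
      integrable_Lip1_step_path[OF F N.prob_space_axioms Xind, of "distr N borel (S 1)" h] Xlaw Xint by auto
  have FSm: "(\<lambda>\<omega>. F (\<lambda>t. S t \<omega>)) \<in> borel_measurable N"
    by (rule measurable_Lip1_process[OF F N.prob_space_axioms joint])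
  have FSint: "integrable N (\<lambda>\<omega>. F (\<lambda>t. S t \<omega>))"
  proof (rule Bochner_Integration.integrable_bound[OF _ FSm])
    show "integrable N (\<lambda>\<omega>. \<bar>F (step_path 0 0 (\<lambda>_. 0))\<bar> + sob_norm \<eta> p (\<lambda>t. S t \<omega>))"
      using Sint by auto
    show "AE \<omega> in N. norm (F (\<lambda>t. S t \<omega>)) \<le> norm (\<bar>F (step_path 0 0 (\<lambda>_. 0))\<bar> + sob_norm \<eta> p (\<lambda>t. S t \<omega>))"
      using SinW
    proof eventually_elim
      case (elim \<omega>)
      then have "\<bar>F (\<lambda>t. S t \<omega>) - F (step_path 0 0 (\<lambda>_. 0))\<bar> \<le> sob_norm \<eta> p (\<lambda>t. S t \<omega> - step_path 0 0 (\<lambda>_. 0) t)"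
        using F step_path_in_sob_space unfolding Lip1_def by blast
      then show ?case by (simp add: step_path_def)
    qed
  qed
  have "\<bar>walk_functional F n h (distr N borel (S 1)) - (\<integral>\<omega>. F (\<lambda>t. S t \<omega>) \<partial>N)\<bar> =
      \<bar>\<integral>\<omega>. F (step_path n h (\<lambda>i. X i \<omega>)) - F (\<lambda>t. S t \<omega>) \<partial>N\<bar>"
    using W Wint FSint by simp
  also have "\<dots> \<le> (\<integral>\<omega>. \<bar>F (step_path n h (\<lambda>i. X i \<omega>)) - F (\<lambda>t. S t \<omega>)\<bar> \<partial>N)"
    by (rule integral_abs_bound)
  also have "\<dots> \<le> (\<integral>\<omega>. sob_norm \<eta> p (\<lambda>t. g t \<omega>) \<partial>N)"
  proof (rule integral_mono_AE[OF _ bound(2)])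
    show "integrable N (\<lambda>\<omega>. \<bar>F (step_path n h (\<lambda>i. X i \<omega>)) - F (\<lambda>t. S t \<omega>)\<bar>)"
      using Wint FSint by auto
    show "AE \<omega> in N. \<bar>F (step_path n h (\<lambda>i. X i \<omega>)) - F (\<lambda>t. S t \<omega>)\<bar> \<le> sob_norm \<eta> p (\<lambda>t. g t \<omega>)"
      using SinW S0
    proof eventually_elim
      case (elim \<omega>)
      have "\<bar>F (\<lambda>t. S t \<omega>) - F (step_path n h (\<lambda>i. X i \<omega>))\<bar> \<le> sob_norm \<eta> p (\<lambda>t. S t \<omega> - step_path n h (\<lambda>i. X i \<omega>) t)"
        using F elim(1) step_path_in_sob_space unfolding Lip1_def by blast
      also have "\<dots> = sob_norm \<eta> p (\<lambda>t. g t \<omega>)"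
        unfolding sob_norm_eq
        by (subst sob_energy_cong[of "\<lambda>t. S t \<omega> - step_path n h (\<lambda>i. X i \<omega>) t" "\<lambda>t. g t \<omega>"])
          (auto simp: path g_def elim(2))
      finally show ?case by (simp add: abs_minus_commute)
    qed
  qed
  also have "\<dots> \<le> 2 * E powr (1 / p)" by (rule bound(3))
  also have "E powr (1 / p) = ((1 + kernel_const q (\<eta> * p)) * (2 * 2 powr p * m)) powr (1 / p) * 2 powr (- (n * (a - \<beta>)))"
  proof -
    have "E = ((1 + kernel_const q (\<eta> * p)) * (2 * 2 powr p * m)) * 2 powr (- (n * (a - \<beta>)) * p)"
      by (simp add: E_def B_def m'_def q_def mult_ac flip: powr_add) (simp add: algebra_simps)
    then show ?thesis using p by (simp add: powr_mult powr_powr)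
  qed
  finally show ?thesis by (simp add: levy_const_def q_def h_def mult_ac)
qed

end

section \<open>Renormalized sums of Pareto variables\<close>

text \<open>The randomness behind the symmetric Pareto law: the sign of the point becomes the sign
  of the variable, its modulus the tail probability.\<close>

definition unif_sym :: "real measure" where
  "unif_sym = density lborel (\<lambda>x. ennreal (indicator {-1..1} x / 2))"

lemma sets_unif_sym [simp, measurable_cong]: "sets unif_sym = sets borel"
  by (simp add: unif_sym_def)

lemma space_unif_sym [simp]: "space unif_sym = UNIV"
  by (simp add: unif_sym_def)

lemma ennreal_halve: "x \<ge> 0 \<Longrightarrow> ennreal (2 * x) / 2 = ennreal x"
  using divide_ennreal[of "2 * x" 2] by simp

lemma nn_integral_unif_sym:
  assumes [measurable]: "f \<in> borel_measurable borel"
  shows "(\<integral>\<^sup>+x. f x \<partial>unif_sym) = (\<integral>\<^sup>+x. f x * indicator {-1..1} x \<partial>lborel) / 2"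
proof -
  have "(\<integral>\<^sup>+x. f x \<partial>unif_sym) = (\<integral>\<^sup>+x. (f x * indicator {-1..1} x) / 2 \<partial>lborel)"
    unfolding unif_sym_def
    by (subst nn_integral_density) (auto intro!: nn_integral_cong simp: indicator_def divide_ennreal[symmetric] mult.commute ennreal_times_divide)
  also have "\<dots> = (\<integral>\<^sup>+x. f x * indicator {-1..1} x \<partial>lborel) / 2"
    by (rule nn_integral_divide) measurable
  finally show ?thesis .
qed

lemma prob_space_unif_sym: "prob_space unif_sym"
proof
  have "emeasure unif_sym (space unif_sym) = (\<integral>\<^sup>+x. 1 \<partial>unif_sym)" by simp
  also have "\<dots> = emeasure lborel {-1..1::real} / 2"
    by (subst nn_integral_unif_sym) auto
  also have "\<dots> = 1" by (simp add: ennreal_divide_self)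
  finally show "emeasure unif_sym (space unif_sym) = 1" .
qed

interpretation unif_sym: prob_space unif_sym
  by (rule prob_space_unif_sym)

interpretation unif_sym2: pair_prob_space unif_sym unif_sym ..

lemma AE_unif_sym: "AE x in unif_sym. x \<in> {-1..1} \<and> x \<noteq> 0"
proof -
  have "AE x in lborel. x \<noteq> (0::real)" by (rule AE_lborel_singleton)
  then have "AE x in lborel. 0 < ennreal (indicator {-1..1} x / 2) \<longrightarrow> x \<in> {-1..1} \<and> x \<noteq> (0::real)"
    by eventually_elim (auto simp: indicator_def)
  then show ?thesis unfolding unif_sym_def by (subst AE_density) auto
qed

lemma nn_integral_unif_sym_powr:
  assumes "a > -1"
  shows "(\<integral>\<^sup>+x. ennreal (\<bar>x\<bar> powr a) \<partial>unif_sym) \<le> ennreal (1 / (a + 1))"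
proof -
  let ?h = "\<lambda>x::real. ennreal (x powr a) * indicator {0<..1} x"
  have [measurable]: "?h \<in> borel_measurable borel" by measurable
  have "(\<integral>\<^sup>+x. ennreal (\<bar>x\<bar> powr a) * indicator {-1..1} x \<partial>lborel) \<le> (\<integral>\<^sup>+t. ?h t + ?h (0 + (-1) * t) \<partial>lborel)"
    by (intro nn_integral_mono) (auto simp: indicator_def abs_if)
  also have "\<dots> = (\<integral>\<^sup>+t. ?h t \<partial>lborel) + (\<integral>\<^sup>+t. ?h (0 + (-1) * t) \<partial>lborel)"
    by (intro nn_integral_add) measurable
  also have "(\<integral>\<^sup>+t. ?h (0 + (-1) * t) \<partial>lborel) = (\<integral>\<^sup>+t. ?h t \<partial>lborel)"
    using nn_integral_real_affine[of ?h "-1" 0] by simp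
  also have "(\<integral>\<^sup>+t. ?h t \<partial>lborel) = ennreal (1 / (a + 1))"
    using nn_integral_powr_Ioc[OF assms, of 1] by simp
  also have "ennreal (1 / (a + 1)) + ennreal (1 / (a + 1)) = ennreal (1 / (a + 1)) * 2"
    by (simp add: mult_2_right)
  finally have *: "(\<integral>\<^sup>+x. ennreal (\<bar>x\<bar> powr a) * indicator {-1..1} x \<partial>lborel) \<le> ennreal (1 / (a + 1)) * 2" .
  have "(\<integral>\<^sup>+x. ennreal (\<bar>x\<bar> powr a) \<partial>unif_sym) \<le> (ennreal (1 / (a + 1)) * 2) / 2"
    by (subst nn_integral_unif_sym) (auto intro!: divide_right_mono_ennreal *)
  also have "\<dots> = ennreal (1 / (a + 1))"
    by (subst ennreal_mult_divide_eq) auto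
  finally show ?thesis .
qed

text \<open>The larger of two Pareto variables, which dominates their sum, is the image of the uniform point closer to \<open>0\<close>.
  On \<open>[0,1]\<close>, \<open>spread\<close> is the distribution function \<open>1 - (1 - u)\<^sup>2\<close> of the distance of that point to \<open>0\<close>.\<close>

definition min_unif :: "real \<Rightarrow> real \<Rightarrow> real" where
  "min_unif u v = (if \<bar>u\<bar> \<le> \<bar>v\<bar> then u else v)"

definition spread :: "real \<Rightarrow> real" where
  "spread u = 2 * u - u * \<bar>u\<bar>"

lemma measurable_min_unif [measurable]:
  "(\<lambda>z. min_unif (fst z) (snd z)) \<in> borel_measurable (unif_sym \<Otimes>\<^sub>M unif_sym)"
  unfolding min_unif_def by measurable

lemma measurable_spread [measurable]: "spread \<in> borel_measurable borel"
  unfolding spread_def by measurable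

lemma spread_derivative: "(spread has_real_derivative (2 - 2 * \<bar>u\<bar>)) (at u)"
proof -
  have sq: "((\<lambda>x. x * \<bar>x\<bar>) has_real_derivative 2 * \<bar>u\<bar>) (at u)"
  proof -
    consider "u > 0" | "u < 0" | "u = 0" by linarith
    then show ?thesis
    proof cases
      case 1
      have "((\<lambda>x. x * x) has_real_derivative 2 * \<bar>u\<bar>) (at u)"
        using 1 by (auto intro!: derivative_eq_intros)
      then show ?thesis
        by (rule has_field_derivative_transform_within_open[of _ _ _ "{0<..}"]) (use 1 in auto)
    next
      case 2
      have "((\<lambda>x. - (x * x)) has_real_derivative 2 * \<bar>u\<bar>) (at u)"
        using 2 by (auto intro!: derivative_eq_intros)
      then show ?thesis
        by (rule has_field_derivative_transform_within_open[of _ _ _ "{..<0}"]) (use 2 in auto)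
    next
      case 3
      have "((\<lambda>h::real. \<bar>h\<bar>) \<longlongrightarrow> \<bar>0\<bar>) (at 0)" by (intro tendsto_intros)
      then have "((\<lambda>h::real. h * \<bar>h\<bar> / h) \<longlongrightarrow> \<bar>0\<bar>) (at 0)"
        by (rule Lim_transform_eventually) (auto simp: eventually_at_filter)
      then show ?thesis using 3 by (simp add: DERIV_def)
    qed
  qed
  show ?thesis unfolding spread_def
    by (rule derivative_eq_intros sq refl)+ simp
qed

text \<open>Relative to \<open>unif_sym\<close>, each order of the two moduli gives the smaller
  point the weight \<open>1 - |u|\<close>. The total \<open>2 - 2 * |u|\<close> is the derivative of
  \<open>spread\<close>, so substitution restores the uniform law. Ties go to the first
  variable.\<close>

lemma distr_spread_min_unif:
  "distr (unif_sym \<Otimes>\<^sub>M unif_sym) borel (\<lambda>z. spread (min_unif (fst z) (snd z))) = unif_sym"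
proof (rule measure_eqI)
  let ?P = "unif_sym \<Otimes>\<^sub>M unif_sym" and ?W = "\<lambda>z. spread (min_unif (fst z) (snd z))"
  fix A assume "A \<in> sets (distr ?P borel ?W)"
  then have [measurable]: "A \<in> sets borel" by simp
  let ?f = "\<lambda>u. indicator A (spread u) :: ennreal"
  have small: "(\<integral>\<^sup>+v. of_bool (\<bar>u\<bar> \<le> \<bar>v\<bar>) \<partial>unif_sym) = ennreal (1 - \<bar>u\<bar>)"
    "(\<integral>\<^sup>+v. of_bool (\<bar>u\<bar> < \<bar>v\<bar>) \<partial>unif_sym) = ennreal (1 - \<bar>u\<bar>)" if u: "u \<in> {-1..1}" for u
  proof -
    have eq: "(\<integral>\<^sup>+v. indicator ({-1..1} - C) v \<partial>lborel) / 2 = ennreal (1 - \<bar>u\<bar>)"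
      if C: "C \<in> sets borel" "C \<subseteq> {-1..1}" "emeasure lborel C = ennreal (2 * \<bar>u\<bar>)" for C :: "real set"
    proof -
      have "(\<integral>\<^sup>+v. indicator ({-1..1} - C) v \<partial>lborel) = emeasure lborel ({-1..1::real} - C)"
        using C by simp
      also have "\<dots> = emeasure lborel {-1..1::real} - emeasure lborel C"
        using C by (intro emeasure_Diff) auto
      also have "\<dots> = ennreal (2 - 2 * \<bar>u\<bar>)"
        using C by (simp add: ennreal_minus[symmetric])
      finally show ?thesis using u ennreal_halve[of "1 - \<bar>u\<bar>"] by (auto simp: algebra_simps)
    qed
    have "(\<integral>\<^sup>+v. of_bool (\<bar>u\<bar> \<le> \<bar>v\<bar>) \<partial>unif_sym) = (\<integral>\<^sup>+v. of_bool (\<bar>u\<bar> \<le> \<bar>v\<bar>) * indicator {-1..1} v \<partial>lborel) / 2"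
      by (rule nn_integral_unif_sym) measurable
    also have "(\<integral>\<^sup>+v. of_bool (\<bar>u\<bar> \<le> \<bar>v\<bar>) * indicator {-1..1} v \<partial>lborel) = (\<integral>\<^sup>+v. indicator ({-1..1} - {-\<bar>u\<bar><..<\<bar>u\<bar>}) v \<partial>lborel)"
      by (intro nn_integral_cong) (auto simp: indicator_def)
    also have "\<dots> / 2 = ennreal (1 - \<bar>u\<bar>)" using u by (intro eq) auto
    finally show "(\<integral>\<^sup>+v. of_bool (\<bar>u\<bar> \<le> \<bar>v\<bar>) \<partial>unif_sym) = ennreal (1 - \<bar>u\<bar>)" .
    have "(\<integral>\<^sup>+v. of_bool (\<bar>u\<bar> < \<bar>v\<bar>) \<partial>unif_sym) = (\<integral>\<^sup>+v. of_bool (\<bar>u\<bar> < \<bar>v\<bar>) * indicator {-1..1} v \<partial>lborel) / 2"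
      by (rule nn_integral_unif_sym) measurable
    also have "(\<integral>\<^sup>+v. of_bool (\<bar>u\<bar> < \<bar>v\<bar>) * indicator {-1..1} v \<partial>lborel) = (\<integral>\<^sup>+v. indicator ({-1..1} - {-\<bar>u\<bar>..\<bar>u\<bar>}) v \<partial>lborel)"
      by (intro nn_integral_cong) (auto simp: indicator_def)
    also have "\<dots> / 2 = ennreal (1 - \<bar>u\<bar>)" using u by (intro eq) auto
    finally show "(\<integral>\<^sup>+v. of_bool (\<bar>u\<bar> < \<bar>v\<bar>) \<partial>unif_sym) = ennreal (1 - \<bar>u\<bar>)" .
  qed
  have half: "(\<integral>\<^sup>+u. ?f u * ennreal (1 - \<bar>u\<bar>) \<partial>unif_sym) = emeasure unif_sym A / 2"
  proof -
    have "(\<integral>\<^sup>+u. ?f u * ennreal (1 - \<bar>u\<bar>) \<partial>unif_sym) = (\<integral>\<^sup>+u. ?f u * ennreal (1 - \<bar>u\<bar>) * indicator {-1..1} u \<partial>lborel) / 2"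
      by (rule nn_integral_unif_sym) measurable
    also have "(\<integral>\<^sup>+u. ?f u * ennreal (1 - \<bar>u\<bar>) * indicator {-1..1} u \<partial>lborel) =
      (\<integral>\<^sup>+u. (?f u * ennreal (2 - 2 * \<bar>u\<bar>) * indicator {-1..1} u) / 2 \<partial>lborel)"
    proof (intro nn_integral_cong)
      fix u :: real
      have "ennreal (1 - \<bar>u\<bar>) = ennreal (2 - 2 * \<bar>u\<bar>) / 2" if "\<bar>u\<bar> \<le> 1"
        using that ennreal_halve[of "1 - \<bar>u\<bar>"] by (auto simp: algebra_simps)
      then show "?f u * ennreal (1 - \<bar>u\<bar>) * indicator {-1..1} u = (?f u * ennreal (2 - 2 * \<bar>u\<bar>) * indicator {-1..1} u) / 2"
        by (auto simp: indicator_def)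
    qed
    also have "\<dots> = (\<integral>\<^sup>+u. ?f u * ennreal (2 - 2 * \<bar>u\<bar>) * indicator {-1..1} u \<partial>lborel) / 2"
      by (rule nn_integral_divide) measurable
    also have "(\<integral>\<^sup>+u. ?f u * ennreal (2 - 2 * \<bar>u\<bar>) * indicator {-1..1} u \<partial>lborel) =
      (\<integral>\<^sup>+x. indicator A x * indicator {spread (-1)..spread 1} x \<partial>lborel)"
      by (rule nn_integral_substitution_aux[symmetric, OF _ _ spread_derivative]) (auto intro!: continuous_intros)
    also have "\<dots> / 2 = emeasure unif_sym A"
      using nn_integral_unif_sym[of "indicator A"] by (simp add: spread_def)
    finally show ?thesis .
  qed
  have "emeasure (distr ?P borel ?W) A = (\<integral>\<^sup>+z. indicator A (?W z) \<partial>?P)"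
    by (subst nn_integral_indicator[symmetric], simp, rule nn_integral_distr) measurable
  also have "\<dots> = (\<integral>\<^sup>+z. ?f (fst z) * of_bool (\<bar>fst z\<bar> \<le> \<bar>snd z\<bar>) + ?f (snd z) * of_bool (\<bar>snd z\<bar> < \<bar>fst z\<bar>) \<partial>?P)"
    by (intro nn_integral_cong) (auto simp: min_unif_def)
  also have "\<dots> = (\<integral>\<^sup>+z. ?f (fst z) * of_bool (\<bar>fst z\<bar> \<le> \<bar>snd z\<bar>) \<partial>?P) + (\<integral>\<^sup>+z. ?f (snd z) * of_bool (\<bar>snd z\<bar> < \<bar>fst z\<bar>) \<partial>?P)"
    by (intro nn_integral_add) measurable
  also have "(\<integral>\<^sup>+z. ?f (fst z) * of_bool (\<bar>fst z\<bar> \<le> \<bar>snd z\<bar>) \<partial>?P) = (\<integral>\<^sup>+u. ?f u * ennreal (1 - \<bar>u\<bar>) \<partial>unif_sym)"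
  proof -
    have "(\<integral>\<^sup>+z. ?f (fst z) * of_bool (\<bar>fst z\<bar> \<le> \<bar>snd z\<bar>) \<partial>?P) = (\<integral>\<^sup>+u. \<integral>\<^sup>+v. ?f u * of_bool (\<bar>u\<bar> \<le> \<bar>v\<bar>) \<partial>unif_sym \<partial>unif_sym)"
      by (subst unif_sym.nn_integral_fst[symmetric]) auto
    also have "\<dots> = (\<integral>\<^sup>+u. ?f u * (\<integral>\<^sup>+v. of_bool (\<bar>u\<bar> \<le> \<bar>v\<bar>) \<partial>unif_sym) \<partial>unif_sym)"
      by (intro nn_integral_cong nn_integral_cmult) measurable
    also have "\<dots> = (\<integral>\<^sup>+u. ?f u * ennreal (1 - \<bar>u\<bar>) \<partial>unif_sym)"
      by (intro nn_integral_cong_AE, use AE_unif_sym in eventually_elim) (simp only: small)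
    finally show ?thesis .
  qed
  also have "(\<integral>\<^sup>+z. ?f (snd z) * of_bool (\<bar>snd z\<bar> < \<bar>fst z\<bar>) \<partial>?P) = (\<integral>\<^sup>+u. ?f u * ennreal (1 - \<bar>u\<bar>) \<partial>unif_sym)"
  proof -
    have "(\<integral>\<^sup>+z. ?f (snd z) * of_bool (\<bar>snd z\<bar> < \<bar>fst z\<bar>) \<partial>?P) = (\<integral>\<^sup>+u. \<integral>\<^sup>+v. ?f u * of_bool (\<bar>u\<bar> < \<bar>v\<bar>) \<partial>unif_sym \<partial>unif_sym)"
      by (subst unif_sym2.nn_integral_snd[symmetric]) (auto simp: case_prod_beta')
    also have "\<dots> = (\<integral>\<^sup>+u. ?f u * (\<integral>\<^sup>+v. of_bool (\<bar>u\<bar> < \<bar>v\<bar>) \<partial>unif_sym) \<partial>unif_sym)"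
      by (intro nn_integral_cong nn_integral_cmult) measurable
    also have "\<dots> = (\<integral>\<^sup>+u. ?f u * ennreal (1 - \<bar>u\<bar>) \<partial>unif_sym)"
      by (intro nn_integral_cong_AE, use AE_unif_sym in eventually_elim) (simp only: small)
    finally show ?thesis .
  qed
  also have "(\<integral>\<^sup>+u. ?f u * ennreal (1 - \<bar>u\<bar>) \<partial>unif_sym) + (\<integral>\<^sup>+u. ?f u * ennreal (1 - \<bar>u\<bar>) \<partial>unif_sym) = emeasure unif_sym A"
  proof -
    have "emeasure unif_sym A / 2 + emeasure unif_sym A / 2 = emeasure unif_sym A * 2 / 2"
      by (simp add: add_divide_distrib_ennreal mult_2_right)
    also have "\<dots> = emeasure unif_sym A" by (rule ennreal_mult_divide_eq) auto
    finally show ?thesis unfolding half .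
  qed
  finally show "emeasure (distr ?P borel ?W) A = emeasure unif_sym A" .
qed simp

section \<open>Independent pairs, renormalisation and square integrable couplings\<close>

lemma distr_pair_snd:
  assumes "prob_space M" "prob_space N"
  shows "distr (M \<Otimes>\<^sub>M N) N snd = N"
proof -
  interpret M: prob_space M by fact
  interpret N: prob_space N by fact
  interpret P: pair_sigma_finite M N ..
  have "distr (M \<Otimes>\<^sub>M N) N snd = distr (N \<Otimes>\<^sub>M M) N (snd \<circ> (\<lambda>(x, y). (y, x)))"
    by (subst P.distr_pair_swap, subst distr_distr) auto
  also have "snd \<circ> (\<lambda>(x, y). (y, x)) = (fst :: 'b \<times> 'a \<Rightarrow> 'b)" by (auto simp: fun_eq_iff)
  finally show ?thesis by (simp add: M.distr_pair_fst)
qed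

lemma
  fixes f :: "'a \<Rightarrow> real"
  assumes Q: "prob_space Q" and f: "integrable Q f"
  shows integrable_pair_fst: "integrable (Q \<Otimes>\<^sub>M Q) (\<lambda>z. f (fst z))"
    and integral_pair_fst: "(\<integral>z. f (fst z) \<partial>(Q \<Otimes>\<^sub>M Q)) = (\<integral>x. f x \<partial>Q)"
    and integrable_pair_snd: "integrable (Q \<Otimes>\<^sub>M Q) (\<lambda>z. f (snd z))"
    and integral_pair_snd: "(\<integral>z. f (snd z) \<partial>(Q \<Otimes>\<^sub>M Q)) = (\<integral>x. f x \<partial>Q)"
proof -
  interpret Q: prob_space Q by fact
  have 1: "distr (Q \<Otimes>\<^sub>M Q) Q fst = Q" by (rule Q.distr_pair_fst)
  have 2: "distr (Q \<Otimes>\<^sub>M Q) Q snd = Q" by (rule distr_pair_snd[OF Q Q])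
  have fm: "f \<in> borel_measurable Q" using f by auto
  show "integrable (Q \<Otimes>\<^sub>M Q) (\<lambda>z. f (fst z))"
    using f fm integrable_distr_eq[of fst "Q \<Otimes>\<^sub>M Q" Q f] 1 by simp
  show "integrable (Q \<Otimes>\<^sub>M Q) (\<lambda>z. f (snd z))"
    using f fm integrable_distr_eq[of snd "Q \<Otimes>\<^sub>M Q" Q f] 2 by simp
  show "(\<integral>z. f (fst z) \<partial>(Q \<Otimes>\<^sub>M Q)) = (\<integral>x. f x \<partial>Q)"
    using fm integral_distr[of fst "Q \<Otimes>\<^sub>M Q" Q f] 1 by simp
  show "(\<integral>z. f (snd z) \<partial>(Q \<Otimes>\<^sub>M Q)) = (\<integral>x. f x \<partial>Q)"
    using fm integral_distr[of snd "Q \<Otimes>\<^sub>M Q" Q f] 2 by simp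
qed

lemma indep_var_pair:
  fixes f g :: "'a \<Rightarrow> real"
  assumes Q: "prob_space Q" and f: "f \<in> borel_measurable Q" and g: "g \<in> borel_measurable Q"
  shows "prob_space.indep_var (Q \<Otimes>\<^sub>M Q) borel (\<lambda>z. f (fst z)) borel (\<lambda>z. g (snd z))"
proof -
  interpret Q: prob_space Q by fact
  interpret P: pair_prob_space Q Q ..
  have "P.P.indep_var Q fst Q snd"
    unfolding P.P.indep_var_distribution_eq using Q.distr_pair_fst[of Q] distr_pair_snd[OF Q Q]
    by (auto simp: distr_id2)
  then have "P.P.indep_var borel (f \<circ> fst) borel (g \<circ> snd)" by (rule P.P.indep_var_compose[OF _ f g])
  then show ?thesis by (simp add: comp_def)
qed

text \<open>For \<open>k = 2 powr (-\<theta>)\<close> the symmetric stable laws of index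
  \<open>1 / \<theta>\<close> are fixed by this map.\<close>

definition renorm :: "real \<Rightarrow> real measure \<Rightarrow> real measure" where
  "renorm k \<mu> = distr (\<mu> \<Otimes>\<^sub>M \<mu>) borel (\<lambda>z. k * (fst z + snd z))"

lemma renorm_distr:
  assumes Q: "prob_space Q" and f [measurable]: "f \<in> borel_measurable Q"
  shows "renorm k (distr Q borel f) = distr (Q \<Otimes>\<^sub>M Q) borel (\<lambda>z. k * (f (fst z) + f (snd z)))"
proof -
  have "sigma_finite_measure (distr Q borel f)"
    using prob_space.prob_space_distr[OF Q f] by (rule prob_space_imp_sigma_finite)
  then have "distr Q borel f \<Otimes>\<^sub>M distr Q borel f = distr (Q \<Otimes>\<^sub>M Q) (borel \<Otimes>\<^sub>M borel) (\<lambda>(x, y). (f x, f y))"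
    by (intro pair_measure_distr) auto
  then show ?thesis unfolding renorm_def by (simp add: distr_distr comp_def case_prod_beta')
qed

lemma real_distribution_renorm:
  assumes "real_distribution \<mu>"
  shows "real_distribution (renorm k \<mu>)"
proof -
  interpret real_distribution \<mu> by fact
  interpret P: pair_prob_space \<mu> \<mu> ..
  have "(\<lambda>z. k * (fst z + snd z)) \<in> borel_measurable (\<mu> \<Otimes>\<^sub>M \<mu>)" by measurable
  then show ?thesis unfolding renorm_def by (rule P.P.real_distribution_distr)
qed

text \<open>The coupling is a measure on the plane, so that no type of sample spaces has to be
  quantified. Square integrability is asked of the difference alone, because the marginals are
  heavy-tailed.\<close>

definition l2_coupled :: "real \<Rightarrow> real measure \<Rightarrow> real measure \<Rightarrow> bool" where
  "l2_coupled c \<mu> \<nu> \<longleftrightarrow> (\<exists>Q :: (real \<times> real) measure. prob_space Q \<and> sets Q = sets borel \<and>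
     distr Q borel fst = \<mu> \<and> distr Q borel snd = \<nu> \<and> integrable Q fst \<and> integrable Q snd \<and>
     (\<integral>z. fst z - snd z \<partial>Q) = 0 \<and> integrable Q (\<lambda>z. (fst z - snd z)\<^sup>2) \<and> (\<integral>z. (fst z - snd z)\<^sup>2 \<partial>Q) \<le> c)"

text \<open>Any coupling may be replaced by the joint law of its two variables.\<close>

lemma l2_coupledI:
  fixes a b :: "'a \<Rightarrow> real"
  assumes P: "prob_space P" and int: "integrable P a" "integrable P b"
    and law: "distr P borel a = \<mu>" "distr P borel b = \<nu>"
    and mean: "(\<integral>x. a x - b x \<partial>P) = 0"
    and sq: "integrable P (\<lambda>x. (a x - b x)\<^sup>2)" "(\<integral>x. (a x - b x)\<^sup>2 \<partial>P) \<le> c"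
  shows "l2_coupled c \<mu> \<nu>"
proof -
  have [measurable]: "a \<in> borel_measurable P" "b \<in> borel_measurable P" using int by auto
  define Q where "Q = distr P (borel \<Otimes>\<^sub>M borel) (\<lambda>x. (a x, b x))"
  have "prob_space Q" unfolding Q_def by (intro prob_space.prob_space_distr P) measurable
  moreover have "sets Q = sets borel" by (simp add: Q_def borel_prod)
  moreover have "distr Q borel fst = \<mu>" "distr Q borel snd = \<nu>"
    using law by (simp_all add: Q_def distr_distr comp_def)
  moreover have "integrable Q fst" "integrable Q snd" "(\<integral>z. fst z - snd z \<partial>Q) = 0"
    "integrable Q (\<lambda>z. (fst z - snd z)\<^sup>2)" "(\<integral>z. (fst z - snd z)\<^sup>2 \<partial>Q) \<le> c"
    using int mean sq by (simp_all add: Q_def integrable_distr_eq integral_distr)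
  ultimately show ?thesis unfolding l2_coupled_def by blast
qed

text \<open>Take two independent copies of the coupled pair: the cross term of the centered
  differences vanishes, so their second moments add, and \<open>k\<close> enters squared.\<close>

lemma renorm_coupled:
  assumes "l2_coupled c \<mu> \<nu>"
  shows "l2_coupled (2 * k\<^sup>2 * c) (renorm k \<mu>) (renorm k \<nu>)"
proof -
  obtain Q :: "(real \<times> real) measure" where Q: "prob_space Q" "sets Q = sets borel"
    and law: "distr Q borel fst = \<mu>" "distr Q borel snd = \<nu>" and int: "integrable Q fst" "integrable Q snd"
    and mean: "(\<integral>z. fst z - snd z \<partial>Q) = 0" and sq: "integrable Q (\<lambda>z. (fst z - snd z)\<^sup>2)"
      "(\<integral>z. (fst z - snd z)\<^sup>2 \<partial>Q) \<le> c"
    using assms unfolding l2_coupled_def by blast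
  interpret Q: prob_space Q by fact
  interpret P: pair_prob_space Q Q ..
  define d where "d = (\<lambda>z::real \<times> real. fst z - snd z)"
  have dint: "integrable Q d" "integrable Q (\<lambda>z. (d z)\<^sup>2)" "(\<integral>z. d z \<partial>Q) = 0" "(\<integral>z. (d z)\<^sup>2 \<partial>Q) \<le> c"
    using int mean sq by (auto simp: d_def)
  have dm: "d \<in> borel_measurable Q" using dint by auto
  note comp = integrable_pair_fst[OF Q(1)] integrable_pair_snd[OF Q(1)] integral_pair_fst[OF Q(1)] integral_pair_snd[OF Q(1)]
  have ind: "P.P.indep_var borel (\<lambda>z. d (fst z)) borel (\<lambda>z. d (snd z))"
    by (rule indep_var_pair[OF Q(1) dm dm])
  have cross: "integrable (Q \<Otimes>\<^sub>M Q) (\<lambda>z. d (fst z) * d (snd z))" "(\<integral>z. d (fst z) * d (snd z) \<partial>(Q \<Otimes>\<^sub>M Q)) = 0"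
    using P.P.indep_var_integrable[OF ind] P.P.indep_var_lebesgue_integral[OF ind] comp dint by auto
  let ?a = "\<lambda>z. k * (fst (fst z) + fst (snd z))" and ?b = "\<lambda>z. k * (snd (fst z) + snd (snd z))"
  have ex: "?a z - ?b z = k * d (fst z) + k * d (snd z)"
    "(?a z - ?b z)\<^sup>2 = k\<^sup>2 * (d (fst z))\<^sup>2 + k\<^sup>2 * (d (snd z))\<^sup>2 + 2 * k\<^sup>2 * (d (fst z) * d (snd z))" for z
    by (simp_all add: d_def power2_eq_square algebra_simps)
  show ?thesis
  proof (rule l2_coupledI[of "Q \<Otimes>\<^sub>M Q" ?a ?b])
    show "prob_space (Q \<Otimes>\<^sub>M Q)" by (rule P.P.prob_space_axioms)
    show "integrable (Q \<Otimes>\<^sub>M Q) ?a" "integrable (Q \<Otimes>\<^sub>M Q) ?b"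
      using comp int by auto
    show "distr (Q \<Otimes>\<^sub>M Q) borel ?a = renorm k \<mu>" "distr (Q \<Otimes>\<^sub>M Q) borel ?b = renorm k \<nu>"
      using int unfolding law[symmetric] by (auto intro!: renorm_distr[symmetric] Q)
    show "(\<integral>z. ?a z - ?b z \<partial>(Q \<Otimes>\<^sub>M Q)) = 0"
      unfolding ex(1) using comp dint by simp
    show "integrable (Q \<Otimes>\<^sub>M Q) (\<lambda>z. (?a z - ?b z)\<^sup>2)"
      unfolding ex(2) using comp(1,2)[OF dint(2)] cross by auto
    have "(\<integral>z. (?a z - ?b z)\<^sup>2 \<partial>(Q \<Otimes>\<^sub>M Q)) = k\<^sup>2 * (\<integral>z. (d z)\<^sup>2 \<partial>Q) + k\<^sup>2 * (\<integral>z. (d z)\<^sup>2 \<partial>Q)"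
      unfolding ex(2) using comp[OF dint(2)] cross by simp
    also have "\<dots> \<le> 2 * k\<^sup>2 * c" using mult_left_mono[OF dint(4), of "k\<^sup>2"] by simp
    finally show "(\<integral>z. (?a z - ?b z)\<^sup>2 \<partial>(Q \<Otimes>\<^sub>M Q)) \<le> 2 * k\<^sup>2 * c" .
  qed
qed

text \<open>The map is a quantile function: \<open>|X| > x\<close> has probability \<open>(b / x) powr (1 / \<theta>)\<close> for \<open>x \<ge> b\<close>.
  Here \<open>\<theta> = 1 / \<alpha>\<close> and \<open>b = A powr \<theta>\<close> in the notation of the theorem.\<close>

definition pareto_map :: "real \<Rightarrow> real \<Rightarrow> real \<Rightarrow> real" where
  "pareto_map b \<theta> u = b * sgn u * \<bar>u\<bar> powr (-\<theta>)"

definition pareto :: "real \<Rightarrow> real \<Rightarrow> real measure" where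
  "pareto b \<theta> = distr unif_sym borel (pareto_map b \<theta>)"

lemma measurable_pareto_map [measurable]: "pareto_map b \<theta> \<in> borel_measurable borel"
  unfolding pareto_map_def by measurable

lemma real_distribution_pareto: "real_distribution (pareto b \<theta>)"
  unfolding pareto_def by (rule unif_sym.real_distribution_distr) measurable

lemma abs_pareto_map: "b > 0 \<Longrightarrow> u \<noteq> 0 \<Longrightarrow> \<bar>pareto_map b \<theta> u\<bar> = b * \<bar>u\<bar> powr (-\<theta>)"
  by (simp add: pareto_map_def abs_mult)

lemma nn_integral_pareto_map_powr:
  assumes "b > 0" "s \<ge> 0" "\<theta> * s < 1"
  shows "(\<integral>\<^sup>+u. ennreal (\<bar>pareto_map b \<theta> u\<bar> powr s) \<partial>unif_sym) \<le> ennreal (b powr s / (1 - \<theta> * s))"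
proof -
  have "(\<integral>\<^sup>+u. ennreal (\<bar>pareto_map b \<theta> u\<bar> powr s) \<partial>unif_sym) = (\<integral>\<^sup>+u. ennreal (b powr s) * ennreal (\<bar>u\<bar> powr (- (\<theta> * s))) \<partial>unif_sym)"
  proof (rule nn_integral_cong_AE)
    show "AE u in unif_sym. ennreal (\<bar>pareto_map b \<theta> u\<bar> powr s) = ennreal (b powr s) * ennreal (\<bar>u\<bar> powr (- (\<theta> * s)))"
      using AE_unif_sym
    proof eventually_elim
      case (elim u)
      then have "\<bar>pareto_map b \<theta> u\<bar> powr s = b powr s * \<bar>u\<bar> powr (- (\<theta> * s))"
        using assms by (simp add: abs_pareto_map powr_mult powr_powr)
      then show ?case by (simp only: ennreal_mult'[OF powr_ge_zero])
    qed
  qed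
  also have "\<dots> = ennreal (b powr s) * (\<integral>\<^sup>+u. ennreal (\<bar>u\<bar> powr (- (\<theta> * s))) \<partial>unif_sym)"
    by (rule nn_integral_cmult) measurable
  also have "\<dots> \<le> ennreal (b powr s) * ennreal (1 / (- (\<theta> * s) + 1))"
    using assms by (intro mult_left_mono nn_integral_unif_sym_powr) auto
  also have "\<dots> = ennreal (b powr s / (1 - \<theta> * s))"
    using assms by (subst ennreal_mult'[symmetric]) auto
  finally show ?thesis .
qed

lemma integrable_pareto_map:
  assumes "b > 0" "\<theta> < 1"
  shows "integrable unif_sym (pareto_map b \<theta>)"
proof (rule integrableI_bounded)
  show "(\<integral>\<^sup>+u. ennreal (norm (pareto_map b \<theta> u)) \<partial>unif_sym) < \<infinity>"
    using nn_integral_pareto_map_powr[of b 1 \<theta>] assms by (auto intro: le_less_trans)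
qed measurable

lemma integral_pareto_map: "(\<integral>u. pareto_map b \<theta> u \<partial>unif_sym) = 0"
proof -
  let ?f = "\<lambda>u. (indicator {-1..1} u / 2) * pareto_map b \<theta> u"
  have "(\<integral>u. pareto_map b \<theta> u \<partial>unif_sym) = (\<integral>u. ?f u \<partial>lborel)"
    unfolding unif_sym_def by (subst integral_real_density) (auto simp: indicator_def)
  moreover have "(\<integral>u. ?f u \<partial>lborel) = - (\<integral>u. ?f u \<partial>lborel)"
  proof -
    have "(\<integral>u. ?f u \<partial>lborel) = (\<integral>u. ?f (0 + (-1) * u) \<partial>lborel)"
      using lborel_integral_real_affine[of "-1" ?f 0] by simp
    also have "\<dots> = (\<integral>u. - ?f u \<partial>lborel)"
      by (intro Bochner_Integration.integral_cong refl) (auto simp: pareto_map_def indicator_def)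
    finally show ?thesis unfolding Bochner_Integration.integral_minus .
  qed
  ultimately show ?thesis by linarith
qed

text \<open>Since \<open>spread w = 2 * w * (1 - |w| / 2)\<close>, the relative error is
  \<open>(1 - |w| / 2) powr (-\<theta>) - 1\<close>, at most \<open>|w|\<close>. Against the
  singularity \<open>|w| powr (-\<theta>)\<close> this stays bounded because
  \<open>\<theta> < 1\<close>.\<close>

lemma pareto_map_spread_bound:
  assumes b: "b > 0" and \<theta>: "0 < \<theta>" "\<theta> < 1" and w: "0 < \<bar>w\<bar>" "\<bar>w\<bar> \<le> 1"
  shows "\<bar>pareto_map b \<theta> (spread w) - 2 powr (-\<theta>) * pareto_map b \<theta> w\<bar> \<le> b"
proof -
  define x where "x = \<bar>w\<bar>"
  have x: "0 < x" "x \<le> 1" using w by (auto simp: x_def)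
  have sw: "spread w = w * (2 - x)" by (simp add: spread_def x_def algebra_simps)
  have "sgn (spread w) = sgn w" using x by (simp add: sw sgn_mult)
  moreover have "\<bar>spread w\<bar> = 2 * x * (1 - x / 2)"
  proof -
    have "\<bar>spread w\<bar> = x * \<bar>2 - x\<bar>" by (simp only: sw abs_mult x_def)
    then show ?thesis using x by (simp add: algebra_simps)
  qed
  ultimately have 1: "pareto_map b \<theta> (spread w) = b * sgn w * ((2 * x) powr (-\<theta>) * (1 - x / 2) powr (-\<theta>))"
    using x by (simp add: pareto_map_def powr_mult)
  have 2: "2 powr (-\<theta>) * pareto_map b \<theta> w = b * sgn w * (2 * x) powr (-\<theta>)"
    using x by (simp add: pareto_map_def powr_mult x_def)
  have lo: "1 \<le> (1 - x / 2) powr (-\<theta>)"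
    using powr_mono'[of "-\<theta>" 0 "1 - x / 2"] x \<theta> by simp
  have "(1 - x / 2) powr (-\<theta>) \<le> (1 - x / 2) powr (-1)"
    using x \<theta> by (intro powr_mono') auto
  also have "\<dots> = 1 / (1 - x / 2)" using x by (simp add: powr_minus_divide)
  also have "\<dots> \<le> 1 + x"
  proof -
    have "1 \<le> (1 + x) * (1 - x / 2)" using x mult_left_mono[of x 1 x] by (simp add: algebra_simps)
    then show ?thesis using x by (simp add: divide_le_eq)
  qed
  finally have hi: "(1 - x / 2) powr (-\<theta>) - 1 \<le> x" by simp
  have "\<bar>pareto_map b \<theta> (spread w) - 2 powr (-\<theta>) * pareto_map b \<theta> w\<bar> =
      b * ((2 * x) powr (-\<theta>) * ((1 - x / 2) powr (-\<theta>) - 1))"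
  proof -
    have "pareto_map b \<theta> (spread w) - 2 powr (-\<theta>) * pareto_map b \<theta> w =
      b * sgn w * ((2 * x) powr (-\<theta>) * ((1 - x / 2) powr (-\<theta>) - 1))"
      unfolding 1 2 by (simp add: algebra_simps)
    then show ?thesis using b lo w by (simp add: abs_mult)
  qed
  also have "\<dots> \<le> b * 1"
  proof (intro mult_left_mono)
    have "(2 * x) powr (-\<theta>) * ((1 - x / 2) powr (-\<theta>) - 1) \<le> x powr (-\<theta>) * x"
      using x \<theta> lo hi by (intro mult_mono powr_mono2') auto
    also have "\<dots> = x powr (1 - \<theta>)" using x powr_mult_base[of x "-\<theta>"] by (simp add: mult.commute)
    also have "\<dots> \<le> 1" using x \<theta> by (intro powr_le1) auto
    finally show "(2 * x) powr (-\<theta>) * ((1 - x / 2) powr (-\<theta>) - 1) \<le> 1" .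
  qed (use b in auto)
  finally show ?thesis by simp
qed

text \<open>Both variables are built from one uniform pair. By \<open>distr_spread_min_unif\<close>
  the point of smaller modulus, after \<open>spread\<close>, is uniform again, and its Pareto image
  matches the dominant summand up to a bounded error. What remains is the smaller of two Pareto
  variables: its square is integrable although, for \<open>2 * \<theta> \<ge> 1\<close>, that of a
  single one is not.\<close>

lemma pareto_renorm_coupled:
  assumes b: "b > 0" and \<theta>: "0 < \<theta>" "\<theta> < 1"
  shows "\<exists>c>0. l2_coupled c (pareto b \<theta>) (renorm (2 powr (-\<theta>)) (pareto b \<theta>))"
proof -
  let ?P = "unif_sym \<Otimes>\<^sub>M unif_sym" and ?x = "pareto_map b \<theta>" and ?k = "2 powr (-\<theta>) :: real"
  define a where "a = (\<lambda>z. ?x (spread (min_unif (fst z) (snd z))))"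
  define b' where "b' = (\<lambda>z. ?k * (?x (fst z) + ?x (snd z)))"
  \<comment> \<open>From \<open>(A - B)^2 \<le> 2 * A^2 + 2 * B^2\<close>, with \<open>A\<close>
    bounded by \<open>b\<close> and two factors \<open>1 / (1 - \<theta>)\<close> bounding the means
    of \<open>|u| powr (-\<theta>)\<close>.\<close>
  define c where "c = 2 * b\<^sup>2 * (1 + 1 / (1 - \<theta>) * (1 / (1 - \<theta>)))"
  have c: "c > 0" using b \<theta> by (simp add: c_def add_pos_pos)
  have W: "(\<lambda>z. spread (min_unif (fst z) (snd z))) \<in> borel_measurable ?P" by measurable
  have [measurable]: "a \<in> borel_measurable ?P" "b' \<in> borel_measurable ?P"
    unfolding a_def b'_def by measurable
  have law_a: "distr ?P borel a = pareto b \<theta>"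
  proof -
    have "distr ?P borel a = distr (distr ?P borel (\<lambda>z. spread (min_unif (fst z) (snd z)))) borel ?x"
      by (subst distr_distr) (auto simp: a_def comp_def)
    then show ?thesis by (simp add: distr_spread_min_unif pareto_def)
  qed
  have law_b: "distr ?P borel b' = renorm ?k (pareto b \<theta>)"
    unfolding pareto_def b'_def by (rule renorm_distr[symmetric]) (auto intro: prob_space_unif_sym)
  note xi = integrable_pareto_map[OF b \<theta>(2)]
  have int_a: "integrable ?P a" "(\<integral>z. a z \<partial>?P) = 0"
  proof -
    have "integrable (distr ?P borel (\<lambda>z. spread (min_unif (fst z) (snd z)))) ?x"
      unfolding distr_spread_min_unif by (rule xi)
    then show "integrable ?P a" unfolding a_def by (subst (asm) integrable_distr_eq) auto
    have "(\<integral>z. a z \<partial>?P) = (\<integral>u. ?x u \<partial>distr ?P borel (\<lambda>z. spread (min_unif (fst z) (snd z))))"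
      unfolding a_def by (rule integral_distr[symmetric]) auto
    then show "(\<integral>z. a z \<partial>?P) = 0" by (simp add: distr_spread_min_unif integral_pareto_map)
  qed
  have int_b: "integrable ?P b'" "(\<integral>z. b' z \<partial>?P) = 0"
    using integrable_pair_fst[OF prob_space_unif_sym xi] integrable_pair_snd[OF prob_space_unif_sym xi]
      integral_pair_fst[OF prob_space_unif_sym xi] integral_pair_snd[OF prob_space_unif_sym xi]
    by (simp_all add: b'_def integral_pareto_map)
  have good: "AE z in ?P. (fst z \<in> {-1..1} \<and> fst z \<noteq> 0) \<and> (snd z \<in> {-1..1} \<and> snd z \<noteq> 0)"
  proof (rule unif_sym2.AE_pair_measure)
    show "AE x in unif_sym. AE y in unif_sym. (fst (x, y) \<in> {-1..1} \<and> fst (x, y) \<noteq> 0) \<and> (snd (x, y) \<in> {-1..1} \<and> snd (x, y) \<noteq> 0)"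
      using AE_unif_sym by eventually_elim (use AE_unif_sym in eventually_elim, auto)
  qed measurable
  have pt: "(a z - b' z)\<^sup>2 \<le> 2 * b\<^sup>2 * (1 + \<bar>fst z\<bar> powr (-\<theta>) * \<bar>snd z\<bar> powr (-\<theta>))"
    if z: "fst z \<in> {-1..1} \<and> fst z \<noteq> 0" "snd z \<in> {-1..1} \<and> snd z \<noteq> 0" for z
  proof -
    define w where "w = min_unif (fst z) (snd z)"
    \<comment> \<open>Here \<open>w\<close> gives the dominant summand, and \<open>o'\<close>, the
      point of larger modulus, the smaller one.\<close>
    obtain o' where o: "?x (fst z) + ?x (snd z) = ?x w + ?x o'" "0 < \<bar>w\<bar>" "\<bar>w\<bar> \<le> \<bar>o'\<bar>" "\<bar>w\<bar> \<le> 1"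
      "\<bar>fst z\<bar> powr (-\<theta>) * \<bar>snd z\<bar> powr (-\<theta>) = \<bar>w\<bar> powr (-\<theta>) * \<bar>o'\<bar> powr (-\<theta>)"
      using z by (cases "\<bar>fst z\<bar> \<le> \<bar>snd z\<bar>") (force simp: w_def min_unif_def)+
    define A where "A = ?x (spread w) - ?k * ?x w"
    define B where "B = ?k * ?x o'"
    have "\<bar>A\<bar> \<le> b" unfolding A_def by (rule pareto_map_spread_bound[OF b \<theta> o(2,4)])
    then have A2: "A\<^sup>2 \<le> b\<^sup>2" using abs_le_square_iff[of A b] b by simp
    have k1: "?k \<le> 1" using powr_mono[of "-\<theta>" 0 "2::real"] \<theta> by simp
    have "\<bar>B\<bar> = ?k * (b * \<bar>o'\<bar> powr (-\<theta>))"
      unfolding B_def abs_mult using o b by (subst abs_pareto_map) auto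
    also have "\<dots> \<le> 1 * (b * \<bar>o'\<bar> powr (-\<theta>))"
      using b by (intro mult_right_mono k1) auto
    finally have "\<bar>B\<bar>\<^sup>2 \<le> (b * \<bar>o'\<bar> powr (-\<theta>))\<^sup>2" by (intro power_mono) auto
    also have "\<dots> = b\<^sup>2 * (\<bar>o'\<bar> powr (-\<theta>) * \<bar>o'\<bar> powr (-\<theta>))" by (simp add: power2_eq_square)
    \<comment> \<open>The decisive trade: one of the two factors at \<open>o'\<close> is enlarged to
      the factor at \<open>w\<close>. The result is a product over the independent coordinates,
      integrable as soon as \<open>\<theta> < 1\<close>.\<close>
    also have "\<dots> \<le> b\<^sup>2 * (\<bar>w\<bar> powr (-\<theta>) * \<bar>o'\<bar> powr (-\<theta>))"
      using o \<theta> by (intro mult_left_mono mult_right_mono powr_mono2') auto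
    finally have B2: "B\<^sup>2 \<le> b\<^sup>2 * (\<bar>fst z\<bar> powr (-\<theta>) * \<bar>snd z\<bar> powr (-\<theta>))" by (simp add: o(5))
    have eq: "a z - b' z = A - B" unfolding a_def b'_def o(1) A_def B_def w_def by (simp add: algebra_simps)
    have "(a z - b' z)\<^sup>2 \<le> 2 * A\<^sup>2 + 2 * B\<^sup>2"
      unfolding eq using zero_le_power2[of "A + B"] by (simp add: power2_eq_square algebra_simps)
    then show ?thesis using A2 B2 by (simp add: algebra_simps)
  qed
  have sq: "(\<integral>\<^sup>+z. ennreal ((a z - b' z)\<^sup>2) \<partial>?P) \<le> ennreal c"
  proof -
    let ?p = "\<lambda>u::real. \<bar>u\<bar> powr (-\<theta>)"
    have "(\<integral>\<^sup>+z. ennreal ((a z - b' z)\<^sup>2) \<partial>?P) \<le> (\<integral>\<^sup>+z. ennreal (2 * b\<^sup>2 * (1 + ?p (fst z) * ?p (snd z))) \<partial>?P)"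
    proof (rule nn_integral_mono_AE)
      show "AE z in ?P. ennreal ((a z - b' z)\<^sup>2) \<le> ennreal (2 * b\<^sup>2 * (1 + ?p (fst z) * ?p (snd z)))"
        using good by eventually_elim (rule ennreal_leI, rule pt, blast+)
    qed
    also have "\<dots> = (\<integral>\<^sup>+z. ennreal (2 * b\<^sup>2) * (1 + ennreal (?p (fst z)) * ennreal (?p (snd z))) \<partial>?P)"
      by (intro nn_integral_cong) (subst ennreal_mult', simp, subst ennreal_plus, auto simp: ennreal_mult')
    also have "\<dots> = ennreal (2 * b\<^sup>2) * (1 + (\<integral>\<^sup>+z. ennreal (?p (fst z)) * ennreal (?p (snd z)) \<partial>?P))"
      by (subst nn_integral_cmult, measurable, subst nn_integral_add) (auto simp: unif_sym2.P.emeasure_space_1)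
    also have "(\<integral>\<^sup>+z. ennreal (?p (fst z)) * ennreal (?p (snd z)) \<partial>?P) = (\<integral>\<^sup>+u. \<integral>\<^sup>+v. ennreal (?p u) * ennreal (?p v) \<partial>unif_sym \<partial>unif_sym)"
      by (subst unif_sym.nn_integral_fst[symmetric]) auto
    also have "\<dots> = (\<integral>\<^sup>+u. ennreal (?p u) \<partial>unif_sym) * (\<integral>\<^sup>+v. ennreal (?p v) \<partial>unif_sym)"
      by (subst nn_integral_cmult, measurable, subst nn_integral_multc) auto
    also have "ennreal (2 * b\<^sup>2) * (1 + \<dots>) \<le> ennreal (2 * b\<^sup>2) * (1 + ennreal (1 / (-\<theta> + 1)) * ennreal (1 / (-\<theta> + 1)))"
      using \<theta> by (intro mult_left_mono add_left_mono mult_mono nn_integral_unif_sym_powr) auto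
    also have "\<dots> = ennreal c"
      using \<theta> unfolding c_def
      by (subst ennreal_mult', simp, subst ennreal_plus, simp, simp, subst ennreal_mult') auto
    finally show ?thesis .
  qed
  have sqi: "integrable ?P (\<lambda>z. (a z - b' z)\<^sup>2)"
    using sq by (intro integrableI_bounded) (auto intro: le_less_trans)
  have "ennreal (\<integral>z. (a z - b' z)\<^sup>2 \<partial>?P) \<le> ennreal c"
    using sq sqi by (subst nn_integral_eq_integral[symmetric]) auto
  then have "(\<integral>z. (a z - b' z)\<^sup>2 \<partial>?P) \<le> c" using c by (subst (asm) ennreal_le_iff) auto
  moreover have "(\<integral>z. a z - b' z \<partial>?P) = 0" using int_a int_b by simp
  ultimately have "l2_coupled c (pareto b \<theta>) (renorm ?k (pareto b \<theta>))"
    using int_a int_b law_a law_b sqi unif_sym2.P.prob_space_axioms by (intro l2_coupledI[of ?P a b']) auto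
  then show ?thesis using c by blast
qed

text \<open>The law of the sum of \<open>2 ^ j\<close> independent Pareto variables, divided by
  \<open>2 powr (j * \<theta>)\<close>.\<close>

definition pareto_sum :: "real \<Rightarrow> real \<Rightarrow> nat \<Rightarrow> real measure" where
  "pareto_sum b \<theta> j = (renorm (2 powr (-\<theta>)) ^^ j) (pareto b \<theta>)"

lemma pareto_sum_0 [simp]: "pareto_sum b \<theta> 0 = pareto b \<theta>"
  and pareto_sum_Suc: "pareto_sum b \<theta> (Suc j) = renorm (2 powr (-\<theta>)) (pareto_sum b \<theta> j)"
  by (simp_all add: pareto_sum_def)

lemma real_distribution_pareto_sum: "real_distribution (pareto_sum b \<theta> j)"
  by (induction j) (simp_all add: pareto_sum_Suc real_distribution_pareto real_distribution_renorm)

text \<open>Each renormalisation multiplies the cost by \<open>2 * (2 powr (-\<theta>))^2\<close>,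
  which is below \<open>1\<close> once \<open>\<theta> > 1 / 2\<close>.\<close>

lemma pareto_sum_coupled:
  assumes "b > 0" "0 < \<theta>" "\<theta> < 1"
  shows "\<exists>c>0. \<forall>j. l2_coupled (c * (2 powr (1 - 2 * \<theta>)) ^ j) (pareto_sum b \<theta> j) (pareto_sum b \<theta> (Suc j))"
proof -
  obtain c where c: "c > 0" "l2_coupled c (pareto b \<theta>) (renorm (2 powr (-\<theta>)) (pareto b \<theta>))"
    using pareto_renorm_coupled[OF assms] by blast
  have k: "2 * (2 powr (-\<theta>))\<^sup>2 = (2 powr (1 - 2 * \<theta>) :: real)"
  proof -
    have "2 powr (1 - 2 * \<theta>) = (2 powr (1 + (-\<theta>) + (-\<theta>)) :: real)"
      by (rule arg_cong[where f = "\<lambda>z. 2 powr z"]) simp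
    also have "\<dots> = 2 powr 1 * 2 powr (-\<theta>) * 2 powr (-\<theta>)" by (simp only: powr_add)
    also have "2 powr 1 = (2::real)" by simp
    finally show ?thesis by (simp only: power2_eq_square mult.assoc)
  qed
  have "l2_coupled (c * (2 powr (1 - 2 * \<theta>)) ^ j) (pareto_sum b \<theta> j) (pareto_sum b \<theta> (Suc j))" for j
  proof (induction j)
    case (Suc j)
    from renorm_coupled[OF Suc, of "2 powr (-\<theta>)"] show ?case
      unfolding pareto_sum_Suc k by (simp add: mult_ac)
  qed (use c in \<open>simp add: pareto_sum_Suc\<close>)
  then show ?thesis using c by blast
qed

text \<open>A discrete Gronwall argument: passing to \<open>m j + 1\<close> absorbs the additive
  error, each step multiplies by at most \<open>exp ((a + d) * e ^ j)\<close>, and these exponents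
  form a convergent series.\<close>

lemma bounded_if_geometric_growth:
  fixes m :: "nat \<Rightarrow> real"
  assumes rec: "\<And>j. m (Suc j) \<le> (1 + a * e ^ j) * m j + d * e ^ j"
    and "a \<ge> 0" "d \<ge> 0" "0 \<le> e" "e < 1" "m 0 \<ge> 0" "\<And>j. m j \<ge> 0"
  shows "\<exists>C. \<forall>j. m j \<le> C"
proof -
  have le: "m j + 1 \<le> (m 0 + 1) * exp ((a + d) * (\<Sum>i<j. e ^ i))" for j
  proof (induction j)
    case (Suc j)
    have "m (Suc j) + 1 \<le> (1 + a * e ^ j) * m j + d * e ^ j + 1" using rec[of j] by simp
    also have "\<dots> \<le> (1 + (a + d) * e ^ j) * (m j + 1)"
      using assms by (simp add: algebra_simps)
    also have "\<dots> \<le> exp ((a + d) * e ^ j) * (m j + 1)"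
      using assms exp_ge_add_one_self[of "(a + d) * e ^ j"] by (intro mult_right_mono) (auto simp: add_nonneg_nonneg)
    also have "\<dots> \<le> exp ((a + d) * e ^ j) * ((m 0 + 1) * exp ((a + d) * (\<Sum>i<j. e ^ i)))"
      by (intro mult_left_mono Suc) auto
    also have "\<dots> = (m 0 + 1) * exp ((a + d) * (\<Sum>i<Suc j. e ^ i))"
      by (simp add: exp_add algebra_simps)
    finally show ?case .
  qed simp
  have "m j \<le> (m 0 + 1) * exp ((a + d) * (1 / (1 - e)))" for j
  proof -
    have "(\<Sum>i<j. e ^ i) \<le> (\<Sum>i. e ^ i)"
      using assms by (intro sum_le_suminf summable_geometric) auto
    also have "\<dots> = 1 / (1 - e)" using assms by (intro suminf_geometric) auto
    finally have "(m 0 + 1) * exp ((a + d) * (\<Sum>i<j. e ^ i)) \<le> (m 0 + 1) * exp ((a + d) * (1 / (1 - e)))"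
      using assms by (intro mult_left_mono iffD2[OF exp_le_cancel_iff] ) auto
    then show ?thesis using le[of j] by linarith
  qed
  then show ?thesis by blast
qed

text \<open>Interpolation at the square root of \<open>c\<close>, the natural size of
  \<open>d\<close>: each term is at most \<open>c powr (s / 2)\<close>.\<close>

lemma l2_coupled_moment:
  fixes d :: "'a \<Rightarrow> real"
  assumes Q: "prob_space Q" and d: "integrable Q (\<lambda>z. (d z)\<^sup>2)" "(\<integral>z. (d z)\<^sup>2 \<partial>Q) \<le> c" "c > 0"
    and s: "0 < s" "s \<le> 2" and dm: "d \<in> borel_measurable Q"
  shows "integrable Q (\<lambda>z. \<bar>d z\<bar> powr s)" "(\<integral>z. \<bar>d z\<bar> powr s \<partial>Q) \<le> 2 * c powr (s / 2)"
proof -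
  interpret Q: prob_space Q by fact
  note [measurable] = dm
  define K where "K = c powr (1 / 2)"
  have K: "K > 0" using d by (simp add: K_def)
  have pt: "\<bar>d z\<bar> powr s \<le> K powr (s - 2) * (d z)\<^sup>2 + K powr s" for z
    using powr_interpolate[of "\<bar>d z\<bar>" K s 2] K s by (simp add: powr_numeral)
  have i: "integrable Q (\<lambda>z. K powr (s - 2) * (d z)\<^sup>2 + K powr s)" using d by auto
  show int: "integrable Q (\<lambda>z. \<bar>d z\<bar> powr s)"
    by (rule Bochner_Integration.integrable_bound[OF i]) (use pt in \<open>auto intro!: order_trans[OF _ abs_ge_self]\<close>)
  have "(\<integral>z. \<bar>d z\<bar> powr s \<partial>Q) \<le> (\<integral>z. K powr (s - 2) * (d z)\<^sup>2 + K powr s \<partial>Q)"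
    by (intro integral_mono int i pt)
  also have "\<dots> = K powr (s - 2) * (\<integral>z. (d z)\<^sup>2 \<partial>Q) + K powr s"
    using d by (simp add: Q.prob_space)
  also have "\<dots> \<le> K powr (s - 2) * c + K powr s" by (intro add_right_mono mult_left_mono d) auto
  also have "c = K powr 2" using d by (simp add: K_def powr_powr)
  also have "K powr (s - 2) * K powr 2 + K powr s = 2 * K powr s" by (simp flip: powr_add)
  also have "K powr s = c powr (s / 2)" by (simp add: K_def powr_powr)
  finally show "(\<integral>z. \<bar>d z\<bar> powr s \<partial>Q) \<le> 2 * c powr (s / 2)" .
qed

text \<open>Passing from \<open>j\<close> to \<open>Suc j\<close> perturbs the variable by a
  difference of geometrically decreasing size. The weighted inequality with weight
  \<open>e ^ j\<close> lets the moment grow by a factor \<open>1 + 3 * e ^ j\<close> and a summable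
  error only.\<close>

lemma pareto_sum_moment:
  assumes b: "b > 0" and \<theta>: "1 / 2 < \<theta>" and s: "1 \<le> s" "\<theta> * s < 1"
  shows "\<exists>C. \<forall>j. integrable (pareto_sum b \<theta> j) (\<lambda>x. \<bar>x\<bar> powr s) \<and> (\<integral>x. \<bar>x\<bar> powr s \<partial>pareto_sum b \<theta> j) \<le> C"
proof -
  have \<theta>1: "\<theta> < 1" 
  proof -
    have "\<theta> * 1 \<le> \<theta> * s" using s \<theta> by (intro mult_left_mono) auto
    then show ?thesis using s by simp
  qed
  have s2: "s \<le> 2"
  proof (rule ccontr)
    assume "\<not> s \<le> 2"
    then have "1 / 2 * 2 \<le> \<theta> * s" using \<theta> by (intro mult_mono) auto
    then show False using s by simp
  qed
  obtain c where c: "c > 0" "\<And>j. l2_coupled (c * (2 powr (1 - 2 * \<theta>)) ^ j) (pareto_sum b \<theta> j) (pareto_sum b \<theta> (Suc j))"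
    using pareto_sum_coupled[OF b _ \<theta>1] \<theta> by auto
  \<comment> \<open>Fourth root of the contraction factor: the moment of the difference decays like
    \<open>e ^ (2 * j * s)\<close>, and the penalty \<open>(2 / e ^ j) powr s\<close> of the
    weighted inequality uses up half of that.\<close>
  define e :: real where "e = 2 powr ((1 - 2 * \<theta>) / 4)"
  have e: "0 < e" "e < 1" using \<theta> by (auto simp: e_def powr_less_one)
  have e4: "2 powr (1 - 2 * \<theta>) = e ^ 4"
  proof -
    have "e ^ 4 = (2 powr ((1 - 2 * \<theta>) / 4)) powr 4" by (simp add: e_def powr_numeral)
    also have "\<dots> = 2 powr ((1 - 2 * \<theta>) / 4 * 4)" by (rule powr_powr)
    also have "(1 - 2 * \<theta>) / 4 * 4 = 1 - 2 * \<theta>" by simp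
    finally show ?thesis ..
  qed
  define m where "m = (\<lambda>j. \<integral>x. \<bar>x\<bar> powr s \<partial>pareto_sum b \<theta> j)"
  have m0: "m j \<ge> 0" for j by (simp add: m_def)
  define K where "K = 2 powr s * (2 * c powr (s / 2))"
  have step: "integrable (pareto_sum b \<theta> (Suc j)) (\<lambda>x. \<bar>x\<bar> powr s) \<and> m (Suc j) \<le> (1 + 3 * e ^ j) * m j + K * e ^ j"
    if ij: "integrable (pareto_sum b \<theta> j) (\<lambda>x. \<bar>x\<bar> powr s)" for j
  proof -
    obtain Q :: "(real \<times> real) measure" where Q: "prob_space Q" "sets Q = sets borel"
      and law: "distr Q borel fst = pareto_sum b \<theta> j" "distr Q borel snd = pareto_sum b \<theta> (Suc j)"
      and int: "integrable Q fst" "integrable Q snd"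
      and sq: "integrable Q (\<lambda>z. (fst z - snd z)\<^sup>2)" "(\<integral>z. (fst z - snd z)\<^sup>2 \<partial>Q) \<le> c * (2 powr (1 - 2 * \<theta>)) ^ j"
      using c(2)[of j] unfolding l2_coupled_def by blast
    have [measurable]: "fst \<in> borel_measurable Q" "snd \<in> borel_measurable Q" using int by auto
    have cj: "c * (2 powr (1 - 2 * \<theta>)) ^ j > 0" using c by simp
    have f: "integrable Q (\<lambda>z. \<bar>fst z\<bar> powr s)" "(\<integral>z. \<bar>fst z\<bar> powr s \<partial>Q) = m j"
      using ij unfolding m_def law(1)[symmetric] by (simp_all add: integrable_distr_eq integral_distr)
    note d = l2_coupled_moment[OF Q(1) sq cj, of s]
    have ej: "0 < e ^ j" "e ^ j \<le> 1" using e by (auto simp: power_le_one)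
    have pt: "\<bar>snd z\<bar> powr s \<le> (1 + 3 * e ^ j) * \<bar>fst z\<bar> powr s + (2 / e ^ j) powr s * \<bar>fst z - snd z\<bar> powr s" for z
    proof -
      have "\<bar>snd z\<bar> powr s \<le> (\<bar>fst z\<bar> + \<bar>fst z - snd z\<bar>) powr s" using s by (intro powr_mono2) auto
      also have "\<dots> \<le> (1 + 3 * e ^ j) * \<bar>fst z\<bar> powr s + (2 / e ^ j) powr s * \<bar>fst z - snd z\<bar> powr s"
        using s s2 ej by (intro powr_add_le_weighted) auto
      finally show ?thesis .
    qed
    have i: "integrable Q (\<lambda>z. (1 + 3 * e ^ j) * \<bar>fst z\<bar> powr s + (2 / e ^ j) powr s * \<bar>fst z - snd z\<bar> powr s)"
      using f d s s2 by auto
    have int_s: "integrable Q (\<lambda>z. \<bar>snd z\<bar> powr s)"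
      by (rule Bochner_Integration.integrable_bound[OF i]) (use pt in \<open>auto intro!: order_trans[OF _ abs_ge_self]\<close>)
    have "m (Suc j) = (\<integral>z. \<bar>snd z\<bar> powr s \<partial>Q)"
      unfolding m_def law(2)[symmetric] by (simp add: integral_distr)
    also have "\<dots> \<le> (\<integral>z. (1 + 3 * e ^ j) * \<bar>fst z\<bar> powr s + (2 / e ^ j) powr s * \<bar>fst z - snd z\<bar> powr s \<partial>Q)"
      by (intro integral_mono int_s i pt)
    also have "\<dots> = (1 + 3 * e ^ j) * m j + (2 / e ^ j) powr s * (\<integral>z. \<bar>fst z - snd z\<bar> powr s \<partial>Q)"
      using f d s s2 by simp
    also have "\<dots> \<le> (1 + 3 * e ^ j) * m j + (2 / e ^ j) powr s * (2 * (c * (2 powr (1 - 2 * \<theta>)) ^ j) powr (s / 2))"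
      using d s s2 by (intro add_left_mono mult_left_mono) auto
    also have "(2 / e ^ j) powr s * (2 * (c * (2 powr (1 - 2 * \<theta>)) ^ j) powr (s / 2)) = K * (e ^ j) powr s"
    proof -
      have "(2 powr (1 - 2 * \<theta>)) ^ j = (e ^ j) powr 4"
        using e by (simp add: e4 powr_numeral flip: power_mult) (simp add: mult.commute)
      then have "(c * (2 powr (1 - 2 * \<theta>)) ^ j) powr (s / 2) = c powr (s / 2) * (e ^ j) powr (2 * s)"
        by (simp add: powr_mult powr_powr)
      moreover have "(2 / e ^ j) powr s = 2 powr s * (e ^ j) powr (- s)"
        by (simp add: powr_divide powr_minus_divide)
      moreover have "(e ^ j) powr (- s) * (e ^ j) powr (2 * s) = (e ^ j) powr s"
        by (simp flip: powr_add)
      ultimately show ?thesis by (simp add: K_def mult_ac)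
    qed
    also have "\<dots> \<le> K * e ^ j"
      using powr_mono'[of 1 s "e ^ j"] ej s by (intro mult_left_mono) (auto simp: K_def)
    finally show ?thesis using int_s unfolding law(2)[symmetric] by (simp add: integrable_distr_eq)
  qed
  have "integrable (pareto b \<theta>) (\<lambda>x. \<bar>x\<bar> powr s)"
  proof -
    have "(\<integral>\<^sup>+u. ennreal (\<bar>pareto_map b \<theta> u\<bar> powr s) \<partial>unif_sym) < \<infinity>"
      using nn_integral_pareto_map_powr[OF b _ s(2)] s by (auto intro: le_less_trans)
    then have "integrable unif_sym (\<lambda>u. \<bar>pareto_map b \<theta> u\<bar> powr s)" by (intro integrableI_bounded) auto
    then show ?thesis unfolding pareto_def by (subst integrable_distr_eq) auto
  qed
  then have int: "integrable (pareto_sum b \<theta> j) (\<lambda>x. \<bar>x\<bar> powr s)" for j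
    by (induction j) (use step in auto)
  have "\<exists>C. \<forall>j. m j \<le> C"
    using step[OF int] e m0 by (intro bounded_if_geometric_growth[of m 3 e K]) (auto simp: K_def)
  then show ?thesis using int unfolding m_def by blast
qed

section \<open>Convergence to the stable law\<close>

text \<open>Taylor's bound for \<open>|u| < 1\<close>, the trivial bound \<open>2\<close> otherwise.
  The cosine estimate is the real part, as the compensator is purely imaginary.\<close>

lemma abs_cos_minus_one_le: "\<bar>cos (\<xi> * u) - 1\<bar> \<le> (2 + \<xi>\<^sup>2) * min 1 (u\<^sup>2)" (is ?A)
  and cmod_iexp_compensated_le:
    "cmod (iexp (\<xi> * u) - 1 - \<i> * of_real (\<xi> * u * indicator {-1<..<1} u)) \<le> (2 + \<xi>\<^sup>2) * min 1 (u\<^sup>2)" (is ?B)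
  for \<xi> u :: real
proof -
  have near: "cmod (iexp (\<xi> * u) - 1 - \<i> * of_real (\<xi> * u)) \<le> \<xi>\<^sup>2 * u\<^sup>2"
  proof -
    have "cmod (iexp (\<xi> * u) - (\<Sum>k\<le>1. (\<i> * (\<xi> * u)) ^ k / fact k)) \<le> \<bar>\<xi> * u\<bar> ^ Suc 1 / fact (Suc 1)"
      by (rule iexp_approx1)
    also have "(\<Sum>k\<le>1. (\<i> * (\<xi> * u)) ^ k / fact k) = 1 + \<i> * of_real (\<xi> * u)" by simp
    also have "\<bar>\<xi> * u\<bar> ^ Suc 1 / fact (Suc 1) \<le> \<xi>\<^sup>2 * u\<^sup>2"
      by (simp add: power_mult_distrib abs_mult flip: power2_eq_square)
    finally show ?thesis by (simp add: algebra_simps)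
  qed
  have far: "cmod (iexp (\<xi> * u) - 1) \<le> 2"
    using norm_triangle_ineq4[of "iexp (\<xi> * u)" 1] by simp
  have u2: "u\<^sup>2 \<le> 1" if "\<bar>u\<bar> < 1" using that by (simp add: abs_square_le_1)
  have u2': "1 \<le> u\<^sup>2" if "\<not> \<bar>u\<bar> < 1"
    using that one_le_power[of "\<bar>u\<bar>" 2] by simp
  show ?B
  proof (cases "\<bar>u\<bar> < 1")
    case True
    have "\<xi>\<^sup>2 * u\<^sup>2 \<le> (2 + \<xi>\<^sup>2) * u\<^sup>2" by (intro mult_right_mono) auto
    with near True u2 show ?thesis by (simp add: indicator_def abs_less_iff min_def)
  next
    case False
    then have "u \<notin> {-1<..<1}" by auto
    moreover have "min 1 (u\<^sup>2) = 1" using u2'[OF False] by simp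
    ultimately show ?thesis using far by (simp add: add_increasing2)
  qed
  have re: "\<bar>cos (\<xi> * u) - 1\<bar> \<le> cmod (iexp (\<xi> * u) - 1 - \<i> * of_real c)" for c
    using abs_Re_le_cmod[of "iexp (\<xi> * u) - 1 - \<i> * of_real c"] by (simp add: Re_exp)
  show ?A using re[of "\<xi> * u * indicator {-1<..<1} u"] \<open>?B\<close> by linarith
qed

locale stable_params =
  fixes b \<theta> :: real
  assumes b: "b > 0" and \<theta>: "1 / 2 < \<theta>" "\<theta> < 1"
begin

lemma \<theta>_pos: "\<theta> > 0" using \<theta> by simp

text \<open>A substitution for the Levy measure: it carries Lebesgue measure on the positive half
  line to twice the positive half of the stable Levy measure, and for \<open>v > 0\<close> it agrees
  with \<open>pareto_map\<close>. So the Pareto and the stable exponent become integrals of one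
  function over different ranges.\<close>

definition scale :: "real \<Rightarrow> real" where
  "scale v = b * v powr (-\<theta>)"

lemma measurable_scale [measurable]: "scale \<in> borel_measurable borel"
  unfolding scale_def by measurable

text \<open>Bounded by \<open>1\<close> up to \<open>1\<close>, and beyond by a multiple of
  \<open>v powr (-2 * \<theta>)\<close>, which is integrable at infinity because
  \<open>\<theta> > 1 / 2\<close>, that is \<open>\<alpha> < 2\<close>.\<close>

lemma integrable_min_scale: "integrable lborel (\<lambda>v. indicator {0<..} v * min 1 ((scale v)\<^sup>2))"
proof -
  have 1: "integrable lborel (\<lambda>v::real. indicator {0<..1} v :: real)" by simp
  have 2: "integrable lborel (\<lambda>v::real. v powr (-2 * \<theta>) * indicator {1..} v)"
  proof -
    have "((\<lambda>v. v powr (-2 * \<theta>)) has_integral (- (1 powr (-2 * \<theta> + 1)) / (-2 * \<theta> + 1))) {1..}"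
      using \<theta> by (intro has_integral_powr_to_inf) auto
    then have "((\<lambda>v. if v \<in> {1..} then v powr (-2 * \<theta>) else 0) has_integral (- (1 powr (-2 * \<theta> + 1)) / (-2 * \<theta> + 1))) UNIV"
      by (simp only: has_integral_restrict_UNIV)
    also have "(\<lambda>v. if v \<in> {1..} then v powr (-2 * \<theta>) else 0) = (\<lambda>v. v powr (-2 * \<theta>) * indicator {1..} v)"
      by (auto simp: indicator_def fun_eq_iff)
    finally have "(\<integral>\<^sup>+v. ennreal (v powr (-2 * \<theta>) * indicator {1..} v) \<partial>lborel) = ennreal (- (1 powr (-2 * \<theta> + 1)) / (-2 * \<theta> + 1))"
      by (intro nn_integral_has_integral_lborel) auto
    then show ?thesis by (intro integrableI_bounded) (auto simp: abs_mult)
  qed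
  have "integrable lborel (\<lambda>v::real. indicator {0<..1} v + b\<^sup>2 * (v powr (-2 * \<theta>) * indicator {1..} v))"
    using 1 2 by auto
  then show ?thesis
  proof (rule Bochner_Integration.integrable_bound)
    show "AE v in lborel. norm (indicator {0<..} v * min 1 ((scale v)\<^sup>2)) \<le> norm (indicator {0<..1} v + b\<^sup>2 * (v powr (-2 * \<theta>) * indicator {1..} v))"
    proof (intro always_eventually allI)
      fix v :: real
      have sq: "(scale v)\<^sup>2 = b\<^sup>2 * v powr (-2 * \<theta>)" if "v > 0"
        using that by (simp add: scale_def power_mult_distrib powr_powr flip: powr_numeral) (simp add: mult.commute)
      consider "v \<le> 0" | "0 < v" "v \<le> 1" | "v > 1" by linarith
      then show "norm (indicator {0<..} v * min 1 ((scale v)\<^sup>2)) \<le> norm (indicator {0<..1} v + b\<^sup>2 * (v powr (-2 * \<theta>) * indicator {1..} v))"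
      proof cases
        case 2
        then have "norm (indicator {0<..} v * min 1 ((scale v)\<^sup>2)) \<le> 1" by simp
        also have "\<dots> \<le> norm (indicator {0<..1} v + b\<^sup>2 * (v powr (-2 * \<theta>) * indicator {1..} v))"
          using 2 by (simp add: indicator_def)
        finally show ?thesis .
      next
        case 3
        then show ?thesis using sq by (simp add: indicator_def)
      qed simp
    qed
  qed measurable
qed

lemma integrable_cos_scale: "integrable lborel (\<lambda>v. indicator {0<..} v * (cos (\<xi> * scale v) - 1))"
proof (rule Bochner_Integration.integrable_bound)
  show "integrable lborel (\<lambda>v. (2 + \<xi>\<^sup>2) * (indicator {0<..} v * min 1 ((scale v)\<^sup>2)))"
    using integrable_min_scale by auto
  show "AE v in lborel. norm (indicator {0<..} v * (cos (\<xi> * scale v) - 1)) \<le> norm ((2 + \<xi>\<^sup>2) * (indicator {0<..} v * min 1 ((scale v)\<^sup>2)))"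
    using abs_cos_minus_one_le[of \<xi>] by (intro always_eventually allI) (auto simp: indicator_def abs_mult)
qed measurable

text \<open>The Levy exponent of the limit in the variable of \<open>scale\<close>; real because the
  law is symmetric.\<close>

definition exponent :: "real \<Rightarrow> real" where
  "exponent \<xi> = (\<integral>v. indicator {0<..} v * (cos (\<xi> * scale v) - 1) \<partial>lborel)"

text \<open>Cutting at \<open>c\<close> removes the small jumps. At \<open>c = 1\<close> this is the
  Pareto characteristic function minus \<open>1\<close>, and each renormalisation doubles
  \<open>c\<close>.\<close>

definition part_exponent :: "real \<Rightarrow> real \<Rightarrow> real" where
  "part_exponent c \<xi> = (\<integral>v. indicator {0<..c} v * (cos (\<xi> * scale v) - 1) \<partial>lborel)"

lemma exponent_nonpos: "exponent \<xi> \<le> 0"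
proof -
  have "0 \<le> (\<integral>v. - (indicator {0<..} v * (cos (\<xi> * scale v) - 1)) \<partial>lborel)"
    by (rule Bochner_Integration.integral_nonneg) (auto simp: indicator_def)
  then show ?thesis unfolding exponent_def Bochner_Integration.integral_minus by simp
qed

lemma scale_mult: "t > 0 \<Longrightarrow> t powr \<theta> * scale (t * v) = scale v"
  by (simp add: scale_def powr_mult powr_minus)

text \<open>The substitution of \<open>t * v\<close> for \<open>v\<close>; this is the
  self-similarity of the limit law.\<close>

lemma exponent_scaling:
  assumes "t > 0"
  shows "exponent (t powr \<theta> * \<xi>) = t * exponent \<xi>"
proof -
  let ?f = "\<lambda>v. indicator {0<..} v * (cos (t powr \<theta> * \<xi> * scale v) - 1)"
  have "exponent (t powr \<theta> * \<xi>) = \<bar>t\<bar> *\<^sub>R (\<integral>v. ?f (0 + t * v) \<partial>lborel)"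
    unfolding exponent_def using assms by (intro lborel_integral_real_affine) auto
  also have "(\<lambda>v. ?f (0 + t * v)) = (\<lambda>v. indicator {0<..} v * (cos (\<xi> * scale v) - 1))"
  proof
    fix v
    have "t powr \<theta> * \<xi> * scale (t * v) = \<xi> * scale v" using scale_mult[OF assms, of v] by (simp add: mult_ac)
    moreover have "indicator {0<..} (t * v) = (indicator {0<..} v :: real)"
      using assms by (simp add: indicator_def zero_less_mult_iff)
    ultimately show "?f (0 + t * v) = indicator {0<..} v * (cos (\<xi> * scale v) - 1)"
      by (simp only: add_0)
  qed
  finally show ?thesis using assms by (simp add: exponent_def)
qed

lemma part_exponent_scaling:
  assumes "t > 0"
  shows "part_exponent 1 (t powr \<theta> * \<xi>) = t * part_exponent (1 / t) \<xi>"
proof -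
  let ?f = "\<lambda>v. indicator {0<..1} v * (cos (t powr \<theta> * \<xi> * scale v) - 1)"
  have "part_exponent 1 (t powr \<theta> * \<xi>) = \<bar>t\<bar> *\<^sub>R (\<integral>v. ?f (0 + t * v) \<partial>lborel)"
    unfolding part_exponent_def using assms by (intro lborel_integral_real_affine) auto
  also have "(\<lambda>v. ?f (0 + t * v)) = (\<lambda>v. indicator {0<..1 / t} v * (cos (\<xi> * scale v) - 1))"
  proof
    fix v
    have "t powr \<theta> * \<xi> * scale (t * v) = \<xi> * scale v" using scale_mult[OF assms, of v] by (simp add: mult_ac)
    moreover have "indicator {0<..1} (t * v) = (indicator {0<..1 / t} v :: real)"
      using assms by (simp add: indicator_def zero_less_mult_iff field_simps)
    ultimately show "?f (0 + t * v) = indicator {0<..1 / t} v * (cos (\<xi> * scale v) - 1)"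
      by (simp only: add_0)
  qed
  finally show ?thesis using assms by (simp add: part_exponent_def)
qed

lemma part_exponent_tendsto: "(\<lambda>j. part_exponent (2 ^ j) \<xi>) \<longlonglongrightarrow> exponent \<xi>"
  unfolding part_exponent_def exponent_def
proof (rule integral_dominated_convergence[where w = "\<lambda>v. \<bar>indicator {0<..} v * (cos (\<xi> * scale v) - 1)\<bar>"])
  show "integrable lborel (\<lambda>v. \<bar>indicator {0<..} v * (cos (\<xi> * scale v) - 1)\<bar>)"
    by (rule integrable_abs[OF integrable_cos_scale])
  show "AE v in lborel. (\<lambda>j. indicator {0<..2 ^ j} v * (cos (\<xi> * scale v) - 1)) \<longlonglongrightarrow> indicator {0<..} v * (cos (\<xi> * scale v) - 1)"
  proof (intro always_eventually allI tendsto_mult_right)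
    fix v :: real
    obtain j0 :: nat where j0: "v < 2 ^ j0" using real_arch_pow[of 2 v] by auto
    have "eventually (\<lambda>j. indicator {0<..2 ^ j} v = (indicator {0<..} v :: real)) sequentially"
    proof (rule eventually_sequentiallyI[of j0])
      fix j assume "j0 \<le> j"
      then have "(2::real) ^ j0 \<le> 2 ^ j" by (intro power_increasing) auto
      then have "v \<le> 2 ^ j" using j0 by linarith
      then show "indicator {0<..2 ^ j} v = (indicator {0<..} v :: real)" by (auto simp: indicator_def)
    qed
    then show "(\<lambda>j. indicator {0<..2 ^ j} v :: real) \<longlonglongrightarrow> indicator {0<..} v" by (rule tendsto_eventually)
  qed
  show "AE v in lborel. norm (indicator {0<..2 ^ j} v * (cos (\<xi> * scale v) - 1)) \<le> \<bar>indicator {0<..} v * (cos (\<xi> * scale v) - 1)\<bar>" for j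
    by (intro always_eventually allI) (auto simp: indicator_def)
qed measurable

text \<open>By symmetry the sine part cancels, and each half of the uniform law gives half of the
  cosine integral.\<close>

lemma char_pareto: "char (pareto b \<theta>) \<xi> = of_real (1 + part_exponent 1 \<xi>)"
proof (rule complex_eqI)
  let ?X = "pareto_map b \<theta>"
  have [measurable]: "(\<lambda>x. iexp (\<xi> * x)) \<in> borel_measurable borel" by measurable
  have int: "integrable unif_sym (\<lambda>u. iexp (\<xi> * ?X u))"
    by (rule unif_sym.integrable_const_bound[of _ 1]) auto
  have c: "char (pareto b \<theta>) \<xi> = (\<integral>u. iexp (\<xi> * ?X u) \<partial>unif_sym)"
    unfolding char_def pareto_def by (subst integral_distr) auto
  have dens: "(\<integral>u. f u \<partial>unif_sym) = (\<integral>u. (indicator {-1..1} u / 2) * f u \<partial>lborel)" if "f \<in> borel_measurable borel" for f :: "real \<Rightarrow> real"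
    unfolding unif_sym_def using that by (subst integral_real_density) (auto simp: indicator_def)
  have "Im (char (pareto b \<theta>) \<xi>) = (\<integral>u. sin (\<xi> * ?X u) \<partial>unif_sym)"
    unfolding c using int by (subst integral_Im[symmetric]) (auto simp: Im_exp)
  also have "\<dots> = 0"
  proof -
    let ?f = "\<lambda>u. (indicator {-1..1} u / 2) * sin (\<xi> * ?X u)"
    have "(\<integral>u. ?f u \<partial>lborel) = - (\<integral>u. ?f u \<partial>lborel)"
    proof -
      have "(\<integral>u. ?f u \<partial>lborel) = (\<integral>u. ?f (0 + (-1) * u) \<partial>lborel)"
        using lborel_integral_real_affine[of "-1" ?f 0] by simp
      also have "\<dots> = (\<integral>u. - ?f u \<partial>lborel)"
        by (intro Bochner_Integration.integral_cong refl) (auto simp: pareto_map_def indicator_def)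
      finally show ?thesis unfolding Bochner_Integration.integral_minus .
    qed
    then have "(\<integral>u. ?f u \<partial>lborel) = 0" by linarith
    then show ?thesis by (subst dens) auto
  qed
  finally show "Im (char (pareto b \<theta>) \<xi>) = Im (complex_of_real (1 + part_exponent 1 \<xi>))" by simp
  have "Re (char (pareto b \<theta>) \<xi>) = (\<integral>u. cos (\<xi> * ?X u) \<partial>unif_sym)"
    unfolding c using int by (subst integral_Re[symmetric]) (auto simp: Re_exp)
  also have "\<dots> = 1 + (\<integral>u. cos (\<xi> * ?X u) - 1 \<partial>unif_sym)"
  proof -
    have "integrable unif_sym (\<lambda>u. cos (\<xi> * ?X u))"
      by (rule unif_sym.integrable_const_bound[of _ 1]) auto
    then show ?thesis using unif_sym.prob_space by simp
  qed
  also have "(\<integral>u. cos (\<xi> * ?X u) - 1 \<partial>unif_sym) = part_exponent 1 \<xi>"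
  proof -
    let ?h = "\<lambda>v. indicator {0<..1} v * (cos (\<xi> * scale v) - 1)"
    have hint: "integrable lborel ?h"
      by (rule Bochner_Integration.integrable_bound[OF integrable_cos_scale[of \<xi>]]) (auto simp: indicator_def)
    have hint': "integrable lborel (\<lambda>v. ?h (0 + (-1) * v))"
      using lborel_integrable_real_affine[OF hint, of "-1" 0] by simp
    have "(\<integral>u. cos (\<xi> * ?X u) - 1 \<partial>unif_sym) = (\<integral>u. (indicator {-1..1} u / 2) * (cos (\<xi> * ?X u) - 1) \<partial>lborel)"
      by (rule dens) measurable
    also have "\<dots> = (\<integral>u. (?h u + ?h (0 + (-1) * u)) / 2 \<partial>lborel)"
    proof (intro Bochner_Integration.integral_cong refl)
      fix u :: real
      consider "u > 0" | "u < 0" | "u = 0" by linarith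
      then show "(indicator {-1..1} u / 2) * (cos (\<xi> * ?X u) - 1) = (?h u + ?h (0 + (-1) * u)) / 2"
        by cases (auto simp: pareto_map_def scale_def indicator_def)
    qed
    also have "\<dots> = ((\<integral>u. ?h u \<partial>lborel) + (\<integral>u. ?h (0 + (-1) * u) \<partial>lborel)) / 2"
      using hint hint' by simp
    also have "(\<integral>u. ?h (0 + (-1) * u) \<partial>lborel) = (\<integral>u. ?h u \<partial>lborel)"
      using lborel_integral_real_affine[of "-1" ?h 0] by simp
    finally show ?thesis by (simp add: part_exponent_def)
  qed
  finally show "Re (char (pareto b \<theta>) \<xi>) = Re (complex_of_real (1 + part_exponent 1 \<xi>))" by simp
qed

lemma char_renorm:
  assumes "real_distribution \<mu>"
  shows "char (renorm k \<mu>) \<xi> = (char \<mu> (k * \<xi>))\<^sup>2"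
proof -
  interpret real_distribution \<mu> by fact
  interpret P: pair_prob_space \<mu> \<mu> ..
  have ind: "P.P.indep_var borel (\<lambda>z. fst z) borel (\<lambda>z. snd z)"
    using indep_var_pair[OF prob_space_axioms, of "\<lambda>x. x" "\<lambda>x. x"] by simp
  have fst: "distr (\<mu> \<Otimes>\<^sub>M \<mu>) borel fst = \<mu>"
  proof -
    have "distr (\<mu> \<Otimes>\<^sub>M \<mu>) borel fst = distr (\<mu> \<Otimes>\<^sub>M \<mu>) \<mu> fst" by (rule distr_cong) auto
    then show ?thesis by (simp add: distr_pair_fst)
  qed
  have snd: "distr (\<mu> \<Otimes>\<^sub>M \<mu>) borel snd = \<mu>"
  proof -
    have "distr (\<mu> \<Otimes>\<^sub>M \<mu>) borel snd = distr (\<mu> \<Otimes>\<^sub>M \<mu>) \<mu> snd" by (rule distr_cong) auto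
    then show ?thesis by (simp add: distr_pair_snd prob_space_axioms)
  qed
  have [measurable]: "fst \<in> borel_measurable (\<mu> \<Otimes>\<^sub>M \<mu>)" "snd \<in> borel_measurable (\<mu> \<Otimes>\<^sub>M \<mu>)" by measurable
  have "char (renorm k \<mu>) \<xi> = (\<integral>z. iexp (\<xi> * (k * (fst z + snd z))) \<partial>(\<mu> \<Otimes>\<^sub>M \<mu>))"
    unfolding char_def renorm_def by (subst integral_distr) auto
  also have "\<dots> = (\<integral>z. iexp (k * \<xi> * (fst z + snd z)) \<partial>(\<mu> \<Otimes>\<^sub>M \<mu>))" by (simp add: mult_ac)
  also have "\<dots> = char (distr (\<mu> \<Otimes>\<^sub>M \<mu>) borel (\<lambda>z. fst z + snd z)) (k * \<xi>)"
    unfolding char_def by (subst integral_distr) auto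
  also have "\<dots> = char (distr (\<mu> \<Otimes>\<^sub>M \<mu>) borel (\<lambda>z. fst z)) (k * \<xi>) * char (distr (\<mu> \<Otimes>\<^sub>M \<mu>) borel (\<lambda>z. snd z)) (k * \<xi>)"
    by (rule P.P.char_distr_add[OF ind])
  also have "\<dots> = (char \<mu> (k * \<xi>))\<^sup>2" using fst snd by (simp add: power2_eq_square)
  finally show ?thesis .
qed

lemma char_pareto_sum: "char (pareto_sum b \<theta> j) \<xi> = of_real ((1 + part_exponent 1 ((1 / 2 ^ j) powr \<theta> * \<xi>)) ^ (2 ^ j))"
proof (induction j arbitrary: \<xi>)
  case (Suc j)
  have k: "(1 / 2 ^ j) powr \<theta> * (2 powr (-\<theta>) * \<xi>) = (1 / 2 ^ Suc j) powr \<theta> * \<xi>"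
    by (simp add: powr_divide powr_mult powr_minus_divide)
  show ?case unfolding pareto_sum_Suc char_renorm[OF real_distribution_pareto_sum] Suc k
    by (simp add: power_mult[symmetric] mult.commute)
qed (simp add: char_pareto)

text \<open>By scaling this is the limit of \<open>(1 + I j / 2 ^ j) ^ (2 ^ j)\<close> with
  \<open>I j\<close> tending to \<open>exponent \<xi>\<close>. The varying \<open>I j\<close> is
  replaced by its limit through \<open>|x ^ k - y ^ k| \<le> k * |x - y|\<close> for numbers of
  modulus at most \<open>1\<close>.\<close>

lemma char_pareto_sum_tendsto: "(\<lambda>j. char (pareto_sum b \<theta> j) \<xi>) \<longlonglongrightarrow> of_real (exp (exponent \<xi>))"
proof -
  define g where "g = exponent \<xi>"
  define I where "I = (\<lambda>j. part_exponent (2 ^ j) \<xi>)"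
  have z: "part_exponent 1 ((1 / 2 ^ j) powr \<theta> * \<xi>) = I j / 2 ^ j" for j
    using part_exponent_scaling[of "1 / 2 ^ j" \<xi>] by (simp add: I_def)
  \<comment> \<open>Read off from the modulus of a characteristic function instead of estimating the
    integral.\<close>
  have abs_le: "\<bar>1 + I j / 2 ^ j\<bar> \<le> 1" for j
  proof -
    interpret real_distribution "pareto b \<theta>" by (rule real_distribution_pareto)
    have "cmod (char (pareto b \<theta>) ((1 / 2 ^ j) powr \<theta> * \<xi>)) \<le> 1" by (rule cmod_char_le_1)
    then show ?thesis unfolding char_pareto z norm_of_real .
  qed
  have lim: "(\<lambda>j. (1 + g / 2 ^ j) ^ (2 ^ j)) \<longlonglongrightarrow> exp g"
  proof -
    have "filterlim (\<lambda>j::nat. (2::nat) ^ j) sequentially sequentially"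
      by (rule filterlim_subseq) (simp add: strict_mono_def)
    from filterlim_compose[OF tendsto_exp_limit_sequentially this, of g] show ?thesis by simp
  qed
  have "(\<lambda>j. (1 + I j / 2 ^ j) ^ (2 ^ j) - (1 + g / 2 ^ j) ^ (2 ^ j)) \<longlonglongrightarrow> 0"
  proof (rule Lim_null_comparison)
    obtain j0 :: nat where j0: "\<bar>g\<bar> < 2 ^ j0" using real_arch_pow[of 2 "\<bar>g\<bar>"] by auto
    show "eventually (\<lambda>j. norm ((1 + I j / 2 ^ j) ^ (2 ^ j) - (1 + g / 2 ^ j) ^ (2 ^ j)) \<le> \<bar>I j - g\<bar>) sequentially"
    proof (rule eventually_sequentiallyI[of j0])
      fix j assume "j0 \<le> j"
      then have "(2::real) ^ j0 \<le> 2 ^ j" by (intro power_increasing) auto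
      then have "\<bar>g\<bar> \<le> 2 ^ j" using j0 by linarith
      then have "- 1 \<le> g / 2 ^ j" by (simp add: field_simps)
      moreover have "g / 2 ^ j \<le> 0" using exponent_nonpos by (simp add: g_def divide_nonpos_pos)
      ultimately have g1: "\<bar>1 + g / 2 ^ j\<bar> \<le> 1" by simp
      have "norm ((1 + I j / 2 ^ j) ^ (2 ^ j) - (1 + g / 2 ^ j) ^ (2 ^ j)) \<le> real (2 ^ j) * norm ((1 + I j / 2 ^ j) - (1 + g / 2 ^ j))"
        using abs_le g1 by (intro norm_power_diff) auto
      also have "(1 + I j / 2 ^ j) - (1 + g / 2 ^ j) = (I j - g) / 2 ^ j" by (simp add: diff_divide_distrib)
      finally show "norm ((1 + I j / 2 ^ j) ^ (2 ^ j) - (1 + g / 2 ^ j) ^ (2 ^ j)) \<le> \<bar>I j - g\<bar>" by simp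
    qed
    have "(\<lambda>j. \<bar>I j - g\<bar>) \<longlonglongrightarrow> \<bar>g - g\<bar>" unfolding I_def g_def by (intro tendsto_intros part_exponent_tendsto)
    then show "(\<lambda>j. \<bar>I j - g\<bar>) \<longlonglongrightarrow> 0" by simp
  qed
  from tendsto_add[OF this lim] have "(\<lambda>j. (1 + I j / 2 ^ j) ^ (2 ^ j)) \<longlonglongrightarrow> exp g" by simp
  then have "(\<lambda>j. complex_of_real ((1 + I j / 2 ^ j) ^ (2 ^ j))) \<longlonglongrightarrow> of_real (exp g)" by (rule tendsto_of_real)
  then show ?thesis unfolding char_pareto_sum z g_def .
qed

section \<open>Identification with the exponent of the stable Levy measure\<close>

abbreviation levy_density :: "real \<Rightarrow> real" where
  "levy_density u \<equiv> b powr (1 / \<theta>) * (1 / \<theta>) / 2 / \<bar>u\<bar> powr (1 + 1 / \<theta>)"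

lemma scale_image: "scale ` {0<..} = {0<..}"
proof (intro equalityI subsetI)
  fix x :: real assume "x \<in> {0<..}"
  then have x: "x > 0" by simp
  have "scale ((x / b) powr (-1 / \<theta>)) = x" using x b \<theta>_pos by (simp add: scale_def powr_powr)
  moreover have "(x / b) powr (-1 / \<theta>) > 0" using x b by simp
  ultimately show "x \<in> scale ` {0<..}" by (metis greaterThan_iff imageI)
qed (use b in \<open>auto simp: scale_def\<close>)

text \<open>The Jacobian of \<open>scale\<close> times \<open>levy_density\<close> along it is
  constantly \<open>1 / 2\<close>. The substitution theorem speaks of absolute integrability for
  Lebesgue measure, hence the passage from \<open>lborel\<close> and back.\<close>

lemma levy_density_change_of_variables:
  fixes F :: "real \<Rightarrow> real"
  assumes F: "F \<in> borel_measurable borel" and int: "integrable lborel (\<lambda>v. indicator {0<..} v * F (scale v))"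
  shows "integrable lborel (\<lambda>x. indicator {0<..} x * (levy_density x * F x))"
    and "(\<integral>x. indicator {0<..} x * (levy_density x * F x) \<partial>lborel) = (\<integral>v. indicator {0<..} v * F (scale v) \<partial>lborel) / 2"
proof -
  note F [measurable]
  let ?f = "\<lambda>x. levy_density x * F x" and ?g' = "\<lambda>v. b * (-\<theta> * v powr (-\<theta> - 1))"
  let ?h = "\<lambda>v. F (scale v) / 2"
  have der: "(scale has_field_derivative ?g' v) (at v within {0<..})" if "v \<in> {0<..}" for v
    unfolding scale_def using that by (auto intro!: derivative_eq_intros)
  have inj: "inj_on scale {0<..}"
  proof (rule inj_onI)
    fix x y assume xy: "x \<in> {0<..}" "y \<in> {0<..}" "scale x = scale y"
    then have "(x powr (-\<theta>)) powr (-1 / \<theta>) = (y powr (-\<theta>)) powr (-1 / \<theta>)" using b by (simp add: scale_def)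
    then show "x = y" using xy \<theta>_pos by (simp add: powr_powr)
  qed
  have eq: "\<bar>?g' v\<bar> * ?f (scale v) = ?h v" if v: "v \<in> {0<..}" for v
  proof -
    have v0: "v > 0" using v by simp
    have "(scale v) powr (1 + 1 / \<theta>) = b powr (1 + 1 / \<theta>) * v powr (- \<theta> - 1)"
    proof -
      have "-\<theta> * (1 + 1 / \<theta>) = -\<theta> - 1" using \<theta>_pos by (simp add: field_simps)
      then show ?thesis by (simp only: scale_def powr_mult powr_powr)
    qed
    moreover have "scale v > 0" using v0 b by (simp add: scale_def)
    moreover have "b powr (1 + 1 / \<theta>) = b * b powr (1 / \<theta>)" using b by (simp add: powr_add)
    moreover have "v powr (- \<theta> - 1) > 0" "b powr (1 / \<theta>) > 0" using v0 b by auto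
    ultimately show ?thesis using b \<theta>_pos by (simp add: abs_mult field_simps)
  qed
  have lb: "set_integrable lebesgue S f \<longleftrightarrow> integrable lborel (\<lambda>x. indicator S x * f x)"
    "(\<integral>x. indicator S x * f x \<partial>lebesgue) = (\<integral>x. indicator S x * f x \<partial>lborel)"
    if [measurable]: "f \<in> borel_measurable borel" "S \<in> sets borel" for f :: "real \<Rightarrow> real" and S
    by (simp_all add: set_integrable_def integrable_completion integral_completion)
  have hm: "?h \<in> borel_measurable borel" and fm: "?f \<in> borel_measurable borel" by measurable
  have hint: "integrable lborel (\<lambda>v. indicator {0<..} v * ?h v)" using int by simp
  then have h_abs: "?h absolutely_integrable_on {0<..}" using lb(1)[OF hm, of "{0<..}"] by simp
  have "(\<lambda>v. \<bar>?g' v\<bar> * ?f (scale v)) absolutely_integrable_on {0<..} \<longleftrightarrow> ?h absolutely_integrable_on {0<..}"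
    by (rule set_integrable_cong) (use eq in auto)
  then have 1: "(\<lambda>v. \<bar>?g' v\<bar> * ?f (scale v)) absolutely_integrable_on {0<..}" using h_abs by simp
  have "integral {0<..} (\<lambda>v. \<bar>?g' v\<bar> * ?f (scale v)) = integral {0<..} ?h"
    by (rule Henstock_Kurzweil_Integration.integral_cong) (use eq in auto)
  with 1 have f: "?f absolutely_integrable_on (scale ` {0<..}) \<and> integral (scale ` {0<..}) ?f = integral {0<..} ?h"
    using has_absolute_integral_change_of_variables_1'[of "{0<..}" scale ?g' ?f "integral {0<..} ?h"] der inj by auto
  then have f_abs: "?f absolutely_integrable_on {0<..}" and f_int: "integral {0<..} ?f = integral {0<..} ?h"
    unfolding scale_image by auto
  show "integrable lborel (\<lambda>x. indicator {0<..} x * (levy_density x * F x))"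
    using f_abs lb(1)[OF fm, of "{0<..}"] by simp
  have "(\<integral>x. indicator {0<..} x * ?f x \<partial>lborel) = integral {0<..} ?f"
    using set_lebesgue_integral_eq_integral(2)[OF f_abs] lb(2)[OF fm, of "{0<..}"] by (simp add: set_lebesgue_integral_def)
  also have "\<dots> = (\<integral>v. indicator {0<..} v * ?h v \<partial>lborel)"
    using set_lebesgue_integral_eq_integral(2)[OF h_abs] lb(2)[OF hm, of "{0<..}"] f_int by (simp add: set_lebesgue_integral_def)
  finally show "(\<integral>x. indicator {0<..} x * (levy_density x * F x) \<partial>lborel) = (\<integral>v. indicator {0<..} v * F (scale v) \<partial>lborel) / 2"
    by simp
qed

text \<open>Both half lines contribute equally, which cancels the \<open>1 / 2\<close>.\<close>

lemma levy_measure_even: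
  fixes F :: "real \<Rightarrow> real"
  assumes F: "F \<in> borel_measurable borel" and even: "\<And>x. F (-x) = F x"
    and int: "integrable lborel (\<lambda>v. indicator {0<..} v * F (scale v))"
  shows "integrable lborel (\<lambda>x. levy_density x * F x)"
    and "(\<integral>x. levy_density x * F x \<partial>lborel) = (\<integral>v. indicator {0<..} v * F (scale v) \<partial>lborel)"
proof -
  let ?H = "\<lambda>x. indicator {0<..} x * (levy_density x * F x)"
  note cov = levy_density_change_of_variables[OF F int]
  have i2: "integrable lborel (\<lambda>x. ?H (0 + (-1) * x))"
    using lborel_integrable_real_affine[OF cov(1), of "-1" 0] by simp
  have s: "(\<lambda>x. levy_density x * F x) = (\<lambda>x. ?H x + ?H (0 + (-1) * x))"
  proof
    fix x :: real
    consider "x > 0" | "x < 0" | "x = 0" by linarith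
    then show "levy_density x * F x = ?H x + ?H (0 + (-1) * x)" by cases (auto simp: even)
  qed
  show "integrable lborel (\<lambda>x. levy_density x * F x)" unfolding s using cov(1) i2 by (rule Bochner_Integration.integrable_add)
  have "(\<integral>x. levy_density x * F x \<partial>lborel) = (\<integral>x. ?H x \<partial>lborel) + (\<integral>x. ?H (0 + (-1) * x) \<partial>lborel)"
    unfolding s using cov(1) i2 by (rule Bochner_Integration.integral_add)
  also have "(\<integral>x. ?H (0 + (-1) * x) \<partial>lborel) = (\<integral>x. ?H x \<partial>lborel)"
    using lborel_integral_real_affine[of "-1" ?H 0] by simp
  finally show "(\<integral>x. levy_density x * F x \<partial>lborel) = (\<integral>v. indicator {0<..} v * F (scale v) \<partial>lborel)"
    by (simp only: cov(2))
qed

text \<open>The real part of the integrand is even, so the substitution turns it into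
  \<open>exponent\<close>; the imaginary part, compensator included, is odd against an even density
  and integrates to zero.\<close>

lemma levy_exponent_stable:
  "levy_exponent 0 0 (stable_levy_measure (b powr (1 / \<theta>)) (1 / \<theta>)) \<xi> = of_real (exponent \<xi>)"
proof -
  define \<nu> where "\<nu> = stable_levy_measure (b powr (1 / \<theta>)) (1 / \<theta>)"
  have \<nu>: "\<nu> = density lborel (\<lambda>u. ennreal (levy_density u))" by (simp add: \<nu>_def stable_levy_measure_def)
  have dens0: "levy_density u \<ge> 0" for u using b \<theta>_pos by simp
  let ?f = "\<lambda>u. iexp (\<xi> * u) - 1 - \<i> * of_real (\<xi> * u * indicator {-1<..<1} u)"
  have [measurable]: "?f \<in> borel_measurable borel" by measurable
  have "integrable lborel (\<lambda>x. levy_density x * min 1 (x\<^sup>2))"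
    using integrable_min_scale by (intro levy_measure_even) auto
  then have int_min: "integrable \<nu> (\<lambda>x. min 1 (x\<^sup>2))"
    unfolding \<nu> using dens0 by (subst integrable_real_density) auto
  have intf: "integrable \<nu> ?f"
  proof (rule Bochner_Integration.integrable_bound)
    show "integrable \<nu> (\<lambda>x. (2 + \<xi>\<^sup>2) * min 1 (x\<^sup>2))" using int_min by auto
    show "?f \<in> borel_measurable \<nu>" by (simp add: \<nu>)
    show "AE u in \<nu>. norm (?f u) \<le> norm ((2 + \<xi>\<^sup>2) * min 1 (u\<^sup>2))"
      using cmod_iexp_compensated_le[of \<xi>] by (intro always_eventually allI) (auto simp: abs_mult)
  qed
  have "(\<integral>u. ?f u \<partial>\<nu>) = of_real (exponent \<xi>)"
  proof (rule complex_eqI)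
    have "Re (\<integral>u. ?f u \<partial>\<nu>) = (\<integral>u. cos (\<xi> * u) - 1 \<partial>\<nu>)"
      using intf by (subst integral_Re[symmetric]) (auto simp: Re_exp)
    also have "\<dots> = (\<integral>u. levy_density u * (cos (\<xi> * u) - 1) \<partial>lborel)"
      unfolding \<nu> using dens0 by (subst integral_real_density) auto
    also have "\<dots> = exponent \<xi>" unfolding exponent_def
      using integrable_cos_scale by (intro levy_measure_even) auto
    finally show "Re (\<integral>u. ?f u \<partial>\<nu>) = Re (complex_of_real (exponent \<xi>))" by simp
    have "Im (\<integral>u. ?f u \<partial>\<nu>) = (\<integral>u. sin (\<xi> * u) - \<xi> * u * indicator {-1<..<1} u \<partial>\<nu>)"
      using intf by (subst integral_Im[symmetric]) (auto simp: Im_exp)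
    also have "\<dots> = (\<integral>u. levy_density u * (sin (\<xi> * u) - \<xi> * u * indicator {-1<..<1} u) \<partial>lborel)"
      unfolding \<nu> using dens0 by (subst integral_real_density) auto
    also have "\<dots> = 0"
    proof -
      let ?g = "\<lambda>u. levy_density u * (sin (\<xi> * u) - \<xi> * u * indicator {-1<..<1} u)"
      have "(\<integral>u. ?g u \<partial>lborel) = (\<integral>u. ?g (0 + (-1) * u) \<partial>lborel)"
        using lborel_integral_real_affine[of "-1" ?g 0] by simp
      also have "\<dots> = (\<integral>u. - ?g u \<partial>lborel)"
      proof (intro Bochner_Integration.integral_cong refl)
        fix u :: real
        have "indicator {-1<..<1} (-u) = (indicator {-1<..<1} u :: real)" by (auto simp: indicator_def)
        then show "?g (0 + (-1) * u) = - ?g u" by (simp add: algebra_simps diff_divide_distrib)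
      qed
      finally have "(\<integral>u. ?g u \<partial>lborel) = - (\<integral>u. ?g u \<partial>lborel)" unfolding Bochner_Integration.integral_minus .
      then show ?thesis by linarith
    qed
    finally show "Im (\<integral>u. ?f u \<partial>\<nu>) = Im (complex_of_real (exponent \<xi>))" by simp
  qed
  then show ?thesis by (simp add: levy_exponent_def \<nu>_def)
qed

end

section \<open>From the Pareto walk to the stable process\<close>

text \<open>Truncation at \<open>K\<close>: the truncated part converges by dominated convergence,
  and the excess is at most \<open>K powr (1 - q)\<close> times the \<open>q\<close>-th moment,
  small for large \<open>K\<close> uniformly in \<open>j\<close>.\<close>

lemma (in prob_space) expectation_abs_diff_tendsto_0:
  fixes Y :: "'a \<Rightarrow> real"
  assumes lim: "\<And>x. x \<in> space M \<Longrightarrow> (\<lambda>j. Yn j x) \<longlonglongrightarrow> Y x"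
    and meas: "\<And>j. Yn j \<in> borel_measurable M" "Y \<in> borel_measurable M"
    and q: "q > 1" and int: "\<And>j. integrable M (\<lambda>x. \<bar>Yn j x - Y x\<bar> powr q)"
    and bnd: "\<And>j. expectation (\<lambda>x. \<bar>Yn j x - Y x\<bar> powr q) \<le> C"
  shows "(\<lambda>j. expectation (\<lambda>x. \<bar>Yn j x - Y x\<bar>)) \<longlonglongrightarrow> 0"
proof (rule LIMSEQ_I)
  fix e :: real assume e: "e > 0"
  note meas [measurable]
  have "((\<lambda>K. C * K powr (1 - q)) \<longlongrightarrow> C * 0) at_top"
    using q by (intro tendsto_mult tendsto_const tendsto_neg_powr filterlim_ident) auto
  then have "eventually (\<lambda>K. C * K powr (1 - q) < e / 2) at_top"
    using e by (intro order_tendstoD(2)) auto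
  from eventually_conj[OF this eventually_gt_at_top[of 0]]
  obtain K where K: "C * K powr (1 - q) < e / 2" "K > 0"
    by (auto simp: eventually_at_top_linorder)
  have pt: "d \<le> min d K + K powr (1 - q) * d powr q" if "d \<ge> 0" for d :: real
  proof (cases "d \<le> K")
    case False
    have "d = d powr (1 - q) * d powr q" using False K by (simp flip: powr_add)
    also have "\<dots> \<le> K powr (1 - q) * d powr q"
      using False K q by (intro mult_right_mono powr_mono2') auto
    finally show ?thesis using False K by simp
  qed simp
  have imin: "integrable M (\<lambda>x. min \<bar>Yn j x - Y x\<bar> K)" for j
    using K by (intro integrable_const_bound[of _ K]) auto
  have "(\<lambda>j. expectation (\<lambda>x. min \<bar>Yn j x - Y x\<bar> K)) \<longlonglongrightarrow> expectation (\<lambda>x. 0)"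
  proof (rule integral_dominated_convergence[where w = "\<lambda>_. K"])
    show "AE x in M. (\<lambda>j. min \<bar>Yn j x - Y x\<bar> K) \<longlonglongrightarrow> 0"
    proof (rule AE_I2)
      fix x assume "x \<in> space M"
      from lim[OF this] have "(\<lambda>j. min \<bar>Yn j x - Y x\<bar> K) \<longlonglongrightarrow> min \<bar>Y x - Y x\<bar> K"
        by (intro tendsto_intros)
      then show "(\<lambda>j. min \<bar>Yn j x - Y x\<bar> K) \<longlonglongrightarrow> 0" using K by simp
    qed
    show "AE x in M. norm (min \<bar>Yn j x - Y x\<bar> K) \<le> K" for j using K by auto
  qed (use K in auto)
  then have "eventually (\<lambda>j. expectation (\<lambda>x. min \<bar>Yn j x - Y x\<bar> K) < e / 2) sequentially"
    using e by (intro order_tendstoD(2)) auto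
  then obtain j0 where j0: "\<And>j. j \<ge> j0 \<Longrightarrow> expectation (\<lambda>x. min \<bar>Yn j x - Y x\<bar> K) < e / 2"
    by (auto simp: eventually_sequentially)
  show "\<exists>no. \<forall>j\<ge>no. norm (expectation (\<lambda>x. \<bar>Yn j x - Y x\<bar>) - 0) < e"
  proof (intro exI[of _ j0] allI impI)
    fix j assume j: "j \<ge> j0"
    have i1: "integrable M (\<lambda>x. min \<bar>Yn j x - Y x\<bar> K + K powr (1 - q) * \<bar>Yn j x - Y x\<bar> powr q)"
      using imin int by auto
    have i2: "integrable M (\<lambda>x. \<bar>Yn j x - Y x\<bar>)"
      by (rule Bochner_Integration.integrable_bound[OF i1]) (use pt in \<open>auto intro!: order_trans[OF _ abs_ge_self]\<close>)
    have "expectation (\<lambda>x. \<bar>Yn j x - Y x\<bar>) \<le> expectation (\<lambda>x. min \<bar>Yn j x - Y x\<bar> K + K powr (1 - q) * \<bar>Yn j x - Y x\<bar> powr q)"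
      using pt by (intro integral_mono i1 i2) auto
    also have "\<dots> = expectation (\<lambda>x. min \<bar>Yn j x - Y x\<bar> K) + K powr (1 - q) * expectation (\<lambda>x. \<bar>Yn j x - Y x\<bar> powr q)"
      using imin int by simp
    also have "\<dots> \<le> expectation (\<lambda>x. min \<bar>Yn j x - Y x\<bar> K) + K powr (1 - q) * C"
      by (intro add_left_mono mult_left_mono bnd) auto
    also have "\<dots> < e / 2 + e / 2" using j0[OF j] K by (intro add_strict_mono) (auto simp: mult.commute)
    finally show "norm (expectation (\<lambda>x. \<bar>Yn j x - Y x\<bar>) - 0) < e"
      by (simp add: abs_of_nonneg Bochner_Integration.integral_nonneg)
  qed
qed

context stable_params
begin

text \<open>The continuity theorem gives weak convergence; Skorohod's representation turns it into
  pointwise convergence on one space, a coupling of all iterates with the limit.\<close>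

lemma stable_limit:
  assumes \<nu>: "real_distribution \<nu>" and char: "\<And>\<xi>. char \<nu> \<xi> = of_real (exp (exponent \<xi>))"
  shows "\<exists>(\<Omega> :: real measure) Yn Y. prob_space \<Omega> \<and> (\<forall>j. Yn j \<in> borel_measurable \<Omega> \<and> distr \<Omega> borel (Yn j) = pareto_sum b \<theta> j) \<and>
    Y \<in> borel_measurable \<Omega> \<and> distr \<Omega> borel Y = \<nu> \<and> (\<forall>x\<in>space \<Omega>. (\<lambda>j. Yn j x) \<longlonglongrightarrow> Y x)"
proof -
  have "weak_conv_m (pareto_sum b \<theta>) \<nu>"
    using \<nu> real_distribution_pareto_sum char_pareto_sum_tendsto char by (intro levy_continuity) auto
  from Skorohod[OF real_distribution_pareto_sum \<nu> this] show ?thesis by auto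
qed

text \<open>Fatou's lemma along the Skorohod representation, from the moments of the normalised
  sums, which are bounded in \<open>j\<close>.\<close>

lemma stable_moment:
  assumes \<nu>: "real_distribution \<nu>" and char: "\<And>\<xi>. char \<nu> \<xi> = of_real (exp (exponent \<xi>))"
    and s: "1 \<le> s" "\<theta> * s < 1"
  shows "\<exists>m>0. (\<integral>\<^sup>+x. ennreal (\<bar>x\<bar> powr s) \<partial>\<nu>) \<le> ennreal m"
proof -
  obtain \<Omega> :: "real measure" and Yn Y where \<Omega>: "prob_space \<Omega>" "\<And>j. Yn j \<in> borel_measurable \<Omega>"
    "\<And>j. distr \<Omega> borel (Yn j) = pareto_sum b \<theta> j" "Y \<in> borel_measurable \<Omega>" "distr \<Omega> borel Y = \<nu>"
    "\<And>x. x \<in> space \<Omega> \<Longrightarrow> (\<lambda>j. Yn j x) \<longlonglongrightarrow> Y x"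
    using stable_limit[OF \<nu> char] by blast
  note [measurable] = \<Omega>(2,4)
  obtain C where C: "\<And>j. integrable (pareto_sum b \<theta> j) (\<lambda>x. \<bar>x\<bar> powr s)" "\<And>j. (\<integral>x. \<bar>x\<bar> powr s \<partial>pareto_sum b \<theta> j) \<le> C"
    using pareto_sum_moment[OF b \<theta>(1) s] by blast
  have "(\<integral>\<^sup>+x. ennreal (\<bar>x\<bar> powr s) \<partial>\<nu>) = (\<integral>\<^sup>+x. ennreal (\<bar>Y x\<bar> powr s) \<partial>\<Omega>)"
    unfolding \<Omega>(5)[symmetric] by (subst nn_integral_distr) auto
  also have "\<dots> = (\<integral>\<^sup>+x. liminf (\<lambda>j. ennreal (\<bar>Yn j x\<bar> powr s)) \<partial>\<Omega>)"
  proof (intro nn_integral_cong)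
    fix x assume "x \<in> space \<Omega>"
    from \<Omega>(6)[OF this] have "(\<lambda>j. ennreal (\<bar>Yn j x\<bar> powr s)) \<longlonglongrightarrow> ennreal (\<bar>Y x\<bar> powr s)"
      using s by (intro tendsto_ennrealI tendsto_powr' tendsto_rabs tendsto_const) auto
    then show "ennreal (\<bar>Y x\<bar> powr s) = liminf (\<lambda>j. ennreal (\<bar>Yn j x\<bar> powr s))"
      by (intro lim_imp_Liminf[symmetric]) auto
  qed
  also have "\<dots> \<le> liminf (\<lambda>j. \<integral>\<^sup>+x. ennreal (\<bar>Yn j x\<bar> powr s) \<partial>\<Omega>)"
    by (rule nn_integral_liminf) measurable
  also have "\<dots> \<le> liminf (\<lambda>j::nat. ennreal (max 1 C))"
  proof (intro Liminf_mono always_eventually allI)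
    fix j
    have "(\<integral>\<^sup>+x. ennreal (\<bar>Yn j x\<bar> powr s) \<partial>\<Omega>) = (\<integral>\<^sup>+x. ennreal (\<bar>x\<bar> powr s) \<partial>pareto_sum b \<theta> j)"
      unfolding \<Omega>(3)[symmetric] by (subst nn_integral_distr) auto
    also have "\<dots> = ennreal (\<integral>x. \<bar>x\<bar> powr s \<partial>pareto_sum b \<theta> j)"
      using C(1) by (intro nn_integral_eq_integral) auto
    also have "\<dots> \<le> ennreal (max 1 C)" using C(2)[of j] by (intro ennreal_leI) auto
    finally show "(\<integral>\<^sup>+x. ennreal (\<bar>Yn j x\<bar> powr s) \<partial>\<Omega>) \<le> ennreal (max 1 C)" .
  qed
  also have "\<dots> = ennreal (max 1 C)" by (intro Liminf_const) auto
  finally show ?thesis by (intro exI[of _ "max 1 C"]) auto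
qed

end

context sob_params
begin

text \<open>At fixed \<open>n\<close> the functional is Lipschitz in the \<open>2 ^ n\<close> steps,
  so convergence in mean of one step suffices. It follows from pointwise convergence and bounded
  moments of an order above \<open>1\<close>.\<close>

lemma walk_functional_tendsto_stable:
  assumes st: "stable_params b \<theta>" and F: "F \<in> Lip1 \<eta> p"
    and \<nu>: "real_distribution \<nu>" and char: "\<And>\<xi>. char \<nu> \<xi> = of_real (exp (stable_params.exponent b \<theta> \<xi>))"
  shows "(\<lambda>j. walk_functional F n h (pareto_sum b \<theta> j)) \<longlonglongrightarrow> walk_functional F n h \<nu>"
proof -
  interpret stable_params b \<theta> by fact
  \<comment> \<open>The midpoint of \<open>1\<close> and \<open>1 / \<theta>\<close>: above
    \<open>1\<close> for uniform integrability, below \<open>1 / \<theta>\<close> for the moments to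
    exist.\<close>
  define q where "q = (1 + 1 / \<theta>) / 2"
  have q: "1 < q" "\<theta> * q < 1" "q \<le> 2" using \<theta> by (auto simp: q_def field_simps)
  obtain \<Omega> :: "real measure" and Yn Y where \<Omega>: "prob_space \<Omega>" "\<And>j. Yn j \<in> borel_measurable \<Omega>"
    "\<And>j. distr \<Omega> borel (Yn j) = pareto_sum b \<theta> j" "Y \<in> borel_measurable \<Omega>" "distr \<Omega> borel Y = \<nu>"
    "\<And>x. x \<in> space \<Omega> \<Longrightarrow> (\<lambda>j. Yn j x) \<longlonglongrightarrow> Y x"
    using stable_limit[OF \<nu> char] by blast
  interpret \<Omega>: prob_space \<Omega> by fact
  note [measurable] = \<Omega>(2,4)
  obtain C where C: "\<And>j. integrable (pareto_sum b \<theta> j) (\<lambda>x. \<bar>x\<bar> powr q)" "\<And>j. (\<integral>x. \<bar>x\<bar> powr q \<partial>pareto_sum b \<theta> j) \<le> C"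
    using pareto_sum_moment[OF b \<theta>(1), of q] q by auto
  obtain m where m: "m > 0" "(\<integral>\<^sup>+x. ennreal (\<bar>x\<bar> powr q) \<partial>\<nu>) \<le> ennreal m"
    using stable_moment[OF \<nu> char, of q] q by auto
  have Yq: "integrable \<Omega> (\<lambda>x. \<bar>Y x\<bar> powr q)" "(\<integral>x. \<bar>Y x\<bar> powr q \<partial>\<Omega>) \<le> m"
  proof -
    have le: "(\<integral>\<^sup>+x. ennreal (\<bar>Y x\<bar> powr q) \<partial>\<Omega>) \<le> ennreal m"
      using m(2) unfolding \<Omega>(5)[symmetric] by (subst (asm) nn_integral_distr) auto
    then show i: "integrable \<Omega> (\<lambda>x. \<bar>Y x\<bar> powr q)"
      by (intro integrableI_bounded) (auto intro: le_less_trans)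
    have "ennreal (\<integral>x. \<bar>Y x\<bar> powr q \<partial>\<Omega>) \<le> ennreal m"
      using le i by (subst nn_integral_eq_integral[symmetric]) auto
    then show "(\<integral>x. \<bar>Y x\<bar> powr q \<partial>\<Omega>) \<le> m" using m(1) by (subst (asm) ennreal_le_iff) auto
  qed
  have Ynq: "integrable \<Omega> (\<lambda>x. \<bar>Yn j x\<bar> powr q)" "(\<integral>x. \<bar>Yn j x\<bar> powr q \<partial>\<Omega>) \<le> C" for j
    using C(1)[of j] C(2)[of j] unfolding \<Omega>(3)[symmetric] by (simp_all add: integrable_distr_eq integral_distr)
  have pt: "\<bar>Yn j x - Y x\<bar> powr q \<le> 2 powr q * (\<bar>Yn j x\<bar> powr q + \<bar>Y x\<bar> powr q)" for j x
  proof -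
    have "\<bar>Yn j x - Y x\<bar> powr q \<le> (\<bar>Yn j x\<bar> + \<bar>Y x\<bar>) powr q" using q by (intro powr_mono2) auto
    also have "\<dots> \<le> 2 powr q * (\<bar>Yn j x\<bar> powr q + \<bar>Y x\<bar> powr q)" using q by (intro powr_add_le) auto
    finally show ?thesis .
  qed
  have i: "integrable \<Omega> (\<lambda>x. 2 powr q * (\<bar>Yn j x\<bar> powr q + \<bar>Y x\<bar> powr q))" for j using Yq Ynq by auto
  have Dq: "integrable \<Omega> (\<lambda>x. \<bar>Yn j x - Y x\<bar> powr q)" for j
    by (rule Bochner_Integration.integrable_bound[OF i[of j]]) (use pt in \<open>auto intro!: order_trans[OF _ abs_ge_self]\<close>)
  have Dq': "(\<integral>x. \<bar>Yn j x - Y x\<bar> powr q \<partial>\<Omega>) \<le> 2 powr q * (C + m)" for j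
  proof -
    have "(\<integral>x. \<bar>Yn j x - Y x\<bar> powr q \<partial>\<Omega>) \<le> (\<integral>x. 2 powr q * (\<bar>Yn j x\<bar> powr q + \<bar>Y x\<bar> powr q) \<partial>\<Omega>)"
      by (intro integral_mono Dq i pt)
    also have "\<dots> = 2 powr q * ((\<integral>x. \<bar>Yn j x\<bar> powr q \<partial>\<Omega>) + (\<integral>x. \<bar>Y x\<bar> powr q \<partial>\<Omega>))" using Yq Ynq by simp
    also have "\<dots> \<le> 2 powr q * (C + m)" using Yq Ynq by (intro mult_left_mono add_mono) auto
    finally show ?thesis .
  qed
  have lim: "(\<lambda>j. \<Omega>.expectation (\<lambda>x. \<bar>Yn j x - Y x\<bar>)) \<longlonglongrightarrow> 0"
    using \<Omega> q Dq Dq' by (intro \<Omega>.expectation_abs_diff_tendsto_0) auto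
  have int: "integrable \<Omega> (Yn j)" "integrable \<Omega> Y" for j
    using Ynq(1)[of j] Yq(1) q \<Omega> by (auto intro!: integrable_abs_powr_imp_integrable[of \<Omega> _ q] \<Omega>.finite_measure_axioms)
  let ?P = "PiM {1..(2::nat)^n} (\<lambda>_. \<Omega>)"
  interpret P: prob_space ?P using \<Omega>(1) by (intro prob_space_PiM)
  have bound: "\<bar>walk_functional F n h (pareto_sum b \<theta> j) - walk_functional F n h \<nu>\<bar> \<le> step_const n h * (2 ^ n * \<Omega>.expectation (\<lambda>x. \<bar>Yn j x - Y x\<bar>))" for j
  proof -
    obtain eq: "walk_functional F n h (pareto_sum b \<theta> j) - walk_functional F n h \<nu> =
        (\<integral>x. F (step_path n h (\<lambda>i. Yn j (x i))) - F (step_path n h (\<lambda>i. Y (x i))) \<partial>?P)"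
      and int': "integrable ?P (\<lambda>x. F (step_path n h (\<lambda>i. Yn j (x i))) - F (step_path n h (\<lambda>i. Y (x i))))"
      using walk_functional_coupling[OF F \<Omega>(1) int(1) \<Omega>(3) int(2) \<Omega>(5)] by blast
    let ?d = "\<lambda>x. \<bar>Yn j x - Y x\<bar>"
    have comp: "integrable ?P (\<lambda>x. ?d (x i))" "(\<integral>x. ?d (x i) \<partial>?P) = \<Omega>.expectation ?d" if i: "i \<in> {1..2^n}" for i
    proof -
      have dm: "?d \<in> borel_measurable \<Omega>" by measurable
      have law: "distr ?P borel (\<lambda>x. ?d (x i)) = distr \<Omega> borel ?d"
        using i by (intro indep_vars_PiM_coordinates(2) \<Omega>(1) dm) auto
      have m: "(\<lambda>x. ?d (x i)) \<in> borel_measurable ?P"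
        by (rule measurable_compose[where f = "\<lambda>x. x i", OF _ dm], rule measurable_component_singleton, rule i)
      have "integrable (distr \<Omega> borel ?d) (\<lambda>z. z)" using int by (subst integrable_distr_eq) auto
      then have "integrable (distr ?P borel (\<lambda>x. ?d (x i))) (\<lambda>z. z)" using law by simp
      then show "integrable ?P (\<lambda>x. ?d (x i))" using m by (subst (asm) integrable_distr_eq) auto
      have "(\<integral>x. ?d (x i) \<partial>?P) = (\<integral>z. z \<partial>distr ?P borel (\<lambda>x. ?d (x i)))"
        using m by (subst integral_distr) auto
      also have "\<dots> = \<Omega>.expectation ?d" unfolding law using dm by (subst integral_distr) auto
      finally show "(\<integral>x. ?d (x i) \<partial>?P) = \<Omega>.expectation ?d" .
    qed
    have "\<bar>walk_functional F n h (pareto_sum b \<theta> j) - walk_functional F n h \<nu>\<bar> \<le>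
      (\<integral>x. \<bar>F (step_path n h (\<lambda>i. Yn j (x i))) - F (step_path n h (\<lambda>i. Y (x i)))\<bar> \<partial>?P)"
      unfolding eq by (rule integral_abs_bound)
    also have "\<dots> \<le> (\<integral>x. step_const n h * (\<Sum>i\<in>{1..2^n}. ?d (x i)) \<partial>?P)"
      using Lip1_step_path_crude[OF F, of n h]
      by (intro integral_mono integrable_abs[OF int'] Bochner_Integration.integrable_mult_right Bochner_Integration.integrable_sum comp(1)) auto
    also have "\<dots> = step_const n h * (\<Sum>i\<in>{1..(2::nat)^n}. \<Omega>.expectation ?d)"
      using comp by (simp add: Bochner_Integration.integral_sum)
    finally show ?thesis by simp
  qed
  have "(\<lambda>j. walk_functional F n h (pareto_sum b \<theta> j) - walk_functional F n h \<nu>) \<longlonglongrightarrow> 0"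
  proof (rule Lim_null_comparison)
    show "eventually (\<lambda>j. norm (walk_functional F n h (pareto_sum b \<theta> j) - walk_functional F n h \<nu>) \<le> step_const n h * (2 ^ n * \<Omega>.expectation (\<lambda>x. \<bar>Yn j x - Y x\<bar>))) sequentially"
      using bound by (intro always_eventually) auto
    have "(\<lambda>j. step_const n h * (2 ^ n * \<Omega>.expectation (\<lambda>x. \<bar>Yn j x - Y x\<bar>))) \<longlonglongrightarrow> step_const n h * (2 ^ n * 0)"
      by (intro tendsto_intros lim)
    then show "(\<lambda>j. step_const n h * (2 ^ n * \<Omega>.expectation (\<lambda>x. \<bar>Yn j x - Y x\<bar>))) \<longlonglongrightarrow> 0" by simp
  qed
  then show ?thesis by (rule LIM_zero_cancel)
qed

text \<open>The successive laws \<open>pareto_sum b \<theta> j\<close> are coupled at geometrically decreasing cost, so the bounds telescope.\<close>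

lemma walk_functional_pareto_stable:
  assumes st: "stable_params b \<theta>" and F: "F \<in> Lip1 \<eta> p"
    and \<nu>: "real_distribution \<nu>" and char: "\<And>\<xi>. char \<nu> \<xi> = of_real (exp (stable_params.exponent b \<theta> \<xi>))"
    and r: "p \<le> r" "r \<le> 2" "\<eta> * r < 1" and h: "h > 0"
    and c: "c > 0" "\<And>j. l2_coupled (c * (2 powr (1 - 2 * \<theta>)) ^ j) (pareto_sum b \<theta> j) (pareto_sum b \<theta> (Suc j))"
  shows "\<bar>walk_functional F n h (pareto b \<theta>) - walk_functional F n h \<nu>\<bar> \<le>
    coupling_const r * (2 powr (1 / r) * c powr (1 / 2)) / (1 - 2 powr (1 / 2 - \<theta>)) * (h * 2 powr (n / r))"
proof -
  interpret stable_params b \<theta> by fact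
  \<comment> \<open>Square root of the contraction factor, since the cost \<open>cj\<close> enters
    the bound through \<open>cj powr (1 / 2)\<close>.\<close>
  define e :: real where "e = 2 powr (1 / 2 - \<theta>)"
  have e: "0 < e" "e < 1" using \<theta> by (auto simp: e_def powr_less_one)
  define B where "B = coupling_const r * (2 powr (1 / r) * c powr (1 / 2)) * (h * 2 powr (n / r))"
  define w where "w = (\<lambda>j. walk_functional F n h (pareto_sum b \<theta> j))"
  have step: "\<bar>w j - w (Suc j)\<bar> \<le> B * e ^ j" for j
  proof -
    obtain Q :: "(real \<times> real) measure" where Q: "prob_space Q" "sets Q = sets borel"
      and law: "distr Q borel fst = pareto_sum b \<theta> j" "distr Q borel snd = pareto_sum b \<theta> (Suc j)"
      and int: "integrable Q fst" "integrable Q snd" and mean: "(\<integral>z. fst z - snd z \<partial>Q) = 0"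
      and sq: "integrable Q (\<lambda>z. (fst z - snd z)\<^sup>2)" "(\<integral>z. (fst z - snd z)\<^sup>2 \<partial>Q) \<le> c * (2 powr (1 - 2 * \<theta>)) ^ j"
      using c(2)[of j] unfolding l2_coupled_def by blast
    define cj where "cj = c * (2 powr (1 - 2 * \<theta>)) ^ j"
    have cj: "cj > 0" using c by (simp add: cj_def)
    have dm: "(\<lambda>z. fst z - snd z) \<in> borel_measurable Q" using int by auto
    have r0: "0 < r" using r p by simp
    note d = l2_coupled_moment[OF Q(1) sq[folded cj_def] cj r0 r(2) dm]
    have "\<bar>w j - w (Suc j)\<bar> \<le> coupling_const r * h * (2 ^ n * (2 * cj powr (r / 2))) powr (1 / r)"
      unfolding w_def using cj
      by (intro walk_functional_diff_le[OF F Q(1) int(1) law(1) int(2) law(2) mean r d(1) d(2)] h) auto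
    also have "(2 ^ n * (2 * cj powr (r / 2))) powr (1 / r) = 2 powr (n / r) * (2 powr (1 / r) * cj powr (1 / 2))"
      using r0 by (simp add: powr_mult powr_powr flip: powr_realpow)
    also have "cj powr (1 / 2) = c powr (1 / 2) * e ^ j"
    proof -
      have "(2 powr (1 - 2 * \<theta>)) ^ j = (e ^ j) powr 2"
      proof -
        have "2 powr (1 - 2 * \<theta>) = e powr 2" by (simp add: e_def powr_powr algebra_simps)
        then show ?thesis using e by (simp add: powr_numeral power_mult[symmetric] mult.commute)
      qed
      then show ?thesis using e by (simp add: cj_def powr_mult powr_powr)
    qed
    finally show ?thesis by (simp add: B_def mult_ac)
  qed
  have B: "B \<ge> 0" using step[of 0] by simp
  have sum: "\<bar>w 0 - w j\<bar> \<le> B / (1 - e)" for j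
  proof -
    have "\<bar>w 0 - w j\<bar> \<le> (\<Sum>i<j. B * e ^ i)"
    proof (induction j)
      case (Suc j)
      then show ?case using step[of j] by simp
    qed simp
    also have "\<dots> = B * (\<Sum>i<j. e ^ i)" by (simp add: sum_distrib_left)
    also have "\<dots> \<le> B * (1 / (1 - e))"
    proof (intro mult_left_mono B)
      have "(\<Sum>i<j. e ^ i) \<le> (\<Sum>i. e ^ i)"
        using e by (intro sum_le_suminf summable_geometric) auto
      also have "\<dots> = 1 / (1 - e)" using e by (intro suminf_geometric) auto
      finally show "(\<Sum>i<j. e ^ i) \<le> 1 / (1 - e)" .
    qed
    finally show ?thesis by simp
  qed
  have "w \<longlonglongrightarrow> walk_functional F n h \<nu>"
    unfolding w_def by (rule walk_functional_tendsto_stable[OF st F \<nu> char])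
  then have "(\<lambda>j. \<bar>w 0 - w j\<bar>) \<longlonglongrightarrow> \<bar>w 0 - walk_functional F n h \<nu>\<bar>"
    by (intro tendsto_intros)
  then have "\<bar>w 0 - walk_functional F n h \<nu>\<bar> \<le> B / (1 - e)"
    by (rule LIMSEQ_le_const2) (use sum in auto)
  then show ?thesis by (simp add: w_def B_def e_def)
qed

end

section \<open>Quantile coupling with the Pareto law\<close>

lemma abs_one_plus_powr_minus_one_le:
  fixes e \<theta> :: real
  assumes "\<bar>e\<bar> \<le> 1 / 2" "0 < \<theta>" "\<theta> \<le> 1"
  shows "\<bar>(1 + e) powr (-\<theta>) - 1\<bar> \<le> 2 * \<bar>e\<bar>"
proof -
  have pos: "1 + e > 0" using assms by linarith
  show ?thesis
  proof (cases "e \<ge> 0")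
    case True
    have "(1 + e) powr (-1) \<le> (1 + e) powr (-\<theta>)" using True assms by (intro powr_mono) auto
    moreover have "(1 + e) powr (-1) = 1 / (1 + e)" using pos by (simp add: powr_minus_divide)
    moreover have "1 - e \<le> 1 / (1 + e)" using True by (simp add: field_simps)
    moreover have "(1 + e) powr (-\<theta>) \<le> 1"
      using powr_mono[of "-\<theta>" 0 "1 + e"] True assms pos by simp
    ultimately show ?thesis using True by simp
  next
    case False
    have "(1 + e) powr (-\<theta>) \<le> (1 + e) powr (-1)" using False pos assms by (intro powr_mono') auto
    moreover have "(1 + e) powr (-1) = 1 / (1 + e)" using pos by (simp add: powr_minus_divide)
    moreover have "1 / (1 + e) \<le> 1 - 2 * e"
    proof -
      have "0 \<le> - e * (1 + 2 * e)" using False assms by (intro mult_nonneg_nonneg) auto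
      then have "1 \<le> (1 - 2 * e) * (1 + e)" by (simp add: algebra_simps)
      then show ?thesis using pos by (simp add: divide_le_eq)
    qed
    moreover have "1 \<le> (1 + e) powr (-\<theta>)"
      using powr_mono'[of "-\<theta>" 0 "1 + e"] False assms pos by simp
    ultimately show ?thesis using False by simp
  qed
qed

context stable_params
begin

text \<open>The solution \<open>t\<close> of
  \<open>b powr (1 / \<theta>) / 2 * t powr (- 1 / \<theta>) = v\<close>: the upper quantile of an
  exact power tail.\<close>

definition tail_quantile :: "real \<Rightarrow> real" where
  "tail_quantile v = (b powr (1 / \<theta>) / 2 / v) powr \<theta>"

text \<open>Write \<open>v = K * y powr (- 1 / \<theta>) * (1 + e)\<close> with \<open>e\<close> of
  order \<open>y powr (-\<gamma>)\<close>. Then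
  \<open>tail_quantile v = y * (1 + e) powr (-\<theta>)\<close>, so the error has order
  \<open>y * |e|\<close>, that is \<open>y powr (1 - \<gamma>)\<close>.\<close>

lemma tail_quantile_close:
  assumes \<gamma>: "0 < \<gamma>" "\<gamma> < 1" and C: "C \<ge> 0"
  shows "\<exists>y1\<ge>1. C * y1 powr (-\<gamma>) \<le> b powr (1 / \<theta>) / 4 \<and> (\<exists>D\<ge>0. \<forall>v y. v > 0 \<longrightarrow> y \<ge> y1 \<longrightarrow>
     \<bar>v - b powr (1 / \<theta>) / 2 * y powr (- 1 / \<theta>)\<bar> \<le> C * y powr (- 1 / \<theta> - \<gamma>) \<longrightarrow>
     \<bar>y - tail_quantile v\<bar> \<le> D * (tail_quantile v) powr (1 - \<gamma>))"
proof -
  define K where "K = b powr (1 / \<theta>) / 2"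
  have K: "K > 0" using b by (simp add: K_def)
  have "((\<lambda>y::real. C * y powr (-\<gamma>)) \<longlongrightarrow> C * 0) at_top"
    using \<gamma> by (intro tendsto_mult tendsto_const tendsto_neg_powr filterlim_ident) auto
  then have "eventually (\<lambda>y::real. C * y powr (-\<gamma>) < K / 2) at_top"
    using K by (intro order_tendstoD(2)) auto
  from eventually_conj[OF this eventually_ge_at_top[of 1]]
  \<comment> \<open>Beyond \<open>y1\<close> the relative error \<open>e\<close> is at most
    \<open>1 / 2\<close>. The bound is part of the conclusion because it also yields positive tails
    later.\<close>
  obtain y1 where y1: "y1 \<ge> 1" "C * y1 powr (-\<gamma>) < K / 2" by (auto simp: eventually_at_top_linorder)
  have "\<bar>y - tail_quantile v\<bar> \<le> (4 * C / K) * (tail_quantile v) powr (1 - \<gamma>)"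
    if v: "v > 0" and y: "y \<ge> y1" and vy: "\<bar>v - K * y powr (- 1 / \<theta>)\<bar> \<le> C * y powr (- 1 / \<theta> - \<gamma>)" for v y
  proof -
    have y0: "y > 0" using y y1 by simp
    define \<tau> where "\<tau> = tail_quantile v"
    have \<tau>: "\<tau> > 0" using v K by (simp add: \<tau>_def tail_quantile_def K_def[symmetric])
    define e where "e = v / (K * y powr (- 1 / \<theta>)) - 1"
    have X: "K * y powr (- 1 / \<theta>) > 0" using K y0 by simp
    then have "e = (v - K * y powr (- 1 / \<theta>)) / (K * y powr (- 1 / \<theta>))"
      unfolding e_def diff_divide_distrib using K y0 by simp
    then have "\<bar>e\<bar> = \<bar>v - K * y powr (- 1 / \<theta>)\<bar> / (K * y powr (- 1 / \<theta>))"
      by (simp only: abs_divide abs_of_pos[OF X])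
    also have "\<dots> \<le> C * y powr (- 1 / \<theta> - \<gamma>) / (K * y powr (- 1 / \<theta>))"
      using vy K by (intro divide_right_mono) auto
    also have "\<dots> = C / K * y powr (-\<gamma>)"
      using y0 by (simp add: powr_diff powr_minus field_simps)
    finally have e1: "\<bar>e\<bar> \<le> C / K * y powr (-\<gamma>)" .
    also have "\<dots> \<le> C / K * y1 powr (-\<gamma>)"
      using y y1 C K \<gamma> by (intro mult_left_mono powr_mono2') auto
    also have "\<dots> \<le> 1 / 2" using y1(2) K by (simp add: field_simps)
    finally have e2: "\<bar>e\<bar> \<le> 1 / 2" .
    have pos: "1 + e > 0" using e2 by linarith
    have "K / v = y powr (1 / \<theta>) * (1 + e) powr (-1)"
      using K v y0 by (simp add: e_def powr_minus field_simps)
    then have "\<tau> = (y powr (1 / \<theta>) * (1 + e) powr (-1)) powr \<theta>"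
      by (simp add: \<tau>_def tail_quantile_def K_def[symmetric])
    also have "\<dots> = y * (1 + e) powr (-\<theta>)"
      unfolding powr_mult powr_powr using y0 \<theta>_pos by simp
    finally have \<tau>eq: "\<tau> = y * (1 + e) powr (-\<theta>)" .
    have "\<bar>y - \<tau>\<bar> = y * \<bar>(1 + e) powr (-\<theta>) - 1\<bar>"
    proof -
      have "y - \<tau> = - (y * ((1 + e) powr (-\<theta>) - 1))" unfolding \<tau>eq by (simp add: algebra_simps)
      then show ?thesis using y0 by (simp add: abs_mult)
    qed
    also have "\<dots> \<le> y * (2 * \<bar>e\<bar>)"
      using y0 e2 \<theta> \<theta>_pos by (intro mult_left_mono abs_one_plus_powr_minus_one_le) auto
    also have "\<dots> \<le> y * (2 * (C / K * y powr (-\<gamma>)))"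
      using y0 e1 by (intro mult_left_mono) auto
    also have "\<dots> = 2 * C / K * y powr (1 - \<gamma>)"
      using y0 powr_mult_base[of y "-\<gamma>"] by (simp add: mult_ac)
    also have "\<dots> \<le> 2 * C / K * (2 * \<tau> powr (1 - \<gamma>))"
    proof (intro mult_left_mono)
      \<comment> \<open>Exchanges \<open>y\<close> for \<open>\<tau>\<close>, so that the error
        bound depends on \<open>v\<close> alone.\<close>
      have "y \<le> 2 * \<tau>"
      proof -
        have "1 / 2 \<le> (1 + e) powr (-\<theta>)"
        proof -
          have "(1 + e) powr \<theta> \<le> 2 powr \<theta>" using pos e2 \<theta>_pos by (intro powr_mono2) auto
          also have "\<dots> \<le> 2 powr 1" using \<theta> by (intro powr_mono) auto
          finally have "(1 + e) powr \<theta> \<le> 2" by simp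
          then show ?thesis using pos by (simp add: powr_minus_divide field_simps)
        qed
        then show ?thesis unfolding \<tau>eq using mult_left_mono[of "1 / 2" "(1 + e) powr (-\<theta>)" y] y0 by simp
      qed
      then have "y powr (1 - \<gamma>) \<le> (2 * \<tau>) powr (1 - \<gamma>)" using y0 \<gamma> by (intro powr_mono2) auto
      also have "\<dots> = 2 powr (1 - \<gamma>) * \<tau> powr (1 - \<gamma>)" by (rule powr_mult)
      also have "\<dots> \<le> 2 powr 1 * \<tau> powr (1 - \<gamma>)" using \<gamma> by (intro mult_right_mono powr_mono) auto
      finally show "y powr (1 - \<gamma>) \<le> 2 * \<tau> powr (1 - \<gamma>)" by simp
    qed (use C K in auto)
    finally show ?thesis by (simp add: \<tau>_def)
  qed
  then show ?thesis using y1 C K unfolding K_def[symmetric]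
    by (intro exI[of _ y1] conjI exI[of _ "4 * C / K"]) (auto simp: K_def)
qed

text \<open>The sets are chosen so that, for a probability law, the tails are
  \<open>1 - cdf \<mu> t\<close> and \<open>cdf \<mu> (-t)\<close>.\<close>

definition has_stable_tails :: "real \<Rightarrow> real \<Rightarrow> real measure \<Rightarrow> bool" where
  "has_stable_tails \<gamma> C \<mu> \<longleftrightarrow> (\<forall>t\<ge>1.
     \<bar>measure \<mu> {t<..} - b powr (1 / \<theta>) / 2 * t powr (- 1 / \<theta>)\<bar> \<le> C * t powr (- 1 / \<theta> - \<gamma>) \<and>
     \<bar>measure \<mu> {..-t} - b powr (1 / \<theta>) / 2 * t powr (- 1 / \<theta>)\<bar> \<le> C * t powr (- 1 / \<theta> - \<gamma>))"

text \<open>The distribution function may jump at the quantile \<open>y\<close>, so the tail at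
  \<open>y\<close> need not equal \<open>v\<close>. It is at least \<open>v\<close> before
  \<open>y\<close> and at most \<open>v\<close> after it; as the bounds of
  \<open>has_stable_tails\<close> are continuous in \<open>t\<close>, limits from both sides give
  the estimate at \<open>y\<close>.\<close>

lemma quantile_tail:
  assumes \<mu>: "cdf_distribution \<mu>" and tails: "has_stable_tails \<gamma> C \<mu>" and \<gamma>: "0 < \<gamma>" "\<gamma> < 1" and C: "C \<ge> 0"
  shows "\<exists>v0 D. 0 < v0 \<and> v0 < 1 / 2 \<and> D \<ge> 0 \<and> (\<forall>v. 0 < v \<longrightarrow> v < v0 \<longrightarrow>
    \<bar>Inf {x. v \<le> cdf \<mu> x} + tail_quantile v\<bar> \<le> D * (tail_quantile v) powr (1 - \<gamma>) \<and>
    \<bar>Inf {x. 1 - v \<le> cdf \<mu> x} - tail_quantile v\<bar> \<le> D * (tail_quantile v) powr (1 - \<gamma>))"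
proof -
  interpret cdf_distribution \<mu> by fact
  define K where "K = b powr (1 / \<theta>) / 2"
  have K: "K > 0" using b by (simp add: K_def)
  obtain y1 D where y1: "y1 \<ge> 1" "C * y1 powr (-\<gamma>) \<le> K / 2" and D: "D \<ge> 0"
    and close: "\<And>v y. v > 0 \<Longrightarrow> y \<ge> y1 \<Longrightarrow> \<bar>v - K * y powr (- 1 / \<theta>)\<bar> \<le> C * y powr (- 1 / \<theta> - \<gamma>) \<Longrightarrow>
      \<bar>y - tail_quantile v\<bar> \<le> D * (tail_quantile v) powr (1 - \<gamma>)"
    using tail_quantile_close[OF \<gamma> C] unfolding K_def by auto
  \<comment> \<open>Here \<open>H\<close> stands for either tail and \<open>y\<close> for the
    modulus of the matching quantile.\<close>
  have generic: "\<bar>y - tail_quantile v\<bar> \<le> D * (tail_quantile v) powr (1 - \<gamma>)"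
    if v: "v > 0" and y: "y > y1" and H: "\<And>t. t \<ge> 1 \<Longrightarrow> \<bar>H t - K * t powr (- 1 / \<theta>)\<bar> \<le> C * t powr (- 1 / \<theta> - \<gamma>)"
      and lo: "\<And>t. t \<ge> 1 \<Longrightarrow> t < y \<Longrightarrow> v \<le> H t" and hi: "\<And>t. t \<ge> 1 \<Longrightarrow> y < t \<Longrightarrow> H t \<le> v" for v y and H :: "real \<Rightarrow> real"
  proof (rule close[OF v])
    have y0: "y > 1" using y y1 by simp
    have cont: "((\<lambda>t. c * t powr (- 1 / \<theta>) + d * t powr (- 1 / \<theta> - \<gamma>)) \<longlongrightarrow> c * y powr (- 1 / \<theta>) + d * y powr (- 1 / \<theta> - \<gamma>)) (at y within S)" for c d S
      using y0 by (intro tendsto_intros) auto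
    have "v \<le> K * y powr (- 1 / \<theta>) + C * y powr (- 1 / \<theta> - \<gamma>)"
    proof (rule tendsto_lowerbound[OF cont])
      have "eventually (\<lambda>t. t \<in> {1<..<y}) (at_left y)" using y0 by (rule eventually_at_left_real)
      then show "eventually (\<lambda>t. v \<le> K * t powr (- 1 / \<theta>) + C * t powr (- 1 / \<theta> - \<gamma>)) (at_left y)"
      proof eventually_elim
        case (elim t)
        then show ?case using lo[of t] H[of t] by auto
      qed
    qed simp
    moreover have "K * y powr (- 1 / \<theta>) + (- C) * y powr (- 1 / \<theta> - \<gamma>) \<le> v"
    proof (rule tendsto_upperbound[OF cont])
      have "eventually (\<lambda>t. t \<in> {y<..<y + 1}) (at_right y)" by (rule eventually_at_right_real) simp
      then show "eventually (\<lambda>t. K * t powr (- 1 / \<theta>) + (- C) * t powr (- 1 / \<theta> - \<gamma>) \<le> v) (at_right y)"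
      proof eventually_elim
        case (elim t)
        then show ?case using hi[of t] H[of t] y0 by auto
      qed
    qed simp
    ultimately show "\<bar>v - K * y powr (- 1 / \<theta>)\<bar> \<le> C * y powr (- 1 / \<theta> - \<gamma>)" by linarith
  qed (use y in simp)
  \<comment> \<open>The quantile has to exceed \<open>y1\<close> strictly, hence a point beyond
    \<open>y1\<close>.\<close>
  define y2 where "y2 = y1 + 1"
  have y2: "y2 \<ge> 1" "y2 > y1" using y1 by (auto simp: y2_def)
  have tl: "\<bar>measure \<mu> {t<..} - K * t powr (- 1 / \<theta>)\<bar> \<le> C * t powr (- 1 / \<theta> - \<gamma>)"
    "\<bar>measure \<mu> {..-t} - K * t powr (- 1 / \<theta>)\<bar> \<le> C * t powr (- 1 / \<theta> - \<gamma>)" if "t \<ge> 1" for t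
    using tails that by (auto simp: has_stable_tails_def K_def)
  have small: "C * y2 powr (- 1 / \<theta> - \<gamma>) < K * y2 powr (- 1 / \<theta>)"
  proof -
    have "C * y2 powr (- \<gamma>) \<le> C * y1 powr (- \<gamma>)" using y1 y2 C \<gamma> by (intro mult_left_mono powr_mono2') auto
    then have "C * y2 powr (- \<gamma>) < K" using y1(2) K by linarith
    then have "y2 powr (- 1 / \<theta>) * (C * y2 powr (- \<gamma>)) < y2 powr (- 1 / \<theta>) * K" using y2 by (intro mult_strict_left_mono) auto
    moreover have "y2 powr (- 1 / \<theta> - \<gamma>) = y2 powr (- 1 / \<theta>) * y2 powr (- \<gamma>)"
      by (subst powr_add[symmetric]) simp
    ultimately show ?thesis by (simp only: mult_ac)
  qed
  have pos: "measure \<mu> {y2<..} > 0" "measure \<mu> {..-y2} > 0"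
    using tl[OF y2(1)] small by linarith+
  \<comment> \<open>Levels below both tails at \<open>y2\<close> have quantiles of modulus at least
    \<open>y2\<close>.\<close>
  define v0 where "v0 = min (1 / 4) (min (measure \<mu> {y2<..}) (measure \<mu> {..-y2}))"
  have v0: "0 < v0" "v0 < 1 / 2" using pos by (auto simp: v0_def)
  have right: "measure \<mu> {t<..} = 1 - cdf \<mu> t" for t
  proof -
    have "measure \<mu> {t<..} = measure \<mu> (space \<mu> - {..t})"
      by (rule arg_cong[where f = "measure \<mu>"]) auto
    then show ?thesis by (subst (asm) prob_compl) (auto simp: cdf_def)
  qed
  have left: "measure \<mu> {..-t} = cdf \<mu> (-t)" for t by (simp add: cdf_def)
  have "\<bar>I v + tail_quantile v\<bar> \<le> D * (tail_quantile v) powr (1 - \<gamma>) \<and>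
    \<bar>I (1 - v) - tail_quantile v\<bar> \<le> D * (tail_quantile v) powr (1 - \<gamma>)" if v: "0 < v" "v < v0" for v
  proof
    have v1: "0 < v" "v < 1" "0 < 1 - v" "1 - v < 1" using v v0 by auto
    note ps = pseudoinverse[OF v1(1,2)] pseudoinverse[OF v1(3,4)]
    have "\<bar>(- I v) - tail_quantile v\<bar> \<le> D * (tail_quantile v) powr (1 - \<gamma>)"
    proof (rule generic[of v "- I v" "\<lambda>t. measure \<mu> {..-t}", OF v(1)])
      have "v \<le> cdf \<mu> (-y2)" using v unfolding v0_def left by auto
      then have "I v \<le> - y2" using ps(1) by blast
      then show "y1 < - I v" using y2 by simp
      show "v \<le> measure \<mu> {..- t}" if "t \<ge> 1" "t < - I v" for t
        unfolding left using ps(1)[of "-t"] that by simp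
      show "measure \<mu> {..- t} \<le> v" if "t \<ge> 1" "- I v < t" for t
      proof -
        have "\<not> I v \<le> - t" using that by simp
        then show ?thesis unfolding left using ps(1)[of "-t"] by simp
      qed
    qed (use tl(2) in auto)
    then show "\<bar>I v + tail_quantile v\<bar> \<le> D * (tail_quantile v) powr (1 - \<gamma>)"
      by (simp add: abs_minus_commute[of _ "tail_quantile v"] abs_if split: if_splits)
    show "\<bar>I (1 - v) - tail_quantile v\<bar> \<le> D * (tail_quantile v) powr (1 - \<gamma>)"
    proof (rule generic[of v "I (1 - v)" "\<lambda>t. measure \<mu> {t<..}", OF v(1)])
      have "\<not> (1 - v \<le> cdf \<mu> y2)" using v unfolding v0_def right by auto
      then have "\<not> I (1 - v) \<le> y2" using ps(2) by blast
      then show "y1 < I (1 - v)" using y2 by simp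
      show "v \<le> measure \<mu> {t<..}" if "t \<ge> 1" "t < I (1 - v)" for t
      proof -
        have "\<not> I (1 - v) \<le> t" using that by simp
        then have "\<not> (1 - v \<le> cdf \<mu> t)" using ps(2) by blast
        then show ?thesis unfolding right by simp
      qed
      show "measure \<mu> {t<..} \<le> v" if "t \<ge> 1" "I (1 - v) < t" for t
        unfolding right using ps(2)[of t] that by simp
    qed (use tl(1) in auto)
  qed
  then show ?thesis using v0 D by blast
qed

end

section \<open>Pareto tails and the difference of quantiles\<close>

lemma emeasure_unif_sym:
  assumes "B \<in> sets borel" "B \<inter> {-1..1} = B'"
  shows "emeasure unif_sym B = emeasure lborel B' / 2"
proof -
  have "emeasure unif_sym B = (\<integral>\<^sup>+x. indicator B x \<partial>unif_sym)" using assms by simp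
  also have "\<dots> = (\<integral>\<^sup>+x. indicator B x * indicator {-1..1} x \<partial>lborel) / 2"
    using assms by (intro nn_integral_unif_sym) simp
  also have "(\<integral>\<^sup>+x. indicator B x * indicator {-1..1} x \<partial>lborel) = (\<integral>\<^sup>+x. indicator B' x \<partial>lborel)"
    unfolding assms(2)[symmetric] by (simp add: indicator_inter_arith)
  also have "\<dots> = emeasure lborel B'" using assms by auto
  finally show ?thesis .
qed

context stable_params
begin

text \<open>The number \<open>c\<close> is the probability that the modulus exceeds
  \<open>t\<close>; within \<open>{-1..1}\<close> the preimages of the tails under
  \<open>pareto_map\<close> are intervals of length \<open>c\<close> next to
  \<open>0\<close>.\<close>

lemma pareto_tails:
  assumes t: "t \<ge> b"
  shows "measure (pareto b \<theta>) {t<..} = b powr (1 / \<theta>) / 2 * t powr (- 1 / \<theta>)"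
    and "measure (pareto b \<theta>) {..-t} = b powr (1 / \<theta>) / 2 * t powr (- 1 / \<theta>)"
proof -
  define c where "c = (t / b) powr (- 1 / \<theta>)"
  have t0: "t > 0" using t b by simp
  have c: "c > 0" using b t0 by (simp add: c_def)
  have tb: "1 \<le> t / b" using t b by simp
  have c1: "c \<le> 1" using powr_mono[of "-1 / \<theta>" 0 "t / b"] tb \<theta>_pos b t0 by (simp add: c_def)
  have c\<theta>: "c powr (-\<theta>) = t / b" using \<theta>_pos b t0 by (simp add: c_def powr_powr)
  have ceq: "c / 2 = b powr (1 / \<theta>) / 2 * t powr (- 1 / \<theta>)"
    using b t0 by (simp add: c_def powr_divide powr_minus field_simps)
  have less_iff: "c powr (-\<theta>) < u powr (-\<theta>) \<longleftrightarrow> u < c" if "u > 0" for u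
    using powr_less_mono2_neg[of "-\<theta>" u c] powr_less_mono2_neg[of "-\<theta>" c u] \<theta>_pos c that
    by (cases u c rule: linorder_cases) auto
  have le_iff: "c powr (-\<theta>) \<le> u powr (-\<theta>) \<longleftrightarrow> u \<le> c" if "u > 0" for u
    using powr_less_mono2_neg[of "-\<theta>" u c] powr_less_mono2_neg[of "-\<theta>" c u] \<theta>_pos c that
    by (cases u c rule: linorder_cases) auto
  let ?X = "pareto_map b \<theta>"
  have Xpos: "?X u = b * u powr (-\<theta>)" if "u > 0" for u using that by (simp add: pareto_map_def)
  have Xneg: "?X u = - (b * (-u) powr (-\<theta>))" if "u < 0" for u using that by (simp add: pareto_map_def)
  have X0: "?X 0 = 0" by (simp add: pareto_map_def)
  have r: "?X -` {t<..} \<inter> {-1..1} = {0<..<c}"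
  proof (intro equalityI subsetI)
    fix u assume u: "u \<in> ?X -` {t<..} \<inter> {-1..1}"
    have "\<not> u \<le> 0"
    proof
      assume "u \<le> 0"
      then have "?X u \<le> 0" using Xneg X0 b by (cases "u = 0") auto
      then show False using u t0 by auto
    qed
    then have u0: "u > 0" by simp
    then have "t / b < u powr (-\<theta>)" using u b Xpos[OF u0] by (simp add: field_simps)
    then show "u \<in> {0<..<c}" using less_iff[OF u0] u0 unfolding c\<theta> by simp
  next
    fix u assume u: "u \<in> {0<..<c}"
    then have "t / b < u powr (-\<theta>)" using less_iff[of u] unfolding c\<theta> by simp
    then show "u \<in> ?X -` {t<..} \<inter> {-1..1}" using u b c1 Xpos[of u] by (simp add: field_simps)
  qed
  have l: "?X -` {..-t} \<inter> {-1..1} = {-c..<0}"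
  proof (intro equalityI subsetI)
    fix u assume u: "u \<in> ?X -` {..-t} \<inter> {-1..1}"
    have "\<not> u \<ge> 0"
    proof
      assume "u \<ge> 0"
      then have "?X u \<ge> 0" using Xpos X0 b by (cases "u = 0") auto
      then show False using u t0 by auto
    qed
    then have u0: "u < 0" by simp
    then have "t / b \<le> (-u) powr (-\<theta>)" using u b Xneg[OF u0] by (simp add: field_simps)
    then show "u \<in> {-c..<0}" using le_iff[of "-u"] u0 unfolding c\<theta> by auto
  next
    fix u assume u: "u \<in> {-c..<0}"
    then have "t / b \<le> (-u) powr (-\<theta>)" using le_iff[of "-u"] unfolding c\<theta> by auto
    then show "u \<in> ?X -` {..-t} \<inter> {-1..1}" using u b c1 Xneg[of u] by (simp add: field_simps)
  qed
  have Xm: "?X \<in> borel_measurable unif_sym" by measurable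
  have vm: "?X -` S \<in> sets borel" if "S \<in> sets borel" for S
    using measurable_sets[OF measurable_pareto_map that] by simp
  have "measure (pareto b \<theta>) {t<..} = enn2real (emeasure unif_sym (?X -` {t<..}))"
    unfolding pareto_def using Xm by (subst measure_distr) (auto simp: measure_def)
  also have "emeasure unif_sym (?X -` {t<..}) = emeasure lborel {0<..<c} / 2"
    by (intro emeasure_unif_sym vm r) simp
  also have "\<dots> = ennreal (c / 2)" using c divide_ennreal[of c 2] by simp
  finally show "measure (pareto b \<theta>) {t<..} = b powr (1 / \<theta>) / 2 * t powr (- 1 / \<theta>)"
    unfolding ceq[symmetric] using c by simp
  have "measure (pareto b \<theta>) {..-t} = enn2real (emeasure unif_sym (?X -` {..-t}))"
    unfolding pareto_def using Xm by (subst measure_distr) (auto simp: measure_def)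
  also have "emeasure unif_sym (?X -` {..-t}) = emeasure lborel {-c..<0} / 2"
    by (intro emeasure_unif_sym vm l) simp
  also have "\<dots> = ennreal (c / 2)" using c divide_ennreal[of c 2] by simp
  finally show "measure (pareto b \<theta>) {..-t} = b powr (1 / \<theta>) / 2 * t powr (- 1 / \<theta>)"
    unfolding ceq[symmetric] using c by simp
qed

text \<open>From \<open>b\<close> on the tail is exact; below \<open>b\<close> the error is at most
  \<open>1 + K\<close> and is absorbed by enlarging \<open>C\<close>.\<close>

lemma pareto_has_stable_tails:
  assumes "\<gamma> > 0"
  shows "\<exists>C\<ge>0. has_stable_tails \<gamma> C (pareto b \<theta>)"
proof -
  interpret real_distribution "pareto b \<theta>" by (rule real_distribution_pareto)
  define K where "K = b powr (1 / \<theta>) / 2"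
  define w where "w = 1 / \<theta> + \<gamma>"
  define C where "C = (1 + K) * (max 1 b) powr w"
  have K: "K \<ge> 0" by (simp add: K_def)
  have w: "w > 0" using assms \<theta>_pos by (simp add: w_def add_pos_pos)
  have C: "C \<ge> 0" using K by (simp add: C_def)
  have "\<bar>x - K * t powr (- 1 / \<theta>)\<bar> \<le> C * t powr (- 1 / \<theta> - \<gamma>)"
    if t: "t \<ge> 1" and x: "0 \<le> x" "x \<le> 1" "t \<ge> b \<Longrightarrow> x = K * t powr (- 1 / \<theta>)" for x t
  proof (cases "t \<ge> b")
    case True
    then show ?thesis using x(3) C by simp
  next
    case False
    have e: "- 1 / \<theta> - \<gamma> = - w" by (simp add: w_def)
    have t1: "t powr (- 1 / \<theta>) \<le> 1" using powr_mono[of "-1 / \<theta>" 0 t] t \<theta>_pos by simp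
    have "K * t powr (- 1 / \<theta>) \<le> K * 1" using t1 K by (intro mult_left_mono) auto
    moreover have "0 \<le> K * t powr (- 1 / \<theta>)" using K by simp
    ultimately have "\<bar>x - K * t powr (- 1 / \<theta>)\<bar> \<le> 1 + K" using x(1,2) by linarith
    also have "\<dots> = (1 + K) * (t powr w * t powr (- w))" using t by (simp flip: powr_add)
    also have "\<dots> \<le> (1 + K) * ((max 1 b) powr w * t powr (- w))"
      using False t K w by (intro mult_left_mono mult_right_mono powr_mono2) auto
    finally show ?thesis unfolding e by (simp add: C_def mult_ac)
  qed
  then show ?thesis using C pareto_tails
    by (intro exI[of _ C] conjI) (auto simp: has_stable_tails_def K_def measure_nonneg)
qed

text \<open>Near each end of the unit interval both quantiles are compared with the same
  \<open>tail_quantile\<close>, so the leading terms cancel, and at distance \<open>v\<close> from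
  the end the difference has order \<open>v powr (- \<theta> * (1 - \<gamma>))\<close>. The
  condition on \<open>r\<close> makes its \<open>r\<close>-th power integrable; in the middle,
  monotone functions are bounded.\<close>

lemma integrable_quantile_difference:
  assumes \<mu>: "cdf_distribution \<mu>" and tails: "has_stable_tails \<gamma> C \<mu>" and \<gamma>: "0 < \<gamma>" "\<gamma> < 1" and C: "C \<ge> 0"
    and r: "1 \<le> r" "\<theta> * (1 - \<gamma>) * r < 1"
  shows "integrable (restrict_space lborel {0<..<1})
    (\<lambda>v. \<bar>Inf {x. v \<le> cdf \<mu> x} - Inf {x. v \<le> cdf (pareto b \<theta>) x}\<bar> powr r)"
proof -
  interpret M: cdf_distribution \<mu> by fact
  interpret P: cdf_distribution "pareto b \<theta>"
    unfolding cdf_distribution_def by (rule real_distribution_pareto)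
  obtain C' where C': "C' \<ge> 0" "has_stable_tails \<gamma> C' (pareto b \<theta>)" using pareto_has_stable_tails[OF \<gamma>(1)] by blast
  obtain v1 D1 where 1: "0 < v1" "v1 < 1 / 2" "D1 \<ge> 0" "\<And>v. 0 < v \<Longrightarrow> v < v1 \<Longrightarrow>
    \<bar>M.I v + tail_quantile v\<bar> \<le> D1 * (tail_quantile v) powr (1 - \<gamma>) \<and> \<bar>M.I (1 - v) - tail_quantile v\<bar> \<le> D1 * (tail_quantile v) powr (1 - \<gamma>)"
    using quantile_tail[OF \<mu> tails \<gamma> C] by blast
  obtain v2 D2 where 2: "0 < v2" "v2 < 1 / 2" "D2 \<ge> 0" "\<And>v. 0 < v \<Longrightarrow> v < v2 \<Longrightarrow>
    \<bar>P.I v + tail_quantile v\<bar> \<le> D2 * (tail_quantile v) powr (1 - \<gamma>) \<and> \<bar>P.I (1 - v) - tail_quantile v\<bar> \<le> D2 * (tail_quantile v) powr (1 - \<gamma>)"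
    using quantile_tail[OF P.cdf_distribution_axioms C'(2) \<gamma> C'(1)] by blast
  define K where "K = b powr (1 / \<theta>) / 2"
  have K: "K > 0" using b by (simp add: K_def)
  define v0 where "v0 = min v1 v2"
  have v0: "0 < v0" "v0 < 1 / 2" using 1 2 by (auto simp: v0_def)
  define D where "D = D1 + D2"
  have D: "D \<ge> 0" using 1 2 by (simp add: D_def)
  define \<kappa> where "\<kappa> = \<theta> * (1 - \<gamma>) * r"
  have \<kappa>: "\<kappa> < 1" using r by (simp add: \<kappa>_def)
  define d where "d = (\<lambda>v. M.I v - P.I v)"
  have edge: "\<bar>d v\<bar> \<le> D * (tail_quantile v) powr (1 - \<gamma>)" "\<bar>d (1 - v)\<bar> \<le> D * (tail_quantile v) powr (1 - \<gamma>)" if "0 < v" "v < v0" for v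
    using 1(4)[of v] 2(4)[of v] that by (auto simp: d_def D_def v0_def distrib_right)
  define c where "c = D powr r * K powr \<kappa>"
  have pw: "(D * (tail_quantile v) powr (1 - \<gamma>)) powr r = c * v powr (- \<kappa>)" if "v > 0" for v
    using K that by (simp add: tail_quantile_def K_def[symmetric] powr_mult powr_powr powr_divide powr_minus_divide c_def \<kappa>_def)
  define B where "B = \<bar>M.I v0\<bar> + \<bar>M.I (1 - v0)\<bar> + \<bar>P.I v0\<bar> + \<bar>P.I (1 - v0)\<bar>"
  have mid: "\<bar>d v\<bar> \<le> B" if v: "v0 \<le> v" "v \<le> 1 - v0" for v
  proof -
    have "M.I v0 \<le> M.I v" "M.I v \<le> M.I (1 - v0)" "P.I v0 \<le> P.I v" "P.I v \<le> P.I (1 - v0)"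
      using M.mono_I P.mono_I v v0 by (auto simp: mono_on_def)
    then show ?thesis by (simp add: d_def B_def)
  qed
  have bound: "\<bar>d v\<bar> powr r \<le> c * v powr (- \<kappa>) + c * (1 - v) powr (- \<kappa>) + B powr r" if v: "0 < v" "v < 1" for v
  proof -
    have c0: "c \<ge> 0" by (simp add: c_def)
    consider "v < v0" | "1 - v < v0" | "v0 \<le> v" "v \<le> 1 - v0" by linarith
    then show ?thesis
    proof cases
      case 1
      have "\<bar>d v\<bar> powr r \<le> c * v powr (- \<kappa>)"
        unfolding pw[OF v(1), symmetric] using edge(1)[OF v(1) 1] r by (intro powr_mono2) auto
      then show ?thesis using c0 by (simp add: add_increasing2)
    next
      case 2
      have "\<bar>d (1 - (1 - v))\<bar> powr r \<le> c * (1 - v) powr (- \<kappa>)"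
        using v pw[of "1 - v", symmetric] edge(2)[of "1 - v"] 2 r by (auto intro!: powr_mono2)
      then show ?thesis using c0 by (simp add: add_increasing add_increasing2)
    next
      case 3
      then have "\<bar>d v\<bar> powr r \<le> B powr r" using mid[of v] r by (intro powr_mono2) auto
      then show ?thesis using c0 by (simp add: add_increasing)
    qed
  qed
  let ?\<Omega> = "restrict_space lborel {0<..<1} :: real measure"
  have sets\<Omega>: "sets ?\<Omega> = sets (restrict_space borel {0<..<1})" by (simp add: sets_restrict_space)
  have dm: "d \<in> borel_measurable ?\<Omega>"
    unfolding d_def using M.measurable_CI P.measurable_CI measurable_cong_sets[OF sets\<Omega> refl, of borel] by auto
  have int0: "integrable ?\<Omega> (\<lambda>v. v powr (- \<kappa>))" "integrable ?\<Omega> (\<lambda>v. (1 - v) powr (- \<kappa>))"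
  proof -
    let ?h = "\<lambda>x::real. ennreal (x powr (- \<kappa>)) * indicator {0<..1} x"
    have [measurable]: "?h \<in> borel_measurable borel" by measurable
    have fin: "(\<integral>\<^sup>+x. ?h x \<partial>lborel) < \<infinity>" using nn_integral_powr_Ioc[of "-\<kappa>" 1] \<kappa> by simp
    have "(\<integral>\<^sup>+v. ennreal (norm (v powr (- \<kappa>))) \<partial>?\<Omega>) \<le> (\<integral>\<^sup>+x. ?h x \<partial>lborel)"
      by (subst nn_integral_restrict_space) (auto intro!: nn_integral_mono simp: indicator_def)
    then show "integrable ?\<Omega> (\<lambda>v. v powr (- \<kappa>))"
      using fin by (intro integrableI_bounded) (auto intro: le_less_trans measurable_restrict_space1)
    have "(\<integral>\<^sup>+v. ennreal (norm ((1 - v) powr (- \<kappa>))) \<partial>?\<Omega>) \<le> (\<integral>\<^sup>+x. ?h (1 + (-1) * x) \<partial>lborel)"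
      by (subst nn_integral_restrict_space) (auto intro!: nn_integral_mono simp: indicator_def)
    also have "\<dots> = (\<integral>\<^sup>+x. ?h x \<partial>lborel)" using nn_integral_real_affine[of ?h "-1" 1] by simp
    finally show "integrable ?\<Omega> (\<lambda>v. (1 - v) powr (- \<kappa>))"
      using fin by (intro integrableI_bounded) (auto intro: le_less_trans measurable_restrict_space1)
  qed
  interpret \<Omega>: prob_space ?\<Omega>
    by (auto simp: emeasure_restrict_space space_restrict_space intro!: prob_spaceI)
  have "integrable ?\<Omega> (\<lambda>v. c * v powr (- \<kappa>) + c * (1 - v) powr (- \<kappa>) + B powr r)"
    using int0 by auto
  then have "integrable ?\<Omega> (\<lambda>v. \<bar>d v\<bar> powr r)"
  proof (rule Bochner_Integration.integrable_bound)
    show "AE v in ?\<Omega>. norm (\<bar>d v\<bar> powr r) \<le> norm (c * v powr (- \<kappa>) + c * (1 - v) powr (- \<kappa>) + B powr r)"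
      using bound by (intro AE_I2) (auto simp: space_restrict_space intro!: order_trans[OF _ abs_ge_self])
  qed (use dm in measurable)
  then show ?thesis by (simp add: d_def)
qed

end

text \<open>With \<open>x = (1 / \<alpha> - \<eta>) * p\<close> and \<open>m\<close> the minimum,
  the rate is \<open>m * x / (1 + x)\<close>. As \<open>x < 1\<close>, it is below
  \<open>m / 2\<close>; the bound by \<open>1 / \<alpha> - \<eta>\<close> follows from
  \<open>p * m < 1\<close>.\<close>

lemma rate_bounds:
  fixes \<alpha> \<gamma> \<eta> p :: real
  assumes "1 < \<alpha>" "\<alpha> < 2" "\<gamma> > 0" "0 < \<eta>" "\<eta> < 1 / \<alpha>" "1 \<le> p" "p < \<alpha>"
  defines "\<upsilon> \<equiv> (1 / \<alpha> - \<eta>) * p * (min (2 / \<alpha> - 1) (\<gamma> / \<alpha>) / (1 + (1 / \<alpha> - \<eta>) * p))"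
  shows "0 < \<upsilon>" "\<upsilon> < 1 / \<alpha> - \<eta>" "\<upsilon> < 1 / \<alpha> - 1 / 2" "\<upsilon> < \<gamma> / \<alpha>"
proof -
  define a where "a = 1 / \<alpha> - \<eta>"
  define m where "m = min (2 / \<alpha> - 1) (\<gamma> / \<alpha>)"
  have a: "a > 0" "a < 1 / \<alpha>" using assms by (auto simp: a_def)
  have m: "m > 0" "m \<le> 2 / \<alpha> - 1" "m \<le> \<gamma> / \<alpha>" using assms by (auto simp: m_def)
  define x where "x = a * p"
  have x0: "x > 0" using a assms by (simp add: x_def)
  have x1: "x < 1"
  proof -
    have "a * p < 1 / \<alpha> * \<alpha>" using a assms by (intro mult_strict_mono) auto
    then show ?thesis using assms by (simp add: x_def)
  qed
  have \<upsilon>: "\<upsilon> = x * m / (1 + x)" by (simp add: \<upsilon>_def x_def a_def m_def)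
  show "0 < \<upsilon>" unfolding \<upsilon> using x0 m by simp
  have "\<upsilon> = (x / (1 + x)) * m" by (simp add: \<upsilon>)
  also have "\<dots> < 1 / 2 * m" using x0 x1 m by (intro mult_strict_right_mono) (auto simp: field_simps)
  finally have half: "\<upsilon> < m / 2" by simp
  show "\<upsilon> < 1 / \<alpha> - 1 / 2" using half m(2) by simp
  show "\<upsilon> < \<gamma> / \<alpha>" using half m by linarith
  have "p * m < 1 + x"
  proof -
    have "p * m \<le> p * (2 / \<alpha> - 1)" using m assms by (intro mult_left_mono) auto
    also have "\<dots> \<le> \<alpha> * (2 / \<alpha> - 1)" using assms by (intro mult_right_mono) auto
    also have "\<dots> < 1" using assms by (simp add: field_simps)
    finally show ?thesis using x0 by linarith
  qed
  then have "a * (p * m / (1 + x)) < a * 1" using a x0 by (intro mult_strict_left_mono) auto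
  then show "\<upsilon> < 1 / \<alpha> - \<eta>" by (simp add: \<upsilon> x_def a_def mult_ac)
qed

lemma power_tail_le:
  fixes f :: "real \<Rightarrow> real"
  assumes "bdd_above (range (\<lambda>t. \<bar>t\<bar> powr \<gamma> * \<bar>f t\<bar>))" "\<gamma>' \<le> \<gamma>"
  shows "\<exists>C\<ge>0. \<forall>t. \<bar>t\<bar> \<ge> 1 \<longrightarrow> \<bar>f t\<bar> \<le> C * \<bar>t\<bar> powr (- \<gamma>')"
proof -
  obtain B where B: "\<And>t. \<bar>t\<bar> powr \<gamma> * \<bar>f t\<bar> \<le> B" using assms(1) by (auto simp: bdd_above_def)
  have B0: "B \<ge> 0" using B[of 0] by simp
  have "\<bar>f t\<bar> \<le> B * \<bar>t\<bar> powr (- \<gamma>')" if t: "\<bar>t\<bar> \<ge> 1" for t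
  proof -
    have "\<bar>f t\<bar> = (\<bar>t\<bar> powr \<gamma> * \<bar>f t\<bar>) * \<bar>t\<bar> powr (- \<gamma>)"
      using t by (simp add: mult_ac flip: powr_add)
    also have "\<dots> \<le> B * \<bar>t\<bar> powr (- \<gamma>)" by (intro mult_right_mono B) auto
    also have "\<dots> \<le> B * \<bar>t\<bar> powr (- \<gamma>')" using assms t B0 by (intro mult_left_mono powr_mono) auto
    finally show ?thesis .
  qed
  then show ?thesis using B0 by blast
qed

lemma centered_if_distr:
  fixes X :: "'a \<Rightarrow> real"
  assumes [measurable]: "X \<in> borel_measurable M" and "distr M borel X = \<mu>"
    and "integrable \<mu> (\<lambda>x. x)" "(\<integral>x. x \<partial>\<mu>) = 0"
  shows "integrable M X" "(\<integral>\<omega>. X \<omega> \<partial>M) = 0"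
  using assms(3,4) unfolding assms(2)[symmetric] by (simp_all add: integrable_distr_eq integral_distr)

theorem theorem1:
  fixes M :: "'a measure" and Y :: "nat \<Rightarrow> 'a \<Rightarrow> real"
    and N :: "'b measure" and S :: "real \<Rightarrow> 'b \<Rightarrow> real"
    and \<alpha> A \<gamma> :: real and \<epsilon> :: "real \<Rightarrow> real"
  assumes "1 < \<alpha>" and "\<alpha> < 2"
    and "prob_space M"
    and indep: "prob_space.indep_vars M (\<lambda>_. borel) Y {1..}"
    and ident: "\<And>i. i \<ge> 1 \<Longrightarrow> distr M borel (Y i) = distr M borel (Y 1)"
    and centered: "integrable M (Y 1)" "(\<integral>\<omega>. Y 1 \<omega> \<partial>M) = 0"
    and "A > 0" and "\<gamma> > 0"
    and right_tail: "\<And>t. t > 0 \<Longrightarrow> measure M {\<omega> \<in> space M. Y 1 \<omega> > t} =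
          A / 2 * (1 / t powr \<alpha>) * indicator {1..} t + (1 - A) * (\<epsilon> t / t powr \<alpha>)"
    and left_tail: "\<And>t. t < 0 \<Longrightarrow> measure M {\<omega> \<in> space M. Y 1 \<omega> \<le> t} =
          A / 2 * (1 / \<bar>min t (-1)\<bar> powr \<alpha>) + (1 - A) * (\<epsilon> t / \<bar>t\<bar> powr \<alpha>)"
    and "bounded (\<epsilon> ` {-1..1})"
    and "bdd_above (range (\<lambda>t. \<bar>t\<bar> powr \<gamma> * \<bar>\<epsilon> t\<bar>))"
    and S: "sym_stable_levy_process N S A \<alpha>"
  shows "\<forall>\<eta> p. 0 < \<eta> \<and> \<eta> < 1 / \<alpha> \<and> 1 \<le> p \<and> p < \<alpha> \<longrightarrow>
    (\<exists>\<upsilon> c. \<upsilon> > 0 \<and> c > 0 \<and>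
      \<upsilon> = (1 / \<alpha> - \<eta>) * p * (min (2 / \<alpha> - 1) (\<gamma> / \<alpha>) / (1 + (1 / \<alpha> - \<eta>) * p)) \<and>
      (\<forall>n\<ge>1. wasserstein1 \<eta> p M (walk \<alpha> Y n) N S \<le> ereal (c * 2 powr (- (real n * \<upsilon>)))))"
proof (intro allI impI)
  fix \<eta> p :: real
  assume asm: "0 < \<eta> \<and> \<eta> < 1 / \<alpha> \<and> 1 \<le> p \<and> p < \<alpha>"
  define \<upsilon> where "\<upsilon> = (1 / \<alpha> - \<eta>) * p * (min (2 / \<alpha> - 1) (\<gamma> / \<alpha>) / (1 + (1 / \<alpha> - \<eta>) * p))"
  have rate: "0 < \<upsilon>" "\<upsilon> < 1 / \<alpha> - \<eta>" "\<upsilon> < 1 / \<alpha> - 1 / 2" "\<upsilon> < \<gamma> / \<alpha>"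
    unfolding \<upsilon>_def using rate_bounds[of \<alpha> \<gamma> \<eta> p] assms(1,2) \<open>\<gamma> > 0\<close> asm by auto
  define \<theta> where "\<theta> = 1 / \<alpha>"
  define \<beta> where "\<beta> = \<theta> - \<upsilon>"
  define r where "r = 1 / \<beta>"
  \<comment> \<open>Gives \<open>pareto b \<theta>\<close> the leading tail
    \<open>A / 2 * t powr (-\<alpha>)\<close>.\<close>
  define b where "b = A powr \<theta>"
  have \<theta>: "1 / 2 < \<theta>" "\<theta> < 1" "\<theta> > 0" using assms(1,2) by (auto simp: \<theta>_def)
  have \<alpha>: "\<alpha> = 1 / \<theta>" by (simp add: \<theta>_def)
  have \<beta>: "\<eta> < \<beta>" "1 / 2 < \<beta>" "\<beta> < \<theta>" "\<beta> > 0" using rate asm by (auto simp: \<beta>_def \<theta>_def)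
  have r: "r \<le> 2" "p \<le> r" "\<eta> * r < 1" "1 \<le> r" "1 / r = \<beta>"
  proof -
    show "r \<le> 2" "\<eta> * r < 1" "1 / r = \<beta>" using \<beta> by (auto simp: r_def field_simps)
    have "\<alpha> \<le> r" unfolding r_def \<alpha> using \<beta> by (intro divide_left_mono) auto
    then show "p \<le> r" "1 \<le> r" using asm by auto
  qed
  have bA: "b powr (1 / \<theta>) = A" using \<open>A > 0\<close> \<theta> by (simp add: b_def powr_powr)
  have \<eta>p: "\<eta> * p < 1"
  proof -
    have "\<eta> * p < 1 / \<alpha> * \<alpha>" using asm by (intro mult_strict_mono) auto
    then show ?thesis using assms(1) by simp
  qed
  interpret sob: sob_params \<eta> p using asm \<eta>p by unfold_locales auto
  have st: "stable_params b \<theta>" using \<theta> \<open>A > 0\<close> by unfold_locales (auto simp: b_def)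
  interpret st: stable_params b \<theta> by fact
  interpret M: prob_space M by fact
  have levy: "levy_process N S" and trip: "has_levy_triplet N S 0 0 (stable_levy_measure A \<alpha>)"
    using S by (auto simp: sym_stable_levy_process_def)
  interpret N: prob_space N using levy by (simp add: levy_process_def)
  have Sm: "S t \<in> borel_measurable N" if "t \<in> {0..1}" for t using levy that by (simp add: levy_process_def)
  define \<nu> where "\<nu> = distr N borel (S 1)"
  have S1 [measurable]: "S 1 \<in> borel_measurable N" by (rule Sm) simp
  have \<nu>: "real_distribution \<nu>" unfolding \<nu>_def by (rule N.real_distribution_distr) measurable
  have charS: "char (distr N borel (S t)) \<xi> = of_real (exp (t * st.exponent \<xi>))" if "t \<in> {0..1}" for t \<xi>
  proof -
    have "levy_exponent 0 0 (stable_levy_measure A \<alpha>) \<xi> = of_real (st.exponent \<xi>)"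
      unfolding \<alpha> using st.levy_exponent_stable[of \<xi>] unfolding bA .
    then show ?thesis using trip that unfolding has_levy_triplet_def by (simp add: exp_of_real[symmetric])
  qed
  have char\<nu>: "char \<nu> \<xi> = of_real (exp (st.exponent \<xi>))" for \<xi>
    using charS[of 1] by (simp add: \<nu>_def)
  \<comment> \<open>One-dimensional laws are determined by their characteristic functions, and
    \<open>exponent_scaling\<close> is the self-similarity. Time \<open>0\<close> is separate
    because that lemma needs a positive factor.\<close>
  have scaling: "distr N borel (S t) = distr N borel (\<lambda>\<omega>. t powr \<theta> * S 1 \<omega>)" if t: "t \<in> {0..1}" for t
  proof (rule Levy_uniqueness)
    note Sm[OF t, measurable]
    show "real_distribution (distr N borel (S t))" "real_distribution (distr N borel (\<lambda>\<omega>. t powr \<theta> * S 1 \<omega>))"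
      by (intro N.real_distribution_distr; measurable)+
    show "char (distr N borel (S t)) = char (distr N borel (\<lambda>\<omega>. t powr \<theta> * S 1 \<omega>))"
    proof
      fix \<xi>
      have "char (distr N borel (\<lambda>\<omega>. t powr \<theta> * S 1 \<omega>)) \<xi> = char \<nu> (t powr \<theta> * \<xi>)"
        unfolding \<nu>_def char_def by (simp add: integral_distr mult_ac)
      also have "\<dots> = of_real (exp (t * st.exponent \<xi>))"
      proof (cases "t = 0")
        case True
        interpret \<nu>: real_distribution \<nu> by (rule \<nu>)
        show ?thesis using True by (simp add: \<nu>.char_zero)
      next
        case False
        then show ?thesis using t unfolding char\<nu> by (subst st.exponent_scaling) auto
      qed
      finally show "char (distr N borel (S t)) \<xi> = char (distr N borel (\<lambda>\<omega>. t powr \<theta> * S 1 \<omega>)) \<xi>"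
        using charS[OF t] by simp
    qed
  qed
  obtain m where m: "m > 0" "(\<integral>\<^sup>+\<omega>. ennreal (\<bar>S 1 \<omega>\<bar> powr p) \<partial>N) \<le> ennreal m"
  proof -
    have "\<theta> * p < 1" using asm assms(1) by (simp add: \<theta>_def)
    then obtain m where "m > 0" "(\<integral>\<^sup>+x. ennreal (\<bar>x\<bar> powr p) \<partial>\<nu>) \<le> ennreal m"
      using st.stable_moment[OF \<nu> char\<nu>, of p] asm by auto
    then show thesis by (intro that[of m]) (auto simp: \<nu>_def nn_integral_distr)
  qed
  define \<mu> where "\<mu> = distr M borel (Y 1)"
  have Y1 [measurable]: "Y 1 \<in> borel_measurable M" using centered by auto
  have \<mu>: "real_distribution \<mu>" unfolding \<mu>_def by (rule M.real_distribution_distr) measurable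
  have cdf\<mu>: "cdf_distribution \<mu>" unfolding cdf_distribution_def by (rule \<mu>)
  interpret Mu: cdf_distribution \<mu> by (rule cdf\<mu>)
  interpret Pa: cdf_distribution "pareto b \<theta>"
    unfolding cdf_distribution_def by (rule real_distribution_pareto)
  \<comment> \<open>Lowered below \<open>1\<close>, as the quantile estimates require, yet above
    \<open>\<upsilon> * \<alpha>\<close>, which is possible because
    \<open>\<upsilon> < 1 / \<alpha> - 1 / 2\<close>.\<close>
  define \<gamma>' where "\<gamma>' = min \<gamma> ((2 - \<alpha>) / 2)"
  have \<gamma>': "0 < \<gamma>'" "\<gamma>' < 1" "\<gamma>' \<le> \<gamma>" using \<open>\<gamma> > 0\<close> assms(1,2) min.cobounded2[of \<gamma> "(2 - \<alpha>) / 2"]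
    by (auto simp: \<gamma>'_def simp del: min.cobounded2)
  have "\<upsilon> * \<alpha> < \<gamma>'" using rate(3,4) assms(1,2) by (auto simp: \<gamma>'_def field_simps)
  \<comment> \<open>The condition of \<open>integrable_quantile_difference\<close>, equivalent to
    \<open>\<upsilon> < \<theta> * \<gamma>'\<close>.\<close>
  then have \<gamma>r: "\<theta> * (1 - \<gamma>') * r < 1"
  proof -
    have "\<upsilon> < \<theta> * \<gamma>'" using \<open>\<upsilon> * \<alpha> < \<gamma>'\<close> \<theta> by (simp add: \<alpha> field_simps)
    then have "\<theta> * (1 - \<gamma>') < \<beta>" by (simp add: \<beta>_def algebra_simps)
    then show ?thesis using \<beta> by (simp add: r_def field_simps)
  qed
  obtain C where C: "C \<ge> 0" "\<And>t. \<bar>t\<bar> \<ge> 1 \<Longrightarrow> \<bar>\<epsilon> t\<bar> \<le> C * \<bar>t\<bar> powr (- \<gamma>')"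
    using power_tail_le[OF \<open>bdd_above (range (\<lambda>t. \<bar>t\<bar> powr \<gamma> * \<bar>\<epsilon> t\<bar>))\<close> \<gamma>'(3)] by blast
  have tails: "st.has_stable_tails \<gamma>' (\<bar>1 - A\<bar> * C) \<mu>"
    unfolding st.has_stable_tails_def
  proof (intro allI impI conjI)
    \<comment> \<open>For \<open>t \<ge> 1\<close> the indicator is \<open>1\<close> and
      \<open>min (- t) (-1)\<close> is \<open>- t\<close>, so both sides have the same main
      term.\<close>
    fix t :: real assume t: "1 \<le> t"
    have err: "\<bar>(1 - A) * (\<epsilon> s / t powr \<alpha>)\<bar> \<le> \<bar>1 - A\<bar> * C * t powr (- 1 / \<theta> - \<gamma>')" if s: "\<bar>s\<bar> = t" for s
    proof -
      have "\<bar>(1 - A) * (\<epsilon> s / t powr \<alpha>)\<bar> = \<bar>1 - A\<bar> * (\<bar>\<epsilon> s\<bar> * t powr (- \<alpha>))"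
        by (simp add: abs_mult powr_minus_divide)
      also have "\<dots> \<le> \<bar>1 - A\<bar> * (C * t powr (- \<gamma>') * t powr (- \<alpha>))"
        using C(2)[of s] s t by (intro mult_left_mono mult_right_mono) auto
      also have "t powr (- 1 / \<theta> - \<gamma>') = t powr (- \<gamma>') * t powr (- \<alpha>)"
        unfolding powr_add[symmetric] by (rule arg_cong[where f = "(powr) t"]) (simp add: \<alpha>)
      ultimately show ?thesis by (simp only: mult_ac)
    qed
    have main: "A / 2 * (1 / t powr \<alpha>) = b powr (1 / \<theta>) / 2 * t powr (- 1 / \<theta>)"
      by (simp add: bA \<alpha> powr_minus_divide)
    have "measure \<mu> {t<..} = measure M {\<omega> \<in> space M. Y 1 \<omega> > t}"
      unfolding \<mu>_def by (subst measure_distr[OF Y1]) (auto intro: arg_cong[where f = "measure M"])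
    also have "\<dots> = b powr (1 / \<theta>) / 2 * t powr (- 1 / \<theta>) + (1 - A) * (\<epsilon> t / t powr \<alpha>)"
      using right_tail[of t] t unfolding main by simp
    finally show "\<bar>measure \<mu> {t<..} - b powr (1 / \<theta>) / 2 * t powr (- 1 / \<theta>)\<bar> \<le> \<bar>1 - A\<bar> * C * t powr (- 1 / \<theta> - \<gamma>')"
      using err[of t] t by simp
    have "measure \<mu> {..-t} = measure M {\<omega> \<in> space M. Y 1 \<omega> \<le> - t}"
      unfolding \<mu>_def by (subst measure_distr[OF Y1]) (auto intro: arg_cong[where f = "measure M"])
    also have "\<dots> = b powr (1 / \<theta>) / 2 * t powr (- 1 / \<theta>) + (1 - A) * (\<epsilon> (- t) / t powr \<alpha>)"
      using left_tail[of "- t"] t unfolding main[symmetric] by simp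
    finally show "\<bar>measure \<mu> {..-t} - b powr (1 / \<theta>) / 2 * t powr (- 1 / \<theta>)\<bar> \<le> \<bar>1 - A\<bar> * C * t powr (- 1 / \<theta> - \<gamma>')"
      using err[of "-t"] t by simp
  qed
  \<comment> \<open>The quantile coupling: both pseudoinverses are evaluated at the same uniform
    point.\<close>
  let ?\<Omega> = "restrict_space lborel {0<..<1} :: real measure"
  have \<Omega>: "prob_space ?\<Omega>"
    by (auto simp: emeasure_restrict_space space_restrict_space intro!: prob_spaceI)
  have sets\<Omega>: "sets ?\<Omega> = sets (restrict_space borel {0<..<1})" by (simp add: sets_restrict_space)
  have Im: "Mu.I \<in> borel_measurable ?\<Omega>" "Pa.I \<in> borel_measurable ?\<Omega>"
    using Mu.measurable_CI Pa.measurable_CI measurable_cong_sets[OF sets\<Omega> refl, of borel] by auto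
  have laws: "distr ?\<Omega> borel Mu.I = \<mu>" "distr ?\<Omega> borel Pa.I = pareto b \<theta>"
    by (rule Mu.distr_I_eq_M, rule Pa.distr_I_eq_M)
  have mu_id: "integrable \<mu> (\<lambda>x. x)" "(\<integral>x. x \<partial>\<mu>) = 0"
    using centered by (simp_all add: \<mu>_def integrable_distr_eq integral_distr)
  have pa_id: "integrable (pareto b \<theta>) (\<lambda>x. x)" "(\<integral>x. x \<partial>pareto b \<theta>) = 0"
    using integrable_pareto_map[OF st.b \<theta>(2)] integral_pareto_map
    by (simp_all add: pareto_def integrable_distr_eq integral_distr)
  have Iint: "integrable ?\<Omega> Mu.I" "integrable ?\<Omega> Pa.I" "(\<integral>v. Mu.I v \<partial>?\<Omega>) = 0" "(\<integral>v. Pa.I v \<partial>?\<Omega>) = 0"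
    by (rule centered_if_distr[OF Im(1) laws(1) mu_id] centered_if_distr[OF Im(2) laws(2) pa_id])+
  have mean: "(\<integral>v. Mu.I v - Pa.I v \<partial>?\<Omega>) = 0" using Iint by simp
  have pow: "integrable ?\<Omega> (\<lambda>v. \<bar>Mu.I v - Pa.I v\<bar> powr r)"
    using st.integrable_quantile_difference[OF cdf\<mu> tails \<gamma>'(1,2) _ r(4) \<gamma>r] C by simp
  \<comment> \<open>The maximum with \<open>1\<close> supplies the positive constant that
    \<open>walk_functional_diff_le\<close> asks for.\<close>
  define cY where "cY = max 1 (\<integral>v. \<bar>Mu.I v - Pa.I v\<bar> powr r \<partial>?\<Omega>)"
  obtain cP where cP: "cP > 0" "\<And>j. l2_coupled (cP * (2 powr (1 - 2 * \<theta>)) ^ j) (pareto_sum b \<theta> j) (pareto_sum b \<theta> (Suc j))"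
    using pareto_sum_coupled[OF st.b \<theta>(3,2)] by blast
  define c1 where "c1 = sob.coupling_const r * cY powr (1 / r)"
  define c2 where "c2 = sob.coupling_const r * (2 powr (1 / r) * cP powr (1 / 2)) / (1 - 2 powr (1 / 2 - \<theta>))"
  define c3 where "c3 = sob.levy_const \<beta> m"
  \<comment> \<open>Absolute values avoid checking the signs of the three constants; the
    \<open>1\<close> makes \<open>c\<close> positive.\<close>
  define c where "c = \<bar>c1\<bar> + \<bar>c2\<bar> + \<bar>c3\<bar> + 1"
  have bound: "\<bar>(\<integral>\<omega>. F (\<lambda>t. walk \<alpha> Y n t \<omega>) \<partial>M) - (\<integral>\<omega>. F (\<lambda>t. S t \<omega>) \<partial>N)\<bar> \<le> c * 2 powr (- (real n * \<upsilon>))"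
    if F: "F \<in> Lip1 \<eta> p" for F n
  proof -
    define h where "h = 2 powr (- (n * \<theta>))"
    have h: "h > 0" by (simp add: h_def)
    have hw: "1 / 2 powr (n / \<alpha>) = h" by (simp add: h_def \<alpha> powr_minus_divide)
    \<comment> \<open>The scale times the growth of a sum of \<open>2 ^ n\<close> differences, with
      \<open>\<theta> - 1 / r = \<upsilon>\<close>.\<close>
    have hr: "h * 2 powr (n / r) = 2 powr (- (real n * \<upsilon>))"
    proof -
      have "n / r = n * \<beta>" using r(5) by (metis times_divide_eq_right mult.right_neutral)
      then have "- (n * \<theta>) + n / r = - (real n * \<upsilon>)" by (simp add: \<beta>_def algebra_simps)
      then show ?thesis unfolding h_def powr_add[symmetric] by simp
    qed
    have ind: "M.indep_vars (\<lambda>_. borel) Y {1..2 ^ n}" using indep by (rule M.indep_vars_subset) auto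
    have law: "distr M borel (Y i) = \<mu>" if "i \<in> {1..2 ^ n}" for i using ident[of i] that by (simp add: \<mu>_def)
    have Yint: "integrable M (Y i)" if i: "i \<in> {1..2 ^ n}" for i
    proof -
      have "Y i \<in> borel_measurable M" using ind i by (auto simp: M.indep_vars_def)
      then show ?thesis by (rule centered_if_distr(1)[OF _ law[OF i] mu_id])
    qed
    have "(\<integral>\<omega>. F (\<lambda>t. walk \<alpha> Y n t \<omega>) \<partial>M) = walk_functional F n h \<mu>"
      unfolding walk_eq_step_path hw using law Yint
      by (intro sob.walk_functional_eq[OF F \<open>prob_space M\<close> ind]) auto
    moreover have "\<bar>walk_functional F n h \<mu> - walk_functional F n h (pareto b \<theta>)\<bar> \<le> c1 * 2 powr (- (real n * \<upsilon>))"
    proof -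
      have "\<bar>walk_functional F n h \<mu> - walk_functional F n h (pareto b \<theta>)\<bar> \<le> sob.coupling_const r * h * (2 ^ n * cY) powr (1 / r)"
        by (rule sob.walk_functional_diff_le[OF F \<Omega> Iint(1) laws(1) Iint(2) laws(2) mean r(2,1,3) pow _ _ h]) (auto simp: cY_def)
      also have "(2 ^ n * cY) powr (1 / r) = 2 powr (n / r) * cY powr (1 / r)"
        by (simp add: powr_mult powr_powr flip: powr_realpow)
      also have "sob.coupling_const r * h * (2 powr (n / r) * cY powr (1 / r)) = c1 * (h * 2 powr (n / r))"
        by (simp add: c1_def)
      finally show ?thesis unfolding hr .
    qed
    moreover have "\<bar>walk_functional F n h (pareto b \<theta>) - walk_functional F n h \<nu>\<bar> \<le> c2 * 2 powr (- (real n * \<upsilon>))"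
      using sob.walk_functional_pareto_stable[OF st F \<nu> char\<nu> r(2,1,3) h cP, of n] unfolding hr c2_def .
    \<comment> \<open>Here \<beta> acts as a smoothness index above \<eta>, and the loss
      \<open>\<theta> - \<beta>\<close> is again \<upsilon>.\<close>
    moreover have "\<bar>walk_functional F n h \<nu> - (\<integral>\<omega>. F (\<lambda>t. S t \<omega>) \<partial>N)\<bar> \<le> c3 * 2 powr (- (real n * \<upsilon>))"
      using sob.levy_process_discretization[OF F levy scaling \<beta>(1) _ m(2,1), of n] \<beta>(3)
      by (simp add: c3_def h_def \<nu>_def \<beta>_def)
    ultimately have "\<bar>(\<integral>\<omega>. F (\<lambda>t. walk \<alpha> Y n t \<omega>) \<partial>M) - (\<integral>\<omega>. F (\<lambda>t. S t \<omega>) \<partial>N)\<bar> \<le>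
      c1 * 2 powr (- (real n * \<upsilon>)) + c2 * 2 powr (- (real n * \<upsilon>)) + c3 * 2 powr (- (real n * \<upsilon>))"
      by linarith
    also have "\<dots> = (c1 + c2 + c3) * 2 powr (- (real n * \<upsilon>))" by (simp add: distrib_right)
    also have "\<dots> \<le> c * 2 powr (- (real n * \<upsilon>))" by (intro mult_right_mono) (auto simp: c_def)
    finally show ?thesis .
  qed
  have "wasserstein1 \<eta> p M (walk \<alpha> Y n) N S \<le> ereal (c * 2 powr (- (real n * \<upsilon>)))" for n
    unfolding wasserstein1_def
  proof (rule SUP_least)
    fix F assume "F \<in> Lip1 \<eta> p"
    from bound[OF this, of n]
    show "ereal ((\<integral>\<omega>. F (\<lambda>t. walk \<alpha> Y n t \<omega>) \<partial>M) - (\<integral>\<omega>. F (\<lambda>t. S t \<omega>) \<partial>N)) \<le> ereal (c * 2 powr (- (real n * \<upsilon>)))"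
      by simp
  qed
  moreover have "c > 0" by (simp add: c_def add_nonneg_pos)
  ultimately show "\<exists>\<upsilon> c. \<upsilon> > 0 \<and> c > 0 \<and>
      \<upsilon> = (1 / \<alpha> - \<eta>) * p * (min (2 / \<alpha> - 1) (\<gamma> / \<alpha>) / (1 + (1 / \<alpha> - \<eta>) * p)) \<and>
      (\<forall>n\<ge>1. wasserstein1 \<eta> p M (walk \<alpha> Y n) N S \<le> ereal (c * 2 powr (- (real n * \<upsilon>))))"
    using rate(1) \<upsilon>_def by (intro exI[of _ \<upsilon>] exI[of _ c]) auto
qed

end
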